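(* Let $R$ be a normed ring, let $n\ge0$, let $f\colon X\to Y$ be an $(n+1)$-equivalence between (based) connected Kan complexes, and let $\mathcal{A}$ be a seminormed local coefficient system on $X$. Then the canonical map $$H_b^i(Y;\mathcal{H}_b^0(F;\mathcal{A}))\to H_b^i(X;\mathcal{A})$$ is an isomorphism of $R$-modules for all $i\le n$ and injective for $i=n+1$.
   Context: Fix a normed ring $(R,|\cdot|)$. $\mathrm{Mod}^{\mathrm{sn}}_R$ is the category of seminormed $R$-modules ($\|ra_1+a_2\|\le|r|\|a_1\|+\|a_2\|$) and seminorm non-increasing $R$-linear maps. For a simplicial set $X$, the fundamental groupoid $\pi(X)$ has object set $X_0$ and is generated as a groupoid by $X_1$ (an edge $\sigma$ is a morphism $\partial_1\sigma\to\partial_0\sigma$) with relations $\partial_0\sigma\circ\partial_2\sigma=\partial_1\sigma$ for $\sigma\in X_2$. A seminormed local coefficient system on $X$ is a functor $\mathcal{A}\colon\pi(X)\to\mathrm{Mod}_R^{\mathrm{sn}}$; for $g\colon X'\to X$ put $g^*\mathcal{A}=\mathcal{A}\circ\pi(g)$. $C_b^n(X;\mathcal{A})$ is the module of functions $\varphi$ on $X_n$ with $\varphi(\sigma)\in\mathcal{A}(\sigma_0)$ ($\sigma_0$ the $0$-th vertex) and $\sup_\sigma\|\varphi(\sigma)\|<\infty$, with differential $\delta^n(\varphi)(\sigma)=\mathcal{A}([\sigma_{[0,1]}]^{-1})(\varphi(\partial_0\sigma))+\sum_{i=1}^{n+1}(-1)^i\varphi(\partial_i\sigma)$, where $\sigma_{[0,1]}$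 is the front edge. $H_b^*(X;\mathcal{A})$ is its cohomology. A map $f$ of Kan complexes is an $n$-equivalence ($n\ge0$) if $\pi_k(X,x)\to\pi_k(Y,f(x))$ is an isomorphism for all $k\le n-1$ and surjective for $k=n$, for all basepoints. If $f\colon X\to Y$ is a Kan fibration: let $F_y$ be the fiber over $y\in Y_0$, $\mathcal{A}_y=\mathcal{A}|_{F_y}$. For an edge $\gamma\colon\Delta^1\to Y$ from $y$ to $z$, let $F_\gamma$ be the fiber over $\gamma$ of $X^{\Delta^1}\to Y^{\Delta^1}$, with coefficients $\mathcal{A}_\gamma$ pulled back under evaluation at the last vertex; the restrictions $F_y\leftarrow F_\gamma\to F_z$ (coefficients identified by applying $\mathcal{A}$ to the edges of $X$ given by vertices of $F_\gamma$) induce isometric isomorphisms in bounded cohomology. This defines the seminormed local coefficient system $\mathcal{H}_b^0(F;\mathcal{A})$ on $Y$, $y\mapsto H_b^0(F_y;\mathcal{A}_y)$, whose elements are bounded compatible families $(s_x)_{x\in(F_y)_0}$, $s_x\in\mathcal{A}(x)$. The canonical map (edge homomorphism) is induced by sending $\psi\in C_b^n(Y;\mathcal{H}_b^0(F;\mathcal{A}))$ to $\sigma\mapsto\psi(f\circ\sigma)_{\sigma_0}\in\mathcal{A}(\sigma_0)$, $\sigma\in X_n$. For general $f$ between Kan complexes, factor $f=p\circ j$ with $j\colon X\to Z$ a weak equivalence of Kan complexes and $p\colon Z\to Y$ a Kan fibration, and choose $\mathcal{A}'$ on $Z$ with $j^*\mathcal{A}'\cong\mathcal{A}$. Then $F$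 is the homotopy fiber (the fiber of $p$), $\mathcal{H}_b^0(F;\mathcal{A})$ is the system defined by $(p,\mathcal{A}')$, and the canonical map is that of $p$ followed by the isomorphism $H_b^*(Z;\mathcal{A}')\cong H_b^*(X;\mathcal{A})$ induced by $j$. *)

theory Defs
  imports Complex_Main "HOL-Algebra.Module" "HOL-Algebra.AbelCoset"
begin

section \<open>Seminormed modules over a normed ring\<close>

text \<open>
  Rings are unital, not necessarily commutative; this is why \<^locale>\<open>module\<close>, which requires a
  commutative ring, is not used. No relation between the norm of the unit and the real number 1
  is imposed.
\<close>

locale normed_ring = ring R for R (structure) +
  fixes N :: "'r \<Rightarrow> real"
  assumes norm_nonneg: "r \<in> carrier R \<Longrightarrow> 0 \<le> N r"
    and norm_eq_0_iff: "r \<in> carrier R \<Longrightarrow> N r = 0 \<longleftrightarrow> r = \<zero>"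
    and norm_minus: "r \<in> carrier R \<Longrightarrow> N (\<ominus> r) = N r"
    and norm_add: "r \<in> carrier R \<Longrightarrow> s \<in> carrier R \<Longrightarrow> N (r \<oplus> s) \<le> N r + N s"
    and norm_mult: "r \<in> carrier R \<Longrightarrow> s \<in> carrier R \<Longrightarrow> N (r \<otimes> s) \<le> N r * N s"

locale left_module = R?: ring R + M?: abelian_group M
  for R :: "('r, 'm) ring_scheme" (structure)
    and M :: "('r, 'a, 'n) module_scheme" (structure) +
  assumes smult_closed:
      "r \<in> carrier R \<Longrightarrow> a \<in> carrier M \<Longrightarrow> r \<odot>\<^bsub>M\<^esub> a \<in> carrier M"
    and smult_l_distr:
      "r \<in> carrier R \<Longrightarrow> s \<in> carrier R \<Longrightarrow> a \<in> carrier M \<Longrightarrow>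
        (r \<oplus>\<^bsub>R\<^esub> s) \<odot>\<^bsub>M\<^esub> a = r \<odot>\<^bsub>M\<^esub> a \<oplus>\<^bsub>M\<^esub> s \<odot>\<^bsub>M\<^esub> a"
    and smult_r_distr:
      "r \<in> carrier R \<Longrightarrow> a \<in> carrier M \<Longrightarrow> b \<in> carrier M \<Longrightarrow>
        r \<odot>\<^bsub>M\<^esub> (a \<oplus>\<^bsub>M\<^esub> b) = r \<odot>\<^bsub>M\<^esub> a \<oplus>\<^bsub>M\<^esub> r \<odot>\<^bsub>M\<^esub> b"
    and smult_assoc:
      "r \<in> carrier R \<Longrightarrow> s \<in> carrier R \<Longrightarrow> a \<in> carrier M \<Longrightarrow>
        (r \<otimes>\<^bsub>R\<^esub> s) \<odot>\<^bsub>M\<^esub> a = r \<odot>\<^bsub>M\<^esub> (s \<odot>\<^bsub>M\<^esub> a)"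
    and smult_one:
      "a \<in> carrier M \<Longrightarrow> \<one>\<^bsub>R\<^esub> \<odot>\<^bsub>M\<^esub> a = a"

record ('r, 'a) sn_module = "('r, 'a) module" +
  snorm :: "'a \<Rightarrow> real"

locale seminormed_module = left_module R M
  for R :: "('r, 'm) ring_scheme" (structure)
    and N :: "'r \<Rightarrow> real"
    and M :: "('r, 'a) sn_module" (structure) +
  assumes snorm_nonneg: "a \<in> carrier M \<Longrightarrow> 0 \<le> snorm M a"
    and snorm_zero: "snorm M \<zero>\<^bsub>M\<^esub> = 0"
    and snorm_smult_add:
      "r \<in> carrier R \<Longrightarrow> a \<in> carrier M \<Longrightarrow> b \<in> carrier M \<Longrightarrow>
        snorm M (r \<odot>\<^bsub>M\<^esub> a \<oplus>\<^bsub>M\<^esub> b) \<le> N r * snorm M a + snorm M b"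

definition linear_maps ::
  "('r, 'm) ring_scheme \<Rightarrow> ('r, 'a, 'n) module_scheme \<Rightarrow> ('r, 'b, 'k) module_scheme \<Rightarrow> ('a \<Rightarrow> 'b) set"
  where "linear_maps R M M' =
    {h. h ` carrier M \<subseteq> carrier M' \<and>
        (\<forall>a\<in>carrier M. \<forall>b\<in>carrier M. h (a \<oplus>\<^bsub>M\<^esub> b) = h a \<oplus>\<^bsub>M'\<^esub> h b) \<and>
        (\<forall>r\<in>carrier R. \<forall>a\<in>carrier M. h (r \<odot>\<^bsub>M\<^esub> a) = r \<odot>\<^bsub>M'\<^esub> h a)}"

definition linear_isos ::
  "('r, 'm) ring_scheme \<Rightarrow> ('r, 'a, 'n) module_scheme \<Rightarrow> ('r, 'b, 'k) module_scheme \<Rightarrow> ('a \<Rightarrow> 'b) set"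
  where "linear_isos R M M' = {h \<in> linear_maps R M M'. bij_betw h (carrier M) (carrier M')}"

definition sn_maps ::
  "('r, 'm) ring_scheme \<Rightarrow> ('r, 'a) sn_module \<Rightarrow> ('r, 'b) sn_module \<Rightarrow> ('a \<Rightarrow> 'b) set"
  where "sn_maps R M M' = {h \<in> linear_maps R M M'. \<forall>a\<in>carrier M. snorm M' (h a) \<le> snorm M a}"

definition sn_isos ::
  "('r, 'm) ring_scheme \<Rightarrow> ('r, 'a) sn_module \<Rightarrow> ('r, 'b) sn_module \<Rightarrow> ('a \<Rightarrow> 'b) set"
  where "sn_isos R M M' =
    {h \<in> sn_maps R M M'. bij_betw h (carrier M) (carrier M') \<and>
        inv_into (carrier M) h \<in> sn_maps R M' M}"

text \<open>
  The quotient of a module by a submodule \<open>B\<close>; its elements are additive cosets. The ring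
  multiplication and unit of the record, meaningless for modules, are left undefined.
\<close>

definition quot_module :: "('r, 'a, 'n) module_scheme \<Rightarrow> 'a set \<Rightarrow> ('r, 'a set) module"
  where "quot_module M B =
    \<lparr>carrier = a_rcosets\<^bsub>M\<^esub> B, mult = undefined, one = undefined,
     zero = B, add = (\<lambda>C D. C <+>\<^bsub>M\<^esub> D),
     smult = (\<lambda>r C. \<Union>a\<in>C. B +>\<^bsub>M\<^esub> (r \<odot>\<^bsub>M\<^esub> a))\<rparr>"


section \<open>Simplicial sets\<close>

text \<open>
  \<open>face X n i\<close> is the \<open>i\<close>-th face operator from \<open>n\<close>-simplices to \<open>(n - 1)\<close>-simplices
  (used for \<open>n \<ge> 1\<close> only), \<open>degen X n i\<close> the \<open>i\<close>-th degeneracy operator from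
  \<open>n\<close>-simplices to \<open>(n + 1)\<close>-simplices. The sets of simplices of distinct dimensions need not be
  disjoint, hence the index \<open>n\<close> and the dimension argument of simplicial maps.
\<close>

record 'x sset =
  simplices :: "nat \<Rightarrow> 'x set"
  face :: "nat \<Rightarrow> nat \<Rightarrow> 'x \<Rightarrow> 'x"
  degen :: "nat \<Rightarrow> nat \<Rightarrow> 'x \<Rightarrow> 'x"

locale simplicial_set =
  fixes X :: "'x sset"
  assumes face_closed:
      "\<sigma> \<in> simplices X (Suc n) \<Longrightarrow> i \<le> Suc n \<Longrightarrow> face X (Suc n) i \<sigma> \<in> simplices X n"
    and degen_closed:
      "\<sigma> \<in> simplices X n \<Longrightarrow> i \<le> n \<Longrightarrow> degen X n i \<sigma> \<in> simplices X (Suc n)"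
    and face_face:
      "\<sigma> \<in> simplices X (Suc (Suc n)) \<Longrightarrow> i < j \<Longrightarrow> j \<le> Suc (Suc n) \<Longrightarrow>
        face X (Suc n) i (face X (Suc (Suc n)) j \<sigma>) =
        face X (Suc n) (j - 1) (face X (Suc (Suc n)) i \<sigma>)"
    and face_degen_less:
      "\<sigma> \<in> simplices X (Suc n) \<Longrightarrow> i < j \<Longrightarrow> j \<le> Suc n \<Longrightarrow>
        face X (Suc (Suc n)) i (degen X (Suc n) j \<sigma>) = degen X n (j - 1) (face X (Suc n) i \<sigma>)"
    and face_degen_eq:
      "\<sigma> \<in> simplices X n \<Longrightarrow> j \<le> n \<Longrightarrow> i = j \<or> i = Suc j \<Longrightarrow>
        face X (Suc n) i (degen X n j \<sigma>) = \<sigma>"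
    and face_degen_greater:
      "\<sigma> \<in> simplices X (Suc n) \<Longrightarrow> Suc j < i \<Longrightarrow> i \<le> Suc (Suc n) \<Longrightarrow>
        face X (Suc (Suc n)) i (degen X (Suc n) j \<sigma>) = degen X n j (face X (Suc n) (i - 1) \<sigma>)"
    and degen_degen:
      "\<sigma> \<in> simplices X n \<Longrightarrow> i \<le> j \<Longrightarrow> j \<le> n \<Longrightarrow>
        degen X (Suc n) i (degen X n j \<sigma>) = degen X (Suc n) (Suc j) (degen X n i \<sigma>)"

definition simplicial_map :: "'x sset \<Rightarrow> 'y sset \<Rightarrow> (nat \<Rightarrow> 'x \<Rightarrow> 'y) \<Rightarrow> bool"
  where "simplicial_map X Y f \<longleftrightarrow>
    (\<forall>n. \<forall>\<sigma>\<in>simplices X n. f n \<sigma> \<in> simplices Y n) \<and>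
    (\<forall>n. \<forall>\<sigma>\<in>simplices X (Suc n). \<forall>i\<le>Suc n.
        f n (face X (Suc n) i \<sigma>) = face Y (Suc n) i (f (Suc n) \<sigma>)) \<and>
    (\<forall>n. \<forall>\<sigma>\<in>simplices X n. \<forall>i\<le>n. f (Suc n) (degen X n i \<sigma>) = degen Y n i (f n \<sigma>))"

fun const_simplex :: "'x sset \<Rightarrow> nat \<Rightarrow> 'x \<Rightarrow> 'x"
  where "const_simplex X 0 x = x"
  | "const_simplex X (Suc n) x = degen X n 0 (const_simplex X n x)"

fun vertex0 :: "'x sset \<Rightarrow> nat \<Rightarrow> 'x \<Rightarrow> 'x"
  where "vertex0 X 0 \<sigma> = \<sigma>"
  | "vertex0 X (Suc n) \<sigma> = vertex0 X n (face X (Suc n) (Suc n) \<sigma>)"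

text \<open>The front edge of an \<open>(n + 1)\<close>-simplex.\<close>

fun front_edge :: "'x sset \<Rightarrow> nat \<Rightarrow> 'x \<Rightarrow> 'x"
  where "front_edge X 0 \<sigma> = \<sigma>"
  | "front_edge X (Suc n) \<sigma> = front_edge X n (face X (Suc (Suc n)) (Suc (Suc n)) \<sigma>)"

abbreviation src :: "'x sset \<Rightarrow> 'x \<Rightarrow> 'x" where "src X e \<equiv> face X (Suc 0) (Suc 0) e"
abbreviation tgt :: "'x sset \<Rightarrow> 'x \<Rightarrow> 'x" where "tgt X e \<equiv> face X (Suc 0) 0 e"

text \<open>
  \<open>horn X n k \<tau>\<close>: the \<open>n\<close>-simplices \<open>\<tau> i\<close> (\<open>i \<le> n + 1\<close>, \<open>i \<noteq> k\<close>) are the faces of a map to \<open>X\<close>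
  from the \<open>k\<close>-th horn of the standard \<open>(n + 1)\<close>-simplex. For \<open>n = 0\<close> the compatibility condition
  is empty.
\<close>

definition horn :: "'x sset \<Rightarrow> nat \<Rightarrow> nat \<Rightarrow> (nat \<Rightarrow> 'x) \<Rightarrow> bool"
  where "horn X n k \<tau> \<longleftrightarrow> k \<le> Suc n \<and>
    (\<forall>i\<le>Suc n. i \<noteq> k \<longrightarrow> \<tau> i \<in> simplices X n) \<and>
    (\<forall>i j. i < j \<and> j \<le> Suc n \<and> i \<noteq> k \<and> j \<noteq> k \<longrightarrow> face X n i (\<tau> j) = face X n (j - 1) (\<tau> i))"

definition kan_complex :: "'x sset \<Rightarrow> bool"
  where "kan_complex X \<longleftrightarrow> simplicial_set X \<and>
    (\<forall>n k \<tau>. horn X n k \<tau> \<longrightarrow>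
      (\<exists>\<sigma>\<in>simplices X (Suc n). \<forall>i\<le>Suc n. i \<noteq> k \<longrightarrow> face X (Suc n) i \<sigma> = \<tau> i))"

definition kan_fibration :: "'x sset \<Rightarrow> 'y sset \<Rightarrow> (nat \<Rightarrow> 'x \<Rightarrow> 'y) \<Rightarrow> bool"
  where "kan_fibration X Y p \<longleftrightarrow> simplicial_set X \<and> simplicial_set Y \<and> simplicial_map X Y p \<and>
    (\<forall>n k \<tau>. \<forall>\<omega>\<in>simplices Y (Suc n).
      horn X n k \<tau> \<and> (\<forall>i\<le>Suc n. i \<noteq> k \<longrightarrow> face Y (Suc n) i \<omega> = p n (\<tau> i)) \<longrightarrow>
      (\<exists>\<sigma>\<in>simplices X (Suc n). p (Suc n) \<sigma> = \<omega> \<and>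
        (\<forall>i\<le>Suc n. i \<noteq> k \<longrightarrow> face X (Suc n) i \<sigma> = \<tau> i)))"

definition fibre :: "'x sset \<Rightarrow> 'y sset \<Rightarrow> (nat \<Rightarrow> 'x \<Rightarrow> 'y) \<Rightarrow> 'y \<Rightarrow> 'x sset"
  where "fibre X Y p y =
    X\<lparr>simplices := (\<lambda>n. {\<sigma> \<in> simplices X n. p n \<sigma> = const_simplex Y n y})\<rparr>"


section \<open>Homotopy groups of Kan complexes\<close>

text \<open>
  \<open>homotopy_rel X k x\<close> is the usual relation on \<open>k\<close>-simplices with constant boundary, whose classes
  form \<open>\<pi>\<^sub>k(X, x)\<close> when \<open>X\<close> is a Kan complex. For \<open>k = 0\<close> it relates any two vertices joined by an
  edge, independently of \<open>x\<close>.
\<close>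

definition spheres :: "'x sset \<Rightarrow> nat \<Rightarrow> 'x \<Rightarrow> 'x set"
  where "spheres X k x =
    {\<sigma> \<in> simplices X k. \<forall>i\<le>k. 0 < k \<longrightarrow> face X k i \<sigma> = const_simplex X (k - 1) x}"

definition homotopy_rel :: "'x sset \<Rightarrow> nat \<Rightarrow> 'x \<Rightarrow> ('x \<times> 'x) set"
  where "homotopy_rel X k x =
    {(\<sigma>, \<tau>). \<sigma> \<in> spheres X k x \<and> \<tau> \<in> spheres X k x \<and>
      (\<exists>\<omega>\<in>simplices X (Suc k). face X (Suc k) k \<omega> = \<sigma> \<and> face X (Suc k) (Suc k) \<omega> = \<tau> \<and>
        (\<forall>i<k. face X (Suc k) i \<omega> = const_simplex X k x))}"

definition homotopy_group :: "'x sset \<Rightarrow> nat \<Rightarrow> 'x \<Rightarrow> 'x set set"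
  where "homotopy_group X k x = spheres X k x // homotopy_rel X k x"

definition homotopy_map ::
  "'x sset \<Rightarrow> 'y sset \<Rightarrow> (nat \<Rightarrow> 'x \<Rightarrow> 'y) \<Rightarrow> nat \<Rightarrow> 'x \<Rightarrow> 'x set \<Rightarrow> 'y set"
  where "homotopy_map X Y f k x c = homotopy_rel Y k (f 0 x) `` (f k ` c)"

text \<open>
  The induced maps are group homomorphisms for \<open>k \<ge> 1\<close>, so being an isomorphism means being
  bijective.
\<close>

definition n_equivalence :: "nat \<Rightarrow> 'x sset \<Rightarrow> 'y sset \<Rightarrow> (nat \<Rightarrow> 'x \<Rightarrow> 'y) \<Rightarrow> bool"
  where "n_equivalence n X Y f \<longleftrightarrow> simplicial_map X Y f \<and>
    (\<forall>x\<in>simplices X 0.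
      (\<forall>k<n. bij_betw (homotopy_map X Y f k x) (homotopy_group X k x) (homotopy_group Y k (f 0 x))) \<and>
      homotopy_map X Y f n x ` homotopy_group X n x = homotopy_group Y n (f 0 x))"

text \<open>The first clause matters only if \<open>X\<close> is empty, where there are no basepoints.\<close>

definition weak_equivalence :: "'x sset \<Rightarrow> 'y sset \<Rightarrow> (nat \<Rightarrow> 'x \<Rightarrow> 'y) \<Rightarrow> bool"
  where "weak_equivalence X Y f \<longleftrightarrow> simplicial_map X Y f \<and>
    (simplices X 0 = {} \<longrightarrow> simplices Y 0 = {}) \<and>
    (\<forall>x\<in>simplices X 0. \<forall>k.
      bij_betw (homotopy_map X Y f k x) (homotopy_group X k x) (homotopy_group Y k (f 0 x)))"


section \<open>The fundamental groupoid\<close>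

text \<open>
  Words in the edges and their formal inverses, read from left to right: the letter \<open>(e, True)\<close>
  stands for the edge \<open>e\<close> from \<open>src X e\<close> to \<open>tgt X e\<close>, and \<open>(e, False)\<close> for its inverse.
\<close>

type_synonym 'x word = "('x \<times> bool) list"

inductive is_path :: "'x sset \<Rightarrow> 'x \<Rightarrow> 'x word \<Rightarrow> 'x \<Rightarrow> bool" for X
  where empty: "x \<in> simplices X 0 \<Longrightarrow> is_path X x [] x"
  | edge: "e \<in> simplices X 1 \<Longrightarrow> is_path X (tgt X e) w y \<Longrightarrow> is_path X (src X e) ((e, True) # w) y"
  | inverse: "e \<in> simplices X 1 \<Longrightarrow> is_path X (src X e) w y \<Longrightarrow> is_path X (tgt X e) ((e, False) # w) y"

inductive path_eq :: "'x sset \<Rightarrow> 'x \<Rightarrow> 'x \<Rightarrow> 'x word \<Rightarrow> 'x word \<Rightarrow> bool" for X x y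
  where refl: "is_path X x w y \<Longrightarrow> path_eq X x y w w"
  | sym: "path_eq X x y w w' \<Longrightarrow> path_eq X x y w' w"
  | trans: "path_eq X x y w w' \<Longrightarrow> path_eq X x y w' w'' \<Longrightarrow> path_eq X x y w w''"
  | cancel: "is_path X x (u @ [(e, b), (e, \<not> b)] @ v) y \<Longrightarrow>
      path_eq X x y (u @ [(e, b), (e, \<not> b)] @ v) (u @ v)"
  | triangle: "\<sigma> \<in> simplices X 2 \<Longrightarrow>
      is_path X x (u @ [(face X 2 2 \<sigma>, True), (face X 2 0 \<sigma>, True)] @ v) y \<Longrightarrow>
      path_eq X x y (u @ [(face X 2 2 \<sigma>, True), (face X 2 0 \<sigma>, True)] @ v)
        (u @ [(face X 2 1 \<sigma>, True)] @ v)"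

definition path_class :: "'x sset \<Rightarrow> 'x \<Rightarrow> 'x \<Rightarrow> 'x word \<Rightarrow> 'x word set"
  where "path_class X x y w = {w'. path_eq X x y w w'}"

definition pi_hom :: "'x sset \<Rightarrow> 'x \<Rightarrow> 'x \<Rightarrow> 'x word set set"
  where "pi_hom X x y = {path_class X x y w |w. is_path X x w y}"

definition pi_id :: "'x sset \<Rightarrow> 'x \<Rightarrow> 'x word set"
  where "pi_id X x = path_class X x x []"

text \<open>Composition in diagrammatic order: first \<open>c\<close> from \<open>x\<close>, then \<open>d\<close> to \<open>z\<close>.\<close>

definition pi_comp :: "'x sset \<Rightarrow> 'x \<Rightarrow> 'x \<Rightarrow> 'x word set \<Rightarrow> 'x word set \<Rightarrow> 'x word set"
  where "pi_comp X x z c d = (\<Union>u\<in>c. \<Union>v\<in>d. path_class X x z (u @ v))"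

definition pi_edge :: "'x sset \<Rightarrow> 'x \<Rightarrow> 'x word set"
  where "pi_edge X e = path_class X (src X e) (tgt X e) [(e, True)]"

definition pi_edge_inv :: "'x sset \<Rightarrow> 'x \<Rightarrow> 'x word set"
  where "pi_edge_inv X e = path_class X (tgt X e) (src X e) [(e, False)]"

definition pi_map ::
  "'x sset \<Rightarrow> 'y sset \<Rightarrow> (nat \<Rightarrow> 'x \<Rightarrow> 'y) \<Rightarrow> 'x \<Rightarrow> 'x \<Rightarrow> 'x word set \<Rightarrow> 'y word set"
  where "pi_map X Y g x y c =
    (\<Union>w\<in>c. path_class Y (g 0 x) (g 0 y) (map (\<lambda>(e, b). (g 1 e, b)) w))"

definition connected_sset :: "'x sset \<Rightarrow> bool"
  where "connected_sset X \<longleftrightarrow> simplices X 0 \<noteq> {} \<and>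
    (\<forall>x\<in>simplices X 0. \<forall>y\<in>simplices X 0. pi_hom X x y \<noteq> {})"


section \<open>Seminormed local coefficient systems\<close>

text \<open>
  \<open>transport A x y c\<close> is the value of the functor \<open>A\<close> on the morphism \<open>c\<close> from \<open>x\<close> to \<open>y\<close>; only its
  restriction to the carrier of \<open>stalk A x\<close> is relevant.
\<close>

record ('r, 'x, 'a) coeff_system =
  stalk :: "'x \<Rightarrow> ('r, 'a) sn_module"
  transport :: "'x \<Rightarrow> 'x \<Rightarrow> 'x word set \<Rightarrow> 'a \<Rightarrow> 'a"

locale local_system =
  fixes R :: "('r, 'm) ring_scheme"
    and N :: "'r \<Rightarrow> real"
    and X :: "'x sset"
    and A :: "('r, 'x, 'a) coeff_system"
  assumes stalk_module: "x \<in> simplices X 0 \<Longrightarrow> seminormed_module R N (stalk A x)"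
    and transport_map:
      "x \<in> simplices X 0 \<Longrightarrow> y \<in> simplices X 0 \<Longrightarrow> c \<in> pi_hom X x y \<Longrightarrow>
        transport A x y c \<in> sn_maps R (stalk A x) (stalk A y)"
    and transport_id:
      "x \<in> simplices X 0 \<Longrightarrow> a \<in> carrier (stalk A x) \<Longrightarrow> transport A x x (pi_id X x) a = a"
    and transport_comp:
      "x \<in> simplices X 0 \<Longrightarrow> y \<in> simplices X 0 \<Longrightarrow> z \<in> simplices X 0 \<Longrightarrow>
        c \<in> pi_hom X x y \<Longrightarrow> d \<in> pi_hom X y z \<Longrightarrow> a \<in> carrier (stalk A x) \<Longrightarrow>
        transport A x z (pi_comp X x z c d) a = transport A y z d (transport A x y c a)"

definition pullback_system ::
  "'x sset \<Rightarrow> 'y sset \<Rightarrow> (nat \<Rightarrow> 'x \<Rightarrow> 'y) \<Rightarrow> ('r, 'y, 'a) coeff_system \<Rightarrow> ('r, 'x, 'a) coeff_system"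
  where "pullback_system X Y g A =
    \<lparr>stalk = (\<lambda>x. stalk A (g 0 x)),
     transport = (\<lambda>x y c. transport A (g 0 x) (g 0 y) (pi_map X Y g x y c))\<rparr>"

definition system_iso ::
  "('r, 'm) ring_scheme \<Rightarrow> 'x sset \<Rightarrow> ('r, 'x, 'b) coeff_system \<Rightarrow> ('r, 'x, 'a) coeff_system \<Rightarrow>
    ('x \<Rightarrow> 'b \<Rightarrow> 'a) \<Rightarrow> bool"
  where "system_iso R X B A \<eta> \<longleftrightarrow>
    (\<forall>x\<in>simplices X 0. \<eta> x \<in> sn_isos R (stalk B x) (stalk A x)) \<and>
    (\<forall>x\<in>simplices X 0. \<forall>y\<in>simplices X 0. \<forall>c\<in>pi_hom X x y. \<forall>b\<in>carrier (stalk B x).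
      \<eta> y (transport B x y c b) = transport A x y c (\<eta> x b))"


section \<open>Bounded cohomology\<close>

definition Cb :: "'x sset \<Rightarrow> ('r, 'x, 'a) coeff_system \<Rightarrow> nat \<Rightarrow> ('r, 'x \<Rightarrow> 'a) sn_module"
  where "Cb X A n =
    (let M = (\<lambda>\<sigma>. stalk A (vertex0 X n \<sigma>)) in
    \<lparr>carrier = {\<phi> \<in> (\<Pi>\<^sub>E \<sigma>\<in>simplices X n. carrier (M \<sigma>)).
        \<exists>K. \<forall>\<sigma>\<in>simplices X n. snorm (M \<sigma>) (\<phi> \<sigma>) \<le> K},
     mult = undefined, one = undefined,
     zero = (\<lambda>\<sigma>\<in>simplices X n. \<zero>\<^bsub>M \<sigma>\<^esub>),
     add = (\<lambda>\<phi> \<psi>. \<lambda>\<sigma>\<in>simplices X n. \<phi> \<sigma> \<oplus>\<^bsub>M \<sigma>\<^esub> \<psi> \<sigma>),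
     smult = (\<lambda>r \<phi>. \<lambda>\<sigma>\<in>simplices X n. r \<odot>\<^bsub>M \<sigma>\<^esub> \<phi> \<sigma>),
     snorm = (\<lambda>\<phi>. Sup (insert 0 ((\<lambda>\<sigma>. snorm (M \<sigma>) (\<phi> \<sigma>)) ` simplices X n)))\<rparr>)"

definition coboundary ::
  "'x sset \<Rightarrow> ('r, 'x, 'a) coeff_system \<Rightarrow> nat \<Rightarrow> ('x \<Rightarrow> 'a) \<Rightarrow> ('x \<Rightarrow> 'a)"
  where "coboundary X A n \<phi> =
    (\<lambda>\<sigma>\<in>simplices X (Suc n).
      let e = front_edge X n \<sigma>; M = stalk A (vertex0 X (Suc n) \<sigma>) in
      transport A (tgt X e) (src X e) (pi_edge_inv X e) (\<phi> (face X (Suc n) 0 \<sigma>)) \<oplus>\<^bsub>M\<^esub>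
      (\<Oplus>\<^bsub>M\<^esub>i\<in>{1..Suc n}.
        if even i then \<phi> (face X (Suc n) i \<sigma>) else \<ominus>\<^bsub>M\<^esub> \<phi> (face X (Suc n) i \<sigma>)))"

definition Zb :: "'x sset \<Rightarrow> ('r, 'x, 'a) coeff_system \<Rightarrow> nat \<Rightarrow> ('x \<Rightarrow> 'a) set"
  where "Zb X A n = {\<phi> \<in> carrier (Cb X A n). coboundary X A n \<phi> = \<zero>\<^bsub>Cb X A (Suc n)\<^esub>}"

definition Bb :: "'x sset \<Rightarrow> ('r, 'x, 'a) coeff_system \<Rightarrow> nat \<Rightarrow> ('x \<Rightarrow> 'a) set"
  where "Bb X A n =
    (case n of 0 \<Rightarrow> {\<zero>\<^bsub>Cb X A 0\<^esub>} | Suc m \<Rightarrow> coboundary X A m ` carrier (Cb X A m))"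

definition Hb :: "'x sset \<Rightarrow> ('r, 'x, 'a) coeff_system \<Rightarrow> nat \<Rightarrow> ('r, ('x \<Rightarrow> 'a) set) module"
  where "Hb X A n = quot_module (Cb X A n\<lparr>carrier := Zb X A n\<rparr>) (Bb X A n)"

definition Hb_map ::
  "'x sset \<Rightarrow> ('r, 'x, 'a) coeff_system \<Rightarrow> nat \<Rightarrow> ('c \<Rightarrow> 'x \<Rightarrow> 'a) \<Rightarrow> 'c set \<Rightarrow> ('x \<Rightarrow> 'a) set"
  where "Hb_map X A n F c = (\<Union>\<phi>\<in>c. Bb X A n +>\<^bsub>Cb X A n\<^esub> F \<phi>)"


section \<open>The coefficient system of degree 0 bounded cohomology of the fibres\<close>

definition fibre_system ::
  "'x sset \<Rightarrow> 'y sset \<Rightarrow> (nat \<Rightarrow> 'x \<Rightarrow> 'y) \<Rightarrow> ('r, 'x, 'a) coeff_system \<Rightarrow> 'y \<Rightarrow>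
    ('r, 'x, 'a) coeff_system"
  where "fibre_system X Y p A y = pullback_system (fibre X Y p y) X (\<lambda>_ \<sigma>. \<sigma>) A"

text \<open>
  Degree 0 cohomology is represented by its 0-cocycles, i.e. by bounded compatible families indexed
  by the vertices of the fibre, with the supremum seminorm.
\<close>

definition fibre_Hb0 ::
  "'x sset \<Rightarrow> 'y sset \<Rightarrow> (nat \<Rightarrow> 'x \<Rightarrow> 'y) \<Rightarrow> ('r, 'x, 'a) coeff_system \<Rightarrow> 'y \<Rightarrow>
    ('r, 'x \<Rightarrow> 'a) sn_module"
  where "fibre_Hb0 X Y p A y =
    Cb (fibre X Y p y) (fibre_system X Y p A y) 0
      \<lparr>carrier := Zb (fibre X Y p y) (fibre_system X Y p A y) 0\<rparr>"

text \<open>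
  Transport along an edge \<open>\<gamma>\<close> from \<open>y\<close> to \<open>z\<close>. The vertices of \<open>F\<^sub>\<gamma>\<close> are the edges \<open>e\<close> of \<open>X\<close> over \<open>\<gamma>\<close>,
  and its coefficients at \<open>e\<close> are those of \<open>A\<close> at the last vertex of \<open>e\<close>. The restriction from
  \<open>F\<^sub>z\<close> sends \<open>t\<close> to the family of all \<open>t (tgt X e)\<close>; the restriction from \<open>F\<^sub>y\<close> sends \<open>s\<close> to the
  family of all \<open>s (src X e)\<close> moved by \<open>A\<close> along \<open>e\<close>. Thus the transport of \<open>s\<close> is the unique
  \<open>t\<close> having the same restriction to \<open>F\<^sub>\<gamma>\<close> as \<open>s\<close>.
\<close>

definition edge_transport ::
  "'x sset \<Rightarrow> 'y sset \<Rightarrow> (nat \<Rightarrow> 'x \<Rightarrow> 'y) \<Rightarrow> ('r, 'x, 'a) coeff_system \<Rightarrow> 'y \<Rightarrow>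
    ('x \<Rightarrow> 'a) \<Rightarrow> ('x \<Rightarrow> 'a)"
  where "edge_transport X Y p A \<gamma> s =
    (THE t. t \<in> carrier (fibre_Hb0 X Y p A (tgt Y \<gamma>)) \<and>
      (\<forall>e\<in>simplices X 1. p 1 e = \<gamma> \<longrightarrow>
        t (tgt X e) = transport A (src X e) (tgt X e) (pi_edge X e) (s (src X e))))"

definition letter_transport ::
  "'x sset \<Rightarrow> 'y sset \<Rightarrow> (nat \<Rightarrow> 'x \<Rightarrow> 'y) \<Rightarrow> ('r, 'x, 'a) coeff_system \<Rightarrow> 'y \<times> bool \<Rightarrow>
    ('x \<Rightarrow> 'a) \<Rightarrow> ('x \<Rightarrow> 'a)"
  where "letter_transport X Y p A = (\<lambda>(\<gamma>, b).
    if b then edge_transport X Y p A \<gamma>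
    else inv_into (carrier (fibre_Hb0 X Y p A (src Y \<gamma>))) (edge_transport X Y p A \<gamma>))"

text \<open>
  The functor is determined by its values on the generating edges; a morphism is sent to the
  composite of the transports along the letters of any word representing it.
\<close>

definition Hb0_system ::
  "'x sset \<Rightarrow> 'y sset \<Rightarrow> (nat \<Rightarrow> 'x \<Rightarrow> 'y) \<Rightarrow> ('r, 'x, 'a) coeff_system \<Rightarrow>
    ('r, 'y, 'x \<Rightarrow> 'a) coeff_system"
  where "Hb0_system X Y p A =
    \<lparr>stalk = fibre_Hb0 X Y p A,
     transport = (\<lambda>y z c. fold (letter_transport X Y p A) (SOME w. w \<in> c))\<rparr>"


section \<open>The canonical map\<close>

definition edge_cochain ::
  "'x sset \<Rightarrow> (nat \<Rightarrow> 'x \<Rightarrow> 'y) \<Rightarrow> nat \<Rightarrow> ('y \<Rightarrow> 'x \<Rightarrow> 'a) \<Rightarrow> ('x \<Rightarrow> 'a)"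
  where "edge_cochain X p n \<psi> = (\<lambda>\<sigma>\<in>simplices X n. \<psi> (p n \<sigma>) (vertex0 X n \<sigma>))"

definition edge_hom ::
  "'x sset \<Rightarrow> 'y sset \<Rightarrow> (nat \<Rightarrow> 'x \<Rightarrow> 'y) \<Rightarrow> ('r, 'x, 'a) coeff_system \<Rightarrow> nat \<Rightarrow>
    ('y \<Rightarrow> 'x \<Rightarrow> 'a) set \<Rightarrow> ('x \<Rightarrow> 'a) set"
  where "edge_hom X Y p A n = Hb_map X A n (edge_cochain X p n)"

text \<open>
  Pullback along \<open>j\<close>, followed by the identification \<open>\<eta>\<close> of the pulled back coefficient system
  with \<open>A\<close>.
\<close>

definition pullback_cochain ::
  "'x sset \<Rightarrow> (nat \<Rightarrow> 'x \<Rightarrow> 'z) \<Rightarrow> ('x \<Rightarrow> 'b \<Rightarrow> 'a) \<Rightarrow> nat \<Rightarrow> ('z \<Rightarrow> 'b) \<Rightarrow> ('x \<Rightarrow> 'a)"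
  where "pullback_cochain X j \<eta> n \<phi> = (\<lambda>\<sigma>\<in>simplices X n. \<eta> (vertex0 X n \<sigma>) (\<phi> (j n \<sigma>)))"

definition pullback_hom ::
  "'x sset \<Rightarrow> (nat \<Rightarrow> 'x \<Rightarrow> 'z) \<Rightarrow> ('x \<Rightarrow> 'b \<Rightarrow> 'a) \<Rightarrow> ('r, 'x, 'a) coeff_system \<Rightarrow> nat \<Rightarrow>
    ('z \<Rightarrow> 'b) set \<Rightarrow> ('x \<Rightarrow> 'a) set"
  where "pullback_hom X j \<eta> A n = Hb_map X A n (pullback_cochain X j \<eta> n)"

text \<open>
  A fibrant replacement \<open>f = p \<circ> j\<close> of \<open>f\<close> through a Kan complex \<open>Z\<close>, together with an extension
  \<open>A'\<close> of the coefficient system \<open>A\<close> to \<open>Z\<close>.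
\<close>

definition fibrant_replacement ::
  "('r, 'm) ring_scheme \<Rightarrow> ('r \<Rightarrow> real) \<Rightarrow> 'x sset \<Rightarrow> 'y sset \<Rightarrow> (nat \<Rightarrow> 'x \<Rightarrow> 'y) \<Rightarrow>
    ('r, 'x, 'a) coeff_system \<Rightarrow> 'z sset \<Rightarrow> (nat \<Rightarrow> 'x \<Rightarrow> 'z) \<Rightarrow> (nat \<Rightarrow> 'z \<Rightarrow> 'y) \<Rightarrow>
    ('r, 'z, 'b) coeff_system \<Rightarrow> ('x \<Rightarrow> 'b \<Rightarrow> 'a) \<Rightarrow> bool"
  where "fibrant_replacement R N X Y f A Z j p A' \<eta> \<longleftrightarrow>
    kan_complex Z \<and> weak_equivalence X Z j \<and> kan_fibration Z Y p \<and>
    (\<forall>n. \<forall>\<sigma>\<in>simplices X n. f n \<sigma> = p n (j n \<sigma>)) \<and>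
    local_system R N Z A' \<and> system_iso R X (pullback_system X Z j A') A \<eta>"

definition canonical_map ::
  "'x sset \<Rightarrow> 'y sset \<Rightarrow> ('r, 'x, 'a) coeff_system \<Rightarrow> 'z sset \<Rightarrow> (nat \<Rightarrow> 'x \<Rightarrow> 'z) \<Rightarrow>
    (nat \<Rightarrow> 'z \<Rightarrow> 'y) \<Rightarrow> ('r, 'z, 'b) coeff_system \<Rightarrow> ('x \<Rightarrow> 'b \<Rightarrow> 'a) \<Rightarrow> nat \<Rightarrow>
    ('y \<Rightarrow> 'z \<Rightarrow> 'b) set \<Rightarrow> ('x \<Rightarrow> 'a) set"
  where "canonical_map X Y A Z j p A' \<eta> i = pullback_hom X j \<eta> A i \<circ> edge_hom Z Y p A' i"

end

theory Submission
  imports Defs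
begin

text \<open>
  Since cochains are not normalised, simplices may be lifted one at a time without regard to
  degeneracies. If a map of (semi-)simplicial sets has the right lifting property against the
  boundaries of the simplices of dimension at most \<open>m\<close>, it has a semi-simplicial section up to
  dimension \<open>m\<close>, and a vertical homotopy, consisting of a bounded number of simplices per prism,
  shows that it is an isomorphism on bounded cohomology below degree \<open>m\<close> and injective in degree
  \<open>m\<close>. The path space of an \<open>m\<close>-equivalence \<open>j\<close> of Kan complexes has this lifting property over
  the target, whence the same conclusion for \<open>j\<close>. For the Kan fibration \<open>p\<close> the lifting property
  holds up to dimension \<open>n + 1\<close>. If \<open>n \<ge> 1\<close>, the fibres are therefore simply connected, so that
  evaluation identifies the pullback of \<open>\<H>\<^sub>b\<^sup>0(F; A')\<close> along \<open>p\<close> with \<open>A'\<close>. For \<open>n = 0\<close> only the degrees 0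
  and 1 occur; there the edge homomorphism can be inverted by hand, by restricting cochains to the
  fibres.
\<close>

section \<open>Relative homotopies of simplices in Kan complexes\<close>

text \<open>The hypotheses concern homotopy groups, hence simplices with constant boundary, whereas
  lifting needs arbitrary boundaries. Instead of changing base points, injectivity and surjectivity
  on homotopy classes are formulated at a single simplex, relative to its boundary
  (\<open>inj_at\<close>, \<open>surj_at\<close>). Both conditions pass from one face of a
  \<open>(k + 1)\<close>-simplex to another, and a chain of such faces links each
  \<open>k\<close>-simplex to a constant one. Only horn filling enters, no group structure.
  Injectivity in dimension \<open>k\<close> corrects the last face of a horn filler, surjectivity in
  dimension \<open>k + 1\<close> then corrects the filler itself. So spheres lift up to relative
  homotopy, and either the fibration property of \<open>p\<close> or the freedom in the prisms of
  the path space of \<open>j\<close> makes the lift strict. Bounds survive because every cochain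
  operator uses a number of simplices depending on the degree alone and moves coefficients by
  seminorm non-increasing maps. The case \<open>n = 0\<close> is separate because lifting in
  dimension 1 only connects the fibres: loops in a fibre may act on the coefficients, so evaluation
  of compatible families need not be surjective.\<close>

locale semi_simplicial_set =
  fixes X :: "'x sset"
  assumes face_in: "\<sigma> \<in> simplices X (Suc n) \<Longrightarrow> i \<le> Suc n \<Longrightarrow> face X (Suc n) i \<sigma> \<in> simplices X n"
    and face_comm: "\<sigma> \<in> simplices X (Suc (Suc n)) \<Longrightarrow> i < j \<Longrightarrow> j \<le> Suc (Suc n) \<Longrightarrow>
        face X (Suc n) i (face X (Suc (Suc n)) j \<sigma>) =
        face X (Suc n) (j - 1) (face X (Suc (Suc n)) i \<sigma>)"

sublocale simplicial_set \<subseteq> semi_simplicial_set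
  by unfold_locales (auto simp: face_closed face_face)

text \<open>The position of the vertex \<open>i\<close> in the face opposite to the vertex \<open>v\<close>.\<close>

definition face_index :: "nat \<Rightarrow> nat \<Rightarrow> nat"
  where "face_index i v = (if i < v then i else i - 1)"

text \<open>Both sides omit the vertices \<open>i\<close> and \<open>v\<close>. This symmetric form
  of the face identity avoids a case distinction on the order of the two vertices at each
  use.\<close>

lemma (in semi_simplicial_set) face_swap:
  assumes "\<sigma> \<in> simplices X (Suc (Suc n))" "i \<noteq> v" "i \<le> Suc (Suc n)" "v \<le> Suc (Suc n)"
  shows "face X (Suc n) (face_index i v) (face X (Suc (Suc n)) v \<sigma>) =
    face X (Suc n) (face_index v i) (face X (Suc (Suc n)) i \<sigma>)"
proof (cases "i < v")
  case True
  then show ?thesis using face_comm[of \<sigma> n i v] assms by (simp add: face_index_def)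
next
  case False
  then have "v < i" using assms by simp
  then show ?thesis using face_comm[of \<sigma> n v i] assms by (simp add: face_index_def)
qed

lemma face_index_surj:
  assumes "i \<le> n" "k \<le> Suc n"
  obtains i' where "i' \<le> Suc n" "i' \<noteq> k" "i = face_index i' k"
  using assms that[of "if i < k then i else Suc i"] by (auto simp: face_index_def split: if_splits)

text \<open>The guard \<open>0 < n\<close> makes any two vertices have the same (empty) boundary,
  since \<open>face X 0\<close> has no meaning.\<close>

definition same_boundary :: "'x sset \<Rightarrow> nat \<Rightarrow> 'x \<Rightarrow> 'x \<Rightarrow> bool"
  where "same_boundary X n a b \<longleftrightarrow> (\<forall>i\<le>n. 0 < n \<longrightarrow> face X n i a = face X n i b)"

lemma same_boundary_refl [simp]: "same_boundary X n a a"
  by (simp add: same_boundary_def)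

lemma same_boundary_sym: "same_boundary X n a b \<Longrightarrow> same_boundary X n b a"
  by (simp add: same_boundary_def)

text \<open>Each face of the \<open>k\<close>-th face is shared with another face of the simplex.
  That one is either common to \<open>h\<close> and \<open>h'\<close> or the \<open>v\<close>-th,
  whose boundary is unchanged.\<close>

lemma (in semi_simplicial_set) same_boundary_face:
  assumes h: "h \<in> simplices X (Suc n)" "h' \<in> simplices X (Suc n)"
    and v: "v \<noteq> k" "v \<le> Suc n" "k \<le> Suc n"
    and eq: "\<And>i. i \<le> Suc n \<Longrightarrow> i \<noteq> v \<Longrightarrow> i \<noteq> k \<Longrightarrow> face X (Suc n) i h = face X (Suc n) i h'"
    and bd: "same_boundary X n (face X (Suc n) v h) (face X (Suc n) v h')"
  shows "same_boundary X n (face X (Suc n) k h) (face X (Suc n) k h')"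
proof (cases n)
  case 0
  then show ?thesis by (simp add: same_boundary_def)
next
  case (Suc m)
  have "face X n i (face X (Suc n) k h) = face X n i (face X (Suc n) k h')" if i: "i \<le> n" for i
  proof -
    obtain i' where i': "i' \<le> Suc n" "i' \<noteq> k" "i = face_index i' k"
      using face_index_surj[OF i v(3)] by blast
    have "face X n (face_index k i') (face X (Suc n) i' h) = face X n (face_index k i') (face X (Suc n) i' h')"
    proof (cases "i' = v")
      case True
      have "face_index k i' \<le> n" using i' v by (auto simp: face_index_def)
      then show ?thesis using bd True Suc by (auto simp: same_boundary_def)
    qed (simp add: eq i')
    then show ?thesis using face_swap[of h m i' k] face_swap[of h' m i' k] h i' v Suc by simp
  qed
  then show ?thesis by (simp add: same_boundary_def)
qed

locale kan_set =
  fixes X :: "'x sset"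
  assumes kan: "kan_complex X"

sublocale kan_set \<subseteq> simplicial_set
  using kan by (simp add: kan_complex_def)

context kan_set begin

text \<open>The faces of \<open>h0\<close> other than the \<open>k\<close>-th, with \<open>c\<close>
  put in place of the \<open>v\<close>-th, still form a horn: \<open>c\<close> has to match the old
  face only where it meets the faces that are kept. The side of \<open>c\<close> shared with the
  missing face is free.\<close>

lemma replace_face:
  assumes h0: "h0 \<in> simplices X (Suc n)" and vk: "v \<noteq> k" "v \<le> Suc n" "k \<le> Suc n"
    and c: "c \<in> simplices X n"
    and eq: "\<And>i. i \<le> Suc n \<Longrightarrow> i \<noteq> v \<Longrightarrow> i \<noteq> k \<Longrightarrow>
      face X n (face_index i v) c = face X n (face_index i v) (face X (Suc n) v h0)"
  obtains h where "h \<in> simplices X (Suc n)" "face X (Suc n) v h = c"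
    "\<And>i. i \<le> Suc n \<Longrightarrow> i \<noteq> v \<Longrightarrow> i \<noteq> k \<Longrightarrow> face X (Suc n) i h = face X (Suc n) i h0"
proof -
  let ?t = "\<lambda>i. if i = v then c else face X (Suc n) i h0"
  have "face X n i (?t j) = face X n (j - 1) (?t i)"
    if ij: "i < j" "j \<le> Suc n" "i \<noteq> k" "j \<noteq> k" for i j
  proof -
    obtain m where n: "n = Suc m" using vk ij by (cases n) auto
    note sw = face_comm[of h0 m i j]
    consider "i = v" | "j = v" | "i \<noteq> v" "j \<noteq> v" by blast
    then show ?thesis
    proof cases
      case 1
      then show ?thesis using eq[of j] ij sw h0 n by (simp add: face_index_def)
    next
      case 2
      then show ?thesis using eq[of i] ij sw h0 n by (simp add: face_index_def)
    next
      case 3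
      then show ?thesis using ij sw h0 n by simp
    qed
  qed
  then have "horn X n k ?t"
    using vk c h0 by (auto simp: horn_def face_in)
  then obtain h where h: "h \<in> simplices X (Suc n)" "\<forall>i\<le>Suc n. i \<noteq> k \<longrightarrow> face X (Suc n) i h = ?t i"
    using kan unfolding kan_complex_def by blast
  show thesis
    by (rule that[of h]) (use h vk in auto)
qed

text \<open>This moves a change of one face, relative to its boundary, into a change of another
  face, again relative to its boundary. It is the mechanism by which relative conditions propagate
  from face to face.\<close>

lemma replace_face_same_boundary:
  assumes h0: "h0 \<in> simplices X (Suc n)" and vk: "v \<noteq> k" "v \<le> Suc n" "k \<le> Suc n"
    and c: "c \<in> simplices X n" "same_boundary X n c (face X (Suc n) v h0)"
  obtains h where "h \<in> simplices X (Suc n)" "face X (Suc n) v h = c"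
    "\<And>i. i \<le> Suc n \<Longrightarrow> i \<noteq> v \<Longrightarrow> i \<noteq> k \<Longrightarrow> face X (Suc n) i h = face X (Suc n) i h0"
    "same_boundary X n (face X (Suc n) k h) (face X (Suc n) k h0)"
proof -
  have *: "face X n (face_index i v) c = face X n (face_index i v) (face X (Suc n) v h0)"
    if "i \<le> Suc n" "i \<noteq> v" "i \<noteq> k" for i
  proof -
    have "0 < n" using that vk by (cases n) auto
    moreover have "face_index i v \<le> n" using that vk by (auto simp: face_index_def)
    ultimately show ?thesis using c by (simp add: same_boundary_def)
  qed
  obtain h where h: "h \<in> simplices X (Suc n)" "face X (Suc n) v h = c"
    "\<And>i. i \<le> Suc n \<Longrightarrow> i \<noteq> v \<Longrightarrow> i \<noteq> k \<Longrightarrow> face X (Suc n) i h = face X (Suc n) i h0"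
    using replace_face[OF h0 vk c(1) *] by blast
  show thesis
    by (rule that[OF h])
      (auto intro!: same_boundary_face[OF h(1) h0 vk h(3)] simp: h(2) c(2))
qed

end

text \<open>Homotopy relative to the boundary, witnessed by a simplex in which the vertex \<open>j\<close> is doubled.\<close>

definition homotopic_at :: "'x sset \<Rightarrow> nat \<Rightarrow> nat \<Rightarrow> 'x \<Rightarrow> 'x \<Rightarrow> bool"
  where "homotopic_at X n j a b \<longleftrightarrow> a \<in> simplices X n \<and> b \<in> simplices X n \<and>
    (\<exists>w\<in>simplices X (Suc n). face X (Suc n) j w = a \<and> face X (Suc n) (Suc j) w = b \<and>
      (\<forall>i\<le>Suc n. i \<noteq> j \<longrightarrow> i \<noteq> Suc j \<longrightarrow> face X (Suc n) i w = face X (Suc n) i (degen X n j a)))"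

abbreviation homotopic :: "'x sset \<Rightarrow> nat \<Rightarrow> 'x \<Rightarrow> 'x \<Rightarrow> bool"
  where "homotopic X n \<equiv> homotopic_at X n 0"

section \<open>Relative homotopy as an equivalence relation, and its behaviour under passing to
  faces\<close>

context kan_set begin

text \<open>Doubling the vertex \<open>v\<close> of \<open>h\<close> and inserting \<open>h'\<close> as one of the two faces equal to \<open>h\<close>
  leaves a horn whose missing face is the homotopy.\<close>

lemma homotopic_face:
  assumes h: "h \<in> simplices X (Suc n)" "h' \<in> simplices X (Suc n)" and b: "b \<le> Suc n"
    and eq: "\<And>i. i \<le> Suc n \<Longrightarrow> i \<noteq> b \<Longrightarrow> face X (Suc n) i h = face X (Suc n) i h'"
    and j: "j \<le> n"
  shows "homotopic_at X n j (face X (Suc n) b h) (face X (Suc n) b h')"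
proof -
  \<comment> \<open>\<open>v\<close> is the vertex of \<open>h\<close> that becomes the vertex
    \<open>j\<close> of its \<open>b\<close>-th face. Among the faces of the degeneracy of
    \<open>h\<close> at \<open>v\<close>, the one coming from the \<open>b\<close>-th face of
    \<open>h\<close> has index \<open>k\<close>.\<close>
  define v where "v = (if j < b then j else Suc j)"
  define k where "k = (if b < v then b else Suc b)"
  have v: "v \<le> Suc n" "v \<noteq> b" using j b by (auto simp: v_def)
  have k: "k \<le> Suc (Suc n)" "k \<noteq> v" "k \<noteq> Suc v" using b v by (auto simp: k_def)
  have sv: "Suc v \<noteq> k" "Suc v \<le> Suc (Suc n)" using k v by auto
  define T0 where "T0 = degen X (Suc n) v h"
  have T0: "T0 \<in> simplices X (Suc (Suc n))" using h v by (simp add: T0_def degen_closed)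
  have T0f: "face X (Suc (Suc n)) v T0 = h" "face X (Suc (Suc n)) (Suc v) T0 = h"
    using h v by (simp_all add: T0_def face_degen_eq)
  have comp: "face X (Suc n) (face_index i (Suc v)) h' =
      face X (Suc n) (face_index i (Suc v)) (face X (Suc (Suc n)) (Suc v) T0)"
    if "i \<le> Suc (Suc n)" "i \<noteq> Suc v" "i \<noteq> k" for i
    using that v by (subst T0f, intro eq[symmetric]) (auto simp: face_index_def k_def split: if_splits)
  obtain T where T: "T \<in> simplices X (Suc (Suc n))" "face X (Suc (Suc n)) (Suc v) T = h'"
    "\<And>i. i \<le> Suc (Suc n) \<Longrightarrow> i \<noteq> Suc v \<Longrightarrow> i \<noteq> k \<Longrightarrow>
      face X (Suc (Suc n)) i T = face X (Suc (Suc n)) i T0"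
    using replace_face[OF T0 sv k(1) h(2) comp] by blast
  define w where "w = face X (Suc (Suc n)) k T"
  have "face X (Suc n) (face_index v k) w = face X (Suc n) (face_index k v) h"
    using face_swap[OF T(1), of v k] T(3)[of v] T0f k v by (simp add: w_def)
  moreover have "face_index v k = j" "face_index k v = b"
    by (auto simp: face_index_def k_def v_def)
  ultimately have w1: "face X (Suc n) j w = face X (Suc n) b h" by simp
  have "face X (Suc n) (face_index (Suc v) k) w = face X (Suc n) (face_index k (Suc v)) h'"
    using face_swap[OF T(1), of "Suc v" k] T(2) T0f k v by (simp add: w_def)
  moreover have "face_index (Suc v) k = Suc j" "face_index k (Suc v) = b"
    by (auto simp: face_index_def k_def v_def)
  ultimately have w2: "face X (Suc n) (Suc j) w = face X (Suc n) b h'" by simp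
  have kT0: "face X (Suc (Suc n)) k T0 = degen X n j (face X (Suc n) b h)"
  proof (cases "b < v")
    case True
    then show ?thesis using face_degen_less[OF h(1), of b v] v unfolding T0_def k_def
      by (auto simp: v_def split: if_splits)
  next
    case False
    then show ?thesis using face_degen_greater[OF h(1), of v "Suc b"] v b unfolding T0_def k_def
      by (auto simp: v_def split: if_splits)
  qed
  have w3: "face X (Suc n) i w = face X (Suc n) i (degen X n j (face X (Suc n) b h))"
    if i: "i \<le> Suc n" "i \<noteq> j" "i \<noteq> Suc j" for i
  proof -
    obtain i' where i': "i' \<le> Suc (Suc n)" "i' \<noteq> k" "i = face_index i' k"
      using face_index_surj[OF i(1) k(1)] by blast
    have "i' \<noteq> Suc v" using i' i \<open>face_index (Suc v) k = Suc j\<close> by auto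
    then show ?thesis
      using face_swap[OF T(1), of i' k] face_swap[OF T0, of i' k] T(3)[of i'] i' k kT0
      by (simp add: w_def)
  qed
  show ?thesis unfolding homotopic_at_def
    using w1 w2 w3 T(1) k h b by (auto simp: w_def face_in intro!: bexI[of _ w])
qed

text \<open>A homotopy doubling the vertex \<open>j\<close> and the degeneracy of \<open>a\<close>
  at \<open>j\<close> agree on all faces except the one of index \<open>Suc j\<close>, where they
  have \<open>b\<close> and \<open>a\<close>. So \<open>homotopic_face\<close> applies, with any
  vertex doubled.\<close>

lemma homotopic_at_change:
  assumes "homotopic_at X n j a b" "j \<le> n" "j' \<le> n"
  shows "homotopic_at X n j' a b"
proof -
  obtain w where w: "a \<in> simplices X n" "w \<in> simplices X (Suc n)"
    "face X (Suc n) j w = a" "face X (Suc n) (Suc j) w = b"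
    "\<forall>i\<le>Suc n. i \<noteq> j \<longrightarrow> i \<noteq> Suc j \<longrightarrow> face X (Suc n) i w = face X (Suc n) i (degen X n j a)"
    using assms unfolding homotopic_at_def by blast
  have "homotopic_at X n j' (face X (Suc n) (Suc j) (degen X n j a)) (face X (Suc n) (Suc j) w)"
    by (rule homotopic_face) (use w assms in \<open>auto simp: degen_closed face_degen_eq\<close>)
  then show ?thesis using w assms by (simp add: face_degen_eq)
qed

lemma homotopic_refl: "a \<in> simplices X n \<Longrightarrow> homotopic X n a a"
  by (auto simp: homotopic_at_def degen_closed face_degen_eq intro!: bexI[of _ "degen X n 0 a"])

text \<open>Two homotopies that start at \<open>a\<close> differ only in the face of index 1. With
  reflexivity, this single property yields symmetry and transitivity.\<close>

lemma homotopic_cotrans: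
  assumes "homotopic X n a b" "homotopic X n a c"
  shows "homotopic X n b c"
proof -
  obtain w where w: "a \<in> simplices X n" "w \<in> simplices X (Suc n)"
    "face X (Suc n) 0 w = a" "face X (Suc n) (Suc 0) w = b"
    "\<forall>i\<le>Suc n. i \<noteq> 0 \<longrightarrow> i \<noteq> Suc 0 \<longrightarrow> face X (Suc n) i w = face X (Suc n) i (degen X n 0 a)"
    using assms(1) unfolding homotopic_at_def by blast
  obtain w' where w': "w' \<in> simplices X (Suc n)"
    "face X (Suc n) 0 w' = a" "face X (Suc n) (Suc 0) w' = c"
    "\<forall>i\<le>Suc n. i \<noteq> 0 \<longrightarrow> i \<noteq> Suc 0 \<longrightarrow> face X (Suc n) i w' = face X (Suc n) i (degen X n 0 a)"
    using assms(2) unfolding homotopic_at_def by blast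
  have "homotopic X n (face X (Suc n) (Suc 0) w) (face X (Suc n) (Suc 0) w')"
  proof (rule homotopic_face)
    show "face X (Suc n) i w = face X (Suc n) i w'" if "i \<le> Suc n" "i \<noteq> Suc 0" for i
      using that w w' by (cases "i = 0") auto
  qed (use w w' in auto)
  then show ?thesis using w w' by simp
qed

lemma homotopic_sym: "homotopic X n a b \<Longrightarrow> homotopic X n b a"
  using homotopic_cotrans homotopic_refl homotopic_at_def by metis

lemma homotopic_trans: "homotopic X n a b \<Longrightarrow> homotopic X n b c \<Longrightarrow> homotopic X n a c"
  using homotopic_cotrans homotopic_sym by blast

text \<open>In a degeneracy of \<open>h\<close>, the face that degenerates the \<open>a\<close>-th
  face of \<open>h\<close> is replaced by the homotopy. One of the two copies of \<open>h\<close> is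
  left open as the missing face of a horn, and the filler supplies \<open>h'\<close> there.\<close>

lemma replace_face_homotopic:
  assumes h: "h \<in> simplices X (Suc n)" and a: "a \<le> Suc n" and c: "homotopic X n (face X (Suc n) a h) c"
  obtains h' where "h' \<in> simplices X (Suc n)" "face X (Suc n) a h' = c"
    "\<And>i. i \<le> Suc n \<Longrightarrow> i \<noteq> a \<Longrightarrow> face X (Suc n) i h' = face X (Suc n) i h"
proof -
  \<comment> \<open>The doubled vertex must differ from \<open>a\<close>, and the face
    \<open>a'\<close> must be exactly the degeneracy of the \<open>a\<close>-th face at its vertex
    0, because the homotopy \<open>w\<close> doubles that vertex. For \<open>a = 0\<close> this
    forces doubling the vertex 1 instead of 0.\<close>
  define v where "v = (if a = 0 then Suc 0 else 0)"
  define a' where "a' = (if a = 0 then 0 else Suc a)"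
  define T0 where "T0 = degen X (Suc n) v h"
  have T0: "T0 \<in> simplices X (Suc (Suc n))" using h by (simp add: T0_def v_def degen_closed)
  have T0f: "face X (Suc (Suc n)) v T0 = h" "face X (Suc (Suc n)) (Suc v) T0 = h"
    using h by (simp_all add: T0_def face_degen_eq v_def)
  let ?x = "face X (Suc n) a h"
  obtain w where w: "w \<in> simplices X (Suc n)"
    "face X (Suc n) 0 w = ?x" "face X (Suc n) (Suc 0) w = c"
    "\<forall>i\<le>Suc n. i \<noteq> 0 \<longrightarrow> i \<noteq> Suc 0 \<longrightarrow> face X (Suc n) i w = face X (Suc n) i (degen X n 0 ?x)"
    using c unfolding homotopic_at_def by blast
  have xs: "?x \<in> simplices X n" using h a by (simp add: face_in)
  have a'T0: "face X (Suc (Suc n)) a' T0 = degen X n 0 ?x"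
    using face_degen_less[OF h, of 0 "Suc 0"] face_degen_greater[OF h, of 0 "Suc a"] a
    by (auto simp: T0_def a'_def v_def)
  have ne: "a' \<noteq> Suc v" "a' \<le> Suc (Suc n)" "Suc v \<le> Suc (Suc n)"
    using a by (auto simp: a'_def v_def)
  have wall: "face X (Suc n) i w = face X (Suc n) i (degen X n 0 ?x)" if "i \<le> Suc n" "i \<noteq> Suc 0" for i
    using that w xs by (cases "i = 0") (auto simp: face_degen_eq)
  have comp: "face X (Suc n) (face_index i a') w =
      face X (Suc n) (face_index i a') (face X (Suc (Suc n)) a' T0)"
    if i: "i \<le> Suc (Suc n)" "i \<noteq> a'" "i \<noteq> Suc v" for i
    unfolding a'T0 using i a
    by (intro wall) (auto simp: face_index_def a'_def v_def split: if_splits)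
  obtain T where T: "T \<in> simplices X (Suc (Suc n))" "face X (Suc (Suc n)) a' T = w"
    "\<And>i. i \<le> Suc (Suc n) \<Longrightarrow> i \<noteq> a' \<Longrightarrow> i \<noteq> Suc v \<Longrightarrow>
      face X (Suc (Suc n)) i T = face X (Suc (Suc n)) i T0"
    using replace_face[OF T0 ne(1,2,3) w(1) comp] by blast
  let ?h' = "face X (Suc (Suc n)) (Suc v) T"
  show thesis
  proof (rule that)
    show "?h' \<in> simplices X (Suc n)" using T ne by (simp add: face_in)
    have "face X (Suc n) (face_index a' (Suc v)) ?h' = face X (Suc n) (face_index (Suc v) a') w"
      using face_swap[OF T(1), of a' "Suc v"] T(2) ne by simp
    moreover have "face_index a' (Suc v) = a" "face_index (Suc v) a' = Suc 0"
      by (auto simp: face_index_def a'_def v_def)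
    ultimately show "face X (Suc n) a ?h' = c" using w by simp
    fix i assume i: "i \<le> Suc n" "i \<noteq> a"
    obtain i' where i': "i' \<le> Suc (Suc n)" "i' \<noteq> Suc v" "i = face_index i' (Suc v)"
      using face_index_surj[OF i(1) ne(3)] by blast
    have "i' \<noteq> a'" using i' i \<open>face_index a' (Suc v) = a\<close> by auto
    then show "face X (Suc n) i ?h' = face X (Suc n) i h"
      using face_swap[OF T(1), of i' "Suc v"] face_swap[OF T0, of i' "Suc v"] T(3)[of i'] i' ne T0f by simp
  qed
qed

text \<open>First \<open>h\<close> is changed so that its \<open>a\<close>-th face equals that of
  \<open>h'\<close>. Afterwards only the \<open>b\<close>-th faces differ, and
  \<open>homotopic_face\<close> compares them.\<close>

lemma homotopic_other_face:
  assumes h: "h \<in> simplices X (Suc n)" "h' \<in> simplices X (Suc n)"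
    and ab: "a \<noteq> b" "a \<le> Suc n" "b \<le> Suc n"
    and eq: "\<And>i. i \<le> Suc n \<Longrightarrow> i \<noteq> a \<Longrightarrow> i \<noteq> b \<Longrightarrow> face X (Suc n) i h = face X (Suc n) i h'"
    and hom: "homotopic X n (face X (Suc n) a h) (face X (Suc n) a h')"
  shows "homotopic X n (face X (Suc n) b h) (face X (Suc n) b h')"
proof -
  obtain k where k: "k \<in> simplices X (Suc n)" "face X (Suc n) a k = face X (Suc n) a h'"
    "\<And>i. i \<le> Suc n \<Longrightarrow> i \<noteq> a \<Longrightarrow> face X (Suc n) i k = face X (Suc n) i h"
    using replace_face_homotopic[OF h(1) ab(2) hom] by blast
  have "homotopic X n (face X (Suc n) b k) (face X (Suc n) b h')"
  proof (rule homotopic_face)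
    show "face X (Suc n) i k = face X (Suc n) i h'" if "i \<le> Suc n" "i \<noteq> b" for i
      using that k eq by (cases "i = a") auto
  qed (use k h ab in auto)
  then show ?thesis using k ab by simp
qed

end

lemma simplicial_mapD:
  assumes "simplicial_map X Y f"
  shows "\<sigma> \<in> simplices X n \<Longrightarrow> f n \<sigma> \<in> simplices Y n"
    and "\<sigma> \<in> simplices X (Suc n) \<Longrightarrow> i \<le> Suc n \<Longrightarrow> f n (face X (Suc n) i \<sigma>) = face Y (Suc n) i (f (Suc n) \<sigma>)"
    and "\<sigma> \<in> simplices X n \<Longrightarrow> i \<le> n \<Longrightarrow> f (Suc n) (degen X n i \<sigma>) = degen Y n i (f n \<sigma>)"
  using assms by (auto simp: simplicial_map_def)

lemma homotopic_at_map:
  assumes X: "simplicial_set X" and g: "simplicial_map X Y g" and hom: "homotopic_at X n j a b" and j: "j \<le> n"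
  shows "homotopic_at Y n j (g n a) (g n b)"
proof -
  interpret simplicial_set X by fact
  obtain w where w: "a \<in> simplices X n" "b \<in> simplices X n" "w \<in> simplices X (Suc n)"
    "face X (Suc n) j w = a" "face X (Suc n) (Suc j) w = b"
    "\<forall>i\<le>Suc n. i \<noteq> j \<longrightarrow> i \<noteq> Suc j \<longrightarrow> face X (Suc n) i w = face X (Suc n) i (degen X n j a)"
    using hom unfolding homotopic_at_def by blast
  have "face Y (Suc n) i (g (Suc n) w) = face Y (Suc n) i (degen Y n j (g n a))"
    if "i \<le> Suc n" "i \<noteq> j" "i \<noteq> Suc j" for i
    using that w j simplicial_mapD[OF g] degen_closed by metis
  then show ?thesis unfolding homotopic_at_def
    using w j simplicial_mapD[OF g] by (intro conjI bexI[of _ "g (Suc n) w"]) auto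
qed

section \<open>Lifting of simplices along highly connected maps\<close>

fun mult_degen :: "'x sset \<Rightarrow> nat \<Rightarrow> nat \<Rightarrow> 'x \<Rightarrow> 'x"
  where "mult_degen X m 0 w = w"
  | "mult_degen X m (Suc i) w = degen X (m + i) 0 (mult_degen X m i w)"

context simplicial_set begin

lemma mult_degen_in: "w \<in> simplices X m \<Longrightarrow> mult_degen X m i w \<in> simplices X (m + i)"
  by (induction i) (auto simp: degen_closed)

lemma face_mult_degen:
  assumes "w \<in> simplices X (Suc m)"
  shows "face X (Suc m + i) (Suc i) (mult_degen X (Suc m) i w) = mult_degen X m i (face X (Suc m) (Suc 0) w)"
proof (induction i)
  case (Suc i)
  show ?case
    using face_degen_greater[of "mult_degen X (Suc m) i w" "m + i" 0 "Suc (Suc i)"]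
      mult_degen_in[OF assms, of i] Suc by simp
qed simp

lemma degen_mult_degen:
  assumes "w \<in> simplices X m"
  shows "degen X (m + i) i (mult_degen X m i w) = mult_degen X m (Suc i) w"
proof (induction i)
  case (Suc i)
  show ?case
    using degen_degen[of "mult_degen X m i w" "m + i" 0 i] mult_degen_in[OF assms, of i] Suc by simp
qed simp

text \<open>Replacing the vertices of \<open>a\<close> one after another by the first one, with \<open>s\<^sub>i d\<^sub>i\<^sub>+\<^sub>1\<close>, leads to a
  constant simplex; consecutive simplices are faces of a common one.\<close>

lemma simplex_induct_constant:
  assumes base: "\<And>x. x \<in> simplices X 0 \<Longrightarrow> P (mult_degen X 0 n x)"
    and step: "\<And>h v k. h \<in> simplices X (Suc n) \<Longrightarrow> v \<noteq> k \<Longrightarrow> v \<le> Suc n \<Longrightarrow> k \<le> Suc n \<Longrightarrow>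
      P (face X (Suc n) k h) \<Longrightarrow> P (face X (Suc n) v h)"
    and a: "a \<in> simplices X n"
  shows "P a"
proof -
  have "P (mult_degen X m i w)" if "m + i = n" "w \<in> simplices X m" for m i w
    using that
  proof (induction m arbitrary: i w)
    case 0
    then show ?case using base by simp
  next
    case (Suc m)
    let ?a = "mult_degen X (Suc m) i w"
    have a: "?a \<in> simplices X n" using mult_degen_in[OF Suc.prems(2)] Suc.prems by metis
    have le: "i \<le> n" "Suc (Suc i) \<le> Suc n" using Suc.prems by auto
    have h: "degen X n i ?a \<in> simplices X (Suc n)" using a le by (simp add: degen_closed)
    \<comment> \<open>Two faces of this degenerate simplex matter: the one of index
      \<open>Suc i\<close> is \<open>?a\<close> itself, the one of index \<open>Suc (Suc i)\<close>
      is the next simplex of the chain, which degenerates a simplex of smaller dimension.\<close>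
    have "face X (Suc n) (Suc (Suc i)) (degen X n i ?a) = degen X (n - 1) i (face X n (Suc i) ?a)"
      using face_degen_greater[of ?a "n - 1" i "Suc (Suc i)"] a le Suc.prems by (cases n) auto
    also have "\<dots> = mult_degen X m (Suc i) (face X (Suc m) (Suc 0) w)"
      using face_mult_degen[OF Suc.prems(2), of i] Suc.prems(1)[symmetric]
        degen_mult_degen[OF face_in[OF Suc.prems(2), of "Suc 0"], of i] by simp
    finally have "P (face X (Suc n) (Suc (Suc i)) (degen X n i ?a))"
      using Suc.IH[of "Suc i" "face X (Suc m) (Suc 0) w"] Suc.prems face_in by simp
    then have "P (face X (Suc n) (Suc i) (degen X n i ?a))"
      using step[OF h, of "Suc i" "Suc (Suc i)"] le by simp
    then show ?case using a le by (simp add: face_degen_eq)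
  qed
  from this[of n 0 a] a show ?thesis by simp
qed

lemma const_simplex_eq_mult_degen: "const_simplex X n x = mult_degen X 0 n x"
  by (induction n) auto

lemma const_simplex_in: "x \<in> simplices X 0 \<Longrightarrow> const_simplex X n x \<in> simplices X n"
  using mult_degen_in[of x 0 n] by (simp add: const_simplex_eq_mult_degen)

lemma face_const_simplex:
  "x \<in> simplices X 0 \<Longrightarrow> i \<le> Suc n \<Longrightarrow> face X (Suc n) i (const_simplex X (Suc n) x) = const_simplex X n x"
proof (induction n arbitrary: i)
  case 0
  then show ?case using face_degen_eq[of x 0 0 i] by (cases i) auto
next
  case (Suc n)
  then show ?case
    using face_degen_eq[of "const_simplex X (Suc n) x" "Suc n" 0 i]
      face_degen_greater[of "const_simplex X (Suc n) x" n 0 i] const_simplex_in[of x "Suc n"]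
      Suc.IH[of "i - 1"]
    by (cases "i = 0 \<or> i = Suc 0") auto
qed

lemma degen_const_simplex:
  "x \<in> simplices X 0 \<Longrightarrow> i \<le> n \<Longrightarrow> degen X n i (const_simplex X n x) = const_simplex X (Suc n) x"
proof (induction n arbitrary: i)
  case (Suc n)
  show ?case
  proof (cases i)
    case (Suc j)
    then show ?thesis
      using degen_degen[of "const_simplex X n x" n 0 j] const_simplex_in[of x n] Suc.IH[of j] Suc.prems by simp
  qed simp
qed simp

lemma spheres_eq:
  "x \<in> simplices X 0 \<Longrightarrow> spheres X k x = {\<sigma> \<in> simplices X k. same_boundary X k (const_simplex X k x) \<sigma>}"
  using face_const_simplex[of x _ "k - 1"]
  by (cases k) (auto simp: spheres_def same_boundary_def)

text \<open>For a sphere all lower faces of its last degeneracy are constant, so the usual relation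
  is the relative homotopy in which the last vertex is doubled.\<close>

lemma homotopy_rel_eq:
  assumes x: "x \<in> simplices X 0"
  shows "homotopy_rel X k x = {(\<sigma>, \<tau>). \<sigma> \<in> spheres X k x \<and> \<tau> \<in> spheres X k x \<and> homotopic_at X k k \<sigma> \<tau>}"
proof -
  have "face X (Suc k) i (degen X k k \<sigma>) = const_simplex X k x" if "\<sigma> \<in> spheres X k x" "i < k" for \<sigma> i
    using that face_degen_less[of \<sigma> "k - 1" i k] degen_const_simplex[OF x, of "k - 1" "k - 1"]
    by (cases k) (auto simp: spheres_def)
  then have "(\<forall>i<k. face X (Suc k) i \<omega> = const_simplex X k x) \<longleftrightarrow>
      (\<forall>i\<le>Suc k. i \<noteq> k \<longrightarrow> i \<noteq> Suc k \<longrightarrow> face X (Suc k) i \<omega> = face X (Suc k) i (degen X k k \<sigma>))"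
    if "\<sigma> \<in> spheres X k x" for \<sigma> \<omega>
    using that by (metis le_Suc_eq less_SucI less_irrefl_nat less_or_eq_imp_le not_less_eq order_le_less)
  then show ?thesis unfolding homotopy_rel_def homotopic_at_def
    by (auto simp: spheres_def)
qed

end

lemma map_const_simplex:
  assumes "simplicial_set X" "simplicial_map X Y f" "x \<in> simplices X 0"
  shows "f n (const_simplex X n x) = const_simplex Y n (f 0 x)"
proof (induction n)
  case (Suc n)
  then show ?case
    using simplicial_mapD(3)[OF assms(2), of "const_simplex X n x" n 0]
      simplicial_set.const_simplex_in[OF assms(1,3)] by simp
qed simp

lemma map_same_boundary:
  assumes "simplicial_map X Y f" "same_boundary X n a b" "a \<in> simplices X n" "b \<in> simplices X n"
  shows "same_boundary Y n (f n a) (f n b)"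
proof (cases n)
  case (Suc m)
  show ?thesis
    using assms(2-4) simplicial_mapD(2)[OF assms(1), of _ m, symmetric] Suc by (simp add: same_boundary_def)
qed (simp add: same_boundary_def)

context kan_set begin

lemma homotopy_rel_eq_homotopic:
  "x \<in> simplices X 0 \<Longrightarrow> homotopy_rel X k x =
    {(\<sigma>, \<tau>). \<sigma> \<in> spheres X k x \<and> \<tau> \<in> spheres X k x \<and> homotopic X k \<sigma> \<tau>}"
  using homotopy_rel_eq[of x k] homotopic_at_change[of k] by blast

lemma equiv_homotopy_rel:
  "x \<in> simplices X 0 \<Longrightarrow> equiv (spheres X k x) (homotopy_rel X k x)"
proof (rule equivI)
  assume x: "x \<in> simplices X 0"
  show "homotopy_rel X k x \<subseteq> spheres X k x \<times> spheres X k x"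
    using x by (auto simp: homotopy_rel_eq_homotopic)
  show "refl_on (spheres X k x) (homotopy_rel X k x)"
    using x by (auto simp: homotopy_rel_eq_homotopic spheres_def intro!: refl_onI homotopic_refl)
  show "sym (homotopy_rel X k x)"
    using x homotopic_sym by (auto simp: homotopy_rel_eq_homotopic sym_def)
  show "trans (homotopy_rel X k x)"
    using x homotopic_trans by (auto simp: homotopy_rel_eq_homotopic trans_def)
qed

end

text \<open>Injectivity on homotopy classes relative to the boundary of \<open>a\<close>, at the
  class of \<open>a\<close>. For constant \<open>a\<close> this is triviality of the kernel on a
  homotopy group; for general \<open>a\<close> it is a condition that can be moved along
  faces.\<close>

definition inj_at :: "'x sset \<Rightarrow> 'y sset \<Rightarrow> (nat \<Rightarrow> 'x \<Rightarrow> 'y) \<Rightarrow> nat \<Rightarrow> 'x \<Rightarrow> bool"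
  where "inj_at X Y g n a \<longleftrightarrow> (\<forall>b\<in>simplices X n. same_boundary X n a b \<longrightarrow>
    homotopic Y n (g n a) (g n b) \<longrightarrow> homotopic X n a b)"

text \<open>Surjectivity on classes relative to a boundary that is already known to bound a simplex
  \<open>a\<close>. That a given sphere bounds at all has to be shown separately, in
  \<open>fill_up_to_homotopy\<close>.\<close>

definition surj_at :: "'x sset \<Rightarrow> 'y sset \<Rightarrow> (nat \<Rightarrow> 'x \<Rightarrow> 'y) \<Rightarrow> nat \<Rightarrow> 'x \<Rightarrow> bool"
  where "surj_at X Y g n a \<longleftrightarrow> (\<forall>b\<in>simplices Y n. same_boundary Y n (g n a) b \<longrightarrow>
    (\<exists>a'\<in>simplices X n. same_boundary X n a a' \<and> homotopic Y n (g n a') b))"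

text \<open>Maps from the boundary of the standard \<open>(k + 1)\<close>-simplex, encoded as a horn
  without a missing face. Two vertices (\<open>k = 0\<close>) have no common faces, so they need no
  compatibility.\<close>

definition sphere_data :: "'x sset \<Rightarrow> nat \<Rightarrow> (nat \<Rightarrow> 'x) \<Rightarrow> bool"
  where "sphere_data X k t \<longleftrightarrow> (\<forall>i\<le>Suc k. t i \<in> simplices X k) \<and>
    (\<forall>i j. 0 < k \<and> i < j \<and> j \<le> Suc k \<longrightarrow> face X k i (t j) = face X k (j - 1) (t i))"

text \<open>The right lifting property against the inclusion of the boundary of the standard \<open>k\<close>-simplex.\<close>

definition lifts_spheres :: "'x sset \<Rightarrow> 'y sset \<Rightarrow> (nat \<Rightarrow> 'x \<Rightarrow> 'y) \<Rightarrow> nat \<Rightarrow> bool"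
  where "lifts_spheres X Y q k \<longleftrightarrow> (case k of
      0 \<Rightarrow> \<forall>\<sigma>\<in>simplices Y 0. \<exists>\<tau>\<in>simplices X 0. q 0 \<tau> = \<sigma>
    | Suc k \<Rightarrow> \<forall>\<sigma>\<in>simplices Y (Suc k). \<forall>t. sphere_data X k t \<and>
        (\<forall>i\<le>Suc k. q k (t i) = face Y (Suc k) i \<sigma>) \<longrightarrow>
        (\<exists>\<tau>\<in>simplices X (Suc k). q (Suc k) \<tau> = \<sigma> \<and> (\<forall>i\<le>Suc k. face X (Suc k) i \<tau> = t i)))"

lemma kan_fibrationD:
  assumes "kan_fibration X Y p" "\<omega> \<in> simplices Y (Suc n)" "horn X n k \<tau>"
    and "\<And>i. i \<le> Suc n \<Longrightarrow> i \<noteq> k \<Longrightarrow> face Y (Suc n) i \<omega> = p n (\<tau> i)"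
  shows "\<exists>\<sigma>\<in>simplices X (Suc n). p (Suc n) \<sigma> = \<omega> \<and>
    (\<forall>i\<le>Suc n. i \<noteq> k \<longrightarrow> face X (Suc n) i \<sigma> = \<tau> i)"
  using assms unfolding kan_fibration_def by simp

section \<open>Relative homotopy classes under a map of Kan complexes\<close>

locale kan_map = X: kan_set X + Y: kan_set Y for X :: "'x sset" and Y :: "'y sset" +
  fixes g :: "nat \<Rightarrow> 'x \<Rightarrow> 'y"
  assumes g: "simplicial_map X Y g"
begin

text \<open>Putting \<open>b\<close> in place of the \<open>v\<close>-th face of \<open>h\<close>
  changes the \<open>k\<close>-th face into another one with the same boundary. A homotopy of the
  images of the \<open>v\<close>-th faces gives one of the images of the \<open>k\<close>-th faces;
  the assumption pulls it back to \<open>X\<close>, where it is moved to the \<open>v\<close>-th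
  faces again.\<close>

lemma inj_at_face:
  assumes h: "h \<in> simplices X (Suc n)" and vk: "v \<noteq> k" "v \<le> Suc n" "k \<le> Suc n"
    and inj: "inj_at X Y g n (face X (Suc n) k h)"
  shows "inj_at X Y g n (face X (Suc n) v h)"
  unfolding inj_at_def
proof (intro ballI impI)
  fix b assume b: "b \<in> simplices X n" "same_boundary X n (face X (Suc n) v h) b"
    and hom: "homotopic Y n (g n (face X (Suc n) v h)) (g n b)"
  obtain h' where h': "h' \<in> simplices X (Suc n)" "face X (Suc n) v h' = b"
    "\<And>i. i \<le> Suc n \<Longrightarrow> i \<noteq> v \<Longrightarrow> i \<noteq> k \<Longrightarrow> face X (Suc n) i h' = face X (Suc n) i h"
    "same_boundary X n (face X (Suc n) k h') (face X (Suc n) k h)"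
    using X.replace_face_same_boundary[OF h vk b(1) same_boundary_sym[OF b(2)]] by blast
  have "homotopic Y n (face Y (Suc n) k (g (Suc n) h)) (face Y (Suc n) k (g (Suc n) h'))"
  proof (rule Y.homotopic_other_face[OF _ _ vk])
    show "face Y (Suc n) i (g (Suc n) h) = face Y (Suc n) i (g (Suc n) h')"
      if "i \<le> Suc n" "i \<noteq> v" "i \<noteq> k" for i
      using that h h'(1,3) simplicial_mapD(2)[OF g] by metis
    show "homotopic Y n (face Y (Suc n) v (g (Suc n) h)) (face Y (Suc n) v (g (Suc n) h'))"
      using hom h h' vk simplicial_mapD(2)[OF g] by metis
  qed (use h h' simplicial_mapD(1)[OF g] in auto)
  then have "homotopic Y n (g n (face X (Suc n) k h)) (g n (face X (Suc n) k h'))"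
    using h h' vk simplicial_mapD(2)[OF g] by metis
  then have "homotopic X n (face X (Suc n) k h) (face X (Suc n) k h')"
    using inj h' vk same_boundary_sym unfolding inj_at_def by (metis X.face_in)
  then have "homotopic X n (face X (Suc n) v h) (face X (Suc n) v h')"
    by (rule X.homotopic_other_face[OF h h'(1) vk(1)[symmetric] vk(3,2), rotated]) (simp add: h'(3))
  then show "homotopic X n (face X (Suc n) v h) b" using h' by simp
qed

text \<open>Putting \<open>b\<close> in place of the \<open>v\<close>-th face of the image of
  \<open>h\<close> produces a new \<open>k\<close>-th face in \<open>Y\<close>. This is lifted up to
  homotopy by assumption, the lift is inserted as the \<open>k\<close>-th face of \<open>h\<close>,
  and the resulting \<open>v\<close>-th face maps to \<open>b\<close> up to homotopy.\<close>

lemma surj_at_face: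
  assumes h: "h \<in> simplices X (Suc n)" and vk: "v \<noteq> k" "v \<le> Suc n" "k \<le> Suc n"
    and surj: "surj_at X Y g n (face X (Suc n) k h)"
  shows "surj_at X Y g n (face X (Suc n) v h)"
  unfolding surj_at_def
proof (intro ballI impI)
  fix b assume b: "b \<in> simplices Y n" "same_boundary Y n (g n (face X (Suc n) v h)) b"
  have gh: "g (Suc n) h \<in> simplices Y (Suc n)" using h simplicial_mapD(1)[OF g] by blast
  have gf: "face Y (Suc n) i (g (Suc n) x) = g n (face X (Suc n) i x)"
    if "x \<in> simplices X (Suc n)" "i \<le> Suc n" for i x
    using that simplicial_mapD(2)[OF g] by metis
  have b': "same_boundary Y n b (face Y (Suc n) v (g (Suc n) h))"
    using b(2) gf[OF h vk(2)] by (simp add: same_boundary_sym)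
  obtain W where W: "W \<in> simplices Y (Suc n)" "face Y (Suc n) v W = b"
    "\<And>i. i \<le> Suc n \<Longrightarrow> i \<noteq> v \<Longrightarrow> i \<noteq> k \<Longrightarrow> face Y (Suc n) i W = face Y (Suc n) i (g (Suc n) h)"
    "same_boundary Y n (face Y (Suc n) k W) (face Y (Suc n) k (g (Suc n) h))"
    using Y.replace_face_same_boundary[OF gh vk b(1) b'] by blast
  have "face Y (Suc n) k W \<in> simplices Y n" using W vk by (simp add: Y.face_in)
  moreover have "same_boundary Y n (g n (face X (Suc n) k h)) (face Y (Suc n) k W)"
    using W(4) gf[OF h vk(3)] by (simp add: same_boundary_sym)
  ultimately obtain e where e: "e \<in> simplices X n" "same_boundary X n (face X (Suc n) k h) e"
    "homotopic Y n (g n e) (face Y (Suc n) k W)"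
    using surj unfolding surj_at_def by blast
  obtain h' where h': "h' \<in> simplices X (Suc n)" "face X (Suc n) k h' = e"
    "\<And>i. i \<le> Suc n \<Longrightarrow> i \<noteq> k \<Longrightarrow> i \<noteq> v \<Longrightarrow> face X (Suc n) i h' = face X (Suc n) i h"
    "same_boundary X n (face X (Suc n) v h') (face X (Suc n) v h)"
    using X.replace_face_same_boundary[OF h vk(1)[symmetric] vk(3,2) e(1) same_boundary_sym[OF e(2)]] by blast
  have "homotopic Y n (face Y (Suc n) v (g (Suc n) h')) (face Y (Suc n) v W)"
  proof (rule Y.homotopic_other_face[OF _ W(1) vk(1)[symmetric] vk(3,2)])
    show "g (Suc n) h' \<in> simplices Y (Suc n)" using h' simplicial_mapD(1)[OF g] by blast
  qed (use h h' vk W e gf in auto)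
  then have "homotopic Y n (g n (face X (Suc n) v h')) b" using gf[OF h'(1) vk(2)] W by simp
  then show "\<exists>a'\<in>simplices X n. same_boundary X n (face X (Suc n) v h) a' \<and> homotopic Y n (g n a') b"
    using X.face_in[OF h'(1) vk(2)] same_boundary_sym[OF h'(4)] by blast
qed

lemma homotopy_map_class:
  assumes x: "x \<in> simplices X 0" and b: "b \<in> spheres X k x"
  shows "g k b \<in> spheres Y k (g 0 x)"
    and "homotopy_map X Y g k x (homotopy_rel X k x `` {b}) = homotopy_rel Y k (g 0 x) `` {g k b}"
proof -
  have y: "g 0 x \<in> simplices Y 0" using x simplicial_mapD(1)[OF g] by blast
  have sph: "g k c \<in> spheres Y k (g 0 x)" if "c \<in> spheres X k x" for c
    using that x y map_same_boundary[OF g, of k "const_simplex X k x" c]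
      map_const_simplex[OF X.simplicial_set_axioms g x, of k] simplicial_mapD(1)[OF g] X.const_simplex_in[OF x]
    by (auto simp: X.spheres_eq Y.spheres_eq)
  then show "g k b \<in> spheres Y k (g 0 x)" using b by blast
  note eqY = Y.equiv_homotopy_rel[OF y, of k]
  have rel: "(g k b, g k c) \<in> homotopy_rel Y k (g 0 x)" if "(b, c) \<in> homotopy_rel X k x" for c
    using that x y sph homotopic_at_map[OF X.simplicial_set_axioms g, of k 0 b c]
    by (auto simp: X.homotopy_rel_eq_homotopic Y.homotopy_rel_eq_homotopic)
  have bb: "(b, b) \<in> homotopy_rel X k x"
    using X.equiv_homotopy_rel[OF x, of k] b by (meson equiv_class_self Image_singleton_iff)
  show "homotopy_map X Y g k x (homotopy_rel X k x `` {b}) = homotopy_rel Y k (g 0 x) `` {g k b}"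
    unfolding homotopy_map_def
  proof (intro equalityI subsetI)
    fix d assume "d \<in> homotopy_rel Y k (g 0 x) `` (g k ` (homotopy_rel X k x `` {b}))"
    then obtain c where "(b, c) \<in> homotopy_rel X k x" "(g k c, d) \<in> homotopy_rel Y k (g 0 x)" by blast
    then show "d \<in> homotopy_rel Y k (g 0 x) `` {g k b}"
      using rel eqY by (meson Image_singleton_iff equivE transE)
  qed (use bb in blast)
qed

text \<open>At a constant simplex the condition is part of injectivity on the homotopy group based
  at \<open>x\<close>. \<open>inj_at_face\<close> spreads it to all simplices along
  \<open>simplex_induct_constant\<close>.\<close>

lemma inj_at_all:
  assumes inj: "\<And>x. x \<in> simplices X 0 \<Longrightarrow> inj_on (homotopy_map X Y g k x) (homotopy_group X k x)"
    and a: "a \<in> simplices X k"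
  shows "inj_at X Y g k a"
proof (rule X.simplex_induct_constant[OF _ _ a, where P = "inj_at X Y g k"])
  fix x assume x: "x \<in> simplices X 0"
  let ?c = "const_simplex X k x"
  have y: "g 0 x \<in> simplices Y 0" using x simplicial_mapD(1)[OF g] by blast
  have "homotopic X k ?c b"
    if b: "b \<in> simplices X k" "same_boundary X k ?c b" "homotopic Y k (g k ?c) (g k b)" for b
  proof -
    have sp: "?c \<in> spheres X k x" "b \<in> spheres X k x"
      using b x X.const_simplex_in by (auto simp: X.spheres_eq)
    have "(g k ?c, g k b) \<in> homotopy_rel Y k (g 0 x)"
      using homotopy_map_class(1)[OF x] sp b(3) y by (auto simp: Y.homotopy_rel_eq_homotopic)
    then have "homotopy_map X Y g k x (homotopy_rel X k x `` {?c}) =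
        homotopy_map X Y g k x (homotopy_rel X k x `` {b})"
      using homotopy_map_class(2)[OF x] sp Y.equiv_homotopy_rel[OF y] equiv_class_eq by metis
    then have "homotopy_rel X k x `` {?c} = homotopy_rel X k x `` {b}"
      using inj[OF x] sp unfolding homotopy_group_def by (meson inj_onD quotientI)
    then have "(?c, b) \<in> homotopy_rel X k x"
      using eq_equiv_class[OF _ X.equiv_homotopy_rel[OF x]] sp by metis
    then show ?thesis using x by (auto simp: X.homotopy_rel_eq_homotopic)
  qed
  then show "inj_at X Y g k (mult_degen X 0 k x)"
    by (auto simp: inj_at_def X.const_simplex_eq_mult_degen)
qed (use inj_at_face in blast)

lemma surj_at_all:
  assumes surj: "\<And>x. x \<in> simplices X 0 \<Longrightarrow>
      homotopy_map X Y g k x ` homotopy_group X k x = homotopy_group Y k (g 0 x)"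
    and a: "a \<in> simplices X k"
  shows "surj_at X Y g k a"
proof (rule X.simplex_induct_constant[OF _ _ a, where P = "surj_at X Y g k"])
  fix x assume x: "x \<in> simplices X 0"
  let ?c = "const_simplex X k x"
  have y: "g 0 x \<in> simplices Y 0" using x simplicial_mapD(1)[OF g] by blast
  have "\<exists>a'\<in>simplices X k. same_boundary X k ?c a' \<and> homotopic Y k (g k a') b"
    if b: "b \<in> simplices Y k" "same_boundary Y k (g k ?c) b" for b
  proof -
    have sp: "b \<in> spheres Y k (g 0 x)"
      using b y map_const_simplex[OF X.simplicial_set_axioms g x, of k] by (auto simp: Y.spheres_eq)
    then have "homotopy_rel Y k (g 0 x) `` {b} \<in> homotopy_group Y k (g 0 x)"
      by (simp add: homotopy_group_def quotientI)
    then obtain C where C: "C \<in> homotopy_group X k x"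
      "homotopy_rel Y k (g 0 x) `` {b} = homotopy_map X Y g k x C"
      using surj[OF x] by blast
    then obtain a' where a': "a' \<in> spheres X k x" "C = homotopy_rel X k x `` {a'}"
      unfolding homotopy_group_def by (auto elim: quotientE)
    then have "homotopy_rel Y k (g 0 x) `` {g k a'} = homotopy_rel Y k (g 0 x) `` {b}"
      using C homotopy_map_class(2)[OF x a'(1)] by simp
    then have "(g k a', b) \<in> homotopy_rel Y k (g 0 x)"
      using eq_equiv_class[OF _ Y.equiv_homotopy_rel[OF y]] sp by metis
    then show ?thesis using a' x y
      by (auto simp: X.spheres_eq Y.homotopy_rel_eq_homotopic intro!: bexI[of _ a'])
  qed
  then show "surj_at X Y g k (mult_degen X 0 k x)"
    by (auto simp: surj_at_def X.const_simplex_eq_mult_degen)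
qed (use surj_at_face in blast)

text \<open>A filler of the horn given by all faces but the last has a last face with the right
  boundary. Its image is homotopic to that of the prescribed face, since the image of the filler and
  \<open>\<sigma>\<close> share all other faces. Injectivity in dimension \<open>k\<close> makes the
  two last faces homotopic in \<open>X\<close>, so the filler can be corrected; surjectivity in
  dimension \<open>k + 1\<close> then adjusts its image.\<close>

lemma fill_up_to_homotopy:
  assumes inj: "\<And>a. a \<in> simplices X k \<Longrightarrow> inj_at X Y g k a"
    and surj: "\<And>a. a \<in> simplices X (Suc k) \<Longrightarrow> surj_at X Y g (Suc k) a"
    and t: "sphere_data X k t"
    and \<sigma>: "\<sigma> \<in> simplices Y (Suc k)" "\<And>i. i \<le> Suc k \<Longrightarrow> face Y (Suc k) i \<sigma> = g k (t i)"
  obtains x where "x \<in> simplices X (Suc k)" "\<And>i. i \<le> Suc k \<Longrightarrow> face X (Suc k) i x = t i"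
    "homotopic Y (Suc k) (g (Suc k) x) \<sigma>"
proof -
  have "horn X k (Suc k) t"
    using t by (cases k) (auto simp: horn_def sphere_data_def)
  then obtain u where u: "u \<in> simplices X (Suc k)" "\<And>i. i \<le> k \<Longrightarrow> face X (Suc k) i u = t i"
    using X.kan unfolding kan_complex_def by (metis Suc_n_not_le_n le_SucI)
  have ts: "t i \<in> simplices X k" if "i \<le> Suc k" for i using t that by (simp add: sphere_data_def)
  define a where "a = face X (Suc k) (Suc k) u"
  have a: "a \<in> simplices X k" using u by (simp add: a_def X.face_in)
  have sb: "same_boundary X k a (t (Suc k))"
  proof (cases k)
    case (Suc m)
    have "face X k i a = face X k i (t (Suc k))" if "i \<le> k" for i
      using that X.face_comm[of u m i "Suc k"] u t Suc by (auto simp: a_def sphere_data_def)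
    then show ?thesis by (simp add: same_boundary_def)
  qed (simp add: same_boundary_def)
  have "homotopic Y k (face Y (Suc k) (Suc k) (g (Suc k) u)) (face Y (Suc k) (Suc k) \<sigma>)"
  proof (rule Y.homotopic_face[OF _ \<sigma>(1)])
    show "face Y (Suc k) i (g (Suc k) u) = face Y (Suc k) i \<sigma>" if "i \<le> Suc k" "i \<noteq> Suc k" for i
      using that u \<sigma>(2)[of i] simplicial_mapD(2)[OF g u(1), of i] by simp
  qed (use u simplicial_mapD(1)[OF g] in auto)
  then have "homotopic Y k (g k a) (g k (t (Suc k)))"
    using simplicial_mapD(2)[OF g u(1), of "Suc k"] \<sigma>(2)[of "Suc k"] by (simp add: a_def)
  then have "homotopic X k (face X (Suc k) (Suc k) u) (t (Suc k))"
    using inj[OF a] sb ts[of "Suc k"] by (auto simp: inj_at_def a_def)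
  then obtain x' where x': "x' \<in> simplices X (Suc k)" "face X (Suc k) (Suc k) x' = t (Suc k)"
    "\<And>i. i \<le> Suc k \<Longrightarrow> i \<noteq> Suc k \<Longrightarrow> face X (Suc k) i x' = face X (Suc k) i u"
    using X.replace_face_homotopic[OF u(1) le_refl] by blast
  have x'f: "face X (Suc k) i x' = t i" if "i \<le> Suc k" for i
    using that x' u by (cases "i = Suc k") auto
  have "same_boundary Y (Suc k) (g (Suc k) x') \<sigma>"
    using x'f \<sigma>(2) simplicial_mapD(2)[OF g x'(1)] by (simp add: same_boundary_def)
  then obtain x where "x \<in> simplices X (Suc k)" "same_boundary X (Suc k) x' x"
    "homotopic Y (Suc k) (g (Suc k) x) \<sigma>"
    using surj[OF x'(1)] \<sigma>(1) unfolding surj_at_def by blast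
  then show thesis using x'f by (intro that[of x]) (auto simp: same_boundary_def)
qed

text \<open>The homotopy is lifted with prescribed faces those of a degeneracy of \<open>x\<close>.
  It is first rewritten to double the last vertex, so that \<open>\<sigma>\<close> lies under the
  last face, which is the one left open.\<close>

lemma fibration_lift_homotopic:
  assumes fib: "kan_fibration X Y g" and x: "x \<in> simplices X N" and hom: "homotopic Y N (g N x) \<sigma>"
  obtains z where "z \<in> simplices X N" "g N z = \<sigma>" "same_boundary X N x z"
proof -
  have "homotopic_at Y N N (g N x) \<sigma>" using Y.homotopic_at_change[OF hom] by simp
  then obtain w where w: "w \<in> simplices Y (Suc N)" "face Y (Suc N) N w = g N x"
    "face Y (Suc N) (Suc N) w = \<sigma>"
    "\<And>i. i < N \<Longrightarrow> face Y (Suc N) i w = face Y (Suc N) i (degen Y N N (g N x))"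
    unfolding homotopic_at_def by auto
  let ?d = "degen X N N x"
  let ?t = "\<lambda>i. face X (Suc N) i ?d"
  have d: "?d \<in> simplices X (Suc N)" "g (Suc N) ?d = degen Y N N (g N x)"
    "face X (Suc N) N ?d = x" "face X (Suc N) (Suc N) ?d = x"
    using x X.degen_closed simplicial_mapD(3)[OF g x] by (auto simp: X.face_degen_eq)
  have "horn X N (Suc N) ?t"
    unfolding horn_def using d X.face_in X.face_comm[of ?d "N - 1"] by (cases N) auto
  moreover have "face Y (Suc N) i w = g N (?t i)" if "i \<le> Suc N" "i \<noteq> Suc N" for i
    using that w d simplicial_mapD(2)[OF g d(1), of i] by (cases "i = N") auto
  ultimately obtain s where s: "s \<in> simplices X (Suc N)" "g (Suc N) s = w"
    "\<And>i. i \<le> Suc N \<Longrightarrow> i \<noteq> Suc N \<Longrightarrow> face X (Suc N) i s = ?t i"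
    using kan_fibrationD[OF fib w(1)] by blast
  have "same_boundary X N (face X (Suc N) (Suc N) ?d) (face X (Suc N) (Suc N) s)"
    by (rule X.same_boundary_face[OF d(1) s(1), of N]) (use s in auto)
  then show thesis
    using that[of "face X (Suc N) (Suc N) s"] s d w X.face_in simplicial_mapD(2)[OF g s(1), of "Suc N"] by auto
qed

text \<open>Homotopy lifting turns the lift up to homotopy into a strict one without touching its
  boundary. In dimension 0 the starting simplex for \<open>surj_at\<close> has to be an arbitrary
  vertex, hence the nonemptiness.\<close>

lemma fibration_lifts_spheres:
  assumes fib: "kan_fibration X Y g" and ne: "simplices X 0 \<noteq> {}"
    and inj: "\<And>k a. k < m \<Longrightarrow> a \<in> simplices X k \<Longrightarrow> inj_at X Y g k a"
    and surj: "\<And>k a. k \<le> m \<Longrightarrow> a \<in> simplices X k \<Longrightarrow> surj_at X Y g k a"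
    and k: "k \<le> m"
  shows "lifts_spheres X Y g k"
proof (cases k)
  case 0
  have "\<exists>z\<in>simplices X 0. g 0 z = \<sigma>" if \<sigma>: "\<sigma> \<in> simplices Y 0" for \<sigma>
  proof -
    obtain a where a: "a \<in> simplices X 0" using ne by blast
    obtain x where "x \<in> simplices X 0" "homotopic Y 0 (g 0 x) \<sigma>"
      using surj[OF _ a] \<sigma> by (auto simp: surj_at_def same_boundary_def)
    then show ?thesis using fibration_lift_homotopic[OF fib] by metis
  qed
  then show ?thesis using 0 by (simp add: lifts_spheres_def)
next
  case (Suc l)
  have "\<exists>z\<in>simplices X k. g k z = \<sigma> \<and> (\<forall>i\<le>k. face X k i z = t i)"
    if \<sigma>: "\<sigma> \<in> simplices Y k" and t: "sphere_data X l t" "\<And>i. i \<le> k \<Longrightarrow> g l (t i) = face Y k i \<sigma>" for \<sigma> t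
  proof -
    obtain x where x: "x \<in> simplices X k" "\<And>i. i \<le> k \<Longrightarrow> face X k i x = t i"
      "homotopic Y k (g k x) \<sigma>"
    proof (rule fill_up_to_homotopy[of l t \<sigma>])
      show "face Y (Suc l) i \<sigma> = g l (t i)" if "i \<le> Suc l" for i using t(2) that Suc by simp
    qed (use Suc k \<sigma> t(1) inj surj in auto)
    obtain z where "z \<in> simplices X k" "g k z = \<sigma>" "same_boundary X k x z"
      using fibration_lift_homotopic[OF fib x(1,3)] by blast
    then show ?thesis using x(2) Suc by (auto simp: same_boundary_def)
  qed
  then show ?thesis using Suc by (auto simp: lifts_spheres_def)
qed

end

lemma lifts_spheresD:
  assumes "lifts_spheres X Y q (Suc k)" "\<sigma> \<in> simplices Y (Suc k)" "sphere_data X k t"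
    and "\<forall>i\<le>Suc k. q k (t i) = face Y (Suc k) i \<sigma>"
  shows "\<exists>\<tau>\<in>simplices X (Suc k). q (Suc k) \<tau> = \<sigma> \<and> (\<forall>i\<le>Suc k. face X (Suc k) i \<tau> = t i)"
  using assms unfolding lifts_spheres_def by simp

section \<open>Prisms and the path space of a map\<close>

text \<open>A map from the prism over the standard \<open>k\<close>-simplex with vertices \<open>a\<^sub>0, \<dots>, a\<^sub>k\<close> (bottom) and
  \<open>b\<^sub>0, \<dots>, b\<^sub>k\<close> (top) is given by its values \<open>h l\<close> on the simplices
  \<open>a\<^sub>0, \<dots>, a\<^sub>l, b\<^sub>l, \<dots>, b\<^sub>k\<close>; the walls \<open>a\<^sub>0, \<dots>, a\<^sub>l\<^sub>-\<^sub>1, b\<^sub>l, \<dots>, b\<^sub>k\<close> interpolate between the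
  top (\<open>l = 0\<close>) and the bottom (\<open>l = k + 1\<close>).\<close>

definition prism :: "'x sset \<Rightarrow> nat \<Rightarrow> (nat \<Rightarrow> 'x) \<Rightarrow> bool"
  where "prism X k h \<longleftrightarrow> h \<in> {..k} \<rightarrow>\<^sub>E simplices X (Suc k) \<and>
    (\<forall>l<k. face X (Suc k) (Suc l) (h l) = face X (Suc k) (Suc l) (h (Suc l)))"

definition wall :: "'x sset \<Rightarrow> nat \<Rightarrow> (nat \<Rightarrow> 'x) \<Rightarrow> nat \<Rightarrow> 'x"
  where "wall X k h l = (if l \<le> k then face X (Suc k) l (h l) else face X (Suc k) (Suc k) (h k))"

text \<open>Restriction to the prism over the \<open>i\<close>-th face, which loses both
  \<open>a_i\<close> and \<open>b_i\<close>. A simplex with \<open>l < i\<close> contains only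
  \<open>b_i\<close>, at position \<open>Suc i\<close>; one with index above \<open>i\<close>
  contains only \<open>a_i\<close>, at position \<open>i\<close>. The simplex of index
  \<open>i\<close> contains both and disappears.\<close>

definition prism_face :: "'x sset \<Rightarrow> nat \<Rightarrow> nat \<Rightarrow> (nat \<Rightarrow> 'x) \<Rightarrow> (nat \<Rightarrow> 'x)"
  where "prism_face X k i h = (\<lambda>l\<in>{..<k}. if l < i then face X (Suc k) (Suc i) (h l)
    else face X (Suc k) i (h (Suc l)))"

lemma prism_in: "prism X k h \<Longrightarrow> l \<le> k \<Longrightarrow> h l \<in> simplices X (Suc k)"
  by (auto simp: prism_def)

text \<open>An interior wall is a common face of two neighbouring simplices, so it may be read off
  from either of them.\<close>

lemma wall_Suc:
  assumes "prism X k h" "l \<le> k"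
  shows "wall X k h (Suc l) = face X (Suc k) (Suc l) (h l)"
proof (cases "l < k")
  case True
  then show ?thesis using assms by (auto simp: prism_def wall_def)
next
  case False
  then have "l = k" using assms by simp
  then show ?thesis by (simp add: wall_def)
qed

lemma wall_le: "l \<le> k \<Longrightarrow> wall X k h l = face X (Suc k) l (h l)"
  by (simp add: wall_def)

definition constant_prism :: "'x sset \<Rightarrow> nat \<Rightarrow> 'x \<Rightarrow> (nat \<Rightarrow> 'x)"
  where "constant_prism X k y = (\<lambda>l\<in>{..k}. degen X k l y)"

context semi_simplicial_set begin

lemma wall_in: "prism X k h \<Longrightarrow> l \<le> Suc k \<Longrightarrow> wall X k h l \<in> simplices X k"
  by (auto simp: wall_def prism_in face_in)

text \<open>The vertex of wall \<open>l\<close> at position \<open>i\<close> is \<open>a_i\<close>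
  if \<open>i < l\<close> and \<open>b_i\<close> otherwise. Only in the first case does the place
  where the wall changes from bottom to top move down by one.\<close>

lemma face_wall:
  assumes h: "prism X (Suc k) h" and i: "i \<le> Suc k" and l: "l \<le> Suc (Suc k)"
  shows "face X (Suc k) i (wall X (Suc k) h l) =
    wall X k (prism_face X (Suc k) i h) (if l \<le> i then l else l - 1)"
proof -
  have hin: "h j \<in> simplices X (Suc (Suc k))" if "j \<le> Suc k" for j
    using h that by (simp add: prism_in)
  have fc: "face X (Suc k) a (face X (Suc (Suc k)) b (h j)) =
      face X (Suc k) (b - 1) (face X (Suc (Suc k)) a (h j))"
    if "j \<le> Suc k" "a < b" "b \<le> Suc (Suc k)" for a b j
    using face_comm[OF hin[OF that(1)] that(2,3)] .
  have adj: "face X (Suc (Suc k)) (Suc j) (h j) = face X (Suc (Suc k)) (Suc j) (h (Suc j))" if "j \<le> k" for j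
    using h that by (simp add: prism_def)
  consider "l < i" "l \<le> k" | "l = i" "l \<le> k" | "l = i" "l = Suc k" | "i < l" "l \<le> Suc k"
    | "i < l" "l = Suc (Suc k)" "i \<le> k" | "l = Suc (Suc k)" "i = Suc k"
    using i l by linarith
  then show ?thesis
  proof cases
    case 1
    then show ?thesis using fc[of l l "Suc i"] i by (simp add: wall_def prism_face_def)
  next
    case 2
    then show ?thesis using fc[of i i "Suc i"] fc[of "Suc i" i "Suc i"] adj[of i]
      by (simp add: wall_def prism_face_def)
  next
    case 3
    then show ?thesis using fc[of k "Suc k" "Suc (Suc k)"] adj[of k]
      by (simp add: wall_def prism_face_def)
  next
    case 4
    then obtain l' where l': "l = Suc l'" by (cases l) auto
    show ?thesis using fc[of l i l] 4 l' by (simp add: wall_def prism_face_def)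
  next
    case 5
    then show ?thesis using fc[of "Suc k" i "Suc (Suc k)"]
      by (simp add: wall_def prism_face_def)
  next
    case 6
    then show ?thesis using fc[of k "Suc k" "Suc (Suc k)"] fc[of "Suc k" "Suc k" "Suc (Suc k)"] adj[of k]
      by (simp add: wall_def prism_face_def)
  qed
qed

lemma prism_face_prism:
  assumes h: "prism X (Suc k) h" and i: "i \<le> Suc k"
  shows "prism X k (prism_face X (Suc k) i h)"
proof -
  have hin: "h j \<in> simplices X (Suc (Suc k))" if "j \<le> Suc k" for j
    using h that by (simp add: prism_in)
  have fc: "face X (Suc k) a (face X (Suc (Suc k)) b (h j)) =
      face X (Suc k) (b - 1) (face X (Suc (Suc k)) a (h j))"
    if "j \<le> Suc k" "a < b" "b \<le> Suc (Suc k)" for a b j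
    using face_comm[OF hin[OF that(1)] that(2,3)] .
  have adj: "face X (Suc (Suc k)) (Suc j) (h j) = face X (Suc (Suc k)) (Suc j) (h (Suc j))" if "j \<le> k" for j
    using h that by (simp add: prism_def)
  have "face X (Suc k) (Suc l) (prism_face X (Suc k) i h l) =
      face X (Suc k) (Suc l) (prism_face X (Suc k) i h (Suc l))" if l: "l < k" for l
  proof -
    consider "Suc l < i" | "Suc l = i" | "i \<le> l" by linarith
    then show ?thesis
    proof cases
      case 1
      then show ?thesis
        using l i fc[of l "Suc l" "Suc i"] fc[of "Suc l" "Suc l" "Suc i"] adj[of l] by (simp add: prism_face_def)
    next
      case 2
      then show ?thesis
        using l i fc[of l i "Suc i"] fc[of "Suc l" i "Suc i"] fc[of "Suc (Suc l)" i "Suc i"] adj[of l] adj[of "Suc l"]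
        by (simp add: prism_face_def)
    next
      case 3
      then show ?thesis
        using l i fc[of "Suc l" i "Suc (Suc l)"] fc[of "Suc (Suc l)" i "Suc (Suc l)"] adj[of "Suc l"]
        by (simp add: prism_face_def)
    qed
  qed
  moreover have "prism_face X (Suc k) i h \<in> {..k} \<rightarrow>\<^sub>E simplices X (Suc k)"
    using hin i face_in by (auto simp: prism_face_def split: if_splits)
  ultimately show ?thesis by (simp add: prism_def)
qed

lemma prism_face_comm:
  assumes h: "prism X (Suc (Suc k)) h" and ij: "i < j" "j \<le> Suc (Suc k)"
  shows "prism_face X (Suc k) i (prism_face X (Suc (Suc k)) j h) =
    prism_face X (Suc k) (j - 1) (prism_face X (Suc (Suc k)) i h)"
proof
  fix l
  have fc: "face X (Suc (Suc k)) a (face X (Suc (Suc (Suc k))) b (h c)) =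
      face X (Suc (Suc k)) (b - 1) (face X (Suc (Suc (Suc k))) a (h c))"
    if "c \<le> Suc (Suc k)" "a < b" "b \<le> Suc (Suc (Suc k))" for a b c
    using face_comm[OF prism_in[OF h that(1)] that(2,3)] .
  obtain j' where j': "j = Suc j'" using ij by (cases j) auto
  show "prism_face X (Suc k) i (prism_face X (Suc (Suc k)) j h) l =
    prism_face X (Suc k) (j - 1) (prism_face X (Suc (Suc k)) i h) l"
  proof (cases "l < Suc k")
    case True
    consider "l < i" | "i \<le> l" "Suc l < j" | "j \<le> Suc l" by linarith
    then show ?thesis
    proof cases
      case 1
      then show ?thesis using True ij j' fc[of l "Suc i" "Suc j"] by (simp add: prism_face_def)
    next
      case 2
      then show ?thesis using True ij j' fc[of "Suc l" i "Suc j"] by (simp add: prism_face_def)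
    next
      case 3
      then show ?thesis using True ij j' fc[of "Suc (Suc l)" i j] by (simp add: prism_face_def)
    qed
  qed (simp add: prism_face_def)
qed

text \<open>In the following, \<open>H\<close> consists of the prisms over the faces of a \<open>(k + 1)\<close>-simplex.\<close>

definition prism_sphere :: "nat \<Rightarrow> (nat \<Rightarrow> nat \<Rightarrow> 'x) \<Rightarrow> bool"
  where "prism_sphere k H \<longleftrightarrow> (\<forall>i\<le>Suc k. prism X k (H i)) \<and>
    (\<forall>i j. 0 < k \<and> i < j \<and> j \<le> Suc k \<longrightarrow> prism_face X k i (H j) = prism_face X k (j - 1) (H i))"

text \<open>The faces that wall \<open>l\<close> of a prism with sides \<open>H\<close> must have
  according to \<open>face_wall\<close>, expressed before such a prism exists.\<close>

definition wall_boundary :: "nat \<Rightarrow> (nat \<Rightarrow> nat \<Rightarrow> 'x) \<Rightarrow> nat \<Rightarrow> nat \<Rightarrow> 'x"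
  where "wall_boundary k H l i = wall X k (H i) (if l \<le> i then l else l - 1)"

definition is_wall :: "nat \<Rightarrow> (nat \<Rightarrow> nat \<Rightarrow> 'x) \<Rightarrow> nat \<Rightarrow> 'x \<Rightarrow> bool"
  where "is_wall k H l w \<longleftrightarrow> w \<in> simplices X (Suc k) \<and>
    (\<forall>i\<le>Suc k. face X (Suc k) i w = wall_boundary k H l i)"

text \<open>The faces that the \<open>l\<close>-th simplex of the unknown prism must have. Omitting
  \<open>a_l\<close> or \<open>b_l\<close> gives the walls \<open>w\<close> and \<open>w'\<close>;
  omitting an earlier \<open>a_i\<close> leads to the side \<open>i\<close>, and omitting the vertex
  \<open>b_(i - 1)\<close> at a later position \<open>i\<close> leads to the side
  \<open>i - 1\<close>.\<close>

definition component_face :: "(nat \<Rightarrow> nat \<Rightarrow> 'x) \<Rightarrow> nat \<Rightarrow> 'x \<Rightarrow> 'x \<Rightarrow> nat \<Rightarrow> 'x"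
  where "component_face H l w w' i =
    (if i = l then w else if i = Suc l then w' else if i < l then H i (l - 1) else H (i - 1) l)"

text \<open>The walls are only required where they occur among the two compared faces. So the
  statement serves both for a horn in which \<open>w'\<close> is still unknown and for a complete
  sphere.\<close>

lemma component_face_comm:
  assumes H: "prism_sphere k H" and l: "l \<le> Suc k" and ij: "i < j" "j \<le> Suc (Suc k)"
    and w: "i = l \<or> j = l \<Longrightarrow> is_wall k H l w"
    and w': "i = Suc l \<or> j = Suc l \<Longrightarrow> is_wall k H (Suc l) w'"
  shows "face X (Suc k) i (component_face H l w w' j) = face X (Suc k) (j - 1) (component_face H l w w' i)"
proof -
  obtain j' where j': "j = Suc j'" using ij by (cases j) auto
  have pr: "prism X k (H a)" if "a \<le> Suc k" for a using H that by (simp add: prism_sphere_def)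
  have ws: "face X (Suc k) (Suc a) (H b a) = wall X k (H b) (Suc a)" if "a \<le> k" "b \<le> Suc k" for a b
    using wall_Suc[OF pr that(1)] that by simp
  have wl: "face X (Suc k) a (H b a) = wall X k (H b) a" if "a \<le> k" "b \<le> Suc k" for a b
    using that by (simp add: wall_def)
  have Hc: "prism_face X k a (H b) c = prism_face X k (b - 1) (H a) c" if "0 < k" "a < b" "b \<le> Suc k" for a b c
    using H that by (simp add: prism_sphere_def)
  consider "j < l" | "j = l" | "i < l" "j = Suc l" | "i < l" "Suc l < j"
    | "i = l" "j = Suc l" | "i = l" "Suc l < j" | "i = Suc l" | "Suc l < i"
    using ij by linarith
  then show ?thesis
  proof cases
    case 1
    then obtain l'' where l'': "l = Suc (Suc l'')" using ij by (cases l; cases "l - 1") auto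
    show ?thesis using Hc[of i j l''] 1 ij l l'' j' by (simp add: component_face_def prism_face_def)
  next
    case 2
    then obtain l' where l': "l = Suc l'" using ij by (cases l) auto
    then show ?thesis using w 2 ij l wl[of l' i]
      by (simp add: component_face_def is_wall_def wall_boundary_def)
  next
    case 3
    then obtain l' where l': "l = Suc l'" by (cases l) auto
    then show ?thesis using w' 3 ij l ws[of l' i]
      by (simp add: component_face_def is_wall_def wall_boundary_def)
  next
    case 4
    then obtain l' where l': "l = Suc l'" by (cases l) auto
    show ?thesis using Hc[of i j' l'] 4 ij l l' j' by (auto simp: component_face_def prism_face_def)
  next
    case 5
    then show ?thesis using w w' ij l
      by (simp add: component_face_def is_wall_def wall_boundary_def)
  next
    case 6
    then show ?thesis using w ij l j' wl[of l j']
      by (simp add: component_face_def is_wall_def wall_boundary_def)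
  next
    case 7
    then show ?thesis using w' ij l j' ws[of l j']
      by (simp add: component_face_def is_wall_def wall_boundary_def)
  next
    case 8
    then obtain i' where i': "i = Suc i'" by (cases i) auto
    show ?thesis using Hc[of i' j' l] 8 ij l i' j' by (auto simp: component_face_def prism_face_def)
  qed
qed

lemma component_face_in:
  assumes H: "prism_sphere k H" and l: "l \<le> Suc k" and i: "i \<le> Suc (Suc k)"
    and "i = l \<Longrightarrow> w \<in> simplices X (Suc k)" "i = Suc l \<Longrightarrow> w' \<in> simplices X (Suc k)"
  shows "component_face H l w w' i \<in> simplices X (Suc k)"
  using assms prism_in[of X k "H i" "l - 1"] prism_in[of X k "H (i - 1)" l]
  by (auto simp: component_face_def prism_sphere_def)

lemma assemble_prism:
  assumes H: "prism_sphere k H"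
    and h: "\<And>l. l \<le> Suc k \<Longrightarrow> h l \<in> simplices X (Suc (Suc k))"
    and f: "\<And>l i. l \<le> Suc k \<Longrightarrow> i \<le> Suc (Suc k) \<Longrightarrow>
      face X (Suc (Suc k)) i (h l) = component_face H l (w l) (w (Suc l)) i"
  shows "prism X (Suc k) (restrict h {..Suc k})"
    and "i \<le> Suc k \<Longrightarrow> prism_face X (Suc k) i (restrict h {..Suc k}) = H i"
    and "l \<le> Suc (Suc k) \<Longrightarrow> wall X (Suc k) (restrict h {..Suc k}) l = w l"
proof -
  show "prism X (Suc k) (restrict h {..Suc k})"
    using h f by (auto simp: prism_def component_face_def)
  show "prism_face X (Suc k) i (restrict h {..Suc k}) = H i" if i: "i \<le> Suc k"
  proof
    fix l
    show "prism_face X (Suc k) i (restrict h {..Suc k}) l = H i l"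
    proof (cases "l \<le> k")
      case True
      then show ?thesis using f[of l "Suc i"] f[of "Suc l" i] i
        by (auto simp: prism_face_def component_face_def)
    next
      case False
      have "H i \<in> extensional {..k}"
        using H i by (auto simp: prism_sphere_def prism_def PiE_def)
      then show ?thesis using False by (simp add: prism_face_def extensional_def)
    qed
  qed
  show "wall X (Suc k) (restrict h {..Suc k}) l = w l" if "l \<le> Suc (Suc k)"
    using that f[of l l] f[of "Suc k" "Suc (Suc k)"]
    by (cases "l = Suc (Suc k)") (auto simp: wall_def component_face_def)
qed

text \<open>Every face of the missing face is shared with a prescribed one, so filling the horn
  automatically produces a wall with the correct boundary.\<close>

lemma is_wall_next:
  assumes H: "prism_sphere k H" and l: "l \<le> Suc k" and h: "h \<in> simplices X (Suc (Suc k))"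
    and w: "is_wall k H l w"
    and f: "\<And>i. i \<le> Suc (Suc k) \<Longrightarrow> i \<noteq> Suc l \<Longrightarrow> face X (Suc (Suc k)) i h = component_face H l w w' i"
  shows "is_wall k H (Suc l) (face X (Suc (Suc k)) (Suc l) h)"
proof -
  have pr: "prism X k (H a)" if "a \<le> Suc k" for a using H that by (simp add: prism_sphere_def)
  have ws: "face X (Suc k) (Suc a) (H b a) = wall X k (H b) (Suc a)" if "a \<le> k" "b \<le> Suc k" for a b
    using wall_Suc[OF pr that(1)] that by simp
  have "face X (Suc k) i (face X (Suc (Suc k)) (Suc l) h) = wall_boundary k H (Suc l) i" if i: "i \<le> Suc k" for i
  proof -
    consider "i < l" | "i = l" | "l < i" by linarith
    then show ?thesis
    proof cases
      case 1
      then obtain l' where l': "l = Suc l'" by (cases l) auto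
      then show ?thesis using face_comm[OF h, of i "Suc l"] f[of i] 1 l ws[of l' i]
        by (simp add: component_face_def wall_boundary_def)
    next
      case 2
      then show ?thesis using face_comm[OF h, of i "Suc l"] f[of i] l w i
        by (simp add: component_face_def wall_boundary_def is_wall_def)
    next
      case 3
      then show ?thesis using face_comm[OF h, of "Suc l" "Suc i"] f[of "Suc i"] l i ws[of l i]
        by (simp add: component_face_def wall_boundary_def)
    qed
  qed
  then show ?thesis using h l by (simp add: is_wall_def face_in)
qed

end

context simplicial_set begin

lemma constant_prism:
  assumes y: "y \<in> simplices X k"
  shows "prism X k (constant_prism X k y)"
    and "l \<le> Suc k \<Longrightarrow> wall X k (constant_prism X k y) l = y"
  using y by (auto simp: prism_def wall_def constant_prism_def degen_closed face_degen_eq)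

lemma prism_face_constant_prism:
  assumes y: "y \<in> simplices X (Suc k)" and i: "i \<le> Suc k"
  shows "prism_face X (Suc k) i (constant_prism X (Suc k) y) = constant_prism X k (face X (Suc k) i y)"
proof
  fix l
  show "prism_face X (Suc k) i (constant_prism X (Suc k) y) l = constant_prism X k (face X (Suc k) i y) l"
    using face_degen_greater[OF y, of l "Suc i"] face_degen_less[OF y, of i "Suc l"] i
    by (auto simp: prism_face_def constant_prism_def)
qed

end

text \<open>Top and sides are given, the bottom is not. The simplices are filled in order of
  increasing \<open>l\<close>, each as a horn whose missing face is the next wall, which in turn
  enters the next horn; the last missing face is the bottom.\<close>

lemma (in kan_set) fill_prism_from_top:
  assumes H: "prism_sphere k H" and top: "is_wall k H 0 \<sigma>"
  obtains h w where "w 0 = \<sigma>"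
    "\<And>l. l \<le> Suc k \<Longrightarrow> h l \<in> simplices X (Suc (Suc k))"
    "\<And>l i. l \<le> Suc k \<Longrightarrow> i \<le> Suc (Suc k) \<Longrightarrow>
      face X (Suc (Suc k)) i (h l) = component_face H l (w l) (w (Suc l)) i"
    "\<And>l. l \<le> Suc (Suc k) \<Longrightarrow> is_wall k H l (w l)"
proof -
  have "\<exists>h w. w 0 = \<sigma> \<and> (\<forall>l<n. h l \<in> simplices X (Suc (Suc k)) \<and>
      (\<forall>i\<le>Suc (Suc k). face X (Suc (Suc k)) i (h l) = component_face H l (w l) (w (Suc l)) i)) \<and>
      (\<forall>l\<le>n. is_wall k H l (w l))" if "n \<le> Suc (Suc k)" for n
    using that
  proof (induction n)
    case 0
    show ?case using top by (intro exI[of _ "\<lambda>_. \<sigma>"]) auto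
  next
    case (Suc n)
    then obtain h w where IH: "w 0 = \<sigma>" "\<forall>l<n. h l \<in> simplices X (Suc (Suc k)) \<and>
      (\<forall>i\<le>Suc (Suc k). face X (Suc (Suc k)) i (h l) = component_face H l (w l) (w (Suc l)) i)"
      "\<forall>l\<le>n. is_wall k H l (w l)" by auto
    have n: "n \<le> Suc k" using Suc.prems by simp
    \<comment> \<open>\<open>undefined\<close> sits at the index \<open>Suc n\<close> of the missing
      face and is never inspected by the horn condition.\<close>
    let ?t = "component_face H n (w n) undefined"
    have wn: "is_wall k H n (w n)" using IH by simp
    have "?t i \<in> simplices X (Suc k)" if "i \<le> Suc (Suc k)" "i \<noteq> Suc n" for i
      using component_face_in[OF H n, of i "w n" undefined] wn that by (auto simp: is_wall_def)
    moreover have "face X (Suc k) i (?t j) = face X (Suc k) (j - 1) (?t i)"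
      if "i < j" "j \<le> Suc (Suc k)" "i \<noteq> Suc n" "j \<noteq> Suc n" for i j
      using component_face_comm[OF H n that(1,2), of "w n" undefined] wn that by auto
    ultimately have "horn X (Suc k) (Suc n) ?t"
      using n by (simp add: horn_def)
    then obtain s where s: "s \<in> simplices X (Suc (Suc k))"
      "\<forall>i\<le>Suc (Suc k). i \<noteq> Suc n \<longrightarrow> face X (Suc (Suc k)) i s = ?t i"
      using kan unfolding kan_complex_def by blast
    let ?w' = "face X (Suc (Suc k)) (Suc n) s"
    have w': "is_wall k H (Suc n) ?w'"
      using is_wall_next[OF H n s(1) wn, of undefined] s(2) by blast
    have sf: "face X (Suc (Suc k)) i s = component_face H n (w n) ?w' i" if "i \<le> Suc (Suc k)" for i
      using s(2) that by (cases "i = Suc n") (auto simp: component_face_def)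
    let ?h = "h(n := s)" and ?w = "w(Suc n := ?w')"
    have "?h l \<in> simplices X (Suc (Suc k)) \<and>
        (\<forall>i\<le>Suc (Suc k). face X (Suc (Suc k)) i (?h l) = component_face H l (?w l) (?w (Suc l)) i)"
      if "l < Suc n" for l
    proof (cases "l = n")
      case True
      then show ?thesis using s(1) sf by simp
    next
      case False
      then have "l < n" using that by simp
      then have "?h l = h l" "?w l = w l" "?w (Suc l) = w (Suc l)" by auto
      then show ?thesis using IH(2) \<open>l < n\<close> by metis
    qed
    moreover have "is_wall k H l (?w l)" if "l \<le> Suc n" for l
      using IH(3) w' that by (cases "l = Suc n") auto
    moreover have "?w 0 = \<sigma>" using IH(1) by simp
    ultimately show ?case by blast
  qed
  then obtain h w where "w 0 = \<sigma>" "\<forall>l<Suc (Suc k). h l \<in> simplices X (Suc (Suc k)) \<and>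
      (\<forall>i\<le>Suc (Suc k). face X (Suc (Suc k)) i (h l) = component_face H l (w l) (w (Suc l)) i)"
      "\<forall>l\<le>Suc (Suc k). is_wall k H l (w l)" by blast
  then show thesis using that[of w h] by (simp add: less_Suc_eq_le)
qed

text \<open>The mapping path space of \<open>g\<close>: the bottom of the prism is the image of a
  simplex of \<open>X\<close>, the top is free. It records faces only, because the later lifts over
  it are chosen simplex by simplex.\<close>

definition path_space :: "'x sset \<Rightarrow> 'z sset \<Rightarrow> (nat \<Rightarrow> 'x \<Rightarrow> 'z) \<Rightarrow> ('x \<times> (nat \<Rightarrow> 'z)) sset"
  where "path_space X Z g = \<lparr>
    simplices = (\<lambda>k. {(x, h). x \<in> simplices X k \<and> prism Z k h \<and> wall Z k h (Suc k) = g k x}),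
    face = (\<lambda>k i (x, h). (face X k i x, prism_face Z k i h)),
    degen = undefined\<rparr>"

abbreviation path_top :: "'z sset \<Rightarrow> nat \<Rightarrow> 'x \<times> (nat \<Rightarrow> 'z) \<Rightarrow> 'z"
  where "path_top Z k e \<equiv> wall Z k (snd e) 0"

lemma path_space_simplices:
  "(x, h) \<in> simplices (path_space X Z g) k \<longleftrightarrow> x \<in> simplices X k \<and> prism Z k h \<and> wall Z k h (Suc k) = g k x"
  by (simp add: path_space_def)

lemma path_space_face:
  "face (path_space X Z g) k i e = (face X k i (fst e), prism_face Z k i (snd e))"
  by (simp add: path_space_def split_beta)

section \<open>The path space of a highly connected map lifts spheres through its top
  projection\<close>

context kan_map begin

lemma path_space_semi_simplicial: "semi_simplicial_set (path_space X Y g)"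
proof
  fix e n i assume e: "e \<in> simplices (path_space X Y g) (Suc n)" and i: "i \<le> Suc n"
  obtain x h where eq: "e = (x, h)" by force
  then show "face (path_space X Y g) (Suc n) i e \<in> simplices (path_space X Y g) n"
    using e i Y.face_wall[of n h i "Suc (Suc n)"] simplicial_mapD(2)[OF g, of x n i]
    by (simp add: path_space_simplices path_space_face X.face_in Y.prism_face_prism)
next
  fix e n and i j :: nat
  assume e: "e \<in> simplices (path_space X Y g) (Suc (Suc n))" and ij: "i < j" "j \<le> Suc (Suc n)"
  then show "face (path_space X Y g) (Suc n) i (face (path_space X Y g) (Suc (Suc n)) j e) =
      face (path_space X Y g) (Suc n) (j - 1) (face (path_space X Y g) (Suc (Suc n)) i e)"
    using X.face_comm[of "fst e" n i j] Y.prism_face_comm[of n "snd e" i j]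
    by (cases e) (simp add: path_space_simplices path_space_face)
qed

text \<open>Filling from the prescribed top yields a bottom whose boundary is the image of a sphere
  in \<open>X\<close>. By \<open>fill_up_to_homotopy\<close> that sphere bounds a simplex whose
  image is homotopic to the bottom. Replacing the bottom by this image makes the prism end in the
  image of \<open>g\<close>, while top and sides stay as prescribed.\<close>

lemma path_space_lifts_spheres:
  assumes ne: "simplices X 0 \<noteq> {}"
    and inj: "\<And>k a. k < m \<Longrightarrow> a \<in> simplices X k \<Longrightarrow> inj_at X Y g k a"
    and surj: "\<And>k a. k \<le> m \<Longrightarrow> a \<in> simplices X k \<Longrightarrow> surj_at X Y g k a"
    and n: "n \<le> m"
  shows "lifts_spheres (path_space X Y g) Y (path_top Y) n"
proof (cases n)
  case 0
  have "\<exists>e\<in>simplices (path_space X Y g) 0. path_top Y 0 e = \<sigma>" if \<sigma>: "\<sigma> \<in> simplices Y 0" for \<sigma>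
  proof -
    obtain a where a: "a \<in> simplices X 0" using ne by blast
    obtain x where x: "x \<in> simplices X 0" "homotopic Y 0 (g 0 x) \<sigma>"
      using surj[OF _ a] \<sigma> by (auto simp: surj_at_def same_boundary_def)
    obtain w where "w \<in> simplices Y (Suc 0)" "face Y (Suc 0) 0 w = \<sigma>" "face Y (Suc 0) (Suc 0) w = g 0 x"
      using Y.homotopic_sym[OF x(2)] by (auto simp: homotopic_at_def)
    then show ?thesis using x(1)
      by (intro bexI[of _ "(x, \<lambda>l\<in>{..0}. w)"]) (auto simp: path_space_simplices prism_def wall_def)
  qed
  then show ?thesis using 0 by (simp add: lifts_spheres_def)
next
  case (Suc k)
  have "\<exists>e\<in>simplices (path_space X Y g) n. path_top Y n e = \<sigma> \<and>
      (\<forall>i\<le>n. face (path_space X Y g) n i e = t i)"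
    if \<sigma>: "\<sigma> \<in> simplices Y n" and t: "sphere_data (path_space X Y g) k t"
      "\<And>i. i \<le> n \<Longrightarrow> path_top Y k (t i) = face Y n i \<sigma>" for \<sigma> t
  proof -
    define tx where "tx = (\<lambda>i. fst (t i))"
    define H where "H = (\<lambda>i. snd (t i))"
    have t_eq: "t i = (tx i, H i)" for i by (simp add: tx_def H_def)
    have tin: "tx i \<in> simplices X k" "prism Y k (H i)" "wall Y k (H i) (Suc k) = g k (tx i)" if "i \<le> Suc k" for i
      using t(1) that by (auto simp: sphere_data_def t_eq path_space_simplices)
    have tx: "sphere_data X k tx" and H: "Y.prism_sphere k H"
      using t(1) tin by (auto simp: sphere_data_def Y.prism_sphere_def t_eq path_space_face)
    have top: "Y.is_wall k H 0 \<sigma>"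
      using t(2) \<sigma> Suc by (auto simp: Y.is_wall_def Y.wall_boundary_def H_def)
    obtain h w where hw: "w 0 = \<sigma>"
      "\<And>l. l \<le> Suc k \<Longrightarrow> h l \<in> simplices Y (Suc (Suc k))"
      "\<And>l i. l \<le> Suc k \<Longrightarrow> i \<le> Suc (Suc k) \<Longrightarrow>
        face Y (Suc (Suc k)) i (h l) = Y.component_face H l (w l) (w (Suc l)) i"
      "\<And>l. l \<le> Suc (Suc k) \<Longrightarrow> Y.is_wall k H l (w l)"
      using Y.fill_prism_from_top[OF H top] by metis
    let ?b = "w (Suc (Suc k))"
    have b: "?b \<in> simplices Y (Suc k)" "face Y (Suc k) i ?b = g k (tx i)" if "i \<le> Suc k" for i
      using hw(4)[of "Suc (Suc k)"] tin[of i] that by (auto simp: Y.is_wall_def Y.wall_boundary_def)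
    obtain x where x: "x \<in> simplices X (Suc k)" "\<And>i. i \<le> Suc k \<Longrightarrow> face X (Suc k) i x = tx i"
      "homotopic Y (Suc k) (g (Suc k) x) ?b"
    proof (rule fill_up_to_homotopy[OF _ _ tx, of ?b])
      show "?b \<in> simplices Y (Suc k)" using b(1)[of 0] by simp
      show "face Y (Suc k) i ?b = g k (tx i)" if "i \<le> Suc k" for i using b(2) that by blast
    qed (use inj surj n Suc in auto)
    have last: "face Y (Suc (Suc k)) (Suc (Suc k)) (h (Suc k)) = ?b"
      using hw(3)[of "Suc k" "Suc (Suc k)"] by (simp add: Y.component_face_def)
    obtain h' where h': "h' \<in> simplices Y (Suc (Suc k))"
      "face Y (Suc (Suc k)) (Suc (Suc k)) h' = g (Suc k) x"
      "\<And>i. i \<le> Suc (Suc k) \<Longrightarrow> i \<noteq> Suc (Suc k) \<Longrightarrow>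
        face Y (Suc (Suc k)) i h' = face Y (Suc (Suc k)) i (h (Suc k))"
      using Y.replace_face_homotopic[OF hw(2)[OF le_refl] le_refl, of "g (Suc k) x"]
        Y.homotopic_sym[OF x(3)] last by metis
    \<comment> \<open>The bottom is a face of the last simplex of the prism only, so the correction
      leaves all other simplices and walls unchanged.\<close>
    define hn where "hn = h(Suc k := h')"
    define wn where "wn = w(Suc (Suc k) := g (Suc k) x)"
    have fin: "face Y (Suc (Suc k)) i (hn l) = Y.component_face H l (wn l) (wn (Suc l)) i"
      if "l \<le> Suc k" "i \<le> Suc (Suc k)" for l i
    proof (cases "l = Suc k \<and> i = Suc (Suc k)")
      case True
      then show ?thesis using h'(2) by (simp add: hn_def wn_def Y.component_face_def)
    next
      case False
      then show ?thesis using hw(3)[OF that] h'(3)[OF that(2)] that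
        by (auto simp: hn_def wn_def Y.component_face_def)
    qed
    have hin: "hn l \<in> simplices Y (Suc (Suc k))" if "l \<le> Suc k" for l
      using that hw(2) h'(1) by (simp add: hn_def)
    note as = Y.assemble_prism[OF H hin fin]
    let ?h = "restrict hn {..Suc k}"
    have "wall Y (Suc k) ?h (Suc (Suc k)) = g (Suc k) x" "wall Y (Suc k) ?h 0 = \<sigma>"
      using as(3)[of "Suc (Suc k)"] as(3)[of 0] hw(1) by (auto simp: wn_def)
    then show ?thesis using as(1,2) x Suc
      by (intro bexI[of _ "(x, ?h)"]) (auto simp: path_space_simplices path_space_face t_eq)
  qed
  then show ?thesis using Suc by (auto simp: lifts_spheres_def)
qed

end

section \<open>Sections and vertical homotopies\<close>

definition face_map :: "'x sset \<Rightarrow> 'y sset \<Rightarrow> (nat \<Rightarrow> 'x \<Rightarrow> 'y) \<Rightarrow> bool"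
  where "face_map X Y f \<longleftrightarrow> (\<forall>n. \<forall>\<sigma>\<in>simplices X n. f n \<sigma> \<in> simplices Y n) \<and>
    (\<forall>n. \<forall>\<sigma>\<in>simplices X (Suc n). \<forall>i\<le>Suc n. f n (face X (Suc n) i \<sigma>) = face Y (Suc n) i (f (Suc n) \<sigma>))"

lemma face_mapD:
  assumes "face_map X Y f"
  shows "\<sigma> \<in> simplices X n \<Longrightarrow> f n \<sigma> \<in> simplices Y n"
    and "\<sigma> \<in> simplices X (Suc n) \<Longrightarrow> i \<le> Suc n \<Longrightarrow> f n (face X (Suc n) i \<sigma>) = face Y (Suc n) i (f (Suc n) \<sigma>)"
  using assms by (auto simp: face_map_def)

lemma simplicial_map_face_map: "simplicial_map X Y f \<Longrightarrow> face_map X Y f"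
  by (simp add: simplicial_map_def face_map_def)

locale sphere_lifting = E: semi_simplicial_set E + B: simplicial_set B
  for E :: "'e sset" and B :: "'b sset" +
  fixes q :: "nat \<Rightarrow> 'e \<Rightarrow> 'b" and m :: nat
  assumes q: "face_map E B q"
    and lift: "k \<le> m \<Longrightarrow> lifts_spheres E B q k"
begin

definition section_on :: "nat \<Rightarrow> (nat \<Rightarrow> 'b \<Rightarrow> 'e) \<Rightarrow> bool"
  where "section_on n s \<longleftrightarrow> (\<forall>k\<le>n. \<forall>\<sigma>\<in>simplices B k. s k \<sigma> \<in> simplices E k \<and> q k (s k \<sigma>) = \<sigma>) \<and>
    (\<forall>k<n. \<forall>\<sigma>\<in>simplices B (Suc k). \<forall>i\<le>Suc k. face E (Suc k) i (s (Suc k) \<sigma>) = s k (face B (Suc k) i \<sigma>))"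

lemma section_exists: "\<exists>s. section_on m s"
proof -
  have "\<exists>s. section_on n s" if "n \<le> m" for n
    using that
  proof (induction n)
    case 0
    have "\<forall>\<sigma>\<in>simplices B 0. \<exists>\<tau>. \<tau> \<in> simplices E 0 \<and> q 0 \<tau> = \<sigma>"
      using lift[of 0] by (auto simp: lifts_spheres_def)
    then obtain s where "\<forall>\<sigma>\<in>simplices B 0. s \<sigma> \<in> simplices E 0 \<and> q 0 (s \<sigma>) = \<sigma>" by metis
    then show ?case by (intro exI[of _ "\<lambda>_. s"]) (auto simp: section_on_def)
  next
    case (Suc n)
    then obtain s where s: "section_on n s" by auto
    have sin: "s n \<sigma> \<in> simplices E n" "q n (s n \<sigma>) = \<sigma>" if "\<sigma> \<in> simplices B n" for \<sigma>
      using s that by (auto simp: section_on_def)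
    have "\<exists>\<tau>. \<tau> \<in> simplices E (Suc n) \<and> q (Suc n) \<tau> = \<sigma> \<and>
        (\<forall>i\<le>Suc n. face E (Suc n) i \<tau> = s n (face B (Suc n) i \<sigma>))"
      if \<sigma>: "\<sigma> \<in> simplices B (Suc n)" for \<sigma>
    proof -
      let ?t = "\<lambda>i. s n (face B (Suc n) i \<sigma>)"
      have "face E n i (?t j) = face E n (j - 1) (?t i)" if "0 < n" "i < j" "j \<le> Suc n" for i j
      proof -
        obtain l where l: "n = Suc l" using \<open>0 < n\<close> by (cases n) auto
        have sf: "face E (Suc l) a (s (Suc l) x) = s l (face B (Suc l) a x)"
          if "x \<in> simplices B (Suc l)" "a \<le> Suc l" for x a
          using s that l unfolding section_on_def by blast
        show ?thesis using that \<sigma> l B.face_comm[of \<sigma> l i j] by (simp add: sf B.face_in)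
      qed
      then have "sphere_data E n ?t" using sin \<sigma> by (simp add: sphere_data_def B.face_in)
      moreover have "\<forall>i\<le>Suc n. q n (?t i) = face B (Suc n) i \<sigma>" using sin \<sigma> by (simp add: B.face_in)
      ultimately show ?thesis
        using lifts_spheresD[OF lift[OF Suc.prems] \<sigma>, of ?t] by blast
    qed
    then obtain s' where s': "\<And>\<sigma>. \<sigma> \<in> simplices B (Suc n) \<Longrightarrow> s' \<sigma> \<in> simplices E (Suc n) \<and> q (Suc n) (s' \<sigma>) = \<sigma> \<and>
        (\<forall>i\<le>Suc n. face E (Suc n) i (s' \<sigma>) = s n (face B (Suc n) i \<sigma>))" by metis
    show ?case
      by (rule exI[of _ "s(Suc n := s')"]) (use s s' in \<open>auto simp: section_on_def le_Suc_eq less_Suc_eq\<close>)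
  qed
  then show ?thesis by blast
qed

text \<open>A prism from \<open>\<tau>\<close> at the bottom to \<open>r k \<tau>\<close> at the
  top. Its simplices lie over degeneracies of one simplex of \<open>B\<close>, so it projects to the
  constant homotopy.\<close>

definition vertical_prism :: "(nat \<Rightarrow> 'e \<Rightarrow> 'e) \<Rightarrow> nat \<Rightarrow> 'e \<Rightarrow> (nat \<Rightarrow> 'e) \<Rightarrow> bool"
  where "vertical_prism r k \<tau> h \<longleftrightarrow> prism E k h \<and> wall E k h 0 = r k \<tau> \<and> wall E k h (Suc k) = \<tau> \<and>
    (\<forall>l\<le>k. q (Suc k) (h l) = degen B k l (q k \<tau>))"

lemma vertical_prism_wall:
  assumes "vertical_prism r k \<tau> h" "\<tau> \<in> simplices E k" "l \<le> Suc k"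
  shows "q k (wall E k h l) = q k \<tau>"
proof -
  have "q k (face E (Suc k) i (h l')) = q k \<tau>" if "l' \<le> k" "i = l' \<or> i = Suc l'" for i l'
    using assms(1,2) that face_mapD[OF q] prism_in[of E k h l'] B.face_degen_eq[of "q k \<tau>" k l' i]
    by (auto simp: vertical_prism_def)
  then show ?thesis using assms(3) by (auto simp: wall_def)
qed

text \<open>There is no horn filling in \<open>E\<close>. The interior walls are chosen first, as
  lifts of \<open>?y\<close> with prescribed boundary, and then each simplex of the prism is a lift
  with all of its faces prescribed. The latter has dimension \<open>k + 2\<close>, which explains
  the bound.\<close>

lemma vertical_prism_extend:
  assumes km: "Suc (Suc k) \<le> m" and \<tau>: "\<tau> \<in> simplices E (Suc k)"
    and r: "r (Suc k) \<tau> \<in> simplices E (Suc k)" "q (Suc k) (r (Suc k) \<tau>) = q (Suc k) \<tau>"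
      "\<And>i. i \<le> Suc k \<Longrightarrow> face E (Suc k) i (r (Suc k) \<tau>) = r k (face E (Suc k) i \<tau>)"
    and H: "E.prism_sphere k H"
      "\<And>i. i \<le> Suc k \<Longrightarrow> vertical_prism r k (face E (Suc k) i \<tau>) (H i)"
  obtains h where "vertical_prism r (Suc k) \<tau> h" "\<And>i. i \<le> Suc k \<Longrightarrow> prism_face E (Suc k) i h = H i"
proof -
  let ?y = "q (Suc k) \<tau>"
  have y: "?y \<in> simplices B (Suc k)" using \<tau> face_mapD[OF q] by blast
  have pr: "prism E k (H i)" if "i \<le> Suc k" for i using H(1) that by (simp add: E.prism_sphere_def)
  have qy: "q k (face E (Suc k) i \<tau>) = face B (Suc k) i ?y" if "i \<le> Suc k" for i
    using face_mapD(2)[OF q \<tau> that] .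
  have wq: "q k (E.wall_boundary k H l i) = face B (Suc k) i ?y" if "i \<le> Suc k" "l \<le> Suc (Suc k)" for i l
    using vertical_prism_wall[OF H(2)[OF that(1)] E.face_in[OF \<tau> that(1)], of "if l \<le> i then l else l - 1"]
      that qy by (auto simp: E.wall_boundary_def split: if_splits)
  have Hq: "q (Suc k) (H i l) = degen B k l (face B (Suc k) i ?y)" if "i \<le> Suc k" "l \<le> k" for i l
    using H(2)[OF that(1)] that qy by (simp add: vertical_prism_def)
  have "\<exists>w. E.is_wall k H l w \<and> q (Suc k) w = ?y \<and> (l = 0 \<longrightarrow> w = r (Suc k) \<tau>) \<and> (l = Suc (Suc k) \<longrightarrow> w = \<tau>)"
    if l: "l \<le> Suc (Suc k)" for l
  proof -
    consider "l = 0" | "l = Suc (Suc k)" | "0 < l" "l < Suc (Suc k)" using l by linarith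
    then show ?thesis
    proof cases
      case 1
      have "E.is_wall k H l (r (Suc k) \<tau>)"
        using 1 r H(2) by (simp add: E.is_wall_def E.wall_boundary_def vertical_prism_def)
      then show ?thesis using 1 r by auto
    next
      case 2
      have "E.is_wall k H l \<tau>"
        using 2 \<tau> H(2) by (simp add: E.is_wall_def E.wall_boundary_def vertical_prism_def)
      then show ?thesis using 2 by auto
    next
      case 3
      \<comment> \<open>The walls at the two ends are \<open>r (Suc k) \<tau>\<close> and
        \<open>\<tau>\<close>. An interior wall has to be constructed, so it must be checked that
        its prescribed faces fit together.\<close>
      have "face E k i (E.wall_boundary k H l j) = face E k (j - 1) (E.wall_boundary k H l i)"
        if ij: "0 < k" "i < j" "j \<le> Suc k" for i j
      proof -
        obtain k' where k': "k = Suc k'" using ij by (cases k) auto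
        have c: "prism_face E k i (H j) = prism_face E k (j - 1) (H i)"
          using H(1) ij by (simp add: E.prism_sphere_def)
        have fw: "face E k a (wall E k (H b) l') = wall E k' (prism_face E k a (H b)) (if l' \<le> a then l' else l' - 1)"
          if "a \<le> k" "b \<le> Suc k" "l' \<le> Suc k" for a b l'
          using E.face_wall[of k' "H b" a l'] pr that k' by simp
        show ?thesis unfolding E.wall_boundary_def
          using fw[of i j "if l \<le> j then l else l - 1"] fw[of "j - 1" i "if l \<le> i then l else l - 1"] c ij l 3
          by (cases "l \<le> i"; cases "l \<le> j") (auto simp: not_le split: if_splits)
      qed
      moreover have "E.wall_boundary k H l i \<in> simplices E k" if "i \<le> Suc k" for i
        using E.wall_in[OF pr[OF that]] 3 that by (auto simp: E.wall_boundary_def)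
      ultimately have "sphere_data E k (E.wall_boundary k H l)" by (simp add: sphere_data_def)
      then obtain w where "w \<in> simplices E (Suc k)" "q (Suc k) w = ?y"
        "\<forall>i\<le>Suc k. face E (Suc k) i w = E.wall_boundary k H l i"
        using lifts_spheresD[OF lift[of "Suc k"] y, of "E.wall_boundary k H l"] km wq[OF _ l] by auto
      then show ?thesis using 3 by (auto simp: E.is_wall_def)
    qed
  qed
  then obtain w where w: "\<And>l. l \<le> Suc (Suc k) \<Longrightarrow> E.is_wall k H l (w l)"
    "\<And>l. l \<le> Suc (Suc k) \<Longrightarrow> q (Suc k) (w l) = ?y" "w 0 = r (Suc k) \<tau>" "w (Suc (Suc k)) = \<tau>"
    by (metis le_refl zero_le)
  have "\<exists>s. s \<in> simplices E (Suc (Suc k)) \<and> q (Suc (Suc k)) s = degen B (Suc k) l ?y \<and>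
      (\<forall>i\<le>Suc (Suc k). face E (Suc (Suc k)) i s = E.component_face H l (w l) (w (Suc l)) i)"
    if l: "l \<le> Suc k" for l
  proof -
    let ?t = "E.component_face H l (w l) (w (Suc l))"
    have ww: "E.is_wall k H l (w l)" "E.is_wall k H (Suc l) (w (Suc l))" using w l by auto
    have "sphere_data E (Suc k) ?t"
      using E.component_face_in[OF H(1) l] E.component_face_comm[OF H(1) l] ww
      by (simp add: sphere_data_def E.is_wall_def)
    moreover have "q (Suc k) (?t i) = face B (Suc (Suc k)) i (degen B (Suc k) l ?y)" if i: "i \<le> Suc (Suc k)" for i
    proof -
      consider "i = l \<or> i = Suc l" | "i < l" | "Suc l < i" by linarith
      then show ?thesis
      proof cases
        case 1
        then show ?thesis using w(2)[of l] w(2)[of "Suc l"] l B.face_degen_eq[OF y, of l i]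
          by (auto simp: E.component_face_def)
      next
        case 2
        then show ?thesis using l Hq[of i "l - 1"] B.face_degen_less[OF y, of i l]
          by (simp add: E.component_face_def)
      next
        case 3
        then show ?thesis using l i Hq[of "i - 1" l] B.face_degen_greater[OF y, of l i]
          by (simp add: E.component_face_def)
      qed
    qed
    moreover have "degen B (Suc k) l ?y \<in> simplices B (Suc (Suc k))" using y l by (simp add: B.degen_closed)
    ultimately show ?thesis using lifts_spheresD[OF lift[OF km], of "degen B (Suc k) l ?y" ?t] by blast
  qed
  then obtain h where h: "\<And>l. l \<le> Suc k \<Longrightarrow> h l \<in> simplices E (Suc (Suc k))"
    "\<And>l. l \<le> Suc k \<Longrightarrow> q (Suc (Suc k)) (h l) = degen B (Suc k) l ?y"
    "\<And>l i. l \<le> Suc k \<Longrightarrow> i \<le> Suc (Suc k) \<Longrightarrow>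
      face E (Suc (Suc k)) i (h l) = E.component_face H l (w l) (w (Suc l)) i" by metis
  note as = E.assemble_prism[OF H(1) h(1,3)]
  show thesis
  proof (rule that)
    show "vertical_prism r (Suc k) \<tau> (restrict h {..Suc k})"
      using as(1) as(3)[of 0] as(3)[of "Suc (Suc k)"] w(3,4) h(2) by (simp add: vertical_prism_def)
  qed (use as(2) in blast)
qed

definition vertical_homotopy :: "(nat \<Rightarrow> 'e \<Rightarrow> 'e) \<Rightarrow> nat \<Rightarrow> (nat \<Rightarrow> 'e \<Rightarrow> nat \<Rightarrow> 'e) \<Rightarrow> bool"
  where "vertical_homotopy r n H \<longleftrightarrow> (\<forall>k<n. \<forall>\<tau>\<in>simplices E k. vertical_prism r k \<tau> (H k \<tau>)) \<and>
    (\<forall>k. Suc k < n \<longrightarrow> (\<forall>\<tau>\<in>simplices E (Suc k). \<forall>i\<le>Suc k.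
      prism_face E (Suc k) i (H (Suc k) \<tau>) = H k (face E (Suc k) i \<tau>)))"

text \<open>The prism over a \<open>k\<close>-simplex consists of simplices of dimension
  \<open>k + 1\<close>, and lifting stops at dimension \<open>m\<close>. Hence the homotopy reaches
  only \<open>k < m\<close>, one dimension less than a section.\<close>

lemma vertical_homotopy_exists:
  assumes r: "\<And>k \<tau>. k < m \<Longrightarrow> \<tau> \<in> simplices E k \<Longrightarrow> r k \<tau> \<in> simplices E k \<and> q k (r k \<tau>) = q k \<tau>"
    "\<And>k \<tau> i. Suc k < m \<Longrightarrow> \<tau> \<in> simplices E (Suc k) \<Longrightarrow> i \<le> Suc k \<Longrightarrow>
      face E (Suc k) i (r (Suc k) \<tau>) = r k (face E (Suc k) i \<tau>)"
  shows "\<exists>H. vertical_homotopy r m H"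
proof -
  have "\<exists>H. vertical_homotopy r n H" if "n \<le> m" for n
    using that
  proof (induction n)
    case 0
    show ?case by (simp add: vertical_homotopy_def)
  next
    case (Suc n)
    then obtain H where H: "vertical_homotopy r n H" by auto
    have "\<exists>h. vertical_prism r n \<tau> h \<and> (\<forall>k i. n = Suc k \<and> i \<le> n \<longrightarrow> prism_face E n i h = H k (face E n i \<tau>))"
      if \<tau>: "\<tau> \<in> simplices E n" for \<tau>
    proof (cases n)
      case 0
      let ?y = "q 0 \<tau>" and ?t = "\<lambda>i. if i = 0 then r 0 \<tau> else \<tau>"
      have y: "?y \<in> simplices B 0" using \<tau> 0 face_mapD[OF q] by blast
      have r0: "r 0 \<tau> \<in> simplices E 0" "q 0 (r 0 \<tau>) = ?y" using r(1)[of 0 \<tau>] \<tau> 0 Suc.prems by auto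
      have "sphere_data E 0 ?t" using r0 \<tau> 0 by (simp add: sphere_data_def)
      moreover have "\<forall>i\<le>Suc 0. q 0 (?t i) = face B (Suc 0) i (degen B 0 0 ?y)"
        using r0 B.face_degen_eq[OF y, of 0] by (auto simp: le_Suc_eq)
      moreover have "degen B 0 0 ?y \<in> simplices B (Suc 0)" using y by (simp add: B.degen_closed)
      ultimately obtain e where "e \<in> simplices E (Suc 0)" "q (Suc 0) e = degen B 0 0 ?y"
        "\<forall>i\<le>Suc 0. face E (Suc 0) i e = ?t i"
        using lifts_spheresD[OF lift[of "Suc 0"], of "degen B 0 0 ?y" ?t] Suc.prems 0 by auto
      then show ?thesis using 0
        by (intro exI[of _ "\<lambda>l\<in>{..0}. e"]) (auto simp: vertical_prism_def prism_def wall_def)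
    next
      case (Suc k)
      let ?H = "\<lambda>i. H k (face E (Suc k) i \<tau>)"
      have vp: "vertical_prism r k (face E (Suc k) i \<tau>) (?H i)" if "i \<le> Suc k" for i
        using H that \<tau> Suc E.face_in[of \<tau> k i] by (auto simp: vertical_homotopy_def)
      have "prism_face E k i (?H j) = prism_face E k (j - 1) (?H i)" if ij: "0 < k" "i < j" "j \<le> Suc k" for i j
      proof -
        obtain l where l: "k = Suc l" using ij by (cases k) auto
        have hf: "prism_face E (Suc l) a (H (Suc l) x) = H l (face E (Suc l) a x)"
          if "x \<in> simplices E (Suc l)" "a \<le> Suc l" for x a
          using H that l Suc unfolding vertical_homotopy_def by blast
        show ?thesis using ij \<tau> l Suc E.face_comm[of \<tau> l i j] by (simp add: hf E.face_in)
      qed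
      then have ps: "E.prism_sphere k ?H" using vp by (simp add: E.prism_sphere_def vertical_prism_def)
      have rn: "r (Suc k) \<tau> \<in> simplices E (Suc k)" "q (Suc k) (r (Suc k) \<tau>) = q (Suc k) \<tau>"
        using r(1)[of "Suc k" \<tau>] \<tau> Suc Suc.prems by auto
      obtain h where "vertical_prism r (Suc k) \<tau> h" "\<And>i. i \<le> Suc k \<Longrightarrow> prism_face E (Suc k) i h = ?H i"
        using vertical_prism_extend[OF _ _ rn r(2) ps vp] \<tau> Suc Suc.prems by (metis Suc_le_eq)
      then show ?thesis using Suc by auto
    qed
    then obtain H' where H': "\<And>\<tau>. \<tau> \<in> simplices E n \<Longrightarrow> vertical_prism r n \<tau> (H' \<tau>) \<and>
        (\<forall>k i. n = Suc k \<and> i \<le> n \<longrightarrow> prism_face E n i (H' \<tau>) = H k (face E n i \<tau>))" by metis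
    show ?case
      by (rule exI[of _ "H(n := H')"])
        (use H H' in \<open>auto simp: vertical_homotopy_def less_Suc_eq\<close>)
  qed
  then show ?thesis by blast
qed

end

section \<open>Alternating sums and seminormed modules\<close>

definition signed :: "('a, 'm) ring_scheme \<Rightarrow> nat \<Rightarrow> 'a \<Rightarrow> 'a"
  where "signed G i x = (if even i then x else \<ominus>\<^bsub>G\<^esub> x)"

context abelian_group begin

lemma signed_closed [simp]: "x \<in> carrier G \<Longrightarrow> signed G i x \<in> carrier G"
  by (simp add: signed_def)

lemma signed_0 [simp]: "signed G 0 x = x"
  by (simp add: signed_def)

lemma signed_signed: "x \<in> carrier G \<Longrightarrow> signed G i (signed G j x) = signed G (i + j) x"
  by (auto simp: signed_def minus_minus)

lemma signed_Suc: "x \<in> carrier G \<Longrightarrow> signed G (Suc i) x = \<ominus> signed G i x"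
  by (auto simp: signed_def minus_minus)

lemma minus_zero_group: "\<ominus> \<zero> = \<zero>"
  using minus_equality[of \<zero> \<zero>] by simp

lemma finsum_minus:
  assumes "f \<in> A \<rightarrow> carrier G"
  shows "finsum G (\<lambda>x. \<ominus> f x) A = \<ominus> finsum G f A"
proof (cases "finite A")
  case True
  then show ?thesis using assms
  proof (induction A rule: finite_induct)
    case (insert a A)
    then have "(\<lambda>x. \<ominus> f x) \<in> A \<rightarrow> carrier G" "f \<in> A \<rightarrow> carrier G" "f a \<in> carrier G" by auto
    then show ?case using insert by (simp add: minus_add finsum_closed)
  qed (simp add: minus_zero_group)
qed (simp add: minus_zero_group)

lemma signed_finsum:
  assumes "f \<in> A \<rightarrow> carrier G"
  shows "signed G j (finsum G f A) = finsum G (\<lambda>x. signed G j (f x)) A"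
  using finsum_minus[OF assms] by (simp add: signed_def)

lemma signed_signed_finsum:
  assumes "\<And>i. i \<in> A \<Longrightarrow> f i \<in> carrier G"
  shows "signed G j (finsum G (\<lambda>i. signed G i (f i)) A) = finsum G (\<lambda>i. signed G (j + i) (f i)) A"
  using assms by (subst signed_finsum) (auto simp: signed_signed intro!: finsum_cong')

lemma finsum_times:
  assumes "finite A" "finite B" "\<And>a b. a \<in> A \<Longrightarrow> b \<in> B \<Longrightarrow> f a b \<in> carrier G"
  shows "finsum G (\<lambda>a. finsum G (f a) B) A = finsum G (\<lambda>(a, b). f a b) (A \<times> B)"
  using assms(1,3)
proof (induction A rule: finite_induct)
  case (insert a A)
  have fa: "f a \<in> B \<rightarrow> carrier G" using insert by auto
  have eq: "insert a A \<times> B = Pair a ` B \<union> A \<times> B" by auto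
  have "finsum G (\<lambda>(a, b). f a b) (insert a A \<times> B) =
      finsum G (\<lambda>(a, b). f a b) (Pair a ` B) \<oplus> finsum G (\<lambda>(a, b). f a b) (A \<times> B)"
    unfolding eq by (rule finsum_Un_disjoint) (use insert assms(2) in auto)
  also have "finsum G (\<lambda>(a, b). f a b) (Pair a ` B) = finsum G (f a) B"
    using finsum_reindex[of "\<lambda>(a, b). f a b" "Pair a" B] fa by (force simp: inj_on_def)
  also have "finsum G (\<lambda>(a, b). f a b) (A \<times> B) = finsum G (\<lambda>a. finsum G (f a) B) A"
    using insert by simp
  also have "finsum G (f a) B \<oplus> finsum G (\<lambda>a. finsum G (f a) B) A = finsum G (\<lambda>a. finsum G (f a) B) (insert a A)"
    using insert by (subst finsum_insert) (auto intro!: finsum_closed)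
  finally show ?case by simp
qed simp

lemma finsum_telescope:
  assumes "\<And>l. l \<le> n \<Longrightarrow> f l \<in> carrier G" "\<And>l. l \<le> n \<Longrightarrow> g l \<in> carrier G"
    and "\<And>l. l < n \<Longrightarrow> f (Suc l) = g l"
  shows "finsum G (\<lambda>l. f l \<oplus> \<ominus> g l) {..n} = f 0 \<oplus> \<ominus> g n"
  using assms
proof (induction n)
  case (Suc n)
  have c: "(\<lambda>l. f l \<oplus> \<ominus> g l) \<in> {..Suc n} \<rightarrow> carrier G" using Suc.prems by auto
  have "finsum G (\<lambda>l. f l \<oplus> \<ominus> g l) {..Suc n} = (f (Suc n) \<oplus> \<ominus> g (Suc n)) \<oplus> (f 0 \<oplus> \<ominus> g n)"
    using Suc.IH Suc.prems finsum_Suc[OF c] by simp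
  also have "\<dots> = (f 0 \<oplus> \<ominus> g (Suc n)) \<oplus> (g n \<oplus> \<ominus> g n)"
    using Suc.prems(1)[of 0] Suc.prems(2)[of n] Suc.prems(2)[of "Suc n"] Suc.prems(3)[of n]
    by (simp add: a_ac)
  also have "\<dots> = f 0 \<oplus> \<ominus> g (Suc n)"
    using Suc.prems(1)[of 0] Suc.prems(2)[of n] Suc.prems(2)[of "Suc n"] by (simp add: r_neg)
  finally show ?case .
qed simp

text \<open>The identity \<open>P \<delta> + \<delta> P = top - bottom\<close> for the prism operator; \<open>V i l\<close> belongs to the \<open>i\<close>-th
  face of the \<open>l\<close>-th simplex of a prism, and \<open>U i l\<close> to the \<open>l\<close>-th simplex of its \<open>i\<close>-th face.\<close>

lemma prism_sum:
  assumes V: "\<And>i l. i \<le> Suc n \<Longrightarrow> l \<le> n \<Longrightarrow> V i l \<in> carrier G"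
    and U: "\<And>i l. i \<le> n \<Longrightarrow> l < n \<Longrightarrow> U i l \<in> carrier G"
    and diag: "\<And>l. l < n \<Longrightarrow> V (Suc l) (Suc l) = V (Suc l) l"
    and low: "\<And>i l. i \<le> l \<Longrightarrow> l < n \<Longrightarrow> V i (Suc l) = U i l"
    and up: "\<And>i l. l < i \<Longrightarrow> i \<le> n \<Longrightarrow> V (Suc i) l = U i l"
  shows "finsum G (\<lambda>l. signed G l (finsum G (\<lambda>i. signed G i (V i l)) {..Suc n})) {..n} \<oplus>
    finsum G (\<lambda>i. signed G i (finsum G (\<lambda>l. signed G l (U i l)) {..<n})) {..n} =
    V 0 0 \<oplus> \<ominus> V (Suc n) n"
proof -
  define f where "f = (\<lambda>(l, i). signed G (l + i) (V i l))"
  define g where "g = (\<lambda>(i, l). signed G (i + l) (U i l))"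
  \<comment> \<open>\<open>L1\<close> and \<open>L2\<close> are the off-diagonal terms of the first
    double sum. Their bijections with \<open>J1\<close> and \<open>J2\<close> raise
    \<open>i + l\<close> by one, so they cancel the second double sum. The diagonals
    \<open>D0\<close> and \<open>D1\<close> telescope by \<open>diag\<close>.\<close>
  define J1 where "J1 = {(i, l). i \<le> l \<and> l < n}"
  define J2 where "J2 = {(i, l). l < i \<and> i \<le> n}"
  have J: "{..n} \<times> {..<n} = J1 \<union> J2" "J1 \<inter> J2 = {}" by (auto simp: J1_def J2_def)
  have "finite ({..n} \<times> {..<n})" by blast
  then have finJ: "finite J1" "finite J2" unfolding J by auto
  define L1 where "L1 = (\<lambda>(i, l). (Suc l, i)) ` J1"
  define L2 where "L2 = (\<lambda>(i, l). (l, Suc i)) ` J2"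
  define D0 where "D0 = (\<lambda>l. (l, l)) ` {..n}"
  define D1 where "D1 = (\<lambda>l. (l, Suc l)) ` {..n}"
  have I: "{..n} \<times> {..Suc n} = (L1 \<union> L2) \<union> (D0 \<union> D1)"
  proof -
    have "(l, i) \<in> (L1 \<union> L2) \<union> (D0 \<union> D1)" if "l \<le> n" "i \<le> Suc n" for l i
    proof -
      consider "i < l" | "i = l" | "i = Suc l" | "Suc l < i" by linarith
      then show ?thesis
      proof cases
        case 1
        then have "(l, i) = (\<lambda>(i, l). (Suc l, i)) (i, l - 1)" "(i, l - 1) \<in> J1" using that by (auto simp: J1_def)
        then show ?thesis unfolding L1_def by blast
      next
        case 4
        then have "(l, i) = (\<lambda>(i, l). (l, Suc i)) (i - 1, l)" "(i - 1, l) \<in> J2" using that by (auto simp: J2_def)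
        then show ?thesis unfolding L2_def by blast
      qed (use that in \<open>auto simp: D0_def D1_def\<close>)
    qed
    then show ?thesis by (auto simp: L1_def L2_def D0_def D1_def J1_def J2_def)
  qed
  have disj: "(L1 \<union> L2) \<inter> (D0 \<union> D1) = {}" "L1 \<inter> L2 = {}" "D0 \<inter> D1 = {}"
    by (auto simp: L1_def L2_def D0_def D1_def J1_def J2_def)
  have fin: "finite L1" "finite L2" "finite D0" "finite D1"
    using finJ by (auto simp: L1_def L2_def D0_def D1_def)
  have fc: "f \<in> {..n} \<times> {..Suc n} \<rightarrow> carrier G" using V by (auto simp: f_def)
  then have fcs: "f \<in> L1 \<rightarrow> carrier G" "f \<in> L2 \<rightarrow> carrier G" "f \<in> D0 \<rightarrow> carrier G" "f \<in> D1 \<rightarrow> carrier G"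
    unfolding I by auto
  have gc: "g \<in> {..n} \<times> {..<n} \<rightarrow> carrier G" using U by (auto simp: g_def)
  then have gcs: "g \<in> J1 \<rightarrow> carrier G" "g \<in> J2 \<rightarrow> carrier G" unfolding J by auto
  have S1: "finsum G f L1 = \<ominus> finsum G g J1"
  proof -
    have "finsum G f L1 = finsum G (\<lambda>x. f ((\<lambda>(i, l). (Suc l, i)) x)) J1"
      unfolding L1_def by (rule finsum_reindex) (use fcs in \<open>auto simp: L1_def inj_on_def\<close>)
    also have "\<dots> = finsum G (\<lambda>x. \<ominus> g x) J1"
      using gcs(1) U low by (intro finsum_cong')
        (auto simp: f_def g_def J1_def add.commute signed_Suc)
    finally show ?thesis using finsum_minus[OF gcs(1)] by simp
  qed
  have S2: "finsum G f L2 = \<ominus> finsum G g J2"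
  proof -
    have "finsum G f L2 = finsum G (\<lambda>x. f ((\<lambda>(i, l). (l, Suc i)) x)) J2"
      unfolding L2_def by (rule finsum_reindex) (use fcs in \<open>auto simp: L2_def inj_on_def\<close>)
    also have "\<dots> = finsum G (\<lambda>x. \<ominus> g x) J2"
      using gcs(2) U up by (intro finsum_cong')
        (auto simp: f_def g_def J2_def add.commute signed_Suc)
    finally show ?thesis using finsum_minus[OF gcs(2)] by simp
  qed
  have SD: "finsum G f D0 \<oplus> finsum G f D1 = V 0 0 \<oplus> \<ominus> V (Suc n) n"
  proof -
    have "finsum G f D0 = finsum G (\<lambda>l. f (l, l)) {..n}"
      unfolding D0_def by (rule finsum_reindex) (use fcs in \<open>auto simp: D0_def inj_on_def\<close>)
    also have "\<dots> = finsum G (\<lambda>l. V l l) {..n}"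
      using V by (intro finsum_cong') (auto simp: f_def signed_def)
    finally have 1: "finsum G f D0 = finsum G (\<lambda>l. V l l) {..n}" .
    have "finsum G f D1 = finsum G (\<lambda>l. f (l, Suc l)) {..n}"
      unfolding D1_def by (rule finsum_reindex) (use fcs in \<open>auto simp: D1_def inj_on_def\<close>)
    also have "\<dots> = finsum G (\<lambda>l. \<ominus> V (Suc l) l) {..n}"
      using V by (intro finsum_cong') (auto simp: f_def signed_def)
    finally have 2: "finsum G f D1 = finsum G (\<lambda>l. \<ominus> V (Suc l) l) {..n}" .
    have "finsum G f D0 \<oplus> finsum G f D1 = finsum G (\<lambda>l. V l l \<oplus> \<ominus> V (Suc l) l) {..n}"
      unfolding 1 2 using V by (intro finsum_addf[symmetric]) auto
    also have "\<dots> = V 0 0 \<oplus> \<ominus> V (Suc n) n"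
      using V diag by (intro finsum_telescope[where f = "\<lambda>l. V l l" and g = "\<lambda>l. V (Suc l) l"]) auto
    finally show ?thesis .
  qed
  have "finsum G (\<lambda>l. signed G l (finsum G (\<lambda>i. signed G i (V i l)) {..Suc n})) {..n} =
      finsum G (\<lambda>l. finsum G (\<lambda>i. signed G (l + i) (V i l)) {..Suc n}) {..n}"
    using V by (intro finsum_cong' signed_signed_finsum) (auto intro!: finsum_closed simp del: finsum_Suc)
  also have "\<dots> = finsum G f ({..n} \<times> {..Suc n})"
    unfolding f_def using V by (intro finsum_times) auto
  also have "\<dots> = (finsum G f L1 \<oplus> finsum G f L2) \<oplus> (finsum G f D0 \<oplus> finsum G f D1)"
    unfolding I using fin fcs disj by (subst finsum_Un_disjoint; simp)+
  finally have LHS: "finsum G (\<lambda>l. signed G l (finsum G (\<lambda>i. signed G i (V i l)) {..Suc n})) {..n} =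
    (\<ominus> finsum G g J1 \<oplus> \<ominus> finsum G g J2) \<oplus> (V 0 0 \<oplus> \<ominus> V (Suc n) n)"
    unfolding S1 S2 SD .
  have "finsum G (\<lambda>i. signed G i (finsum G (\<lambda>l. signed G l (U i l)) {..<n})) {..n} =
      finsum G (\<lambda>i. finsum G (\<lambda>l. signed G (i + l) (U i l)) {..<n}) {..n}"
    using U by (intro finsum_cong' signed_signed_finsum) (auto intro!: finsum_closed simp del: finsum_Suc)
  also have "\<dots> = finsum G g ({..n} \<times> {..<n})"
    unfolding g_def using U by (intro finsum_times) auto
  also have "\<dots> = finsum G g J1 \<oplus> finsum G g J2"
    unfolding J(1) using J(2) finJ gcs by (intro finsum_Un_disjoint) auto
  finally have RHS: "finsum G (\<lambda>i. signed G i (finsum G (\<lambda>l. signed G l (U i l)) {..<n})) {..n} =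
    finsum G g J1 \<oplus> finsum G g J2" .
  have cl: "finsum G g J1 \<in> carrier G" "finsum G g J2 \<in> carrier G" "V 0 0 \<oplus> \<ominus> V (Suc n) n \<in> carrier G"
    using gcs V by (auto intro: finsum_closed)
  have cancel: "(\<ominus> a \<oplus> \<ominus> b) \<oplus> c \<oplus> (a \<oplus> b) = c"
    if "a \<in> carrier G" "b \<in> carrier G" "c \<in> carrier G" for a b c
  proof -
    have "(\<ominus> a \<oplus> \<ominus> b) \<oplus> c \<oplus> (a \<oplus> b) = c \<oplus> (\<ominus> (a \<oplus> b) \<oplus> (a \<oplus> b))"
      using that by (simp add: minus_add a_ac)
    then show ?thesis using that by (simp add: l_neg)
  qed
  show ?thesis unfolding LHS RHS by (rule cancel[OF cl])
qed

end

section \<open>Linear maps, isometric isomorphisms and seminorm estimates\<close>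

lemma linear_mapsD:
  assumes "h \<in> linear_maps R M M'"
  shows "a \<in> carrier M \<Longrightarrow> h a \<in> carrier M'"
    and "a \<in> carrier M \<Longrightarrow> b \<in> carrier M \<Longrightarrow> h (a \<oplus>\<^bsub>M\<^esub> b) = h a \<oplus>\<^bsub>M'\<^esub> h b"
    and "r \<in> carrier R \<Longrightarrow> a \<in> carrier M \<Longrightarrow> h (r \<odot>\<^bsub>M\<^esub> a) = r \<odot>\<^bsub>M'\<^esub> h a"
  using assms by (auto simp: linear_maps_def)

lemma linear_maps_compose:
  "h \<in> linear_maps R M M' \<Longrightarrow> k \<in> linear_maps R M' M'' \<Longrightarrow> k \<circ> h \<in> linear_maps R M M''"
  by (auto simp: linear_maps_def image_subset_iff)

lemma sn_isosI:
  assumes "abelian_group M" and lin: "h \<in> linear_maps R M M'" and bij: "bij_betw h (carrier M) (carrier M')"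
    and nrm: "\<And>a. a \<in> carrier M \<Longrightarrow> snorm M' (h a) = snorm M a"
    and sm: "\<And>r a. r \<in> carrier R \<Longrightarrow> a \<in> carrier M \<Longrightarrow> r \<odot>\<^bsub>M\<^esub> a \<in> carrier M"
  shows "h \<in> sn_isos R M M'"
proof -
  interpret abelian_group M by fact
  let ?k = "inv_into (carrier M) h"
  have k: "?k b \<in> carrier M" "h (?k b) = b" if "b \<in> carrier M'" for b
    using that bij by (auto simp: bij_betw_def inv_into_into f_inv_into_f)
  have kh: "?k (h a) = a" if "a \<in> carrier M" for a
    using that bij by (simp add: bij_betw_def inv_into_f_f)
  have "?k (a \<oplus>\<^bsub>M'\<^esub> b) = ?k a \<oplus>\<^bsub>M\<^esub> ?k b" if "a \<in> carrier M'" "b \<in> carrier M'" for a b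
    using kh[of "?k a \<oplus>\<^bsub>M\<^esub> ?k b"] linear_mapsD(2)[OF lin, of "?k a" "?k b"] k that by simp
  moreover have "?k (r \<odot>\<^bsub>M'\<^esub> b) = r \<odot>\<^bsub>M\<^esub> ?k b" if "r \<in> carrier R" "b \<in> carrier M'" for r b
    using kh[of "r \<odot>\<^bsub>M\<^esub> ?k b"] linear_mapsD(3)[OF lin, of r "?k b"] k that sm by simp
  ultimately have "?k \<in> linear_maps R M' M" using k by (auto simp: linear_maps_def)
  moreover have "snorm M (?k b) \<le> snorm M' b" if "b \<in> carrier M'" for b
    using nrm[of "?k b"] k that by simp
  ultimately show ?thesis using lin bij nrm by (auto simp: sn_isos_def sn_maps_def)
qed

lemma sn_isosD:
  assumes "h \<in> sn_isos R M M'"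
  shows "h \<in> sn_maps R M M'" "h \<in> linear_maps R M M'" "bij_betw h (carrier M) (carrier M')"
    "a \<in> carrier M \<Longrightarrow> snorm M' (h a) = snorm M a"
proof -
  show "h \<in> sn_maps R M M'" "h \<in> linear_maps R M M'" and bij: "bij_betw h (carrier M) (carrier M')"
    using assms by (auto simp: sn_isos_def sn_maps_def)
  show "snorm M' (h a) = snorm M a" if a: "a \<in> carrier M"
  proof (rule antisym)
    show "snorm M' (h a) \<le> snorm M a" using assms a by (auto simp: sn_isos_def sn_maps_def)
    have "h a \<in> carrier M'" "inv_into (carrier M) h (h a) = a"
      using bij a by (auto simp: bij_betw_def inv_into_f_f)
    then show "snorm M a \<le> snorm M' (h a)"
      using assms by (force simp: sn_isos_def sn_maps_def)
  qed
qed

lemma sn_isos_compose: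
  assumes "abelian_group M" and sm: "\<And>r a. r \<in> carrier R \<Longrightarrow> a \<in> carrier M \<Longrightarrow> r \<odot>\<^bsub>M\<^esub> a \<in> carrier M"
    and h: "h \<in> sn_isos R M M'" and k: "k \<in> sn_isos R M' M''"
  shows "k \<circ> h \<in> sn_isos R M M''"
proof (rule sn_isosI[OF assms(1) _ _ _ sm])
  show "k \<circ> h \<in> linear_maps R M M''" using h k sn_isosD linear_maps_compose by metis
  show "bij_betw (k \<circ> h) (carrier M) (carrier M'')" using sn_isosD(3)[OF h] sn_isosD(3)[OF k] bij_betw_trans by blast
  show "snorm M'' ((k \<circ> h) a) = snorm M a" if "a \<in> carrier M" for a
    using that sn_isosD(4)[OF h] sn_isosD(4)[OF k] linear_mapsD(1)[OF sn_isosD(2)[OF h]] by simp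
qed

context left_module begin

lemma smult_zero_right: "r \<in> carrier R \<Longrightarrow> r \<odot>\<^bsub>M\<^esub> \<zero>\<^bsub>M\<^esub> = \<zero>\<^bsub>M\<^esub>"
  using smult_r_distr[of r "\<zero>\<^bsub>M\<^esub>" "\<zero>\<^bsub>M\<^esub>"] smult_closed[of r "\<zero>\<^bsub>M\<^esub>"]
  by (metis M.add.l_cancel_one M.r_zero M.zero_closed)

lemma smult_zero_left: "a \<in> carrier M \<Longrightarrow> \<zero>\<^bsub>R\<^esub> \<odot>\<^bsub>M\<^esub> a = \<zero>\<^bsub>M\<^esub>"
  using smult_l_distr[of "\<zero>\<^bsub>R\<^esub>" "\<zero>\<^bsub>R\<^esub>" a] smult_closed[of "\<zero>\<^bsub>R\<^esub>" a]
  by (metis M.add.l_cancel_one R.l_zero R.zero_closed)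

lemma smult_minus_one: "a \<in> carrier M \<Longrightarrow> (\<ominus>\<^bsub>R\<^esub> \<one>\<^bsub>R\<^esub>) \<odot>\<^bsub>M\<^esub> a = \<ominus>\<^bsub>M\<^esub> a"
  using smult_l_distr[of "\<ominus>\<^bsub>R\<^esub> \<one>\<^bsub>R\<^esub>" "\<one>\<^bsub>R\<^esub>" a] smult_closed[of "\<ominus>\<^bsub>R\<^esub> \<one>\<^bsub>R\<^esub>" a]
  by (intro M.minus_equality[symmetric]) (auto simp: R.l_neg smult_zero_left smult_one)

lemma smult_minus:
  assumes "r \<in> carrier R" "a \<in> carrier M"
  shows "r \<odot>\<^bsub>M\<^esub> (\<ominus>\<^bsub>M\<^esub> a) = \<ominus>\<^bsub>M\<^esub> (r \<odot>\<^bsub>M\<^esub> a)"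
  using smult_r_distr[of r "\<ominus>\<^bsub>M\<^esub> a" a] smult_closed assms
  by (intro M.minus_equality[symmetric]) (auto simp: M.l_neg smult_zero_right)

lemma smult_signed: "r \<in> carrier R \<Longrightarrow> a \<in> carrier M \<Longrightarrow> r \<odot>\<^bsub>M\<^esub> signed M i a = signed M i (r \<odot>\<^bsub>M\<^esub> a)"
  by (simp add: signed_def smult_minus)

lemma smult_finsum:
  assumes "finite A" "r \<in> carrier R" "f \<in> A \<rightarrow> carrier M"
  shows "r \<odot>\<^bsub>M\<^esub> finsum M f A = finsum M (\<lambda>x. r \<odot>\<^bsub>M\<^esub> f x) A"
  using assms(1,3)
proof (induction A rule: finite_induct)
  case empty
  then show ?case using assms by (simp add: smult_zero_right)
next
  case (insert a A)
  then have "f \<in> A \<rightarrow> carrier M" "f a \<in> carrier M" "(\<lambda>x. r \<odot>\<^bsub>M\<^esub> f x) \<in> A \<rightarrow> carrier M"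
    using assms smult_closed by auto
  then show ?case using insert assms smult_closed by (simp add: smult_r_distr)
qed

lemma linear_zero:
  assumes "h \<in> linear_maps R M M'" "left_module R M'"
  shows "h \<zero>\<^bsub>M\<^esub> = \<zero>\<^bsub>M'\<^esub>"
proof -
  interpret M': left_module R M' by fact
  have "h (\<zero>\<^bsub>R\<^esub> \<odot>\<^bsub>M\<^esub> \<zero>\<^bsub>M\<^esub>) = \<zero>\<^bsub>R\<^esub> \<odot>\<^bsub>M'\<^esub> h \<zero>\<^bsub>M\<^esub>"
    by (rule linear_mapsD(3)[OF assms(1)]) auto
  then show ?thesis
    using linear_mapsD(1)[OF assms(1), of "\<zero>\<^bsub>M\<^esub>"] smult_zero_left M'.smult_zero_left by simp
qed

lemma linear_minus:
  assumes "h \<in> linear_maps R M M'" "left_module R M'" "a \<in> carrier M"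
  shows "h (\<ominus>\<^bsub>M\<^esub> a) = \<ominus>\<^bsub>M'\<^esub> h a"
proof -
  interpret M': left_module R M' by fact
  have "h ((\<ominus>\<^bsub>R\<^esub> \<one>\<^bsub>R\<^esub>) \<odot>\<^bsub>M\<^esub> a) = (\<ominus>\<^bsub>R\<^esub> \<one>\<^bsub>R\<^esub>) \<odot>\<^bsub>M'\<^esub> h a"
    by (rule linear_mapsD(3)[OF assms(1)]) (use assms in auto)
  then show ?thesis
    using linear_mapsD(1)[OF assms(1,3)] assms(3) smult_minus_one M'.smult_minus_one by simp
qed

lemma linear_signed:
  assumes "h \<in> linear_maps R M M'" "left_module R M'" "a \<in> carrier M"
  shows "h (signed M i a) = signed M' i (h a)"
  using linear_minus[OF assms] by (simp add: signed_def)

lemma linear_finsum: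
  assumes "h \<in> linear_maps R M M'" "left_module R M'" "finite A" "f \<in> A \<rightarrow> carrier M"
  shows "h (finsum M f A) = finsum M' (\<lambda>x. h (f x)) A"
proof -
  interpret M': left_module R M' by fact
  show ?thesis using assms(3,4)
  proof (induction A rule: finite_induct)
    case (insert a A)
    then have "f \<in> A \<rightarrow> carrier M" "f a \<in> carrier M" "(\<lambda>x. h (f x)) \<in> A \<rightarrow> carrier M'"
      using linear_mapsD(1)[OF assms(1)] by auto
    then show ?case using insert linear_mapsD(1,2)[OF assms(1)] by simp
  qed (simp add: linear_zero[OF assms(1,2)])
qed

end

locale seminormed_module_over = normed_ring R N + seminormed_module R N M
  for R :: "('r, 'm) ring_scheme" (structure) and N and M :: "('r, 'a) sn_module" (structure)
begin

lemma snorm_add: "a \<in> carrier M \<Longrightarrow> b \<in> carrier M \<Longrightarrow> snorm M (a \<oplus>\<^bsub>M\<^esub> b) \<le> N \<one>\<^bsub>R\<^esub> * snorm M a + snorm M b"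
  using snorm_smult_add[of "\<one>\<^bsub>R\<^esub>" a b] smult_one by simp

lemma snorm_signed_add:
  assumes "a \<in> carrier M" "b \<in> carrier M"
  shows "snorm M (signed M i a \<oplus>\<^bsub>M\<^esub> b) \<le> N \<one>\<^bsub>R\<^esub> * snorm M a + snorm M b"
  using snorm_smult_add[of "\<ominus>\<^bsub>R\<^esub> \<one>\<^bsub>R\<^esub>" a b] snorm_add[OF assms] assms smult_minus_one norm_minus[of "\<one>\<^bsub>R\<^esub>"]
  by (simp add: signed_def)

text \<open>The factor \<open>N 1\<close> is needed since the norm of the unit may exceed 1.\<close>

lemma snorm_signed_sum:
  assumes "finite A" "\<And>x. x \<in> A \<Longrightarrow> f x \<in> carrier M" "\<And>x. x \<in> A \<Longrightarrow> snorm M (f x) \<le> K"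
  shows "snorm M (finsum M (\<lambda>x. signed M (s x) (f x)) A) \<le> card A * (N \<one>\<^bsub>R\<^esub> * K)"
  using assms
proof (induction A rule: finite_induct)
  case (insert a A)
  have fc: "(\<lambda>x. signed M (s x) (f x)) \<in> A \<rightarrow> carrier M" using insert by auto
  have "snorm M (finsum M (\<lambda>x. signed M (s x) (f x)) (insert a A)) =
      snorm M (signed M (s a) (f a) \<oplus>\<^bsub>M\<^esub> finsum M (\<lambda>x. signed M (s x) (f x)) A)"
    using insert fc by simp
  also have "\<dots> \<le> N \<one>\<^bsub>R\<^esub> * snorm M (f a) + snorm M (finsum M (\<lambda>x. signed M (s x) (f x)) A)"
    using insert fc by (intro snorm_signed_add) auto
  also have "\<dots> \<le> N \<one>\<^bsub>R\<^esub> * K + card A * (N \<one>\<^bsub>R\<^esub> * K)"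
    using insert norm_nonneg[of "\<one>\<^bsub>R\<^esub>"] by (intro add_mono mult_left_mono) auto
  finally show ?case using insert by (simp add: algebra_simps)
qed (simp add: snorm_zero)

end

section \<open>Cochains\<close>

context semi_simplicial_set begin

lemma vertex0_in: "\<sigma> \<in> simplices X n \<Longrightarrow> vertex0 X n \<sigma> \<in> simplices X 0"
  by (induction n arbitrary: \<sigma>) (auto simp: face_in)

lemma front_edge_in: "\<sigma> \<in> simplices X (Suc n) \<Longrightarrow> front_edge X n \<sigma> \<in> simplices X (Suc 0)"
  by (induction n arbitrary: \<sigma>) (auto simp: face_in)

lemma vertex0_face:
  "\<sigma> \<in> simplices X (Suc n) \<Longrightarrow> 0 < i \<Longrightarrow> i \<le> Suc n \<Longrightarrow>
    vertex0 X n (face X (Suc n) i \<sigma>) = vertex0 X (Suc n) \<sigma>"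
proof (induction n arbitrary: \<sigma>)
  case 0
  then have "i = Suc 0" by simp
  then show ?case by simp
next
  case (Suc n)
  show ?case
  proof (cases "i = Suc (Suc n)")
    case False
    then have "face X (Suc n) (Suc n) (face X (Suc (Suc n)) i \<sigma>) =
        face X (Suc n) i (face X (Suc (Suc n)) (Suc (Suc n)) \<sigma>)"
      using face_comm[OF Suc.prems(1), of i "Suc (Suc n)"] Suc.prems by simp
    then show ?thesis
      using Suc.IH[of "face X (Suc (Suc n)) (Suc (Suc n)) \<sigma>"] Suc.prems False by (simp add: face_in)
  qed simp
qed

lemma front_edge_face:
  "\<sigma> \<in> simplices X (Suc (Suc n)) \<Longrightarrow> Suc 0 < i \<Longrightarrow> i \<le> Suc (Suc n) \<Longrightarrow>
    front_edge X n (face X (Suc (Suc n)) i \<sigma>) = front_edge X (Suc n) \<sigma>"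
proof (induction n arbitrary: \<sigma>)
  case 0
  then have "i = Suc (Suc 0)" by simp
  then show ?case by simp
next
  case (Suc n)
  show ?case
  proof (cases "i = Suc (Suc (Suc n))")
    case False
    then have "face X (Suc (Suc n)) (Suc (Suc n)) (face X (Suc (Suc (Suc n))) i \<sigma>) =
        face X (Suc (Suc n)) i (face X (Suc (Suc (Suc n))) (Suc (Suc (Suc n))) \<sigma>)"
      using face_comm[OF Suc.prems(1), of i "Suc (Suc (Suc n))"] Suc.prems by simp
    then show ?thesis
      using Suc.IH[of "face X (Suc (Suc (Suc n))) (Suc (Suc (Suc n))) \<sigma>"] Suc.prems False by (simp add: face_in)
  qed simp
qed

lemma src_front_edge: "\<sigma> \<in> simplices X (Suc n) \<Longrightarrow> src X (front_edge X n \<sigma>) = vertex0 X (Suc n) \<sigma>"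
  by (induction n arbitrary: \<sigma>) (auto simp: face_in)

lemma tgt_front_edge:
  "\<sigma> \<in> simplices X (Suc n) \<Longrightarrow> tgt X (front_edge X n \<sigma>) = vertex0 X n (face X (Suc n) 0 \<sigma>)"
proof (induction n arbitrary: \<sigma>)
  case (Suc n)
  then show ?case using face_comm[of \<sigma> n 0 "Suc (Suc n)"] by (simp add: face_in)
qed simp

text \<open>Neighbouring simplices share a face of positive index, which keeps the initial vertex.
  So all of them start at the initial vertex of the bottom.\<close>

lemma vertex0_prism:
  assumes h: "prism X k h" and l: "l \<le> k"
  shows "vertex0 X (Suc k) (h l) = vertex0 X k (wall X k h (Suc k))"
proof -
  have "vertex0 X (Suc k) (h (k - d)) = vertex0 X k (wall X k h (Suc k))" if "d \<le> k" for d
    using that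
  proof (induction d)
    case (Suc d)
    let ?l = "k - Suc d"
    have l: "?l < k" "Suc ?l = k - d" using Suc.prems by auto
    have "face X (Suc k) (Suc ?l) (h ?l) = face X (Suc k) (Suc ?l) (h (k - d))"
      using h l unfolding prism_def by metis
    then have "vertex0 X (Suc k) (h ?l) = vertex0 X (Suc k) (h (k - d))"
      using vertex0_face[OF prism_in[OF h], of ?l "Suc ?l"] vertex0_face[OF prism_in[OF h], of "k - d" "Suc ?l"] l
      by simp
    then show ?case using Suc by simp
  qed (simp add: wall_def)
  from this[of "k - l"] l show ?thesis by simp
qed

text \<open>For \<open>l > 0\<close> the simplices begin with the two bottom vertices
  \<open>a_0\<close>, \<open>a_1\<close>. The simplex of index 0 is excluded because its front edge
  joins \<open>a_0\<close> to \<open>b_0\<close>.\<close>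

lemma front_edge_prism:
  assumes h: "prism X (Suc k) h" and l: "0 < l" "l \<le> Suc k"
  shows "front_edge X (Suc k) (h l) = front_edge X k (wall X (Suc k) h (Suc (Suc k)))"
proof -
  have "front_edge X (Suc k) (h (Suc k - d)) = front_edge X k (wall X (Suc k) h (Suc (Suc k)))" if "d \<le> k" for d
    using that
  proof (induction d)
    case (Suc d)
    let ?l = "Suc k - Suc d"
    have l: "?l < Suc k" "Suc ?l = Suc k - d" "0 < ?l" using Suc.prems by auto
    have "face X (Suc (Suc k)) (Suc ?l) (h ?l) = face X (Suc (Suc k)) (Suc ?l) (h (Suc k - d))"
      using h l unfolding prism_def by metis
    then have "front_edge X (Suc k) (h ?l) = front_edge X (Suc k) (h (Suc k - d))"
      using front_edge_face[OF prism_in[OF h], of ?l "Suc ?l"] front_edge_face[OF prism_in[OF h], of "Suc k - d" "Suc ?l"] l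
      by simp
    then show ?case using Suc by simp
  qed (simp add: wall_def)
  from this[of "Suc k - l"] l show ?thesis by simp
qed

end

declare vertex0.simps(2) [simp del] front_edge.simps(2) [simp del]

definition edge_back :: "'x sset \<Rightarrow> ('r, 'x, 'a) coeff_system \<Rightarrow> 'x \<Rightarrow> 'a \<Rightarrow> 'a"
  where "edge_back X A e = transport A (tgt X e) (src X e) (pi_edge_inv X e)"

text \<open>The part of a local coefficient system that enters the cochain complex. It also makes sense
  when the functor on the whole groupoid is not at hand, and when degeneracies are missing.\<close>

locale edge_system = semi_simplicial_set X + normed_ring R N
  for R :: "('r, 'm) ring_scheme" and N :: "'r \<Rightarrow> real" and X :: "'x sset" +
  fixes A :: "('r, 'x, 'a) coeff_system"
  assumes stalk_seminormed: "x \<in> simplices X 0 \<Longrightarrow> seminormed_module R N (stalk A x)"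
    and edge_back_iso: "e \<in> simplices X (Suc 0) \<Longrightarrow>
      edge_back X A e \<in> sn_isos R (stalk A (tgt X e)) (stalk A (src X e))"
    and edge_back_triangle: "\<sigma> \<in> simplices X (Suc (Suc 0)) \<Longrightarrow>
      a \<in> carrier (stalk A (tgt X (face X (Suc (Suc 0)) 0 \<sigma>))) \<Longrightarrow>
      edge_back X A (face X (Suc (Suc 0)) (Suc (Suc 0)) \<sigma>) (edge_back X A (face X (Suc (Suc 0)) 0 \<sigma>) a) =
      edge_back X A (face X (Suc (Suc 0)) (Suc 0) \<sigma>) a"

text \<open>All summands of the differential, without signs, placed in the stalk at the initial
  vertex. This lets the differential be treated as a single signed sum.\<close>

definition coboundary_term ::
  "'x sset \<Rightarrow> ('r, 'x, 'a) coeff_system \<Rightarrow> nat \<Rightarrow> ('x \<Rightarrow> 'a) \<Rightarrow> 'x \<Rightarrow> nat \<Rightarrow> 'a"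
  where "coboundary_term X A n \<phi> \<sigma> i =
    (if i = 0 then edge_back X A (front_edge X n \<sigma>) (\<phi> (face X (Suc n) 0 \<sigma>)) else \<phi> (face X (Suc n) i \<sigma>))"

lemma Cb_carrier_iff:
  "\<phi> \<in> carrier (Cb X A n) \<longleftrightarrow> \<phi> \<in> extensional (simplices X n) \<and>
    (\<forall>\<sigma>\<in>simplices X n. \<phi> \<sigma> \<in> carrier (stalk A (vertex0 X n \<sigma>))) \<and>
    (\<exists>K. \<forall>\<sigma>\<in>simplices X n. snorm (stalk A (vertex0 X n \<sigma>)) (\<phi> \<sigma>) \<le> K)"
  by (auto simp: Cb_def Let_def PiE_def)

lemma Cb_simps:
  "\<zero>\<^bsub>Cb X A n\<^esub> = (\<lambda>\<sigma>\<in>simplices X n. \<zero>\<^bsub>stalk A (vertex0 X n \<sigma>)\<^esub>)"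
  "\<phi> \<oplus>\<^bsub>Cb X A n\<^esub> \<psi> = (\<lambda>\<sigma>\<in>simplices X n. \<phi> \<sigma> \<oplus>\<^bsub>stalk A (vertex0 X n \<sigma>)\<^esub> \<psi> \<sigma>)"
  "r \<odot>\<^bsub>Cb X A n\<^esub> \<phi> = (\<lambda>\<sigma>\<in>simplices X n. r \<odot>\<^bsub>stalk A (vertex0 X n \<sigma>)\<^esub> \<phi> \<sigma>)"
  "snorm (Cb X A n) \<phi> = Sup (insert 0 ((\<lambda>\<sigma>. snorm (stalk A (vertex0 X n \<sigma>)) (\<phi> \<sigma>)) ` simplices X n))"
  by (simp_all add: Cb_def Let_def)

lemma Cb_in: "\<phi> \<in> carrier (Cb X A n) \<Longrightarrow> \<sigma> \<in> simplices X n \<Longrightarrow> \<phi> \<sigma> \<in> carrier (stalk A (vertex0 X n \<sigma>))"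
  by (simp add: Cb_carrier_iff)

lemma Cb_eqI:
  assumes "\<phi> \<in> carrier (Cb X A n)" "\<psi> \<in> carrier (Cb X A n)" "\<And>\<sigma>. \<sigma> \<in> simplices X n \<Longrightarrow> \<phi> \<sigma> = \<psi> \<sigma>"
  shows "\<phi> = \<psi>"
  using assms by (intro extensionalityI[of \<phi> "simplices X n"]) (auto simp: Cb_carrier_iff)

context edge_system begin

lemma stalk_over: "x \<in> simplices X 0 \<Longrightarrow> seminormed_module_over R N (stalk A x)"
  by (intro seminormed_module_over.intro stalk_seminormed normed_ring_axioms)

lemma stalk_over_simplex:
  "\<sigma> \<in> simplices X n \<Longrightarrow> seminormed_module_over R N (stalk A (vertex0 X n \<sigma>))"
  by (intro stalk_over vertex0_in)

lemma stalk_left_module: "x \<in> simplices X 0 \<Longrightarrow> left_module R (stalk A x)"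
  using stalk_seminormed seminormed_module.axioms by blast

lemma stalk_abelian_group: "x \<in> simplices X 0 \<Longrightarrow> abelian_group (stalk A x)"
  using stalk_left_module left_module.axioms by blast

lemma Cb_bounded_by:
  assumes "\<phi> \<in> carrier (Cb X A n)"
  obtains K where "0 \<le> K" "\<And>\<sigma>. \<sigma> \<in> simplices X n \<Longrightarrow> snorm (stalk A (vertex0 X n \<sigma>)) (\<phi> \<sigma>) \<le> K"
proof -
  obtain K where "\<forall>\<sigma>\<in>simplices X n. snorm (stalk A (vertex0 X n \<sigma>)) (\<phi> \<sigma>) \<le> K"
    using assms by (auto simp: Cb_carrier_iff)
  then show thesis by (intro that[of "max K 0"]) (auto simp: le_max_iff_disj)
qed

lemma Cb_zero: "\<zero>\<^bsub>Cb X A n\<^esub> \<in> carrier (Cb X A n)"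
proof -
  have "\<zero>\<^bsub>stalk A (vertex0 X n \<sigma>)\<^esub> \<in> carrier (stalk A (vertex0 X n \<sigma>)) \<and>
      snorm (stalk A (vertex0 X n \<sigma>)) \<zero>\<^bsub>stalk A (vertex0 X n \<sigma>)\<^esub> \<le> 0" if "\<sigma> \<in> simplices X n" for \<sigma>
  proof -
    interpret M: seminormed_module_over R N "stalk A (vertex0 X n \<sigma>)" using stalk_over_simplex[OF that] .
    show ?thesis using M.snorm_zero by simp
  qed
  then show ?thesis by (auto simp: Cb_carrier_iff Cb_simps)
qed

lemma Cb_smult_add:
  assumes \<phi>: "\<phi> \<in> carrier (Cb X A n)" and \<psi>: "\<psi> \<in> carrier (Cb X A n)" and r: "r \<in> carrier R"
  shows "r \<odot>\<^bsub>Cb X A n\<^esub> \<phi> \<oplus>\<^bsub>Cb X A n\<^esub> \<psi> \<in> carrier (Cb X A n)"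
proof -
  obtain K where K: "\<And>\<sigma>. \<sigma> \<in> simplices X n \<Longrightarrow> snorm (stalk A (vertex0 X n \<sigma>)) (\<phi> \<sigma>) \<le> K"
    using Cb_bounded_by[OF \<phi>] by metis
  obtain L where L: "\<And>\<sigma>. \<sigma> \<in> simplices X n \<Longrightarrow> snorm (stalk A (vertex0 X n \<sigma>)) (\<psi> \<sigma>) \<le> L"
    using Cb_bounded_by[OF \<psi>] by metis
  have *: "r \<odot>\<^bsub>stalk A (vertex0 X n \<sigma>)\<^esub> \<phi> \<sigma> \<oplus>\<^bsub>stalk A (vertex0 X n \<sigma>)\<^esub> \<psi> \<sigma> \<in> carrier (stalk A (vertex0 X n \<sigma>)) \<and>
      snorm (stalk A (vertex0 X n \<sigma>)) (r \<odot>\<^bsub>stalk A (vertex0 X n \<sigma>)\<^esub> \<phi> \<sigma> \<oplus>\<^bsub>stalk A (vertex0 X n \<sigma>)\<^esub> \<psi> \<sigma>) \<le> N r * K + L"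
    if s: "\<sigma> \<in> simplices X n" for \<sigma>
  proof -
    interpret M: seminormed_module_over R N "stalk A (vertex0 X n \<sigma>)" using stalk_over_simplex[OF s] .
    have c: "\<phi> \<sigma> \<in> carrier (stalk A (vertex0 X n \<sigma>))" "\<psi> \<sigma> \<in> carrier (stalk A (vertex0 X n \<sigma>))"
      using Cb_in[OF \<phi> s] Cb_in[OF \<psi> s] by auto
    have "N r * snorm (stalk A (vertex0 X n \<sigma>)) (\<phi> \<sigma>) \<le> N r * K"
      using K[OF s] norm_nonneg[OF r] by (rule mult_left_mono)
    then show ?thesis using M.snorm_smult_add[OF r c] c r L[OF s] M.smult_closed by auto
  qed
  show ?thesis unfolding Cb_carrier_iff Cb_simps using * by (auto intro!: exI[of _ "N r * K + L"])
qed

lemma Cb_left_module: "left_module R (Cb X A n)"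
proof -
  note defs = Cb_simps
  have M: "left_module R (stalk A (vertex0 X n \<sigma>))" if "\<sigma> \<in> simplices X n" for \<sigma>
    using that by (intro stalk_left_module vertex0_in)
  have G: "abelian_group (stalk A (vertex0 X n \<sigma>))" if "\<sigma> \<in> simplices X n" for \<sigma>
    using that by (intro stalk_abelian_group vertex0_in)
  then have Gm: "abelian_monoid (stalk A (vertex0 X n \<sigma>))" if "\<sigma> \<in> simplices X n" for \<sigma>
    using that by (simp add: abelian_group.axioms)
  have add: "\<phi> \<oplus>\<^bsub>Cb X A n\<^esub> \<psi> \<in> carrier (Cb X A n)"
    if "\<phi> \<in> carrier (Cb X A n)" "\<psi> \<in> carrier (Cb X A n)" for \<phi> \<psi>
  proof -
    have "\<one>\<^bsub>R\<^esub> \<odot>\<^bsub>Cb X A n\<^esub> \<phi> = \<phi>"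
      using that(1) M
      by (intro extensionalityI[of _ "simplices X n"]) (auto simp: defs Cb_carrier_iff left_module.smult_one)
    then show ?thesis using Cb_smult_add[OF that, of "\<one>\<^bsub>R\<^esub>"] by simp
  qed
  have sm: "r \<odot>\<^bsub>Cb X A n\<^esub> \<phi> \<in> carrier (Cb X A n)" if "\<phi> \<in> carrier (Cb X A n)" "r \<in> carrier R" for \<phi> r
  proof -
    have "r \<odot>\<^bsub>Cb X A n\<^esub> \<phi> \<oplus>\<^bsub>Cb X A n\<^esub> \<zero>\<^bsub>Cb X A n\<^esub> = r \<odot>\<^bsub>Cb X A n\<^esub> \<phi>"
      using Gm M Cb_in[OF that(1)] that(2)
      by (auto simp: defs fun_eq_iff left_module.smult_closed[OF M] abelian_monoid.r_zero)
    then show ?thesis using Cb_smult_add[OF that(1) Cb_zero that(2)] by simp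
  qed
  show ?thesis
  proof (intro left_module.intro left_module_axioms.intro abelian_groupI)
    show "ring R" by (rule ring_axioms)
  next
    fix \<phi> assume \<phi>: "\<phi> \<in> carrier (Cb X A n)"
    show "\<zero>\<^bsub>Cb X A n\<^esub> \<oplus>\<^bsub>Cb X A n\<^esub> \<phi> = \<phi>" "\<one>\<^bsub>R\<^esub> \<odot>\<^bsub>Cb X A n\<^esub> \<phi> = \<phi>"
      using \<phi> Gm M Cb_in[OF \<phi>]
      by (intro extensionalityI[of _ "simplices X n"];
          auto simp: defs Cb_carrier_iff abelian_monoid.l_zero left_module.smult_one)+
    have "(\<ominus>\<^bsub>R\<^esub> \<one>\<^bsub>R\<^esub>) \<odot>\<^bsub>Cb X A n\<^esub> \<phi> \<oplus>\<^bsub>Cb X A n\<^esub> \<phi> = \<zero>\<^bsub>Cb X A n\<^esub>"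
      using M G Cb_in[OF \<phi>] by (auto simp: defs left_module.smult_minus_one abelian_group.l_neg intro!: restrict_ext)
    then show "\<exists>y\<in>carrier (Cb X A n). y \<oplus>\<^bsub>Cb X A n\<^esub> \<phi> = \<zero>\<^bsub>Cb X A n\<^esub>"
      using sm[OF \<phi>, of "\<ominus>\<^bsub>R\<^esub> \<one>\<^bsub>R\<^esub>"] by auto
  next
    fix \<phi> \<psi> \<chi> assume a: "\<phi> \<in> carrier (Cb X A n)" "\<psi> \<in> carrier (Cb X A n)" "\<chi> \<in> carrier (Cb X A n)"
    show "\<phi> \<oplus>\<^bsub>Cb X A n\<^esub> \<psi> \<oplus>\<^bsub>Cb X A n\<^esub> \<chi> = \<phi> \<oplus>\<^bsub>Cb X A n\<^esub> (\<psi> \<oplus>\<^bsub>Cb X A n\<^esub> \<chi>)"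
      using Gm a[THEN Cb_in] by (auto simp: defs abelian_monoid.a_assoc intro!: restrict_ext)
  next
    fix \<phi> \<psi> assume a: "\<phi> \<in> carrier (Cb X A n)" "\<psi> \<in> carrier (Cb X A n)"
    show "\<phi> \<oplus>\<^bsub>Cb X A n\<^esub> \<psi> = \<psi> \<oplus>\<^bsub>Cb X A n\<^esub> \<phi>"
      using Gm a[THEN Cb_in] by (auto simp: defs abelian_monoid.a_comm intro!: restrict_ext)
  next
    fix r s \<phi> assume r: "r \<in> carrier R" "s \<in> carrier R" and a: "\<phi> \<in> carrier (Cb X A n)"
    show "(r \<oplus>\<^bsub>R\<^esub> s) \<odot>\<^bsub>Cb X A n\<^esub> \<phi> = r \<odot>\<^bsub>Cb X A n\<^esub> \<phi> \<oplus>\<^bsub>Cb X A n\<^esub> s \<odot>\<^bsub>Cb X A n\<^esub> \<phi>"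
      "(r \<otimes>\<^bsub>R\<^esub> s) \<odot>\<^bsub>Cb X A n\<^esub> \<phi> = r \<odot>\<^bsub>Cb X A n\<^esub> (s \<odot>\<^bsub>Cb X A n\<^esub> \<phi>)"
      using M r a[THEN Cb_in] by (auto simp: defs left_module.smult_l_distr left_module.smult_assoc intro!: restrict_ext)
  next
    fix r \<phi> \<psi> assume r: "r \<in> carrier R" and a: "\<phi> \<in> carrier (Cb X A n)" "\<psi> \<in> carrier (Cb X A n)"
    show "r \<odot>\<^bsub>Cb X A n\<^esub> (\<phi> \<oplus>\<^bsub>Cb X A n\<^esub> \<psi>) = r \<odot>\<^bsub>Cb X A n\<^esub> \<phi> \<oplus>\<^bsub>Cb X A n\<^esub> r \<odot>\<^bsub>Cb X A n\<^esub> \<psi>"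
      using M r a[THEN Cb_in] by (auto simp: defs left_module.smult_r_distr[OF M] intro!: restrict_ext)
  qed (use add sm Cb_zero in auto)
qed

lemma coboundary_term_in:
  assumes \<phi>: "\<phi> \<in> carrier (Cb X A n)" and \<sigma>: "\<sigma> \<in> simplices X (Suc n)" and i: "i \<le> Suc n"
  shows "coboundary_term X A n \<phi> \<sigma> i \<in> carrier (stalk A (vertex0 X (Suc n) \<sigma>))"
    and "(\<And>\<tau>. \<tau> \<in> simplices X n \<Longrightarrow> snorm (stalk A (vertex0 X n \<tau>)) (\<phi> \<tau>) \<le> K) \<Longrightarrow>
      snorm (stalk A (vertex0 X (Suc n) \<sigma>)) (coboundary_term X A n \<phi> \<sigma> i) \<le> K"
proof -
  have f: "face X (Suc n) i \<sigma> \<in> simplices X n" using \<sigma> i by (rule face_in)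
  note iso = edge_back_iso[OF front_edge_in[OF \<sigma>]]
  show "coboundary_term X A n \<phi> \<sigma> i \<in> carrier (stalk A (vertex0 X (Suc n) \<sigma>))"
    using Cb_in[OF \<phi> f] vertex0_face[OF \<sigma> _ i] linear_mapsD(1)[OF sn_isosD(2)[OF iso]]
      tgt_front_edge[OF \<sigma>] src_front_edge[OF \<sigma>]
    by (cases "i = 0") (auto simp: coboundary_term_def)
  assume K: "\<And>\<tau>. \<tau> \<in> simplices X n \<Longrightarrow> snorm (stalk A (vertex0 X n \<tau>)) (\<phi> \<tau>) \<le> K"
  show "snorm (stalk A (vertex0 X (Suc n) \<sigma>)) (coboundary_term X A n \<phi> \<sigma> i) \<le> K"
    using Cb_in[OF \<phi> f] vertex0_face[OF \<sigma> _ i] sn_isosD(4)[OF iso] K[OF f]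
      tgt_front_edge[OF \<sigma>] src_front_edge[OF \<sigma>]
    by (cases "i = 0") (auto simp: coboundary_term_def)
qed

lemma coboundary_eq:
  assumes \<phi>: "\<phi> \<in> carrier (Cb X A n)" and \<sigma>: "\<sigma> \<in> simplices X (Suc n)"
  shows "coboundary X A n \<phi> \<sigma> = finsum (stalk A (vertex0 X (Suc n) \<sigma>))
    (\<lambda>i. signed (stalk A (vertex0 X (Suc n) \<sigma>)) i (coboundary_term X A n \<phi> \<sigma> i)) {..Suc n}"
proof -
  let ?M = "stalk A (vertex0 X (Suc n) \<sigma>)"
  let ?f = "\<lambda>i. signed ?M i (coboundary_term X A n \<phi> \<sigma> i)"
  interpret M: abelian_group ?M using \<sigma> by (intro stalk_abelian_group vertex0_in)
  have c: "coboundary_term X A n \<phi> \<sigma> i \<in> carrier ?M" if "i \<le> Suc n" for i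
    using coboundary_term_in(1)[OF \<phi> \<sigma> that] .
  have cf: "\<phi> (face X (Suc n) i \<sigma>) \<in> carrier ?M" if "0 < i" "i \<le> Suc n" for i
    using c[OF that(2)] that(1) by (simp add: coboundary_term_def)
  have eq: "{..Suc n} = insert 0 {1..Suc n}" by auto
  have "finsum ?M ?f {..Suc n} = ?f 0 \<oplus>\<^bsub>?M\<^esub> finsum ?M ?f {1..Suc n}"
    unfolding eq by (rule M.finsum_insert) (use c in auto)
  also have "finsum ?M ?f {1..Suc n} = (\<Oplus>\<^bsub>?M\<^esub>i\<in>{1..Suc n}.
      if even i then \<phi> (face X (Suc n) i \<sigma>) else \<ominus>\<^bsub>?M\<^esub> \<phi> (face X (Suc n) i \<sigma>))"
    using cf by (intro M.finsum_cong') (auto simp: signed_def coboundary_term_def)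
  finally show ?thesis using \<sigma> by (simp add: coboundary_def coboundary_term_def Let_def edge_back_def)
qed

lemma coboundary_in:
  assumes \<phi>: "\<phi> \<in> carrier (Cb X A n)"
  shows "coboundary X A n \<phi> \<in> carrier (Cb X A (Suc n))"
proof -
  obtain K where K: "\<And>\<sigma>. \<sigma> \<in> simplices X n \<Longrightarrow> snorm (stalk A (vertex0 X n \<sigma>)) (\<phi> \<sigma>) \<le> K"
    using Cb_bounded_by[OF \<phi>] by metis
  have "coboundary X A n \<phi> \<sigma> \<in> carrier (stalk A (vertex0 X (Suc n) \<sigma>)) \<and>
      snorm (stalk A (vertex0 X (Suc n) \<sigma>)) (coboundary X A n \<phi> \<sigma>) \<le> card {..Suc n} * (N \<one>\<^bsub>R\<^esub> * K)"
    if \<sigma>: "\<sigma> \<in> simplices X (Suc n)" for \<sigma>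
  proof -
    interpret M: seminormed_module_over R N "stalk A (vertex0 X (Suc n) \<sigma>)" using stalk_over_simplex[OF \<sigma>] .
    show ?thesis unfolding coboundary_eq[OF \<phi> \<sigma>]
      using coboundary_term_in[OF \<phi> \<sigma>] K
      by (intro conjI M.snorm_signed_sum M.finsum_closed) auto
  qed
  then show ?thesis by (auto simp: Cb_carrier_iff coboundary_def)
qed

lemma coboundary_linear: "coboundary X A n \<in> linear_maps R (Cb X A n) (Cb X A (Suc n))"
proof -
  interpret C: left_module R "Cb X A n" by (rule Cb_left_module)
  interpret C': left_module R "Cb X A (Suc n)" by (rule Cb_left_module)
  have term_add: "coboundary_term X A n (\<phi> \<oplus>\<^bsub>Cb X A n\<^esub> \<psi>) \<sigma> i =
      coboundary_term X A n \<phi> \<sigma> i \<oplus>\<^bsub>stalk A (vertex0 X (Suc n) \<sigma>)\<^esub> coboundary_term X A n \<psi> \<sigma> i"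
    if "\<phi> \<in> carrier (Cb X A n)" "\<psi> \<in> carrier (Cb X A n)" "\<sigma> \<in> simplices X (Suc n)" "i \<le> Suc n" for \<phi> \<psi> \<sigma> i
    using that face_in[OF that(3,4)] vertex0_face[OF that(3) _ that(4)]
      Cb_in[OF that(1) face_in[OF that(3,4)]] Cb_in[OF that(2) face_in[OF that(3,4)]]
      linear_mapsD(2)[OF sn_isosD(2)[OF edge_back_iso[OF front_edge_in[OF that(3)]]]]
      tgt_front_edge[OF that(3)] src_front_edge[OF that(3)]
    by (cases "i = 0") (auto simp: coboundary_term_def Cb_simps)
  have term_smult: "coboundary_term X A n (r \<odot>\<^bsub>Cb X A n\<^esub> \<phi>) \<sigma> i =
      r \<odot>\<^bsub>stalk A (vertex0 X (Suc n) \<sigma>)\<^esub> coboundary_term X A n \<phi> \<sigma> i"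
    if "\<phi> \<in> carrier (Cb X A n)" "r \<in> carrier R" "\<sigma> \<in> simplices X (Suc n)" "i \<le> Suc n" for \<phi> r \<sigma> i
    using that face_in[OF that(3,4)] vertex0_face[OF that(3) _ that(4)]
      Cb_in[OF that(1) face_in[OF that(3,4)]]
      linear_mapsD(3)[OF sn_isosD(2)[OF edge_back_iso[OF front_edge_in[OF that(3)]]]]
      tgt_front_edge[OF that(3)] src_front_edge[OF that(3)]
    by (cases "i = 0") (auto simp: coboundary_term_def Cb_simps)
  have "coboundary X A n (\<phi> \<oplus>\<^bsub>Cb X A n\<^esub> \<psi>) = coboundary X A n \<phi> \<oplus>\<^bsub>Cb X A (Suc n)\<^esub> coboundary X A n \<psi>"
    if a: "\<phi> \<in> carrier (Cb X A n)" "\<psi> \<in> carrier (Cb X A n)" for \<phi> \<psi>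
  proof (rule Cb_eqI[of _ _ A])
    show "coboundary X A n (\<phi> \<oplus>\<^bsub>Cb X A n\<^esub> \<psi>) \<in> carrier (Cb X A (Suc n))"
      "coboundary X A n \<phi> \<oplus>\<^bsub>Cb X A (Suc n)\<^esub> coboundary X A n \<psi> \<in> carrier (Cb X A (Suc n))"
      using a coboundary_in by auto
    fix \<sigma> assume \<sigma>: "\<sigma> \<in> simplices X (Suc n)"
    let ?M = "stalk A (vertex0 X (Suc n) \<sigma>)"
    interpret M: seminormed_module_over R N ?M using stalk_over_simplex[OF \<sigma>] .
    note c = coboundary_term_in(1)[OF a(1) \<sigma>] coboundary_term_in(1)[OF a(2) \<sigma>]
    have "coboundary X A n (\<phi> \<oplus>\<^bsub>Cb X A n\<^esub> \<psi>) \<sigma> = finsum ?M (\<lambda>i. signed ?M i (coboundary_term X A n \<phi> \<sigma> i) \<oplus>\<^bsub>?M\<^esub>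
        signed ?M i (coboundary_term X A n \<psi> \<sigma> i)) {..Suc n}"
      unfolding coboundary_eq[OF C.a_closed[OF a] \<sigma>]
      using c term_add[OF a \<sigma>] by (intro M.finsum_cong') (auto simp: signed_def M.minus_add)
    also have "\<dots> = coboundary X A n \<phi> \<sigma> \<oplus>\<^bsub>?M\<^esub> coboundary X A n \<psi> \<sigma>"
      unfolding coboundary_eq[OF a(1) \<sigma>] coboundary_eq[OF a(2) \<sigma>] using c by (intro M.finsum_addf) auto
    finally show "coboundary X A n (\<phi> \<oplus>\<^bsub>Cb X A n\<^esub> \<psi>) \<sigma> =
        (coboundary X A n \<phi> \<oplus>\<^bsub>Cb X A (Suc n)\<^esub> coboundary X A n \<psi>) \<sigma>" using \<sigma> by (simp add: Cb_simps)
  qed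
  moreover have "coboundary X A n (r \<odot>\<^bsub>Cb X A n\<^esub> \<phi>) = r \<odot>\<^bsub>Cb X A (Suc n)\<^esub> coboundary X A n \<phi>"
    if a: "\<phi> \<in> carrier (Cb X A n)" "r \<in> carrier R" for \<phi> r
  proof (rule Cb_eqI[of _ _ A])
    show "coboundary X A n (r \<odot>\<^bsub>Cb X A n\<^esub> \<phi>) \<in> carrier (Cb X A (Suc n))"
      "r \<odot>\<^bsub>Cb X A (Suc n)\<^esub> coboundary X A n \<phi> \<in> carrier (Cb X A (Suc n))"
      using a coboundary_in C.smult_closed C'.smult_closed by auto
    fix \<sigma> assume \<sigma>: "\<sigma> \<in> simplices X (Suc n)"
    let ?M = "stalk A (vertex0 X (Suc n) \<sigma>)"
    interpret M: seminormed_module_over R N ?M using stalk_over_simplex[OF \<sigma>] .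
    note c = coboundary_term_in(1)[OF a(1) \<sigma>]
    have "coboundary X A n (r \<odot>\<^bsub>Cb X A n\<^esub> \<phi>) \<sigma> =
        finsum ?M (\<lambda>i. r \<odot>\<^bsub>?M\<^esub> signed ?M i (coboundary_term X A n \<phi> \<sigma> i)) {..Suc n}"
      unfolding coboundary_eq[OF C.smult_closed[OF a(2,1)] \<sigma>]
      using c a term_smult[OF a \<sigma>] M.smult_closed by (intro M.finsum_cong') (auto simp: M.smult_signed)
    also have "\<dots> = r \<odot>\<^bsub>?M\<^esub> coboundary X A n \<phi> \<sigma>"
      unfolding coboundary_eq[OF a(1) \<sigma>] using c a(2) by (intro M.smult_finsum[symmetric]) auto
    finally show "coboundary X A n (r \<odot>\<^bsub>Cb X A n\<^esub> \<phi>) \<sigma> = (r \<odot>\<^bsub>Cb X A (Suc n)\<^esub> coboundary X A n \<phi>) \<sigma>"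
      using \<sigma> by (simp add: Cb_simps)
  qed
  ultimately show ?thesis using coboundary_in by (auto simp: linear_maps_def)
qed

section \<open>Cocycles and coboundaries as subgroups of the cochains\<close>

lemma Bb_subset: "Bb X A n \<subseteq> carrier (Cb X A n)"
  using Cb_zero coboundary_in by (cases n) (auto simp: Bb_def)

lemma Bb_zero: "\<zero>\<^bsub>Cb X A n\<^esub> \<in> Bb X A n"
proof (cases n)
  case (Suc m)
  interpret C: left_module R "Cb X A m" by (rule Cb_left_module)
  have "coboundary X A m \<zero>\<^bsub>Cb X A m\<^esub> = \<zero>\<^bsub>Cb X A (Suc m)\<^esub>"
    by (rule C.linear_zero[OF coboundary_linear Cb_left_module])
  then show ?thesis using Suc Cb_zero unfolding Bb_def by (auto intro: rev_image_eqI)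
qed (simp add: Bb_def)

lemma Bb_add:
  assumes "a \<in> Bb X A n" "b \<in> Bb X A n"
  shows "a \<oplus>\<^bsub>Cb X A n\<^esub> b \<in> Bb X A n"
proof (cases n)
  case 0
  interpret C: left_module R "Cb X A 0" by (rule Cb_left_module)
  show ?thesis using assms 0 by (simp add: Bb_def)
next
  case (Suc m)
  interpret C: left_module R "Cb X A m" by (rule Cb_left_module)
  obtain a' b' where "a' \<in> carrier (Cb X A m)" "b' \<in> carrier (Cb X A m)" "a = coboundary X A m a'" "b = coboundary X A m b'"
    using assms Suc by (auto simp: Bb_def)
  then show ?thesis using Suc linear_mapsD(2)[OF coboundary_linear, of a' m b']
    by (auto simp: Bb_def intro!: image_eqI[of _ _ "a' \<oplus>\<^bsub>Cb X A m\<^esub> b'"])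
qed

lemma Bb_smult:
  assumes "a \<in> Bb X A n" "r \<in> carrier R"
  shows "r \<odot>\<^bsub>Cb X A n\<^esub> a \<in> Bb X A n"
proof (cases n)
  case 0
  interpret C: left_module R "Cb X A 0" by (rule Cb_left_module)
  show ?thesis using assms 0 C.smult_zero_right by (simp add: Bb_def)
next
  case (Suc m)
  interpret C: left_module R "Cb X A m" by (rule Cb_left_module)
  obtain a' where "a' \<in> carrier (Cb X A m)" "a = coboundary X A m a'"
    using assms Suc by (auto simp: Bb_def)
  then show ?thesis using Suc linear_mapsD(3)[OF coboundary_linear, of r a' m] assms(2) C.smult_closed
    by (auto simp: Bb_def intro!: image_eqI[of _ _ "r \<odot>\<^bsub>Cb X A m\<^esub> a'"])
qed

lemma Bb_minus:
  assumes "a \<in> Bb X A n"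
  shows "\<ominus>\<^bsub>Cb X A n\<^esub> a \<in> Bb X A n"
proof -
  interpret C: left_module R "Cb X A n" by (rule Cb_left_module)
  show ?thesis
    using Bb_smult[OF assms, of "\<ominus>\<^bsub>R\<^esub> \<one>\<^bsub>R\<^esub>"] C.smult_minus_one[OF subsetD[OF Bb_subset assms]] by simp
qed

lemma Zb_iff:
  "\<phi> \<in> Zb X A n \<longleftrightarrow> \<phi> \<in> carrier (Cb X A n) \<and>
    (\<forall>\<sigma>\<in>simplices X (Suc n). coboundary X A n \<phi> \<sigma> = \<zero>\<^bsub>stalk A (vertex0 X (Suc n) \<sigma>)\<^esub>)"
  using Cb_eqI[OF coboundary_in Cb_zero, of \<phi> n] by (auto simp: Zb_def Cb_simps)

end

text \<open>All three edges of \<open>s_0 s_0 y\<close> equal the degenerate edge at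
  \<open>y\<close>, so its transport is idempotent. A bijective idempotent is the identity.\<close>

lemma (in edge_system) edge_back_degenerate:
  assumes S: "simplicial_set X" and y: "y \<in> simplices X 0" and a: "a \<in> carrier (stalk A y)"
  shows "edge_back X A (degen X 0 0 y) a = a"
proof -
  interpret S: simplicial_set X by fact
  let ?e = "degen X 0 0 y"
  let ?s = "degen X (Suc 0) 0 ?e"
  have e: "?e \<in> simplices X (Suc 0)" "src X ?e = y" "tgt X ?e = y"
    using y by (auto simp: S.degen_closed S.face_degen_eq)
  have s: "?s \<in> simplices X (Suc (Suc 0))" using e by (simp add: S.degen_closed)
  have f: "face X (Suc (Suc 0)) 0 ?s = ?e" "face X (Suc (Suc 0)) (Suc 0) ?s = ?e"
    "face X (Suc (Suc 0)) (Suc (Suc 0)) ?s = ?e"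
    using e S.face_degen_greater[OF e(1), of 0 "Suc (Suc 0)"] by (auto simp: S.face_degen_eq)
  note iso = sn_isosD[OF edge_back_iso[OF e(1)]]
  have "edge_back X A ?e (edge_back X A ?e a) = edge_back X A ?e a"
    using edge_back_triangle[OF s, of a] f e a by simp
  then show ?thesis
    using iso(3) e a linear_mapsD(1)[OF iso(2)] by (simp add: bij_betw_def inj_on_def)
qed

section \<open>Maps of coefficient systems and homotopy invariance\<close>

text \<open>Sections of maps are only available up to some dimension, hence the bound \<open>K\<close>.\<close>

definition face_map_upto :: "nat \<Rightarrow> 'x sset \<Rightarrow> 'y sset \<Rightarrow> (nat \<Rightarrow> 'x \<Rightarrow> 'y) \<Rightarrow> bool"
  where "face_map_upto K X Y f \<longleftrightarrow> (\<forall>n\<le>K. \<forall>\<sigma>\<in>simplices X n. f n \<sigma> \<in> simplices Y n) \<and>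
    (\<forall>n<K. \<forall>\<sigma>\<in>simplices X (Suc n). \<forall>i\<le>Suc n. f n (face X (Suc n) i \<sigma>) = face Y (Suc n) i (f (Suc n) \<sigma>))"

text \<open>Since cochains pull back, \<open>\<eta>\<close> runs from the stalk of \<open>B\<close>
  at the image to the stalk of \<open>A\<close>. Naturality is demanded along edges only, which is
  all that the differential sees; the guard \<open>0 < K\<close> expresses that \<open>g\<close>
  then respects edges.\<close>

definition system_map ::
  "nat \<Rightarrow> ('r, 'm) ring_scheme \<Rightarrow> 'x sset \<Rightarrow> ('r, 'x, 'a) coeff_system \<Rightarrow> 'y sset \<Rightarrow>
    ('r, 'y, 'b) coeff_system \<Rightarrow> (nat \<Rightarrow> 'x \<Rightarrow> 'y) \<Rightarrow> ('x \<Rightarrow> 'b \<Rightarrow> 'a) \<Rightarrow> bool"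
  where "system_map K R X A Y B g \<eta> \<longleftrightarrow> face_map_upto K X Y g \<and>
    (\<forall>x\<in>simplices X 0. \<eta> x \<in> sn_maps R (stalk B (g 0 x)) (stalk A x)) \<and>
    (0 < K \<longrightarrow> (\<forall>e\<in>simplices X (Suc 0). \<forall>b\<in>carrier (stalk B (g 0 (tgt X e))).
      \<eta> (src X e) (edge_back Y B (g (Suc 0) e) b) = edge_back X A e (\<eta> (tgt X e) b)))"

lemma face_map_uptoD:
  assumes "face_map_upto K X Y f"
  shows "n \<le> K \<Longrightarrow> \<sigma> \<in> simplices X n \<Longrightarrow> f n \<sigma> \<in> simplices Y n"
    and "n < K \<Longrightarrow> \<sigma> \<in> simplices X (Suc n) \<Longrightarrow> i \<le> Suc n \<Longrightarrow>
      f n (face X (Suc n) i \<sigma>) = face Y (Suc n) i (f (Suc n) \<sigma>)"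
  using assms by (auto simp: face_map_upto_def)

lemma face_map_face_map_upto: "face_map X Y f \<Longrightarrow> face_map_upto K X Y f"
  by (simp add: face_map_def face_map_upto_def)

locale cochain_map = X: edge_system R N X A + Y: edge_system R N Y B
  for K :: nat and R :: "('r, 'm) ring_scheme" and N :: "'r \<Rightarrow> real"
    and X :: "'x sset" and A :: "('r, 'x, 'a) coeff_system"
    and Y :: "'y sset" and B :: "('r, 'y, 'b) coeff_system" +
  fixes g :: "nat \<Rightarrow> 'x \<Rightarrow> 'y" and \<eta> :: "'x \<Rightarrow> 'b \<Rightarrow> 'a"
  assumes sys: "system_map K R X A Y B g \<eta>"
begin

lemma fm: "face_map_upto K X Y g"
  using sys by (simp add: system_map_def)

lemma \<eta>_sn_map: "x \<in> simplices X 0 \<Longrightarrow> \<eta> x \<in> sn_maps R (stalk B (g 0 x)) (stalk A x)"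
  using sys by (simp add: system_map_def)

lemma \<eta>_linear: "x \<in> simplices X 0 \<Longrightarrow> \<eta> x \<in> linear_maps R (stalk B (g 0 x)) (stalk A x)"
  using \<eta>_sn_map by (auto simp: sn_maps_def)

lemma \<eta>_natural:
  "0 < K \<Longrightarrow> e \<in> simplices X (Suc 0) \<Longrightarrow> b \<in> carrier (stalk B (g 0 (tgt X e))) \<Longrightarrow>
    \<eta> (src X e) (edge_back Y B (g (Suc 0) e) b) = edge_back X A e (\<eta> (tgt X e) b)"
  using sys by (simp add: system_map_def)

lemma map_vertex0: "n \<le> K \<Longrightarrow> \<sigma> \<in> simplices X n \<Longrightarrow> vertex0 Y n (g n \<sigma>) = g 0 (vertex0 X n \<sigma>)"
proof (induction n arbitrary: \<sigma>)
  case (Suc n)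
  then show ?case
    using face_map_uptoD(2)[OF fm, of n \<sigma> "Suc n"] Suc.IH[of "face X (Suc n) (Suc n) \<sigma>"]
    by (simp add: vertex0.simps(2) X.face_in)
qed simp

lemma map_front_edge:
  "Suc n \<le> K \<Longrightarrow> \<sigma> \<in> simplices X (Suc n) \<Longrightarrow> front_edge Y n (g (Suc n) \<sigma>) = g (Suc 0) (front_edge X n \<sigma>)"
proof (induction n arbitrary: \<sigma>)
  case (Suc n)
  then show ?case
    using face_map_uptoD(2)[OF fm, of "Suc n" \<sigma> "Suc (Suc n)"]
      Suc.IH[of "face X (Suc (Suc n)) (Suc (Suc n)) \<sigma>"]
    by (simp add: front_edge.simps(2) X.face_in)
qed simp

lemma pullback_linear:
  assumes n: "n \<le> K"
  shows "pullback_cochain X g \<eta> n \<in> linear_maps R (Cb Y B n) (Cb X A n)"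
proof -
  have v: "x \<in> simplices X n \<Longrightarrow> \<eta> (vertex0 X n x) \<in> linear_maps R (stalk B (vertex0 Y n (g n x))) (stalk A (vertex0 X n x))"
    and gin: "x \<in> simplices X n \<Longrightarrow> g n x \<in> simplices Y n" for x
    using \<eta>_linear[OF X.vertex0_in] map_vertex0[OF n] face_map_uptoD(1)[OF fm n] by auto
  have "pullback_cochain X g \<eta> n \<phi> \<in> carrier (Cb X A n)" if \<phi>: "\<phi> \<in> carrier (Cb Y B n)" for \<phi>
  proof -
    obtain K' where K': "\<And>\<sigma>. \<sigma> \<in> simplices Y n \<Longrightarrow> snorm (stalk B (vertex0 Y n \<sigma>)) (\<phi> \<sigma>) \<le> K'"
      using Y.Cb_bounded_by[OF \<phi>] by metis
    have "\<eta> (vertex0 X n x) (\<phi> (g n x)) \<in> carrier (stalk A (vertex0 X n x)) \<and>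
        snorm (stalk A (vertex0 X n x)) (\<eta> (vertex0 X n x) (\<phi> (g n x))) \<le> K'" if x: "x \<in> simplices X n" for x
    proof -
      have c: "\<phi> (g n x) \<in> carrier (stalk B (g 0 (vertex0 X n x)))"
        using Cb_in[OF \<phi> gin[OF x]] map_vertex0[OF n x] by simp
      have "snorm (stalk A (vertex0 X n x)) (\<eta> (vertex0 X n x) (\<phi> (g n x))) \<le> snorm (stalk B (g 0 (vertex0 X n x))) (\<phi> (g n x))"
        using \<eta>_sn_map[OF X.vertex0_in[OF x]] c by (simp add: sn_maps_def)
      also have "\<dots> \<le> K'" using K'[OF gin[OF x]] map_vertex0[OF n x] by simp
      finally show ?thesis using linear_mapsD(1)[OF \<eta>_linear[OF X.vertex0_in[OF x]] c] by simp
    qed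
    then show ?thesis by (auto simp: Cb_carrier_iff pullback_cochain_def)
  qed
  moreover have "pullback_cochain X g \<eta> n (\<phi> \<oplus>\<^bsub>Cb Y B n\<^esub> \<psi>) =
      pullback_cochain X g \<eta> n \<phi> \<oplus>\<^bsub>Cb X A n\<^esub> pullback_cochain X g \<eta> n \<psi>"
    if a: "\<phi> \<in> carrier (Cb Y B n)" "\<psi> \<in> carrier (Cb Y B n)" for \<phi> \<psi>
    using linear_mapsD(2)[OF v] gin a[THEN Cb_in]
    by (auto simp: pullback_cochain_def Cb_simps intro!: restrict_ext)
  moreover have "pullback_cochain X g \<eta> n (r \<odot>\<^bsub>Cb Y B n\<^esub> \<phi>) = r \<odot>\<^bsub>Cb X A n\<^esub> pullback_cochain X g \<eta> n \<phi>"
    if a: "\<phi> \<in> carrier (Cb Y B n)" and r: "r \<in> carrier R" for \<phi> r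
    using linear_mapsD(3)[OF v r] gin a[THEN Cb_in]
    by (auto simp: pullback_cochain_def Cb_simps intro!: restrict_ext)
  ultimately show ?thesis by (auto simp: linear_maps_def)
qed

lemma pullback_coboundary:
  assumes n: "Suc n \<le> K" and \<phi>: "\<phi> \<in> carrier (Cb Y B n)"
  shows "pullback_cochain X g \<eta> (Suc n) (coboundary Y B n \<phi>) = coboundary X A n (pullback_cochain X g \<eta> n \<phi>)"
proof (rule Cb_eqI[of _ X A])
  have p\<phi>: "pullback_cochain X g \<eta> n \<phi> \<in> carrier (Cb X A n)"
    using linear_mapsD(1)[OF pullback_linear] n \<phi> by simp
  show "pullback_cochain X g \<eta> (Suc n) (coboundary Y B n \<phi>) \<in> carrier (Cb X A (Suc n))"
    using linear_mapsD(1)[OF pullback_linear[OF n] Y.coboundary_in[OF \<phi>]] .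
  show "coboundary X A n (pullback_cochain X g \<eta> n \<phi>) \<in> carrier (Cb X A (Suc n))"
    using X.coboundary_in[OF p\<phi>] .
  fix \<sigma> assume \<sigma>: "\<sigma> \<in> simplices X (Suc n)"
  let ?x = "vertex0 X (Suc n) \<sigma>"
  let ?M = "stalk A ?x" and ?M' = "stalk B (vertex0 Y (Suc n) (g (Suc n) \<sigma>))"
  have x: "?x \<in> simplices X 0" "vertex0 Y (Suc n) (g (Suc n) \<sigma>) = g 0 ?x"
    using X.vertex0_in[OF \<sigma>] map_vertex0[OF n \<sigma>] by auto
  have gs: "g (Suc n) \<sigma> \<in> simplices Y (Suc n)" using face_map_uptoD(1)[OF fm n \<sigma>] .
  interpret M: seminormed_module_over R N ?M using X.stalk_over_simplex[OF \<sigma>] .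
  interpret M': seminormed_module_over R N ?M' using Y.stalk_over_simplex[OF gs] .
  have lin: "\<eta> ?x \<in> linear_maps R ?M' ?M" using \<eta>_linear[OF x(1)] x(2) by simp
  have gf: "g n (face X (Suc n) i \<sigma>) = face Y (Suc n) i (g (Suc n) \<sigma>)" if "i \<le> Suc n" for i
    using face_map_uptoD(2)[OF fm _ \<sigma> that] n by simp
  have c: "coboundary_term Y B n \<phi> (g (Suc n) \<sigma>) i \<in> carrier ?M'" if "i \<le> Suc n" for i
    using Y.coboundary_term_in(1)[OF \<phi> gs that] .
  have tm: "\<eta> ?x (coboundary_term Y B n \<phi> (g (Suc n) \<sigma>) i) =
      coboundary_term X A n (pullback_cochain X g \<eta> n \<phi>) \<sigma> i" if i: "i \<le> Suc n" for i
  proof (cases "i = 0")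
    case False
    then show ?thesis
      using gf[OF i] X.face_in[OF \<sigma> i] X.vertex0_face[OF \<sigma> _ i] by (simp add: coboundary_term_def pullback_cochain_def)
  next
    case True
    let ?e = "front_edge X n \<sigma>"
    have e: "?e \<in> simplices X (Suc 0)" "src X ?e = ?x" "tgt X ?e = vertex0 X n (face X (Suc n) 0 \<sigma>)"
      using X.front_edge_in[OF \<sigma>] X.src_front_edge[OF \<sigma>] X.tgt_front_edge[OF \<sigma>] by auto
    have f: "face X (Suc n) 0 \<sigma> \<in> simplices X n" using \<sigma> by (simp add: X.face_in)
    have gin: "g n (face X (Suc n) 0 \<sigma>) \<in> simplices Y n"
      using face_map_uptoD(1)[OF fm _ f] n by simp
    have "\<phi> (g n (face X (Suc n) 0 \<sigma>)) \<in> carrier (stalk B (g 0 (tgt X ?e)))"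
      using Cb_in[OF \<phi> gin] map_vertex0[OF _ f] n e(3) by simp
    then show ?thesis
      using \<eta>_natural[OF _ e(1)] n e gf[of 0] f map_front_edge[OF n \<sigma>] True
      by (simp add: coboundary_term_def pullback_cochain_def)
  qed
  have "pullback_cochain X g \<eta> (Suc n) (coboundary Y B n \<phi>) \<sigma> =
      \<eta> ?x (finsum ?M' (\<lambda>i. signed ?M' i (coboundary_term Y B n \<phi> (g (Suc n) \<sigma>) i)) {..Suc n})"
    using \<sigma> Y.coboundary_eq[OF \<phi> gs] by (simp add: pullback_cochain_def)
  also have "\<dots> = finsum ?M (\<lambda>i. \<eta> ?x (signed ?M' i (coboundary_term Y B n \<phi> (g (Suc n) \<sigma>) i))) {..Suc n}"
    by (rule M'.linear_finsum[OF lin]) (use c M.left_module_axioms in auto)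
  also have "\<dots> = finsum ?M (\<lambda>i. signed ?M i (coboundary_term X A n (pullback_cochain X g \<eta> n \<phi>) \<sigma> i)) {..Suc n}"
    using M'.linear_signed[OF lin M.left_module_axioms c] tm X.coboundary_term_in(1)[OF p\<phi> \<sigma>]
    by (intro M.finsum_cong') auto
  also have "\<dots> = coboundary X A n (pullback_cochain X g \<eta> n \<phi>) \<sigma>"
    using X.coboundary_eq[OF p\<phi> \<sigma>] by simp
  finally show "pullback_cochain X g \<eta> (Suc n) (coboundary Y B n \<phi>) \<sigma> =
      coboundary X A n (pullback_cochain X g \<eta> n \<phi>) \<sigma>" .
qed

lemma pullback_in: "n \<le> K \<Longrightarrow> \<phi> \<in> carrier (Cb Y B n) \<Longrightarrow> pullback_cochain X g \<eta> n \<phi> \<in> carrier (Cb X A n)"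
  using linear_mapsD(1)[OF pullback_linear] .

lemma pullback_zero: "n \<le> K \<Longrightarrow> pullback_cochain X g \<eta> n \<zero>\<^bsub>Cb Y B n\<^esub> = \<zero>\<^bsub>Cb X A n\<^esub>"
  using left_module.linear_zero[OF Y.Cb_left_module pullback_linear X.Cb_left_module] .

lemma pullback_Zb:
  assumes n: "Suc n \<le> K" and \<phi>: "\<phi> \<in> Zb Y B n"
  shows "pullback_cochain X g \<eta> n \<phi> \<in> Zb X A n"
  using assms pullback_coboundary[OF n, of \<phi>] pullback_in[of n \<phi>] pullback_zero[of "Suc n"] by (auto simp: Zb_def)

lemma pullback_Bb:
  assumes n: "n \<le> K" and \<phi>: "\<phi> \<in> Bb Y B n"
  shows "pullback_cochain X g \<eta> n \<phi> \<in> Bb X A n"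
proof (cases n)
  case 0
  then show ?thesis using \<phi> pullback_zero[OF n] by (simp add: Bb_def)
next
  case (Suc m)
  then obtain \<psi> where "\<psi> \<in> carrier (Cb Y B m)" "\<phi> = coboundary Y B m \<psi>" using \<phi> by (auto simp: Bb_def)
  then show ?thesis using Suc n pullback_coboundary[of m \<psi>] pullback_in[of m \<psi>] by (auto simp: Bb_def)
qed

text \<open>A homotopy from \<open>g\<close> to another map, given by prisms. The other pullback has to be moved along
  the edges from the bottom to the top.\<close>

lemma prism_homotopy:
  assumes nK: "Suc n \<le> K"
    and h: "\<And>k \<tau>. k \<le> n \<Longrightarrow> \<tau> \<in> simplices X k \<Longrightarrow> prism Y k (h k \<tau>) \<and> wall Y k (h k \<tau>) (Suc k) = g k \<tau>"
    and hf: "\<And>k \<tau> i. Suc k \<le> n \<Longrightarrow> \<tau> \<in> simplices X (Suc k) \<Longrightarrow> i \<le> Suc k \<Longrightarrow>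
      prism_face Y (Suc k) i (h (Suc k) \<tau>) = h k (face X (Suc k) i \<tau>)"
    and \<phi>: "\<phi> \<in> Zb Y B n"
  obtains b where "b \<in> Bb X A n" "\<And>\<tau>. \<tau> \<in> simplices X n \<Longrightarrow>
    pullback_cochain X g \<eta> n \<phi> \<tau> =
      \<eta> (vertex0 X n \<tau>) (edge_back Y B (h 0 (vertex0 X n \<tau>) 0) (\<phi> (wall Y n (h n \<tau>) 0)))
      \<oplus>\<^bsub>stalk A (vertex0 X n \<tau>)\<^esub> b \<tau>"
proof -
  have \<phi>C: "\<phi> \<in> carrier (Cb Y B n)" and \<phi>Z: "\<And>\<sigma>. \<sigma> \<in> simplices Y (Suc n) \<Longrightarrow>
      coboundary Y B n \<phi> \<sigma> = \<zero>\<^bsub>stalk B (vertex0 Y (Suc n) \<sigma>)\<^esub>"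
    using \<phi> by (auto simp: Y.Zb_iff)
  obtain L where L: "0 \<le> L" "\<And>\<sigma>. \<sigma> \<in> simplices Y n \<Longrightarrow> snorm (stalk B (vertex0 Y n \<sigma>)) (\<phi> \<sigma>) \<le> L"
    using Y.Cb_bounded_by[OF \<phi>C] by metis
  have hin: "h k \<tau> l \<in> simplices Y (Suc k)" if "k \<le> n" "\<tau> \<in> simplices X k" "l \<le> k" for k \<tau> l
    using prism_in h that by blast
  have v0: "vertex0 Y (Suc k) (h k \<tau> l) = g 0 (vertex0 X k \<tau>)" if "k \<le> n" "\<tau> \<in> simplices X k" "l \<le> k" for k \<tau> l
    using Y.vertex0_prism[of k "h k \<tau>" l] h[OF that(1,2)] that map_vertex0[of k \<tau>] nK by simp
  have fe: "front_edge Y (Suc k) (h (Suc k) \<tau> l) = g (Suc 0) (front_edge X k \<tau>)"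
    if "Suc k \<le> n" "\<tau> \<in> simplices X (Suc k)" "0 < l" "l \<le> Suc k" for k \<tau> l
    using Y.front_edge_prism[of k "h (Suc k) \<tau>" l] h[OF that(1,2)] that map_front_edge[of k \<tau>] nK by simp
  \<comment> \<open>The simplex of index 0 starts with the edge from \<open>a_0\<close> to
    \<open>b_0\<close>, and this is the prism over the initial vertex of
    \<open>\<tau>\<close>.\<close>
  have fe0: "front_edge Y k (h k \<tau> 0) = h 0 (vertex0 X k \<tau>) 0" if "k \<le> n" "\<tau> \<in> simplices X k" for k \<tau>
    using that
  proof (induction k arbitrary: \<tau>)
    case (Suc k)
    have "face Y (Suc (Suc k)) (Suc (Suc k)) (h (Suc k) \<tau> 0) = h k (face X (Suc k) (Suc k) \<tau>) 0"
      using hf[OF Suc.prems(1,2) le_refl] by (simp add: prism_face_def fun_eq_iff split: if_splits)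
    then show ?case using Suc X.face_in[OF Suc.prems(2) le_refl]
      by (simp add: front_edge.simps(2) vertex0.simps(2))
  qed simp
  \<comment> \<open>The prism operator taken with the opposite sign, by \<open>Suc l\<close> instead
    of \<open>l\<close>, so that its coboundary appears as a summand added to the transported top.
    In degree 0 there is no operator and \<open>b\<close> is zero.\<close>
  define P where "P = (\<lambda>m. \<lambda>\<tau>\<in>simplices X m. \<eta> (vertex0 X m \<tau>) (finsum (stalk B (g 0 (vertex0 X m \<tau>)))
    (\<lambda>l. signed (stalk B (g 0 (vertex0 X m \<tau>))) (Suc l) (\<phi> (h m \<tau> l))) {..m}))"
  define b where "b = (case n of 0 \<Rightarrow> \<zero>\<^bsub>Cb X A 0\<^esub> | Suc m \<Rightarrow> coboundary X A m (P m))"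
  \<comment> \<open>The cochain is bounded because a prism over an \<open>m\<close>-simplex has
    exactly \<open>m + 1\<close> simplices.\<close>
  have P: "P m \<in> carrier (Cb X A m)" if m: "n = Suc m" for m
  proof -
    have "P m \<tau> \<in> carrier (stalk A (vertex0 X m \<tau>)) \<and>
        snorm (stalk A (vertex0 X m \<tau>)) (P m \<tau>) \<le> card {..m} * (N \<one>\<^bsub>R\<^esub> * L)" if \<tau>: "\<tau> \<in> simplices X m" for \<tau>
    proof -
      let ?M' = "stalk B (g 0 (vertex0 X m \<tau>))"
      have x: "vertex0 X m \<tau> \<in> simplices X 0" using \<tau> by (rule X.vertex0_in)
      interpret M': seminormed_module_over R N ?M'
        using Y.stalk_over[of "g 0 (vertex0 X m \<tau>)"] face_map_uptoD(1)[OF fm _ x] by simp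
      have c: "\<phi> (h m \<tau> l) \<in> carrier ?M'" "snorm ?M' (\<phi> (h m \<tau> l)) \<le> L" if "l \<le> m" for l
        using Cb_in[OF \<phi>C, of "h m \<tau> l"] L(2)[of "h m \<tau> l"] hin[of m \<tau> l] v0[of m \<tau> l] that m \<tau> by auto
      let ?s = "finsum ?M' (\<lambda>l. signed ?M' (Suc l) (\<phi> (h m \<tau> l))) {..m}"
      have sc: "?s \<in> carrier ?M'" using c by (intro M'.finsum_closed) auto
      have "snorm ?M' ?s \<le> card {..m} * (N \<one>\<^bsub>R\<^esub> * L)" using c by (intro M'.snorm_signed_sum) auto
      then show ?thesis using \<eta>_sn_map[OF x] linear_mapsD(1)[OF \<eta>_linear[OF x] sc] sc \<tau>
        by (force simp: P_def sn_maps_def)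
    qed
    then show ?thesis by (auto simp: Cb_carrier_iff P_def)
  qed
  have b: "b \<in> Bb X A n" using P by (cases n) (auto simp: b_def Bb_def)
  show thesis
  proof (rule that[OF b])
    fix \<tau> assume \<tau>: "\<tau> \<in> simplices X n"
    let ?x = "vertex0 X n \<tau>"
    let ?G = "stalk B (g 0 ?x)" and ?M = "stalk A ?x"
    have x: "?x \<in> simplices X 0" using \<tau> by (rule X.vertex0_in)
    have gx: "g 0 ?x \<in> simplices Y 0" using face_map_uptoD(1)[OF fm _ x] by simp
    interpret G: seminormed_module_over R N ?G using Y.stalk_over[OF gx] .
    interpret M: seminormed_module_over R N ?M using X.stalk_over[OF x] .
    define V where "V = (\<lambda>i l. coboundary_term Y B n \<phi> (h n \<tau> l) i)"
    \<comment> \<open>On the face of index 0 the values of \<open>\<phi>\<close> lie over the second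
      vertex of \<open>\<tau>\<close>, so they are carried back along the image of the front edge
      before they can be compared.\<close>
    define U where "U = (\<lambda>i l. if i = 0 then edge_back Y B (g (Suc 0) (front_edge X (n - 1) \<tau>))
      (\<phi> (h (n - 1) (face X n 0 \<tau>) l)) else \<phi> (h (n - 1) (face X n i \<tau>) l))"
    have Vc: "V i l \<in> carrier ?G" if "i \<le> Suc n" "l \<le> n" for i l
      using Y.coboundary_term_in(1)[OF \<phi>C hin[OF le_refl \<tau> that(2)] that(1)] v0[OF le_refl \<tau> that(2)]
      by (simp add: V_def)
    have pr: "prism Y n (h n \<tau>)" "wall Y n (h n \<tau>) (Suc n) = g n \<tau>" using h[OF le_refl \<tau>] by auto
    have diag: "V (Suc l) (Suc l) = V (Suc l) l" if "l < n" for l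
      using pr(1) that by (simp add: V_def coboundary_term_def prism_def)
    have low: "V i (Suc l) = U i l" if il: "i \<le> l" "l < n" for i l
    proof -
      obtain m where m: "n = Suc m" using il by (cases n) auto
      have "face Y (Suc n) i (h n \<tau> (Suc l)) = h m (face X n i \<tau>) l"
        using hf[of m \<tau> i] \<tau> m il by (auto simp: prism_face_def fun_eq_iff split: if_splits dest!: spec[of _ l])
      then show ?thesis using fe[of m \<tau> "Suc l"] \<tau> m il by (cases "i = 0") (simp_all add: V_def U_def coboundary_term_def)
    qed
    have up: "V (Suc i) l = U i l" if il: "l < i" "i \<le> n" for i l
    proof -
      obtain m where m: "n = Suc m" using il by (cases n) auto
      have "face Y (Suc n) (Suc i) (h n \<tau> l) = h m (face X n i \<tau>) l"
        using hf[of m \<tau> i] \<tau> m il by (auto simp: prism_face_def fun_eq_iff split: if_splits dest!: spec[of _ l])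
      then show ?thesis using il m by (simp add: V_def U_def coboundary_term_def)
    qed
    have Uc: "U i l \<in> carrier ?G" if "i \<le> n" "l < n" for i l
      using low[of i l] up[of l i] Vc[of i "Suc l"] Vc[of "Suc i" l] that by (cases "i \<le> l") auto
    define T where "T = finsum ?G (\<lambda>i. signed ?G i (finsum ?G (\<lambda>l. signed ?G l (U i l)) {..<n})) {..n}"
    have inner: "finsum ?G (\<lambda>l. signed ?G l (U i l)) {..<n} \<in> carrier ?G" if "i \<le> n" for i
      using Uc that by (intro G.finsum_closed) auto
    have T: "T \<in> carrier ?G" unfolding T_def using inner by (intro G.finsum_closed) auto
    \<comment> \<open>The inner sums are the values of the coboundary of \<open>\<phi>\<close> on
      the simplices of the prism, which vanish for a cocycle. The prism identity then reduces to
      \<open>T = top - bottom\<close>.\<close>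
    have "finsum ?G (\<lambda>l. signed ?G l (finsum ?G (\<lambda>i. signed ?G i (V i l)) {..Suc n})) {..n} = \<zero>\<^bsub>?G\<^esub>"
    proof -
      have "finsum ?G (\<lambda>i. signed ?G i (V i l)) {..Suc n} = \<zero>\<^bsub>?G\<^esub>" if "l \<le> n" for l
        using Y.coboundary_eq[OF \<phi>C hin[OF le_refl \<tau> that]] \<phi>Z[OF hin[OF le_refl \<tau> that]] v0[OF le_refl \<tau> that]
        by (simp add: V_def)
      then show ?thesis
        by (intro G.add.finprod_one_eqI[simplified]) (auto simp: signed_def G.minus_zero_group)
    qed
    then have T_eq: "T = V 0 0 \<oplus>\<^bsub>?G\<^esub> \<ominus>\<^bsub>?G\<^esub> V (Suc n) n"
      using G.prism_sum[of n V U] Vc Uc diag low up T by (simp add: T_def)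
    have bottom: "V (Suc n) n = \<phi> (g n \<tau>)" using pr(2) by (simp add: V_def coboundary_term_def wall_def)
    have top: "V 0 0 = edge_back Y B (h 0 ?x 0) (\<phi> (wall Y n (h n \<tau>) 0))"
      using fe0[OF le_refl \<tau>] by (simp add: V_def coboundary_term_def wall_def)
    have c: "V 0 0 \<in> carrier ?G" "\<phi> (g n \<tau>) \<in> carrier ?G" using Vc[of 0 0] Vc[of "Suc n" n] bottom by auto
    have "V 0 0 \<oplus>\<^bsub>?G\<^esub> \<ominus>\<^bsub>?G\<^esub> T = \<phi> (g n \<tau>)"
      using c by (simp add: T_eq bottom G.minus_add G.minus_minus G.r_neg1 G.a_assoc[symmetric] G.r_neg)
    then have main: "\<eta> ?x (\<phi> (g n \<tau>)) = \<eta> ?x (V 0 0) \<oplus>\<^bsub>?M\<^esub> \<ominus>\<^bsub>?M\<^esub> \<eta> ?x T"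
      using linear_mapsD(2)[OF \<eta>_linear[OF x], of "V 0 0" "\<ominus>\<^bsub>?G\<^esub> T"] c T
        G.linear_minus[OF \<eta>_linear[OF x] M.left_module_axioms T] by simp
    \<comment> \<open>The terms are compared one at a time. Only the one on the face of index 0
      involves transport, and there naturality of \<open>\<eta>\<close> along the front edge is
      used.\<close>
    have "b \<tau> = \<ominus>\<^bsub>?M\<^esub> \<eta> ?x T"
    proof (cases n)
      case 0
      then have "{..<n} = {}" by simp
      then have "T = \<zero>\<^bsub>?G\<^esub>" unfolding T_def
        by (intro G.add.finprod_one_eqI[simplified]) (auto simp: signed_def G.minus_zero_group)
      then show ?thesis using 0 \<tau> G.linear_zero[OF \<eta>_linear[OF x] M.left_module_axioms] M.minus_zero_group
        by (simp add: b_def Cb_simps)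
    next
      case (Suc m)
      have \<tau>': "\<tau> \<in> simplices X (Suc m)" using \<tau> Suc by simp
      have lm: "{..<n} = {..m}" using Suc by auto
      have Ucm: "U i l \<in> carrier ?G" if "i \<le> n" "l \<le> m" for i l using Uc[of i l] that Suc by simp
      have fin: "face X (Suc m) i \<tau> \<in> simplices X m" if "i \<le> Suc m" for i using X.face_in[OF \<tau>' that] .
      have tm: "coboundary_term X A m (P m) \<tau> i =
          \<ominus>\<^bsub>?M\<^esub> \<eta> ?x (finsum ?G (\<lambda>l. signed ?G l (U i l)) {..<n})" if i: "i \<le> n" for i
      proof -
        have "\<ominus>\<^bsub>?M\<^esub> \<eta> ?x (finsum ?G (\<lambda>l. signed ?G l (U i l)) {..<n}) =
            \<eta> ?x (finsum ?G (\<lambda>l. \<ominus>\<^bsub>?G\<^esub> signed ?G l (U i l)) {..<n})"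
          using G.linear_minus[OF \<eta>_linear[OF x] M.left_module_axioms inner[OF i]] G.finsum_minus[of "\<lambda>l. signed ?G l (U i l)" "{..<n}"] Uc i
          by simp
        also have "\<dots> = \<eta> ?x (finsum ?G (\<lambda>l. signed ?G (Suc l) (U i l)) {..m})"
          unfolding lm using Ucm[OF i] by (intro arg_cong[of _ _ "\<eta> ?x"] G.finsum_cong') (auto simp: G.signed_Suc)
        also have "\<dots> = coboundary_term X A m (P m) \<tau> i"
        proof (cases "i = 0")
          case False
          then show ?thesis using fin[of i] i Suc X.vertex0_face[OF \<tau>', of i]
            by (simp add: coboundary_term_def P_def U_def)
        next
          case True
          let ?e = "front_edge X m \<tau>" and ?f = "face X (Suc m) 0 \<tau>"
          let ?G' = "stalk B (g 0 (vertex0 X m ?f))"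
          have e: "?e \<in> simplices X (Suc 0)" "src X ?e = ?x" "tgt X ?e = vertex0 X m ?f"
            using X.front_edge_in[OF \<tau>'] X.src_front_edge[OF \<tau>'] X.tgt_front_edge[OF \<tau>'] Suc by auto
          have ge: "g (Suc 0) ?e \<in> simplices Y (Suc 0)" "src Y (g (Suc 0) ?e) = g 0 ?x"
            "tgt Y (g (Suc 0) ?e) = g 0 (vertex0 X m ?f)"
            using face_map_uptoD[OF fm] e nK Suc
            by (auto simp: face_map_uptoD(2)[OF fm, symmetric])
          have f0: "?f \<in> simplices X m" using fin by simp
          have vf: "g 0 (vertex0 X m ?f) \<in> simplices Y 0"
            using face_map_uptoD(1)[OF fm _ X.vertex0_in[OF f0]] by simp
          interpret G': seminormed_module_over R N ?G' using Y.stalk_over[OF vf] .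
          have hc: "\<phi> (h m ?f l) \<in> carrier ?G'" if "l \<le> m" for l
            using Cb_in[OF \<phi>C, of "h m ?f l"] hin[of m ?f l] v0[of m ?f l] that Suc f0 by auto
          have lin: "edge_back Y B (g (Suc 0) ?e) \<in> linear_maps R ?G' ?G"
            using sn_isosD(2)[OF Y.edge_back_iso[OF ge(1)]] ge by simp
          let ?s = "finsum ?G' (\<lambda>l. signed ?G' (Suc l) (\<phi> (h m ?f l))) {..m}"
          have sc: "?s \<in> carrier ?G'" using hc by (intro G'.finsum_closed) auto
          have "finsum ?G (\<lambda>l. signed ?G (Suc l) (U i l)) {..m} =
              finsum ?G (\<lambda>l. edge_back Y B (g (Suc 0) ?e) (signed ?G' (Suc l) (\<phi> (h m ?f l)))) {..m}"
          proof (intro G.finsum_cong')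
            fix l assume l: "l \<in> {..m}"
            show "signed ?G (Suc l) (U i l) = edge_back Y B (g (Suc 0) ?e) (signed ?G' (Suc l) (\<phi> (h m ?f l)))"
              using G'.linear_signed[OF lin G.left_module_axioms hc, of l] l True Suc by (simp add: U_def)
          qed (use linear_mapsD(1)[OF lin] hc in auto)
          also have "\<dots> = edge_back Y B (g (Suc 0) ?e) ?s"
            by (rule G'.linear_finsum[OF lin G.left_module_axioms, symmetric]) (use hc in auto)
          finally have "\<eta> ?x (finsum ?G (\<lambda>l. signed ?G (Suc l) (U i l)) {..m}) = edge_back X A ?e (\<eta> (tgt X ?e) ?s)"
            using \<eta>_natural[OF _ e(1), of ?s] sc e nK by simp
          then show ?thesis using True e f0 by (simp add: coboundary_term_def P_def)
        qed
        finally show ?thesis by simp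
      qed
      have am: "{..n} = {..Suc m}" using Suc by simp
      have innerm: "finsum ?G (\<lambda>l. signed ?G l (U i l)) {..<n} \<in> carrier ?G" if "i \<le> Suc m" for i
        using inner[of i] that Suc by simp
      have "b \<tau> = coboundary X A m (P m) \<tau>" using Suc by (simp add: b_def)
      also have "\<dots> = finsum ?M (\<lambda>i. signed ?M i (coboundary_term X A m (P m) \<tau> i)) {..Suc m}"
        using X.coboundary_eq[OF P[OF Suc] \<tau>'] Suc by simp
      also have "\<dots> = finsum ?M (\<lambda>i. \<ominus>\<^bsub>?M\<^esub> \<eta> ?x (signed ?G i (finsum ?G (\<lambda>l. signed ?G l (U i l)) {..<n}))) {..Suc m}"
      proof (intro M.finsum_cong')
        fix i assume "i \<in> {..Suc m}"
        then have i: "i \<le> n" using Suc by simp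
        have "\<eta> ?x (signed ?G i (finsum ?G (\<lambda>l. signed ?G l (U i l)) {..<n})) =
            signed ?M i (\<eta> ?x (finsum ?G (\<lambda>l. signed ?G l (U i l)) {..<n}))"
          by (rule G.linear_signed[OF \<eta>_linear[OF x] M.left_module_axioms inner[OF i]])
        then show "signed ?M i (coboundary_term X A m (P m) \<tau> i) =
            \<ominus>\<^bsub>?M\<^esub> \<eta> ?x (signed ?G i (finsum ?G (\<lambda>l. signed ?G l (U i l)) {..<n}))"
          unfolding tm[OF i] by (simp add: signed_def)
      qed (use innerm linear_mapsD(1)[OF \<eta>_linear[OF x]] in auto)
      also have "\<dots> = \<ominus>\<^bsub>?M\<^esub> finsum ?M (\<lambda>i. \<eta> ?x (signed ?G i (finsum ?G (\<lambda>l. signed ?G l (U i l)) {..<n}))) {..Suc m}"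
        using innerm linear_mapsD(1)[OF \<eta>_linear[OF x]] by (intro M.finsum_minus) auto
      also have "finsum ?M (\<lambda>i. \<eta> ?x (signed ?G i (finsum ?G (\<lambda>l. signed ?G l (U i l)) {..<n}))) {..Suc m} = \<eta> ?x T"
        unfolding T_def am by (rule G.linear_finsum[OF \<eta>_linear[OF x] M.left_module_axioms, symmetric])
          (use innerm in auto)
      finally show ?thesis .
    qed
    then show "pullback_cochain X g \<eta> n \<phi> \<tau> =
        \<eta> ?x (edge_back Y B (h 0 ?x 0) (\<phi> (wall Y n (h n \<tau>) 0))) \<oplus>\<^bsub>?M\<^esub> b \<tau>"
      using main top \<tau> by (simp add: pullback_cochain_def)
  qed
qed

end

text \<open>Triviality of the kernel, stated for cocycles so that no quotients occur in the homotopy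
  arguments. Injectivity on classes follows by linearity in \<open>Hb_map_inj\<close>.\<close>

definition cohomology_inj ::
  "'x sset \<Rightarrow> ('r, 'x, 'a) coeff_system \<Rightarrow> 'y sset \<Rightarrow> ('r, 'y, 'b) coeff_system \<Rightarrow>
    (nat \<Rightarrow> 'x \<Rightarrow> 'y) \<Rightarrow> ('x \<Rightarrow> 'b \<Rightarrow> 'a) \<Rightarrow> nat \<Rightarrow> bool"
  where "cohomology_inj X A Y B g \<eta> n \<longleftrightarrow>
    (\<forall>\<psi>\<in>Zb Y B n. pullback_cochain X g \<eta> n \<psi> \<in> Bb X A n \<longrightarrow> \<psi> \<in> Bb Y B n)"

definition cohomology_surj ::
  "'x sset \<Rightarrow> ('r, 'x, 'a) coeff_system \<Rightarrow> 'y sset \<Rightarrow> ('r, 'y, 'b) coeff_system \<Rightarrow>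
    (nat \<Rightarrow> 'x \<Rightarrow> 'y) \<Rightarrow> ('x \<Rightarrow> 'b \<Rightarrow> 'a) \<Rightarrow> nat \<Rightarrow> bool"
  where "cohomology_surj X A Y B g \<eta> n \<longleftrightarrow>
    (\<forall>\<phi>\<in>Zb X A n. \<exists>\<psi>\<in>Zb Y B n. \<exists>b\<in>Bb X A n. \<phi> = pullback_cochain X g \<eta> n \<psi> \<oplus>\<^bsub>Cb X A n\<^esub> b)"

text \<open>A coboundary is sent to a coboundary by the left inverse. For this
  \<open>n \<le> K\<close> is enough, while preserving cocycles of degree \<open>n\<close> would
  take a map defined in dimension \<open>n + 1\<close>; that is why injectivity reaches one degree
  further.\<close>

lemma cohomology_injI:
  assumes "cochain_map K R N B C E A s \<theta>" "n \<le> K"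
    and "\<And>\<psi>. \<psi> \<in> Zb B C n \<Longrightarrow> pullback_cochain B s \<theta> n (pullback_cochain E q \<eta> n \<psi>) = \<psi>"
  shows "cohomology_inj E A B C q \<eta> n"
  using cochain_map.pullback_Bb[OF assms(1,2)] assms(3) unfolding cohomology_inj_def by metis

text \<open>A section gives a left inverse of the pullback on cochains, and a vertical homotopy shows
  that it is a right inverse on cohomology.\<close>

locale sphere_lifting_systems = sphere_lifting E B q m + E: edge_system R N E A + B: edge_system R N B C
  for E :: "'e sset" and B :: "'b sset" and q and m and R :: "('r, 'm) ring_scheme" and N
    and A :: "('r, 'e, 'a) coeff_system" and C :: "('r, 'b, 'c) coeff_system" +
  fixes \<eta> :: "'e \<Rightarrow> 'c \<Rightarrow> 'a"
  assumes sys: "system_map (Suc m) R E A B C q \<eta>"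
    and iso: "x \<in> simplices E 0 \<Longrightarrow> \<eta> x \<in> sn_isos R (stalk C (q 0 x)) (stalk A x)"
begin

lemma cochain_map_q: "cochain_map (Suc m) R N E A B C q \<eta>"
  using sys by (intro cochain_map.intro cochain_map_axioms.intro E.edge_system_axioms B.edge_system_axioms)

definition \<theta> :: "(nat \<Rightarrow> 'b \<Rightarrow> 'e) \<Rightarrow> 'b \<Rightarrow> 'a \<Rightarrow> 'c"
  where "\<theta> s y = inv_into (carrier (stalk C y)) (\<eta> (s 0 y))"

context
  fixes s assumes s: "section_on m s"
begin

lemma sD:
  "n \<le> m \<Longrightarrow> \<sigma> \<in> simplices B n \<Longrightarrow> s n \<sigma> \<in> simplices E n"
  "n \<le> m \<Longrightarrow> \<sigma> \<in> simplices B n \<Longrightarrow> q n (s n \<sigma>) = \<sigma>"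
  "n < m \<Longrightarrow> \<sigma> \<in> simplices B (Suc n) \<Longrightarrow> i \<le> Suc n \<Longrightarrow> s n (face B (Suc n) i \<sigma>) = face E (Suc n) i (s (Suc n) \<sigma>)"
  using s by (auto simp: section_on_def)

lemma \<theta>:
  assumes y: "y \<in> simplices B 0"
  shows "\<theta> s y \<in> sn_maps R (stalk A (s 0 y)) (stalk C y)"
    and "a \<in> carrier (stalk A (s 0 y)) \<Longrightarrow> \<theta> s y a \<in> carrier (stalk C y) \<and> \<eta> (s 0 y) (\<theta> s y a) = a"
    and "c \<in> carrier (stalk C y) \<Longrightarrow> \<theta> s y (\<eta> (s 0 y) c) = c"
proof -
  have i: "\<eta> (s 0 y) \<in> sn_isos R (stalk C y) (stalk A (s 0 y))"
    using iso[OF sD(1)[OF _ y]] sD(2)[OF _ y] by simp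
  show "\<theta> s y \<in> sn_maps R (stalk A (s 0 y)) (stalk C y)"
    using i by (simp add: sn_isos_def \<theta>_def)
  show "\<theta> s y a \<in> carrier (stalk C y) \<and> \<eta> (s 0 y) (\<theta> s y a) = a" if "a \<in> carrier (stalk A (s 0 y))"
    using sn_isosD(3)[OF i] that by (auto simp: \<theta>_def bij_betw_def inv_into_into f_inv_into_f)
  show "\<theta> s y (\<eta> (s 0 y) c) = c" if "c \<in> carrier (stalk C y)"
    using sn_isosD(3)[OF i] that by (simp add: \<theta>_def bij_betw_def inv_into_f_f)
qed

lemma cochain_map_s: "cochain_map m R N B C E A s (\<theta> s)"
proof (intro cochain_map.intro cochain_map_axioms.intro B.edge_system_axioms E.edge_system_axioms)
  have "\<theta> s (src B e) (edge_back E A (s (Suc 0) e) b) = edge_back B C e (\<theta> s (tgt B e) b)"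
    if m: "0 < m" and e: "e \<in> simplices B (Suc 0)" and b: "b \<in> carrier (stalk A (s 0 (tgt B e)))" for e b
  proof -
    have se: "s (Suc 0) e \<in> simplices E (Suc 0)" "q (Suc 0) (s (Suc 0) e) = e"
      "src E (s (Suc 0) e) = s 0 (src B e)" "tgt E (s (Suc 0) e) = s 0 (tgt B e)"
      using sD(1,2)[of "Suc 0" e] sD(3)[of 0 e] m e by auto
    have y: "tgt B e \<in> simplices B 0" "src B e \<in> simplices B 0" using e by (auto simp: B.face_in)
    have c: "\<theta> s (tgt B e) b \<in> carrier (stalk C (tgt B e))" "\<eta> (s 0 (tgt B e)) (\<theta> s (tgt B e) b) = b"
      using \<theta>(2)[OF y(1) b] by auto
    have qt: "q 0 (tgt E (s (Suc 0) e)) = tgt B e" using se(4) sD(2)[OF _ y(1)] by simp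
    have "\<eta> (s 0 (src B e)) (edge_back B C e (\<theta> s (tgt B e) b)) = edge_back E A (s (Suc 0) e) b"
      using cochain_map.\<eta>_natural[OF cochain_map_q _ se(1), of "\<theta> s (tgt B e) b"] c qt se by simp
    moreover have "edge_back B C e (\<theta> s (tgt B e) b) \<in> carrier (stalk C (src B e))"
      using linear_mapsD(1)[OF sn_isosD(2)[OF B.edge_back_iso[OF e]] c(1)] .
    ultimately show ?thesis using \<theta>(3)[OF y(2)] by metis
  qed
  then show "system_map m R B C E A s (\<theta> s)"
    using sD \<theta>(1) by (simp add: system_map_def face_map_upto_def)
qed

lemma pullback_section:
  assumes n: "n \<le> m" and \<psi>: "\<psi> \<in> carrier (Cb B C n)"
  shows "pullback_cochain B s (\<theta> s) n (pullback_cochain E q \<eta> n \<psi>) = \<psi>"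
proof (rule Cb_eqI[OF _ \<psi>])
  show "pullback_cochain B s (\<theta> s) n (pullback_cochain E q \<eta> n \<psi>) \<in> carrier (Cb B C n)"
    using cochain_map.pullback_in[OF cochain_map_s n] cochain_map.pullback_in[OF cochain_map_q _ \<psi>] n by simp
  fix \<sigma> assume \<sigma>: "\<sigma> \<in> simplices B n"
  have "vertex0 E n (s n \<sigma>) = s 0 (vertex0 B n \<sigma>)"
    using cochain_map.map_vertex0[OF cochain_map_s n \<sigma>] .
  then show "pullback_cochain B s (\<theta> s) n (pullback_cochain E q \<eta> n \<psi>) \<sigma> = \<psi> \<sigma>"
    using \<sigma> sD(1,2)[OF n \<sigma>] \<theta>(3)[OF B.vertex0_in[OF \<sigma>] Cb_in[OF \<psi> \<sigma>]] by (simp add: pullback_cochain_def)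
qed

text \<open>The homotopy formula is applied to the identity of \<open>E\<close> and the prisms
  leading to the section followed by \<open>q\<close>. The transport occurring in it runs along
  edges over degenerate edges of \<open>B\<close>.\<close>

lemma section_pullback:
  assumes n: "n < m" and \<phi>: "\<phi> \<in> Zb E A n"
  obtains b where "b \<in> Bb E A n"
    "\<phi> = pullback_cochain E q \<eta> n (pullback_cochain B s (\<theta> s) n \<phi>) \<oplus>\<^bsub>Cb E A n\<^esub> b"
proof -
  have \<phi>C: "\<phi> \<in> carrier (Cb E A n)" using \<phi> by (simp add: Zb_def)
  have id: "cochain_map (Suc n) R N E A E A (\<lambda>_ \<sigma>. \<sigma>) (\<lambda>_ a. a)"
    by (intro cochain_map.intro cochain_map_axioms.intro E.edge_system_axioms)
      (auto simp: system_map_def face_map_upto_def sn_maps_def linear_maps_def)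
  have qD: "\<tau> \<in> simplices E k \<Longrightarrow> q k \<tau> \<in> simplices B k"
    "\<tau> \<in> simplices E (Suc k) \<Longrightarrow> i \<le> Suc k \<Longrightarrow> q k (face E (Suc k) i \<tau>) = face B (Suc k) i (q (Suc k) \<tau>)" for k \<tau> i
    using face_mapD[OF q] by auto
  have "\<exists>H. vertical_homotopy (\<lambda>k \<tau>. s k (q k \<tau>)) m H"
  proof (rule vertical_homotopy_exists)
    show "s k (q k \<tau>) \<in> simplices E k \<and> q k (s k (q k \<tau>)) = q k \<tau>" if "k < m" "\<tau> \<in> simplices E k" for k \<tau>
      using sD(1,2)[of k "q k \<tau>"] qD(1)[of \<tau> k] that by simp
    show "face E (Suc k) i (s (Suc k) (q (Suc k) \<tau>)) = s k (q k (face E (Suc k) i \<tau>))"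
      if "Suc k < m" "\<tau> \<in> simplices E (Suc k)" "i \<le> Suc k" for k \<tau> i
      using sD(3)[of k "q (Suc k) \<tau>" i] qD(1)[of \<tau> "Suc k"] qD(2)[of \<tau> k i] that by simp
  qed
  then obtain H where H: "vertical_homotopy (\<lambda>k \<tau>. s k (q k \<tau>)) m H" by blast
  have vp: "vertical_prism (\<lambda>k \<tau>. s k (q k \<tau>)) k \<tau> (H k \<tau>)" if "k \<le> n" "\<tau> \<in> simplices E k" for k \<tau>
    using H that n by (simp add: vertical_homotopy_def)
  obtain b where b: "b \<in> Bb E A n" "\<And>\<tau>. \<tau> \<in> simplices E n \<Longrightarrow>
    pullback_cochain E (\<lambda>_ \<sigma>. \<sigma>) (\<lambda>_ a. a) n \<phi> \<tau> =
      edge_back E A (H 0 (vertex0 E n \<tau>) 0) (\<phi> (wall E n (H n \<tau>) 0)) \<oplus>\<^bsub>stalk A (vertex0 E n \<tau>)\<^esub> b \<tau>"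
  proof (rule cochain_map.prism_homotopy[OF id le_refl _ _ \<phi>, of H])
    show "prism E k (H k \<tau>) \<and> wall E k (H k \<tau>) (Suc k) = \<tau>" if "k \<le> n" "\<tau> \<in> simplices E k" for k \<tau>
      using vp[OF that] by (simp add: vertical_prism_def)
    show "prism_face E (Suc k) i (H (Suc k) \<tau>) = H k (face E (Suc k) i \<tau>)"
      if "Suc k \<le> n" "\<tau> \<in> simplices E (Suc k)" "i \<le> Suc k" for k \<tau> i
      using H that n by (simp add: vertical_homotopy_def)
  qed blast
  let ?p = "pullback_cochain E q \<eta> n (pullback_cochain B s (\<theta> s) n \<phi>)"
  have sC: "pullback_cochain B s (\<theta> s) n \<phi> \<in> carrier (Cb B C n)"
    using cochain_map.pullback_in[OF cochain_map_s _ \<phi>C] n by simp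
  have pC: "?p \<in> carrier (Cb E A n)"
    using cochain_map.pullback_in[OF cochain_map_q _ sC] n by simp
  interpret Cn: left_module R "Cb E A n" by (rule E.Cb_left_module)
  have "\<phi> = ?p \<oplus>\<^bsub>Cb E A n\<^esub> b"
  proof (rule Cb_eqI[OF \<phi>C])
    show "?p \<oplus>\<^bsub>Cb E A n\<^esub> b \<in> carrier (Cb E A n)"
      using pC b(1) E.Bb_subset by blast
    fix \<tau> assume \<tau>: "\<tau> \<in> simplices E n"
    let ?x = "vertex0 E n \<tau>"
    let ?v = "H 0 ?x 0" and ?y = "q 0 ?x"
    have x: "?x \<in> simplices E 0" using \<tau> by (rule E.vertex0_in)
    have y: "?y \<in> simplices B 0" using qD(1)[OF x] .
    have qt: "q n \<tau> \<in> simplices B n" using qD(1)[OF \<tau>] .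
    have vy: "vertex0 B n (q n \<tau>) = ?y" using cochain_map.map_vertex0[OF cochain_map_q _ \<tau>] n by simp
    have vs: "vertex0 E n (s n (q n \<tau>)) = s 0 ?y"
      using cochain_map.map_vertex0[OF cochain_map_s _ qt] n vy by simp
    have v: "?v \<in> simplices E (Suc 0)" "src E ?v = ?x" "tgt E ?v = s 0 ?y" "q (Suc 0) ?v = degen B 0 0 ?y"
      using vp[OF le0 x] prism_in[of E 0 "H 0 ?x" 0] by (auto simp: vertical_prism_def wall_def)
    have c: "\<phi> (s n (q n \<tau>)) \<in> carrier (stalk A (s 0 ?y))"
      using Cb_in[OF \<phi>C sD(1)[OF _ qt]] n vs by simp
    let ?d = "\<theta> s ?y (\<phi> (s n (q n \<tau>)))"
    have d: "?d \<in> carrier (stalk C ?y)" "\<eta> (s 0 ?y) ?d = \<phi> (s n (q n \<tau>))" using \<theta>(2)[OF y c] by auto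
    \<comment> \<open>Over a degenerate edge the coefficients on \<open>B\<close> do not move. By
      naturality, transport in \<open>A\<close> along the vertical edge \<open>?v\<close> is
      therefore the comparison of \<open>\<eta>\<close> at its two ends, which is what pulling back
      along the section and then along \<open>q\<close> produces.\<close>
    have "\<eta> ?x (edge_back B C (degen B 0 0 ?y) ?d) = edge_back E A ?v (\<phi> (s n (q n \<tau>)))"
      using cochain_map.\<eta>_natural[OF cochain_map_q _ v(1), of ?d] v d sD(2)[OF _ y] by simp
    then have "edge_back E A ?v (\<phi> (s n (q n \<tau>))) = \<eta> ?x ?d"
      using B.edge_back_degenerate[OF B.simplicial_set_axioms y d(1)] by simp
    moreover have "wall E n (H n \<tau>) 0 = s n (q n \<tau>)" using vp[OF le_refl \<tau>] by (simp add: vertical_prism_def)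
    ultimately show "\<phi> \<tau> = (?p \<oplus>\<^bsub>Cb E A n\<^esub> b) \<tau>"
      using b(2)[OF \<tau>] \<tau> qt vy by (simp add: pullback_cochain_def Cb_simps)
  qed
  then show thesis using that b(1) by blast
qed

end

lemma sphere_lifting_cohomology:
  shows "n \<le> m \<Longrightarrow> cohomology_inj E A B C q \<eta> n"
    and "n < m \<Longrightarrow> cohomology_surj E A B C q \<eta> n"
proof -
  obtain s where s: "section_on m s" using section_exists by blast
  show "cohomology_inj E A B C q \<eta> n" if "n \<le> m"
    by (rule cohomology_injI[OF cochain_map_s[OF s] that]) (use pullback_section[OF s that] in \<open>simp add: Zb_def\<close>)
  show "cohomology_surj E A B C q \<eta> n" if n: "n < m"
    unfolding cohomology_surj_def
  proof
    fix \<phi> assume \<phi>: "\<phi> \<in> Zb E A n"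
    then have "pullback_cochain B s (\<theta> s) n \<phi> \<in> Zb B C n"
      using cochain_map.pullback_Zb[OF cochain_map_s[OF s]] n by simp
    then show "\<exists>\<psi>\<in>Zb B C n. \<exists>b\<in>Bb E A n. \<phi> = pullback_cochain E q \<eta> n \<psi> \<oplus>\<^bsub>Cb E A n\<^esub> b"
      using section_pullback[OF s n \<phi>] by metis
  qed
qed

end

section \<open>Paths and local coefficient systems\<close>

lemma is_path_Nil: "is_path X x [] y \<longleftrightarrow> x = y \<and> x \<in> simplices X 0"
  by (auto elim: is_path.cases intro: is_path.empty)

lemma is_path_Cons:
  "is_path X x ((e, b) # w) y \<longleftrightarrow> e \<in> simplices X (Suc 0) \<and>
    (if b then x = src X e \<and> is_path X (tgt X e) w y else x = tgt X e \<and> is_path X (src X e) w y)"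
  by (auto elim: is_path.cases intro: is_path.edge[unfolded One_nat_def] is_path.inverse[unfolded One_nat_def])

lemma (in semi_simplicial_set) is_path_ends:
  "is_path X x w y \<Longrightarrow> x \<in> simplices X 0 \<and> y \<in> simplices X 0"
  by (induction rule: is_path.induct) (auto simp: face_in)

lemma (in semi_simplicial_set) is_path_append:
  "is_path X x (u @ v) z \<longleftrightarrow> (\<exists>y. is_path X x u y \<and> is_path X y v z)"
proof (induction u arbitrary: x)
  case Nil
  then show ?case using is_path_ends by (auto simp: is_path_Nil)
next
  case (Cons a u)
  then show ?case by (cases a) (auto simp: is_path_Cons)
qed

context semi_simplicial_set begin

lemma triangle_edges:
  assumes "\<sigma> \<in> simplices X (Suc (Suc 0))"
  shows "src X (face X (Suc (Suc 0)) 0 \<sigma>) = tgt X (face X (Suc (Suc 0)) (Suc (Suc 0)) \<sigma>)"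
    "src X (face X (Suc (Suc 0)) (Suc 0) \<sigma>) = src X (face X (Suc (Suc 0)) (Suc (Suc 0)) \<sigma>)"
    "tgt X (face X (Suc (Suc 0)) (Suc 0) \<sigma>) = tgt X (face X (Suc (Suc 0)) 0 \<sigma>)"
  using face_comm[OF assms, of 0 "Suc (Suc 0)"] face_comm[OF assms, of "Suc 0" "Suc (Suc 0)"]
    face_comm[OF assms, of 0 "Suc 0"] by simp_all

lemma path_eq_is_path: "path_eq X x y w w' \<Longrightarrow> is_path X x w y \<and> is_path X x w' y"
proof (induction rule: path_eq.induct)
  case (cancel u e b v)
  then show ?case by (cases b) (auto simp: is_path_append is_path_Cons is_path_Nil)
next
  case (triangle \<sigma> u v)
  have s: "\<sigma> \<in> simplices X (Suc (Suc 0))" using triangle by (simp add: numeral_2_eq_2)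
  show ?case
    using triangle triangle_edges[OF s] face_in[OF s, of "Suc 0"]
    by (auto simp: is_path_append is_path_Cons is_path_Nil numeral_2_eq_2)
qed auto

lemma path_class_eqI: "path_eq X x y w w' \<Longrightarrow> path_class X x y w = path_class X x y w'"
  unfolding path_class_def by (intro Collect_cong iffI) (blast intro: path_eq.sym path_eq.trans)+

lemma path_eq_append_right:
  "path_eq X x y w w' \<Longrightarrow> is_path X y v z \<Longrightarrow> path_eq X x z (w @ v) (w' @ v)"
proof (induction rule: path_eq.induct)
  case (refl w)
  then show ?case using is_path_append by (blast intro: path_eq.refl)
next
  case (cancel u e b v')
  then have "is_path X x (u @ [(e, b), (e, \<not> b)] @ (v' @ v)) z"
    using is_path_append[of x "u @ [(e, b), (e, \<not> b)] @ v'" v z] by auto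
  from path_eq.cancel[OF this] show ?case by simp
next
  case (triangle \<sigma> u v')
  then have "is_path X x (u @ [(face X 2 2 \<sigma>, True), (face X 2 0 \<sigma>, True)] @ (v' @ v)) z"
    using is_path_append[of x "u @ [(face X 2 2 \<sigma>, True), (face X 2 0 \<sigma>, True)] @ v'" v z] by auto
  from path_eq.triangle[OF triangle(1) this] show ?case by simp
qed (blast intro: path_eq.sym path_eq.trans)+

lemma path_eq_append_left:
  "path_eq X y z w w' \<Longrightarrow> is_path X x u y \<Longrightarrow> path_eq X x z (u @ w) (u @ w')"
proof (induction rule: path_eq.induct)
  case (refl w)
  then show ?case using is_path_append by (blast intro: path_eq.refl)
next
  case (cancel u' e b v)
  then have "is_path X x ((u @ u') @ [(e, b), (e, \<not> b)] @ v) z"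
    using is_path_append[of x u "u' @ [(e, b), (e, \<not> b)] @ v" z] by auto
  from path_eq.cancel[OF this] show ?case by simp
next
  case (triangle \<sigma> u' v)
  then have "is_path X x ((u @ u') @ [(face X 2 2 \<sigma>, True), (face X 2 0 \<sigma>, True)] @ v) z"
    using is_path_append[of x u "u' @ [(face X 2 2 \<sigma>, True), (face X 2 0 \<sigma>, True)] @ v" z] by auto
  from path_eq.triangle[OF triangle(1) this] show ?case by simp
qed (blast intro: path_eq.sym path_eq.trans)+

lemma pi_comp_path_class:
  assumes u: "is_path X x u y" and v: "is_path X y v z"
  shows "pi_comp X x z (path_class X x y u) (path_class X y z v) = path_class X x z (u @ v)"
proof -
  have "path_class X x z (u' @ v') = path_class X x z (u @ v)"
    if "u' \<in> path_class X x y u" "v' \<in> path_class X y z v" for u' v'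
  proof -
    have uv: "path_eq X x y u u'" "path_eq X y z v v'" using that by (auto simp: path_class_def)
    have "path_eq X x z (u @ v) (u' @ v)" using path_eq_append_right[OF uv(1) v] .
    moreover have "path_eq X x z (u' @ v) (u' @ v')"
      using path_eq_append_left[OF uv(2)] path_eq_is_path[OF uv(1)] by blast
    ultimately show ?thesis using path_class_eqI path_eq.trans path_eq.sym by metis
  qed
  moreover have "u \<in> path_class X x y u" "v \<in> path_class X y z v"
    using u v by (auto simp: path_class_def intro: path_eq.refl)
  ultimately show ?thesis unfolding pi_comp_def by blast
qed

lemma edge_paths:
  assumes "e \<in> simplices X (Suc 0)"
  shows "is_path X (src X e) [(e, True)] (tgt X e)" "is_path X (tgt X e) [(e, False)] (src X e)"
    "pi_edge X e \<in> pi_hom X (src X e) (tgt X e)" "pi_edge_inv X e \<in> pi_hom X (tgt X e) (src X e)"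
  using assms by (auto simp: is_path_Cons is_path_Nil face_in pi_edge_def pi_edge_inv_def pi_hom_def)

end

definition edge_forth :: "'x sset \<Rightarrow> ('r, 'x, 'a) coeff_system \<Rightarrow> 'x \<Rightarrow> 'a \<Rightarrow> 'a"
  where "edge_forth X A e = transport A (src X e) (tgt X e) (pi_edge X e)"

locale local_system_on = semi_simplicial_set X + normed_ring R N + local_system R N X A
  for R :: "('r, 'm) ring_scheme" and N :: "'r \<Rightarrow> real" and X :: "'x sset"
    and A :: "('r, 'x, 'a) coeff_system"
begin

lemma edge_forth_back:
  assumes e: "e \<in> simplices X (Suc 0)"
  shows "edge_forth X A e \<in> sn_maps R (stalk A (src X e)) (stalk A (tgt X e))"
    and "edge_back X A e \<in> sn_maps R (stalk A (tgt X e)) (stalk A (src X e))"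
    and "a \<in> carrier (stalk A (src X e)) \<Longrightarrow> edge_back X A e (edge_forth X A e a) = a"
    and "a \<in> carrier (stalk A (tgt X e)) \<Longrightarrow> edge_forth X A e (edge_back X A e a) = a"
proof -
  have v: "src X e \<in> simplices X 0" "tgt X e \<in> simplices X 0" using e by (auto simp: face_in)
  note p = edge_paths[OF e]
  show "edge_forth X A e \<in> sn_maps R (stalk A (src X e)) (stalk A (tgt X e))"
    unfolding edge_forth_def using transport_map[OF v p(3)] .
  show "edge_back X A e \<in> sn_maps R (stalk A (tgt X e)) (stalk A (src X e))"
    unfolding edge_back_def using transport_map[OF v(2,1) p(4)] .
  have "path_eq X (src X e) (src X e) ([] @ [(e, True), (e, \<not> True)] @ []) ([] @ [])"
    by (rule path_eq.cancel) (use e v in \<open>auto simp: is_path_Cons is_path_Nil\<close>)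
  then have 1: "pi_comp X (src X e) (src X e) (pi_edge X e) (pi_edge_inv X e) = pi_id X (src X e)"
    using pi_comp_path_class[OF p(1,2)] path_class_eqI by (simp add: pi_edge_def pi_edge_inv_def pi_id_def)
  have "path_eq X (tgt X e) (tgt X e) ([] @ [(e, False), (e, \<not> False)] @ []) ([] @ [])"
    by (rule path_eq.cancel) (use e v in \<open>auto simp: is_path_Cons is_path_Nil\<close>)
  then have 2: "pi_comp X (tgt X e) (tgt X e) (pi_edge_inv X e) (pi_edge X e) = pi_id X (tgt X e)"
    using pi_comp_path_class[OF p(2,1)] path_class_eqI by (simp add: pi_edge_def pi_edge_inv_def pi_id_def)
  show "edge_back X A e (edge_forth X A e a) = a" if "a \<in> carrier (stalk A (src X e))"
    using transport_comp[OF v(1) v(2) v(1) p(3,4) that] transport_id[OF v(1) that] 1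
    by (simp add: edge_back_def edge_forth_def)
  show "edge_forth X A e (edge_back X A e a) = a" if "a \<in> carrier (stalk A (tgt X e))"
    using transport_comp[OF v(2) v(1) v(2) p(4,3) that] transport_id[OF v(2) that] 2
    by (simp add: edge_back_def edge_forth_def)
qed

lemma edge_forth_triangle:
  assumes s: "\<sigma> \<in> simplices X (Suc (Suc 0))"
    and a: "a \<in> carrier (stalk A (src X (face X (Suc (Suc 0)) (Suc (Suc 0)) \<sigma>)))"
  shows "edge_forth X A (face X (Suc (Suc 0)) 0 \<sigma>) (edge_forth X A (face X (Suc (Suc 0)) (Suc (Suc 0)) \<sigma>) a) =
    edge_forth X A (face X (Suc (Suc 0)) (Suc 0) \<sigma>) a"
proof -
  let ?e2 = "face X (Suc (Suc 0)) (Suc (Suc 0)) \<sigma>" and ?e1 = "face X (Suc (Suc 0)) (Suc 0) \<sigma>"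
    and ?e0 = "face X (Suc (Suc 0)) 0 \<sigma>"
  have e: "?e0 \<in> simplices X (Suc 0)" "?e1 \<in> simplices X (Suc 0)" "?e2 \<in> simplices X (Suc 0)"
    using s by (auto simp: face_in)
  have v: "src X ?e2 \<in> simplices X 0" "tgt X ?e2 \<in> simplices X 0" "tgt X ?e0 \<in> simplices X 0"
    using e by (auto simp: face_in)
  note t = triangle_edges[OF s]
  have p0: "is_path X (tgt X ?e2) [(?e0, True)] (tgt X ?e0)" using edge_paths(1)[OF e(1)] t by simp
  have "path_eq X (src X ?e2) (tgt X ?e0) ([] @ [(face X 2 2 \<sigma>, True), (face X 2 0 \<sigma>, True)] @ [])
      ([] @ [(face X 2 1 \<sigma>, True)] @ [])"
    by (rule path_eq.triangle) (use s e t v in \<open>auto simp: is_path_Cons is_path_Nil numeral_2_eq_2\<close>)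
  then have "path_eq X (src X ?e2) (tgt X ?e0) ([(?e2, True)] @ [(?e0, True)]) [(?e1, True)]"
    by (simp add: numeral_2_eq_2)
  then have "pi_comp X (src X ?e2) (tgt X ?e0) (pi_edge X ?e2) (path_class X (tgt X ?e2) (tgt X ?e0) [(?e0, True)]) =
      pi_edge X ?e1"
    using pi_comp_path_class[OF edge_paths(1)[OF e(3)] p0] path_class_eqI t by (simp add: pi_edge_def)
  moreover have "path_class X (tgt X ?e2) (tgt X ?e0) [(?e0, True)] \<in> pi_hom X (tgt X ?e2) (tgt X ?e0)"
    using p0 by (auto simp: pi_hom_def)
  note transport_comp[OF v edge_paths(3)[OF e(3)] this a]
  ultimately show ?thesis
    using t
    by (simp add: edge_forth_def pi_edge_def)
qed

sublocale edge_system R N X A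
proof (intro edge_system.intro edge_system_axioms.intro semi_simplicial_set_axioms normed_ring_axioms)
  fix e assume e: "e \<in> simplices X (Suc 0)"
  have v: "src X e \<in> simplices X 0" "tgt X e \<in> simplices X 0" using e by (auto simp: face_in)
  interpret S: seminormed_module R N "stalk A (tgt X e)" using stalk_module[OF v(2)] .
  note f = edge_forth_back[OF e]
  have fb: "edge_forth X A e ` carrier (stalk A (src X e)) \<subseteq> carrier (stalk A (tgt X e))"
    "edge_back X A e ` carrier (stalk A (tgt X e)) \<subseteq> carrier (stalk A (src X e))"
    using f(1,2) by (auto simp: sn_maps_def linear_maps_def)
  show "edge_back X A e \<in> sn_isos R (stalk A (tgt X e)) (stalk A (src X e))"
  proof (rule sn_isosI)
    show "bij_betw (edge_back X A e) (carrier (stalk A (tgt X e))) (carrier (stalk A (src X e)))"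
      by (rule bij_betw_byWitness[where f' = "edge_forth X A e"]) (use f fb in auto)
    \<comment> \<open>Transport along an edge and along its inverse are mutually inverse and both do
      not increase the seminorm, so each is isometric.\<close>
    show "snorm (stalk A (src X e)) (edge_back X A e a) = snorm (stalk A (tgt X e)) a"
      if a: "a \<in> carrier (stalk A (tgt X e))" for a
    proof (rule antisym)
      show "snorm (stalk A (src X e)) (edge_back X A e a) \<le> snorm (stalk A (tgt X e)) a"
        using f(2) a by (simp add: sn_maps_def)
      have "edge_back X A e a \<in> carrier (stalk A (src X e))" using fb a by blast
      then show "snorm (stalk A (tgt X e)) a \<le> snorm (stalk A (src X e)) (edge_back X A e a)"
        using f(1) f(4)[OF a] by (force simp: sn_maps_def)
    qed
  qed (use f S.abelian_group_axioms S.smult_closed in \<open>auto simp: sn_maps_def\<close>)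
next
  fix \<sigma> a assume s: "\<sigma> \<in> simplices X (Suc (Suc 0))"
  let ?e2 = "face X (Suc (Suc 0)) (Suc (Suc 0)) \<sigma>" and ?e1 = "face X (Suc (Suc 0)) (Suc 0) \<sigma>"
    and ?e0 = "face X (Suc (Suc 0)) 0 \<sigma>"
  assume a: "a \<in> carrier (stalk A (tgt X ?e0))"
  have e: "?e0 \<in> simplices X (Suc 0)" "?e1 \<in> simplices X (Suc 0)" "?e2 \<in> simplices X (Suc 0)"
    using s by (auto simp: face_in)
  note t = triangle_edges[OF s]
  have c0: "edge_back X A ?e0 a \<in> carrier (stalk A (tgt X ?e2))"
    using edge_forth_back(2)[OF e(1)] a t by (auto simp: sn_maps_def linear_maps_def)
  have c2: "edge_back X A ?e2 (edge_back X A ?e0 a) \<in> carrier (stalk A (src X ?e2))"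
    using edge_forth_back(2)[OF e(3)] c0 by (auto simp: sn_maps_def linear_maps_def)
  \<comment> \<open>The triangle relation is known for forward transport. Applying the forward
    transport along the long edge to both sides reduces the backward relation to it.\<close>
  have "edge_forth X A ?e1 (edge_back X A ?e2 (edge_back X A ?e0 a)) = a"
    using edge_forth_triangle[OF s c2] edge_forth_back(4)[OF e(3) c0] edge_forth_back(4)[OF e(1) a] by simp
  then show "edge_back X A ?e2 (edge_back X A ?e0 a) = edge_back X A ?e1 a"
    using edge_forth_back(3)[OF e(2), of "edge_back X A ?e2 (edge_back X A ?e0 a)"] c2 t by simp
qed (use stalk_module in auto)

end

section \<open>Functoriality of path classes and pullback of coefficient systems\<close>

context
  fixes X :: "'x sset" and Y :: "'y sset" and g :: "nat \<Rightarrow> 'x \<Rightarrow> 'y"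
  assumes X: "semi_simplicial_set X" and g: "face_map X Y g"
begin

lemma is_path_map: "is_path X x w y \<Longrightarrow> is_path Y (g 0 x) (map (\<lambda>(e, b). (g 1 e, b)) w) (g 0 y)"
proof (induction rule: is_path.induct)
  case (empty x)
  then show ?case using face_mapD(1)[OF g] by (auto simp: is_path_Nil)
qed (use face_mapD[OF g] in \<open>auto simp: is_path_Cons\<close>)

lemma path_eq_map:
  "path_eq X x y w w' \<Longrightarrow> path_eq Y (g 0 x) (g 0 y) (map (\<lambda>(e, b). (g 1 e, b)) w) (map (\<lambda>(e, b). (g 1 e, b)) w')"
proof (induction rule: path_eq.induct)
  case (refl w)
  then show ?case using is_path_map by (blast intro: path_eq.refl)
next
  case (cancel u e b v)
  let ?f = "map (\<lambda>(e, b). (g 1 e, b))"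
  have "is_path Y (g 0 x) (?f u @ [(g 1 e, b), (g 1 e, \<not> b)] @ ?f v) (g 0 y)"
    using is_path_map[OF cancel] by simp
  from path_eq.cancel[OF this] show ?case by simp
next
  case (triangle \<sigma> u v)
  have s: "\<sigma> \<in> simplices X (Suc (Suc 0))" using triangle by (simp add: numeral_2_eq_2)
  have gs: "g 2 \<sigma> \<in> simplices Y 2" using face_mapD(1)[OF g s] by (simp add: numeral_2_eq_2)
  have gf: "g 1 (face X 2 i \<sigma>) = face Y 2 i (g 2 \<sigma>)" if "i \<le> 2" for i
    using face_mapD(2)[OF g s] that by (simp add: numeral_2_eq_2)
  let ?f = "map (\<lambda>(e, b). (g 1 e, b))"
  have "is_path Y (g 0 x) (?f u @ [(face Y 2 2 (g 2 \<sigma>), True), (face Y 2 0 (g 2 \<sigma>), True)] @ ?f v) (g 0 y)"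
    using is_path_map[OF triangle(2)] gf by simp
  from path_eq.triangle[OF gs this] show ?case using gf by simp
qed (blast intro: path_eq.sym path_eq.trans)+

lemma pi_map_path_class:
  assumes "semi_simplicial_set Y" "is_path X x w y"
  shows "pi_map X Y g x y (path_class X x y w) = path_class Y (g 0 x) (g 0 y) (map (\<lambda>(e, b). (g 1 e, b)) w)"
proof -
  have "w \<in> path_class X x y w" using assms(2) by (auto simp: path_class_def intro: path_eq.refl)
  moreover have "path_class Y (g 0 x) (g 0 y) (map (\<lambda>(e, b). (g 1 e, b)) w') =
      path_class Y (g 0 x) (g 0 y) (map (\<lambda>(e, b). (g 1 e, b)) w)" if "w' \<in> path_class X x y w" for w'
    using that path_eq_map semi_simplicial_set.path_class_eqI[OF assms(1)] by (fastforce simp: path_class_def)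
  ultimately show ?thesis unfolding pi_map_def by blast
qed

lemma edge_back_pullback:
  assumes "semi_simplicial_set Y" and e: "e \<in> simplices X (Suc 0)"
  shows "edge_back X (pullback_system X Y g A) e = edge_back Y A (g (Suc 0) e)"
    and "edge_forth X (pullback_system X Y g A) e = edge_forth Y A (g (Suc 0) e)"
  using pi_map_path_class[OF assms(1) semi_simplicial_set.edge_paths(2)[OF X e]]
    pi_map_path_class[OF assms(1) semi_simplicial_set.edge_paths(1)[OF X e]] face_mapD(2)[OF g e]
  by (simp_all add: edge_back_def edge_forth_def pullback_system_def pi_edge_inv_def pi_edge_def)

lemma edge_system_pullback:
  assumes "edge_system R N Y A"
  shows "edge_system R N X (pullback_system X Y g A)"
proof -
  interpret Y: edge_system R N Y A by fact
  interpret X: semi_simplicial_set X by (rule X)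
  have st: "stalk (pullback_system X Y g A) x = stalk A (g 0 x)" for x by (simp add: pullback_system_def)
  note eb = edge_back_pullback(1)[OF Y.semi_simplicial_set_axioms, of _ A]
  show ?thesis
  proof (intro edge_system.intro edge_system_axioms.intro X Y.normed_ring_axioms)
    show "seminormed_module R N (stalk (pullback_system X Y g A) x)" if "x \<in> simplices X 0" for x
      using Y.stalk_seminormed face_mapD(1)[OF g that] by (simp add: st)
    show "edge_back X (pullback_system X Y g A) e \<in>
        sn_isos R (stalk (pullback_system X Y g A) (tgt X e)) (stalk (pullback_system X Y g A) (src X e))"
      if "e \<in> simplices X (Suc 0)" for e
      using Y.edge_back_iso[OF face_mapD(1)[OF g that]] face_mapD(2)[OF g that] by (simp add: st eb that)
    fix \<sigma> a assume s: "\<sigma> \<in> simplices X (Suc (Suc 0))"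
    assume a: "a \<in> carrier (stalk (pullback_system X Y g A) (tgt X (face X (Suc (Suc 0)) 0 \<sigma>)))"
    have f: "face X (Suc (Suc 0)) i \<sigma> \<in> simplices X (Suc 0)"
      "g (Suc 0) (face X (Suc (Suc 0)) i \<sigma>) = face Y (Suc (Suc 0)) i (g (Suc (Suc 0)) \<sigma>)" if "i \<le> Suc (Suc 0)" for i
      using X.face_in[OF s that] face_mapD(2)[OF g s that] by auto
    have "g 0 (tgt X (face X (Suc (Suc 0)) 0 \<sigma>)) = tgt Y (face Y (Suc (Suc 0)) 0 (g (Suc (Suc 0)) \<sigma>))"
      using face_mapD(2)[OF g f(1)[of 0], of 0] f(2)[of 0] by simp
    then show "edge_back X (pullback_system X Y g A) (face X (Suc (Suc 0)) (Suc (Suc 0)) \<sigma>)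
        (edge_back X (pullback_system X Y g A) (face X (Suc (Suc 0)) 0 \<sigma>) a) =
      edge_back X (pullback_system X Y g A) (face X (Suc (Suc 0)) (Suc 0) \<sigma>) a"
      using Y.edge_back_triangle[OF face_mapD(1)[OF g s], of a] a f by (simp add: st eb)
  qed
qed

end

lemma system_iso_system_map:
  assumes X: "semi_simplicial_set X" and Y: "semi_simplicial_set Y" and g: "face_map X Y g"
    and iso: "system_iso R X (pullback_system X Y g B) A \<eta>"
  shows "system_map K R X A Y B g \<eta>" and "x \<in> simplices X 0 \<Longrightarrow> \<eta> x \<in> sn_isos R (stalk B (g 0 x)) (stalk A x)"
proof -
  have st: "stalk (pullback_system X Y g B) x = stalk B (g 0 x)" for x by (simp add: pullback_system_def)
  show i: "\<eta> x \<in> sn_isos R (stalk B (g 0 x)) (stalk A x)" if "x \<in> simplices X 0" for x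
    using iso that by (simp add: system_iso_def st)
  have "\<eta> (src X e) (edge_back Y B (g (Suc 0) e) b) = edge_back X A e (\<eta> (tgt X e) b)"
    if e: "e \<in> simplices X (Suc 0)" and b: "b \<in> carrier (stalk B (g 0 (tgt X e)))" for e b
  proof -
    have "\<eta> (src X e) (edge_back X (pullback_system X Y g B) e b) = edge_back X A e (\<eta> (tgt X e) b)"
      using iso e b semi_simplicial_set.face_in[OF X e] semi_simplicial_set.edge_paths(4)[OF X e]
      by (simp add: system_iso_def st edge_back_def)
    then show ?thesis using edge_back_pullback(1)[OF X g Y e, of B] by simp
  qed
  then show "system_map K R X A Y B g \<eta>"
    using i g by (auto simp: system_map_def face_map_face_map_upto sn_isosD)
qed

section \<open>Highly connected maps and bounded cohomology\<close>

lemma (in edge_system) Bb_diff: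
  assumes "a \<in> carrier (Cb X A n)" "b \<in> Bb X A n" "a \<oplus>\<^bsub>Cb X A n\<^esub> b \<in> Bb X A n"
  shows "a \<in> Bb X A n"
proof -
  interpret C: left_module R "Cb X A n" by (rule Cb_left_module)
  have b: "b \<in> carrier (Cb X A n)" using assms(2) Bb_subset by blast
  have "(a \<oplus>\<^bsub>Cb X A n\<^esub> b) \<oplus>\<^bsub>Cb X A n\<^esub> \<ominus>\<^bsub>Cb X A n\<^esub> b = a"
    using assms(1) b by (simp add: C.a_assoc C.r_neg)
  then show ?thesis using Bb_add[OF assms(3) Bb_minus[OF assms(2)]] by simp
qed

locale kan_map_systems = kan_map X Z g + X: edge_system R N X A + Z: edge_system R N Z B
  for X :: "'x sset" and Z :: "'z sset" and g and R :: "('r, 'm) ring_scheme" and N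
    and A :: "('r, 'x, 'a) coeff_system" and B :: "('r, 'z, 'b) coeff_system" +
  fixes \<eta> :: "'x \<Rightarrow> 'b \<Rightarrow> 'a" and m :: nat
  assumes sys: "system_map K R X A Z B g \<eta>"
    and iso: "x \<in> simplices X 0 \<Longrightarrow> \<eta> x \<in> sn_isos R (stalk B (g 0 x)) (stalk A x)"
    and ne: "simplices X 0 \<noteq> {}"
    and inj: "k < m \<Longrightarrow> a \<in> simplices X k \<Longrightarrow> inj_at X Z g k a"
    and surj: "k \<le> m \<Longrightarrow> a \<in> simplices X k \<Longrightarrow> surj_at X Z g k a"
begin

abbreviation "E \<equiv> path_space X Z g"
abbreviation "AE \<equiv> pullback_system E X (\<lambda>_. fst) A"

text \<open>A coefficient over the top of a path is first carried back along the path to the image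
  of \<open>X\<close>, where \<open>\<eta>\<close> is available.\<close>

definition \<eta>_top :: "'x \<times> (nat \<Rightarrow> 'z) \<Rightarrow> 'b \<Rightarrow> 'a"
  where "\<eta>_top \<tau> = \<eta> (fst \<tau>) \<circ> edge_back Z B (snd \<tau> 0)"

lemma E_in: "\<tau> \<in> simplices E k \<longleftrightarrow> fst \<tau> \<in> simplices X k \<and> prism Z k (snd \<tau>) \<and> wall Z k (snd \<tau>) (Suc k) = g k (fst \<tau>)"
  by (cases \<tau>) (simp add: path_space_simplices)

lemma face_map_fst: "face_map E X (\<lambda>_. fst)"
  by (auto simp: face_map_def E_in path_space_face)

lemma face_map_top: "face_map E Z (path_top Z)"
  using Y.face_wall[of _ _ _ 0] by (auto simp: face_map_def E_in path_space_face intro!: Y.wall_in)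

lemma face_map_bottom: "face_map E Z (\<lambda>k \<tau>. g k (fst \<tau>))"
  using simplicial_mapD(1,2)[OF g] by (auto simp: face_map_def E_in path_space_face)

lemma E_system: "edge_system R N E AE"
  using edge_system_pullback[OF path_space_semi_simplicial face_map_fst X.edge_system_axioms] .

lemma AE_simps:
  "stalk AE \<tau> = stalk A (fst \<tau>)"
  "e \<in> simplices E (Suc 0) \<Longrightarrow> edge_back E AE e = edge_back X A (fst e)"
  using edge_back_pullback(1)[OF path_space_semi_simplicial face_map_fst X.semi_simplicial_set_axioms]
  by (simp_all add: pullback_system_def)

lemma \<eta>_nat:
  "e \<in> simplices X (Suc 0) \<Longrightarrow> b \<in> carrier (stalk B (g 0 (tgt X e))) \<Longrightarrow>
    \<eta> (src X e) (edge_back Z B (g (Suc 0) e) b) = edge_back X A e (\<eta> (tgt X e) b)"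
  using sys[of "Suc 0"] by (simp add: system_map_def)

lemma path_edge:
  assumes "\<tau> \<in> simplices E 0"
  shows "snd \<tau> 0 \<in> simplices Z (Suc 0)" "src Z (snd \<tau> 0) = g 0 (fst \<tau>)" "tgt Z (snd \<tau> 0) = path_top Z 0 \<tau>"
  using assms prism_in[of Z 0 "snd \<tau>" 0] by (auto simp: E_in wall_def)

lemma \<eta>_top_iso:
  assumes \<tau>: "\<tau> \<in> simplices E 0"
  shows "\<eta>_top \<tau> \<in> sn_isos R (stalk B (path_top Z 0 \<tau>)) (stalk AE \<tau>)"
proof -
  note e = path_edge[OF \<tau>]
  have t: "tgt Z (snd \<tau> 0) \<in> simplices Z 0" using e(1) by (simp add: Y.face_in)
  have x: "fst \<tau> \<in> simplices X 0" using \<tau> by (simp add: E_in)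
  interpret S: left_module R "stalk B (path_top Z 0 \<tau>)" using Z.stalk_left_module[OF t] e by simp
  show ?thesis unfolding \<eta>_top_def AE_simps
    by (rule sn_isos_compose[OF S.abelian_group_axioms S.smult_closed])
      (use Z.edge_back_iso[OF e(1)] iso[OF x] e in auto)
qed

text \<open>A prism over an edge is a square cut by a diagonal. The triangle relation in its two
  halves shows that going back along the top edge and then down one side equals going down the other
  side and then back along the bottom edge; naturality of \<open>\<eta>\<close> handles the bottom
  edge.\<close>

lemma top_system_map: "system_map K R E AE Z B (path_top Z) \<eta>_top"
proof -
  have "\<eta>_top (src E \<tau>) (edge_back Z B (path_top Z (Suc 0) \<tau>) b) = edge_back E AE \<tau> (\<eta>_top (tgt E \<tau>) b)"
    if \<tau>: "\<tau> \<in> simplices E (Suc 0)" and b: "b \<in> carrier (stalk B (path_top Z 0 (tgt E \<tau>)))" for \<tau> b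
  proof -
    let ?h = "snd \<tau>" and ?e = "fst \<tau>"
    have e: "?e \<in> simplices X (Suc 0)" and h: "prism Z (Suc 0) ?h" and bot: "wall Z (Suc 0) ?h (Suc (Suc 0)) = g (Suc 0) ?e"
      using \<tau> by (auto simp: E_in)
    have hin: "?h 0 \<in> simplices Z (Suc (Suc 0))" "?h (Suc 0) \<in> simplices Z (Suc (Suc 0))"
      using prism_in[OF h] by auto
    have adj: "face Z (Suc (Suc 0)) (Suc 0) (?h 0) = face Z (Suc (Suc 0)) (Suc 0) (?h (Suc 0))"
      using h by (simp add: prism_def)
    have bot': "face Z (Suc (Suc 0)) (Suc (Suc 0)) (?h (Suc 0)) = g (Suc 0) ?e" using bot by (simp add: wall_def)
    have tE: "tgt E \<tau> \<in> simplices E 0" using semi_simplicial_set.face_in[OF path_space_semi_simplicial \<tau>] by simp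
    note pe = path_edge[OF tE]
    have tgt_e: "snd (tgt E \<tau>) 0 = face Z (Suc (Suc 0)) 0 (?h (Suc 0))" "fst (tgt E \<tau>) = tgt X ?e"
      by (simp_all add: path_space_face prism_face_def)
    have src_e: "snd (src E \<tau>) 0 = face Z (Suc (Suc 0)) (Suc (Suc 0)) (?h 0)" "fst (src E \<tau>) = src X ?e"
      by (simp_all add: path_space_face prism_face_def)
    have top: "path_top Z (Suc 0) \<tau> = face Z (Suc (Suc 0)) 0 (?h 0)" by (simp add: wall_def)
    have b1: "b \<in> carrier (stalk B (tgt Z (face Z (Suc (Suc 0)) 0 (?h (Suc 0)))))"
      using b pe(3) tgt_e by simp
    have b0: "b \<in> carrier (stalk B (tgt Z (face Z (Suc (Suc 0)) 0 (?h 0))))"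
      using b1 Y.triangle_edges(3)[OF hin(1)] Y.triangle_edges(3)[OF hin(2)] adj by simp
    have c: "edge_back Z B (face Z (Suc (Suc 0)) 0 (?h (Suc 0))) b \<in> carrier (stalk B (g 0 (tgt X ?e)))"
      using linear_mapsD(1)[OF sn_isosD(2)[OF Z.edge_back_iso[OF pe(1)]]] b pe tgt_e by simp
    have "\<eta>_top (src E \<tau>) (edge_back Z B (path_top Z (Suc 0) \<tau>) b) =
        \<eta> (src X ?e) (edge_back Z B (face Z (Suc (Suc 0)) (Suc 0) (?h 0)) b)"
      using Z.edge_back_triangle[OF hin(1) b0] by (simp add: \<eta>_top_def src_e top)
    also have "\<dots> = \<eta> (src X ?e) (edge_back Z B (g (Suc 0) ?e) (edge_back Z B (face Z (Suc (Suc 0)) 0 (?h (Suc 0))) b))"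
      using Z.edge_back_triangle[OF hin(2) b1] adj bot' by simp
    also have "\<dots> = edge_back X A ?e (\<eta> (tgt X ?e) (edge_back Z B (face Z (Suc (Suc 0)) 0 (?h (Suc 0))) b))"
      by (rule \<eta>_nat[OF e c])
    finally show ?thesis using AE_simps(2)[OF \<tau>] by (simp add: \<eta>_top_def tgt_e)
  qed
  then show ?thesis
    using \<eta>_top_iso face_map_face_map_upto[OF face_map_top] unfolding system_map_def
    by (intro conjI ballI impI) (blast intro: sn_isosD(1))+
qed

lemma top_lifting: "sphere_lifting_systems E Z (path_top Z) m R N AE B \<eta>_top"
proof -
  have "sphere_lifting E Z (path_top Z) m"
    using path_space_lifts_spheres[OF ne, of m] inj surj
    by (intro sphere_lifting.intro sphere_lifting_axioms.intro path_space_semi_simplicial face_map_top) 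
      (auto intro: Y.simplicial_set_axioms)
  then show ?thesis
    using E_system Z.edge_system_axioms top_system_map \<eta>_top_iso
    by (intro sphere_lifting_systems.intro sphere_lifting_systems_axioms.intro) auto
qed

lemma cochain_map_g: "cochain_map K R N X A Z B g \<eta>"
  using sys by (intro cochain_map.intro cochain_map_axioms.intro X.edge_system_axioms Z.edge_system_axioms)

lemma cochain_map_fst: "cochain_map K R N E AE X A (\<lambda>_. fst) (\<lambda>_ a. a)"
proof (intro cochain_map.intro cochain_map_axioms.intro X.edge_system_axioms E_system)
  show "system_map K R E AE X A (\<lambda>_. fst) (\<lambda>_ a. a)"
    using face_map_face_map_upto[OF face_map_fst, of K]
    by (auto simp: system_map_def AE_simps sn_maps_def linear_maps_def path_space_face)
qed

lemma cochain_map_bottom: "cochain_map K R N E AE Z B (\<lambda>k \<tau>. g k (fst \<tau>)) (\<lambda>\<tau>. \<eta> (fst \<tau>))"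
proof (intro cochain_map.intro cochain_map_axioms.intro Z.edge_system_axioms E_system)
  show "system_map K R E AE Z B (\<lambda>k \<tau>. g k (fst \<tau>)) (\<lambda>\<tau>. \<eta> (fst \<tau>))"
    using face_map_face_map_upto[OF face_map_bottom, of K] \<eta>_nat
    by (auto simp: system_map_def AE_simps path_space_face E_in sn_isosD(1)[OF iso])
qed

text \<open>Constant paths are a section of the projection to \<open>X\<close>. They bring
  statements about the cohomology of the path space back to \<open>X\<close>.\<close>

lemma cochain_map_const: "cochain_map K R N X A E AE (\<lambda>k x. (x, constant_prism Z k (g k x))) (\<lambda>_ a. a)"
proof (intro cochain_map.intro cochain_map_axioms.intro X.edge_system_axioms E_system)
  have cin: "(x, constant_prism Z k (g k x)) \<in> simplices E k" if "x \<in> simplices X k" for k x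
    using Y.constant_prism[of "g k x" k] simplicial_mapD(1)[OF g] that by (simp add: path_space_simplices)
  have "face_map X E (\<lambda>k x. (x, constant_prism Z k (g k x)))"
    using cin Y.prism_face_constant_prism simplicial_mapD(1,2)[OF g]
    by (auto simp: face_map_def path_space_face)
  then show "system_map K R X A E AE (\<lambda>k x. (x, constant_prism Z k (g k x))) (\<lambda>_ a. a)"
    using face_map_face_map_upto cin
    by (auto simp: system_map_def AE_simps sn_maps_def linear_maps_def)
qed

text \<open>The second components of the simplices of the path space form a tautological homotopy
  from the bottom map to the top map. The homotopy formula for it has exactly the transport built
  into \<open>\<eta>_top\<close>.\<close>

lemma pullback_bottom:
  assumes \<phi>: "\<phi> \<in> Zb Z B n"
  obtains b where "b \<in> Bb E AE n"
    "pullback_cochain E (\<lambda>_. fst) (\<lambda>_ a. a) n (pullback_cochain X g \<eta> n \<phi>) =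
      pullback_cochain E (path_top Z) \<eta>_top n \<phi> \<oplus>\<^bsub>Cb E AE n\<^esub> b"
proof -
  interpret E: edge_system R N E AE by (rule E_system)
  interpret Cn: left_module R "Cb E AE n" by (rule E.Cb_left_module)
  have \<phi>C: "\<phi> \<in> carrier (Cb Z B n)" using \<phi> by (simp add: Zb_def)
  have vf: "fst (vertex0 E n \<tau>) = vertex0 X n (fst \<tau>)" if "\<tau> \<in> simplices E n" for \<tau>
    using cochain_map.map_vertex0[OF cochain_map_fst le_refl that] by simp
  obtain b where b: "b \<in> Bb E AE n" "\<And>\<tau>. \<tau> \<in> simplices E n \<Longrightarrow>
    pullback_cochain E (\<lambda>k \<tau>. g k (fst \<tau>)) (\<lambda>\<tau>. \<eta> (fst \<tau>)) n \<phi> \<tau> =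
      \<eta> (fst (vertex0 E n \<tau>)) (edge_back Z B (snd (vertex0 E n \<tau>) 0) (\<phi> (wall Z n (snd \<tau>) 0)))
      \<oplus>\<^bsub>stalk AE (vertex0 E n \<tau>)\<^esub> b \<tau>"
  proof (rule cochain_map.prism_homotopy[OF cochain_map_bottom le_refl _ _ \<phi>, of "\<lambda>_. snd"])
    show "prism Z k (snd \<tau>) \<and> wall Z k (snd \<tau>) (Suc k) = g k (fst \<tau>)" if "\<tau> \<in> simplices E k" for k \<tau>
      using that by (simp add: E_in)
  qed (auto simp: path_space_face)
  let ?a = "pullback_cochain E (\<lambda>_. fst) (\<lambda>_ a. a) n (pullback_cochain X g \<eta> n \<phi>)"
  let ?t = "pullback_cochain E (path_top Z) \<eta>_top n \<phi>"
  have "?a = ?t \<oplus>\<^bsub>Cb E AE n\<^esub> b"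
  proof (rule Cb_eqI[of _ E AE])
    show "?a \<in> carrier (Cb E AE n)"
      using cochain_map.pullback_in[OF cochain_map_fst le_refl cochain_map.pullback_in[OF cochain_map_g le_refl \<phi>C]] .
    have "?t \<in> carrier (Cb E AE n)"
      using cochain_map.pullback_in[OF sphere_lifting_systems.cochain_map_q[OF top_lifting], of n] \<phi>C
        cochain_map.pullback_in[of n R N E AE Z B "path_top Z" \<eta>_top n \<phi>]
        cochain_map.intro[OF E_system Z.edge_system_axioms cochain_map_axioms.intro[OF top_system_map]] by blast
    then show "?t \<oplus>\<^bsub>Cb E AE n\<^esub> b \<in> carrier (Cb E AE n)" using b(1) E.Bb_subset by blast
    fix \<tau> assume \<tau>: "\<tau> \<in> simplices E n"
    then show "?a \<tau> = (?t \<oplus>\<^bsub>Cb E AE n\<^esub> b) \<tau>"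
      using b(2)[OF \<tau>] vf[OF \<tau>] by (auto simp: pullback_cochain_def Cb_simps E_in \<eta>_top_def)
  qed
  then show thesis using that b(1) by blast
qed

text \<open>Up to coboundaries, pulling back along \<open>g\<close> and then to the path space is
  pulling back along the top projection, for which the result is known. Injectivity is immediate;
  for surjectivity a decomposition found on the path space is restricted to constant paths.\<close>

lemma cohomology_of_connected_map:
  shows "n \<le> m \<Longrightarrow> cohomology_inj X A Z B g \<eta> n"
    and "n < m \<Longrightarrow> cohomology_surj X A Z B g \<eta> n"
proof -
  interpret E: edge_system R N E AE by (rule E_system)
  interpret CE: left_module R "Cb E AE n" by (rule E.Cb_left_module)
  interpret top: cochain_map n R N E AE Z B "path_top Z" \<eta>_top
    by (intro cochain_map.intro cochain_map_axioms.intro E_system Z.edge_system_axioms top_system_map)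
  note T = sphere_lifting_systems.sphere_lifting_cohomology[OF top_lifting, of n]
  show "cohomology_inj X A Z B g \<eta> n" if n: "n \<le> m"
    unfolding cohomology_inj_def
  proof (intro ballI impI)
    fix \<psi> assume \<psi>: "\<psi> \<in> Zb Z B n" and p: "pullback_cochain X g \<eta> n \<psi> \<in> Bb X A n"
    obtain b where b: "b \<in> Bb E AE n"
      "pullback_cochain E (\<lambda>_. fst) (\<lambda>_ a. a) n (pullback_cochain X g \<eta> n \<psi>) =
        pullback_cochain E (path_top Z) \<eta>_top n \<psi> \<oplus>\<^bsub>Cb E AE n\<^esub> b"
      using pullback_bottom[OF \<psi>] by blast
    have "pullback_cochain E (path_top Z) \<eta>_top n \<psi> \<oplus>\<^bsub>Cb E AE n\<^esub> b \<in> Bb E AE n"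
      using cochain_map.pullback_Bb[OF cochain_map_fst le_refl p] b(2) by simp
    then have "pullback_cochain E (path_top Z) \<eta>_top n \<psi> \<in> Bb E AE n"
      using E.Bb_diff[OF top.pullback_in[OF le_refl] b(1)] \<psi> by (simp add: Zb_def)
    then show "\<psi> \<in> Bb Z B n" using T(1)[OF n] \<psi> by (simp add: cohomology_inj_def)
  qed
  show "cohomology_surj X A Z B g \<eta> n" if n: "n < m"
    unfolding cohomology_surj_def
  proof
    fix \<phi> assume \<phi>: "\<phi> \<in> Zb X A n"
    let ?e = "pullback_cochain E (\<lambda>_. fst) (\<lambda>_ a. a) n"
    let ?c = "pullback_cochain X (\<lambda>k x. (x, constant_prism Z k (g k x))) (\<lambda>_ a. a) n"
    have ce: "?c (?e \<chi>) = \<chi>" if "\<chi> \<in> carrier (Cb X A n)" for \<chi>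
      using that cochain_map.fm[OF cochain_map_const, of n]
      by (intro extensionalityI[of _ "simplices X n"])
        (auto simp: pullback_cochain_def Cb_carrier_iff face_map_upto_def)
    have "?e \<phi> \<in> Zb E AE n" using cochain_map.pullback_Zb[OF cochain_map_fst le_refl \<phi>] .
    then obtain \<psi> b' where \<psi>: "\<psi> \<in> Zb Z B n" and b': "b' \<in> Bb E AE n"
      "?e \<phi> = pullback_cochain E (path_top Z) \<eta>_top n \<psi> \<oplus>\<^bsub>Cb E AE n\<^esub> b'"
      using T(2)[OF n] unfolding cohomology_surj_def by blast
    obtain b where b: "b \<in> Bb E AE n"
      "?e (pullback_cochain X g \<eta> n \<psi>) = pullback_cochain E (path_top Z) \<eta>_top n \<psi> \<oplus>\<^bsub>Cb E AE n\<^esub> b"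
      using pullback_bottom[OF \<psi>] by blast
    have \<psi>C: "\<psi> \<in> carrier (Cb Z B n)" using \<psi> by (simp add: Zb_def)
    have g\<psi>: "pullback_cochain X g \<eta> n \<psi> \<in> carrier (Cb X A n)"
      using cochain_map.pullback_in[OF cochain_map_g le_refl \<psi>C] .
    let ?d = "\<ominus>\<^bsub>Cb E AE n\<^esub> b \<oplus>\<^bsub>Cb E AE n\<^esub> b'"
    have d: "?d \<in> Bb E AE n" using E.Bb_add E.Bb_minus b(1) b'(1) by blast
    have bc: "b \<in> carrier (Cb E AE n)" "b' \<in> carrier (Cb E AE n)" "?d \<in> carrier (Cb E AE n)"
      using b(1) b'(1) d E.Bb_subset by blast+
    have "?e \<phi> = ?e (pullback_cochain X g \<eta> n \<psi>) \<oplus>\<^bsub>Cb E AE n\<^esub> ?d"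
    proof -
      have "b \<oplus>\<^bsub>Cb E AE n\<^esub> ?d = b'" using bc by (simp add: CE.a_assoc[symmetric] CE.r_neg)
      then show ?thesis unfolding b'(2) b(2) using bc top.pullback_in[OF le_refl \<psi>C] by (simp add: CE.a_assoc)
    qed
    then have "?c (?e \<phi>) = ?c (?e (pullback_cochain X g \<eta> n \<psi>)) \<oplus>\<^bsub>Cb X A n\<^esub> ?c ?d"
      using linear_mapsD(2)[OF cochain_map.pullback_linear[OF cochain_map_const le_refl]]
        cochain_map.pullback_in[OF cochain_map_fst le_refl g\<psi>] bc by simp
    then have "\<phi> = pullback_cochain X g \<eta> n \<psi> \<oplus>\<^bsub>Cb X A n\<^esub> ?c ?d"
      using ce[OF g\<psi>] ce[of \<phi>] \<phi> by (simp add: Zb_def)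
    moreover have "?c ?d \<in> Bb X A n" using cochain_map.pullback_Bb[OF cochain_map_const le_refl d] .
    ultimately show "\<exists>\<psi>\<in>Zb Z B n. \<exists>b\<in>Bb X A n. \<phi> = pullback_cochain X g \<eta> n \<psi> \<oplus>\<^bsub>Cb X A n\<^esub> b"
      using \<psi> by blast
  qed
qed

end

section \<open>Degree 0 cohomology of the fibres\<close>

context edge_system begin

lemma Zb_submodule:
  shows "\<zero>\<^bsub>Cb X A n\<^esub> \<in> Zb X A n"
    and "\<phi> \<in> Zb X A n \<Longrightarrow> \<psi> \<in> Zb X A n \<Longrightarrow> \<phi> \<oplus>\<^bsub>Cb X A n\<^esub> \<psi> \<in> Zb X A n"
    and "r \<in> carrier R \<Longrightarrow> \<phi> \<in> Zb X A n \<Longrightarrow> r \<odot>\<^bsub>Cb X A n\<^esub> \<phi> \<in> Zb X A n"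
proof -
  interpret C: left_module R "Cb X A n" by (rule Cb_left_module)
  interpret C': left_module R "Cb X A (Suc n)" by (rule Cb_left_module)
  show "\<zero>\<^bsub>Cb X A n\<^esub> \<in> Zb X A n"
    using C.linear_zero[OF coboundary_linear Cb_left_module] Cb_zero by (simp add: Zb_def)
  show "\<phi> \<oplus>\<^bsub>Cb X A n\<^esub> \<psi> \<in> Zb X A n" if "\<phi> \<in> Zb X A n" "\<psi> \<in> Zb X A n"
    using that linear_mapsD(2)[OF coboundary_linear, of \<phi> n \<psi>] by (simp add: Zb_def)
  show "r \<odot>\<^bsub>Cb X A n\<^esub> \<phi> \<in> Zb X A n" if "r \<in> carrier R" "\<phi> \<in> Zb X A n"
    using that linear_mapsD(3)[OF coboundary_linear, of r \<phi> n] C.smult_closed C'.smult_zero_right by (simp add: Zb_def)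
qed

lemma snorm_Cb_upper:
  assumes "\<phi> \<in> carrier (Cb X A n)" "\<sigma> \<in> simplices X n"
  shows "snorm (stalk A (vertex0 X n \<sigma>)) (\<phi> \<sigma>) \<le> snorm (Cb X A n) \<phi>"
proof -
  obtain K where "0 \<le> K" "\<And>\<sigma>. \<sigma> \<in> simplices X n \<Longrightarrow> snorm (stalk A (vertex0 X n \<sigma>)) (\<phi> \<sigma>) \<le> K"
    using Cb_bounded_by[OF assms(1)] by metis
  then have "bdd_above (insert 0 ((\<lambda>\<sigma>. snorm (stalk A (vertex0 X n \<sigma>)) (\<phi> \<sigma>)) ` simplices X n))"
    by (intro bdd_aboveI[of _ K]) auto
  then show ?thesis using assms(2) by (auto simp: Cb_simps intro: cSup_upper)
qed

lemma snorm_Cb_least: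
  assumes "0 \<le> K" "\<And>\<sigma>. \<sigma> \<in> simplices X n \<Longrightarrow> snorm (stalk A (vertex0 X n \<sigma>)) (\<phi> \<sigma>) \<le> K"
  shows "snorm (Cb X A n) \<phi> \<le> K"
  using assms by (auto simp: Cb_simps intro!: cSup_least)

lemma snorm_Cb_nonneg:
  assumes "\<phi> \<in> carrier (Cb X A n)"
  shows "0 \<le> snorm (Cb X A n) \<phi>"
proof -
  obtain K where "0 \<le> K" "\<And>\<sigma>. \<sigma> \<in> simplices X n \<Longrightarrow> snorm (stalk A (vertex0 X n \<sigma>)) (\<phi> \<sigma>) \<le> K"
    using Cb_bounded_by[OF assms(1)] by metis
  then have "bdd_above (insert 0 ((\<lambda>\<sigma>. snorm (stalk A (vertex0 X n \<sigma>)) (\<phi> \<sigma>)) ` simplices X n))"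
    by (intro bdd_aboveI[of _ K]) auto
  then show ?thesis by (auto simp: Cb_simps intro: cSup_upper)
qed

lemma cocycles_seminormed_module: "seminormed_module R N (Cb X A n\<lparr>carrier := Zb X A n\<rparr>)"
proof -
  interpret C: left_module R "Cb X A n" by (rule Cb_left_module)
  let ?Z = "Cb X A n\<lparr>carrier := Zb X A n\<rparr>"
  have sub: "\<phi> \<in> carrier (Cb X A n)" if "\<phi> \<in> Zb X A n" for \<phi> using that by (simp add: Zb_def)
  have "abelian_group ?Z"
  proof (rule abelian_groupI)
    fix \<phi> assume "\<phi> \<in> carrier ?Z"
    then show "\<exists>\<psi>\<in>carrier ?Z. \<psi> \<oplus>\<^bsub>?Z\<^esub> \<phi> = \<zero>\<^bsub>?Z\<^esub>"
      using Zb_submodule(3)[of "\<ominus>\<^bsub>R\<^esub> \<one>\<^bsub>R\<^esub>" \<phi> n] C.smult_minus_one[of \<phi>] sub[of \<phi>] C.l_neg[of \<phi>]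
      by (auto intro!: bexI[of _ "\<ominus>\<^bsub>Cb X A n\<^esub> \<phi>"])
  qed (use Zb_submodule sub in \<open>auto simp: C.a_ac\<close>)
  then have mod: "left_module R ?Z"
    by (intro left_module.intro left_module_axioms.intro ring_axioms)
      (use Zb_submodule sub in \<open>auto simp: C.smult_l_distr C.smult_r_distr C.smult_assoc C.smult_one\<close>)
  show ?thesis
  proof (intro seminormed_module.intro seminormed_module_axioms.intro mod)
    show "0 \<le> snorm ?Z \<phi>" if "\<phi> \<in> carrier ?Z" for \<phi>
      using snorm_Cb_nonneg[OF sub, of \<phi>] that by (simp add: Cb_simps)
    have "snorm (stalk A (vertex0 X n \<sigma>)) (\<zero>\<^bsub>Cb X A n\<^esub> \<sigma>) \<le> 0" if "\<sigma> \<in> simplices X n" for \<sigma>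
    proof -
      interpret M: seminormed_module_over R N "stalk A (vertex0 X n \<sigma>)" using stalk_over_simplex[OF that] .
      show ?thesis using that M.snorm_zero by (simp add: Cb_simps)
    qed
    then have "snorm (Cb X A n) \<zero>\<^bsub>Cb X A n\<^esub> \<le> 0" by (intro snorm_Cb_least) auto
    then show "snorm ?Z \<zero>\<^bsub>?Z\<^esub> = 0" using snorm_Cb_nonneg[OF Cb_zero, of n] by simp
    fix r \<phi> \<psi> assume r: "r \<in> carrier R" and "\<phi> \<in> carrier ?Z" "\<psi> \<in> carrier ?Z"
    then have \<phi>: "\<phi> \<in> carrier (Cb X A n)" and \<psi>: "\<psi> \<in> carrier (Cb X A n)" using sub by auto
    have "snorm (Cb X A n) (r \<odot>\<^bsub>Cb X A n\<^esub> \<phi> \<oplus>\<^bsub>Cb X A n\<^esub> \<psi>) \<le> N r * snorm (Cb X A n) \<phi> + snorm (Cb X A n) \<psi>"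
    proof (rule snorm_Cb_least)
      show "0 \<le> N r * snorm (Cb X A n) \<phi> + snorm (Cb X A n) \<psi>"
        using snorm_Cb_nonneg[OF \<phi>] snorm_Cb_nonneg[OF \<psi>] norm_nonneg[OF r] by simp
      fix \<sigma> assume \<sigma>: "\<sigma> \<in> simplices X n"
      interpret M: seminormed_module_over R N "stalk A (vertex0 X n \<sigma>)" using stalk_over_simplex[OF \<sigma>] .
      have "N r * snorm (stalk A (vertex0 X n \<sigma>)) (\<phi> \<sigma>) \<le> N r * snorm (Cb X A n) \<phi>"
        using snorm_Cb_upper[OF \<phi> \<sigma>] norm_nonneg[OF r] by (rule mult_left_mono)
      then show "snorm (stalk A (vertex0 X n \<sigma>)) ((r \<odot>\<^bsub>Cb X A n\<^esub> \<phi> \<oplus>\<^bsub>Cb X A n\<^esub> \<psi>) \<sigma>) \<le>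
          N r * snorm (Cb X A n) \<phi> + snorm (Cb X A n) \<psi>"
        using M.snorm_smult_add[OF r Cb_in[OF \<phi> \<sigma>] Cb_in[OF \<psi> \<sigma>]] snorm_Cb_upper[OF \<psi> \<sigma>] \<sigma>
        by (simp add: Cb_simps(2,3))
    qed
    then show "snorm ?Z (r \<odot>\<^bsub>?Z\<^esub> \<phi> \<oplus>\<^bsub>?Z\<^esub> \<psi>) \<le> N r * snorm ?Z \<phi> + snorm ?Z \<psi>" by simp
  qed
qed

lemma coboundary_0:
  assumes "\<phi> \<in> carrier (Cb X A 0)" "e \<in> simplices X (Suc 0)"
  shows "coboundary X A 0 \<phi> e = edge_back X A e (\<phi> (tgt X e)) \<oplus>\<^bsub>stalk A (src X e)\<^esub> \<ominus>\<^bsub>stalk A (src X e)\<^esub> \<phi> (src X e)"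
    and "coboundary X A 0 \<phi> e = \<zero>\<^bsub>stalk A (src X e)\<^esub> \<longleftrightarrow> edge_back X A e (\<phi> (tgt X e)) = \<phi> (src X e)"
proof -
  have x: "src X e \<in> simplices X 0" using assms(2) by (simp add: face_in)
  interpret M: abelian_group "stalk A (src X e)" using stalk_abelian_group[OF x] .
  have v: "vertex0 X (Suc 0) e = src X e" by (simp add: vertex0.simps(2))
  have c: "coboundary_term X A 0 \<phi> e 0 \<in> carrier (stalk A (src X e))"
    "coboundary_term X A 0 \<phi> e (Suc 0) \<in> carrier (stalk A (src X e))"
    using coboundary_term_in(1)[OF assms] v by auto
  have "coboundary X A 0 \<phi> e = signed (stalk A (src X e)) (Suc 0) (coboundary_term X A 0 \<phi> e (Suc 0))
      \<oplus>\<^bsub>stalk A (src X e)\<^esub> coboundary_term X A 0 \<phi> e 0"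
    unfolding coboundary_eq[OF assms] v using c
    by (subst M.finsum_Suc) (auto simp: signed_def Pi_iff le_Suc_eq)
  then have eq: "coboundary X A 0 \<phi> e = coboundary_term X A 0 \<phi> e 0 \<oplus>\<^bsub>stalk A (src X e)\<^esub>
      \<ominus>\<^bsub>stalk A (src X e)\<^esub> coboundary_term X A 0 \<phi> e (Suc 0)"
    using c by (simp add: signed_def M.a_comm)
  then show "coboundary X A 0 \<phi> e = edge_back X A e (\<phi> (tgt X e)) \<oplus>\<^bsub>stalk A (src X e)\<^esub> \<ominus>\<^bsub>stalk A (src X e)\<^esub> \<phi> (src X e)"
    by (simp add: coboundary_term_def)
  have "a \<oplus>\<^bsub>stalk A (src X e)\<^esub> \<ominus>\<^bsub>stalk A (src X e)\<^esub> b = \<zero>\<^bsub>stalk A (src X e)\<^esub> \<longleftrightarrow> a = b"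
    if "a \<in> carrier (stalk A (src X e))" "b \<in> carrier (stalk A (src X e))" for a b
    using that M.r_neg M.minus_equality[of a "\<ominus>\<^bsub>stalk A (src X e)\<^esub> b"] M.minus_minus by auto
  from this[OF c] eq show "coboundary X A 0 \<phi> e = \<zero>\<^bsub>stalk A (src X e)\<^esub> \<longleftrightarrow> edge_back X A e (\<phi> (tgt X e)) = \<phi> (src X e)"
    by (simp add: coboundary_term_def)
qed

end

locale fibration_system = Z: simplicial_set Z + Y: simplicial_set Y + Z: local_system_on R N Z A
  for R :: "('r, 'm) ring_scheme" and N :: "'r \<Rightarrow> real" and Z :: "'z sset" and Y :: "'y sset"
    and A :: "('r, 'z, 'b) coeff_system" +
  fixes p :: "nat \<Rightarrow> 'z \<Rightarrow> 'y"
  assumes fib: "kan_fibration Z Y p"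
begin

lemma p: "simplicial_map Z Y p" "face_map Z Y p"
  using fib simplicial_map_face_map by (auto simp: kan_fibration_def)

lemmas p_in = simplicial_mapD(1)[OF p(1)]
lemmas p_face = simplicial_mapD(2)[OF p(1)]

abbreviation "F y \<equiv> fibre Z Y p y"
abbreviation "FA y \<equiv> fibre_system Z Y p A y"
abbreviation "H0 \<equiv> fibre_Hb0 Z Y p A"
abbreviation "AH \<equiv> Hb0_system Z Y p A"
abbreviation "Ed \<equiv> simplices Z (Suc 0)"

lemma F_simps:
  "\<sigma> \<in> simplices (F y) n \<longleftrightarrow> \<sigma> \<in> simplices Z n \<and> p n \<sigma> = const_simplex Y n y"
  "face (F y) = face Z"
  by (auto simp: fibre_def)

context
  fixes y assumes y: "y \<in> simplices Y 0"
begin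

lemma F_semi: "semi_simplicial_set (F y)"
proof
  show "face (F y) (Suc n) i \<sigma> \<in> simplices (F y) n" if "\<sigma> \<in> simplices (F y) (Suc n)" "i \<le> Suc n" for n i \<sigma>
    using that Z.face_in p_face[of \<sigma> n i] Y.face_const_simplex[OF y, of i n] by (simp add: F_simps)
  show "face (F y) (Suc n) i (face (F y) (Suc (Suc n)) j \<sigma>) = face (F y) (Suc n) (j - 1) (face (F y) (Suc (Suc n)) i \<sigma>)"
    if "\<sigma> \<in> simplices (F y) (Suc (Suc n))" "i < j" "j \<le> Suc (Suc n)" for n i j \<sigma>
    using that Z.face_comm[of \<sigma> n i j] by (simp add: F_simps)
qed

lemma F_face_map: "face_map (F y) Z (\<lambda>_ \<sigma>. \<sigma>)"
  by (simp add: face_map_def F_simps)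

lemma F_system: "edge_system R N (F y) (FA y)"
  unfolding fibre_system_def
  by (rule edge_system_pullback[OF F_semi F_face_map Z.edge_system_axioms])

lemma FA_simps:
  "stalk (FA y) x = stalk A x"
  "e \<in> simplices (F y) (Suc 0) \<Longrightarrow> edge_back (F y) (FA y) e = edge_back Z A e"
  using edge_back_pullback(1)[OF F_semi F_face_map Z.semi_simplicial_set_axioms]
  by (simp_all add: fibre_system_def pullback_system_def)

lemma H0_seminormed: "seminormed_module R N (H0 y)"
  unfolding fibre_Hb0_def using edge_system.cocycles_seminormed_module[OF F_system] .

lemma F_edge: "e \<in> simplices (F y) (Suc 0) \<longleftrightarrow> e \<in> Ed \<and> p (Suc 0) e = degen Y 0 0 y"
  by (simp add: F_simps)

lemma F_vertex: "x \<in> simplices (F y) 0 \<longleftrightarrow> x \<in> simplices Z 0 \<and> p 0 x = y"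
  by (simp add: F_simps)

text \<open>Edges of a fibre are the edges over the degenerate edge at \<open>y\<close>, and the
  cocycle condition on such an edge is invariance under its transport. This is the description by
  bounded compatible families.\<close>

lemma H0_iff:
  "s \<in> carrier (H0 y) \<longleftrightarrow> s \<in> extensional {x \<in> simplices Z 0. p 0 x = y} \<and>
    (\<forall>x\<in>simplices Z 0. p 0 x = y \<longrightarrow> s x \<in> carrier (stalk A x)) \<and>
    (\<exists>K. \<forall>x\<in>simplices Z 0. p 0 x = y \<longrightarrow> snorm (stalk A x) (s x) \<le> K) \<and>
    (\<forall>e\<in>Ed. p (Suc 0) e = degen Y 0 0 y \<longrightarrow> edge_back Z A e (s (tgt Z e)) = s (src Z e))"
proof -
  interpret F: edge_system R N "F y" "FA y" by (rule F_system)
  have sF: "simplices (F y) 0 = {x \<in> simplices Z 0. p 0 x = y}" using F_vertex by blast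
  have v: "vertex0 (F y) (Suc 0) e = src Z e" for e by (simp add: vertex0.simps(2) F_simps(2))
  have C: "s \<in> carrier (Cb (F y) (FA y) 0) \<longleftrightarrow> s \<in> extensional {x \<in> simplices Z 0. p 0 x = y} \<and>
    (\<forall>x\<in>simplices Z 0. p 0 x = y \<longrightarrow> s x \<in> carrier (stalk A x)) \<and>
    (\<exists>K. \<forall>x\<in>simplices Z 0. p 0 x = y \<longrightarrow> snorm (stalk A x) (s x) \<le> K)"
    unfolding Cb_carrier_iff sF by (auto simp: FA_simps)
  have "(\<forall>e\<in>simplices (F y) (Suc 0). coboundary (F y) (FA y) 0 s e = \<zero>\<^bsub>stalk (FA y) (vertex0 (F y) (Suc 0) e)\<^esub>) \<longleftrightarrow>
    (\<forall>e\<in>Ed. p (Suc 0) e = degen Y 0 0 y \<longrightarrow> edge_back Z A e (s (tgt Z e)) = s (src Z e))"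
    if "s \<in> carrier (Cb (F y) (FA y) 0)"
    using F.coboundary_0(2)[OF that] FA_simps(2) F_edge v by (auto simp: F_simps(2) FA_simps(1))
  then show ?thesis unfolding fibre_Hb0_def using C by (auto simp: F.Zb_iff)
qed

lemma H0_in: "s \<in> carrier (H0 y) \<Longrightarrow> x \<in> simplices Z 0 \<Longrightarrow> p 0 x = y \<Longrightarrow> s x \<in> carrier (stalk A x)"
  by (simp add: H0_iff)

lemma H0_back: "s \<in> carrier (H0 y) \<Longrightarrow> e \<in> Ed \<Longrightarrow> p (Suc 0) e = degen Y 0 0 y \<Longrightarrow>
    edge_back Z A e (s (tgt Z e)) = s (src Z e)"
  by (simp add: H0_iff)

lemma degen_edge_ends:
  "e \<in> Ed \<Longrightarrow> p (Suc 0) e = degen Y 0 0 y \<Longrightarrow> p 0 (src Z e) = y \<and> p 0 (tgt Z e) = y"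
  using p_face[of e 0] Y.face_degen_eq[OF y, of 0] by simp

lemma H0_forth:
  assumes "s \<in> carrier (H0 y)" "e \<in> Ed" "p (Suc 0) e = degen Y 0 0 y"
  shows "edge_forth Z A e (s (src Z e)) = s (tgt Z e)"
  using H0_back[OF assms] Z.edge_forth_back(4)[OF assms(2), of "s (tgt Z e)"]
    H0_in[OF assms(1), of "tgt Z e"] degen_edge_ends[OF assms(2,3)] assms(2)
  by (simp add: Z.face_in)

lemma H0_eqI:
  assumes "s \<in> carrier (H0 y)" "t \<in> carrier (H0 y)" "\<And>x. x \<in> simplices Z 0 \<Longrightarrow> p 0 x = y \<Longrightarrow> s x = t x"
  shows "s = t"
  using assms by (intro extensionalityI[of s "{x \<in> simplices Z 0. p 0 x = y}"]) (auto simp: H0_iff)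

lemma H0_simps:
  "\<zero>\<^bsub>H0 y\<^esub> = (\<lambda>x\<in>{x \<in> simplices Z 0. p 0 x = y}. \<zero>\<^bsub>stalk A x\<^esub>)"
  "s \<oplus>\<^bsub>H0 y\<^esub> t = (\<lambda>x\<in>{x \<in> simplices Z 0. p 0 x = y}. s x \<oplus>\<^bsub>stalk A x\<^esub> t x)"
  "r \<odot>\<^bsub>H0 y\<^esub> s = (\<lambda>x\<in>{x \<in> simplices Z 0. p 0 x = y}. r \<odot>\<^bsub>stalk A x\<^esub> s x)"
  "snorm (H0 y) s = Sup (insert 0 ((\<lambda>x. snorm (stalk A x) (s x)) ` {x \<in> simplices Z 0. p 0 x = y}))"
proof -
  have sF: "simplices (F y) 0 = {x \<in> simplices Z 0. p 0 x = y}" using F_vertex by blast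
  show "\<zero>\<^bsub>H0 y\<^esub> = (\<lambda>x\<in>{x \<in> simplices Z 0. p 0 x = y}. \<zero>\<^bsub>stalk A x\<^esub>)"
    "s \<oplus>\<^bsub>H0 y\<^esub> t = (\<lambda>x\<in>{x \<in> simplices Z 0. p 0 x = y}. s x \<oplus>\<^bsub>stalk A x\<^esub> t x)"
    "r \<odot>\<^bsub>H0 y\<^esub> s = (\<lambda>x\<in>{x \<in> simplices Z 0. p 0 x = y}. r \<odot>\<^bsub>stalk A x\<^esub> s x)"
    "snorm (H0 y) s = Sup (insert 0 ((\<lambda>x. snorm (stalk A x) (s x)) ` {x \<in> simplices Z 0. p 0 x = y}))"
    unfolding fibre_Hb0_def by (simp_all add: Cb_simps sF FA_simps)
qed

lemma H0_snorm_upper: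
  assumes "s \<in> carrier (H0 y)" "x \<in> simplices Z 0" "p 0 x = y"
  shows "snorm (stalk A x) (s x) \<le> snorm (H0 y) s"
proof -
  interpret F: edge_system R N "F y" "FA y" by (rule F_system)
  show ?thesis using F.snorm_Cb_upper[of s 0 x] assms F_vertex
    by (simp add: fibre_Hb0_def Zb_def FA_simps)
qed

end

lemma lift_edge:
  assumes "\<gamma> \<in> simplices Y (Suc 0)" "k \<le> Suc 0" "x \<in> simplices Z 0" "p 0 x = face Y (Suc 0) k \<gamma>"
  obtains e where "e \<in> Ed" "p (Suc 0) e = \<gamma>" "face Z (Suc 0) k e = x"
proof -
  \<comment> \<open>A horn in an edge is a single vertex: the missing face is \<open>1 - k\<close>,
    so \<open>x\<close> is prescribed as the face \<open>k\<close>.\<close>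
  have "horn Z 0 (1 - k) (\<lambda>_. x)" using assms by (auto simp: horn_def)
  then obtain e where "e \<in> Ed" "p (Suc 0) e = \<gamma>" "\<forall>i\<le>Suc 0. i \<noteq> 1 - k \<longrightarrow> face Z (Suc 0) i e = x"
    using kan_fibrationD[OF fib assms(1), of "1 - k" "\<lambda>_. x"] assms by (auto simp: le_Suc_eq)
  then show thesis using assms(2) by (intro that[of e]) (auto simp: le_Suc_eq)
qed

lemma lift_triangle:
  assumes "\<rho> \<in> simplices Y (Suc (Suc 0))" "i < j" "j \<le> Suc (Suc 0)"
    and "e \<in> Ed" "p (Suc 0) e = face Y (Suc (Suc 0)) i \<rho>" "e' \<in> Ed" "p (Suc 0) e' = face Y (Suc (Suc 0)) j \<rho>"
    and "face Z (Suc 0) i e' = face Z (Suc 0) (j - 1) e"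
  obtains \<sigma> where "\<sigma> \<in> simplices Z (Suc (Suc 0))" "p (Suc (Suc 0)) \<sigma> = \<rho>"
    "face Z (Suc (Suc 0)) i \<sigma> = e" "face Z (Suc (Suc 0)) j \<sigma> = e'"
proof -
  \<comment> \<open>The indices 0, 1, 2 add up to 3, so this is the remaining one.\<close>
  let ?k = "3 - i - j" and ?t = "\<lambda>l. if l = i then e else e'"
  have k: "?k \<noteq> i" "?k \<noteq> j" "?k \<le> Suc (Suc 0)" "\<And>l. l \<le> Suc (Suc 0) \<Longrightarrow> l \<noteq> ?k \<Longrightarrow> l = i \<or> l = j"
    using assms(2,3) by (auto simp: le_Suc_eq less_Suc_eq numeral_3_eq_3)
  have "horn Z (Suc 0) ?k ?t"
    unfolding horn_def
  proof (intro conjI allI impI)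
    fix a b assume "a < b \<and> b \<le> Suc (Suc 0) \<and> a \<noteq> ?k \<and> b \<noteq> ?k"
    then have "a = i" "b = j" using k(4)[of a] k(4)[of b] assms(2) by auto
    then show "face Z (Suc 0) a (?t b) = face Z (Suc 0) (b - 1) (?t a)" using assms by simp
  qed (use k assms in auto)
  moreover have "face Y (Suc (Suc 0)) l \<rho> = p (Suc 0) (?t l)" if "l \<le> Suc (Suc 0)" "l \<noteq> ?k" for l
    using k(4)[OF that] assms by auto
  ultimately obtain \<sigma> where "\<sigma> \<in> simplices Z (Suc (Suc 0))" "p (Suc (Suc 0)) \<sigma> = \<rho>"
    "\<forall>l\<le>Suc (Suc 0). l \<noteq> ?k \<longrightarrow> face Z (Suc (Suc 0)) l \<sigma> = ?t l"
    using kan_fibrationD[OF fib assms(1)] by blast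
  then show thesis using k assms(2,3) by (intro that[of \<sigma>]) auto
qed

text \<open>Equality of the restrictions of \<open>s\<close> and \<open>t\<close> to the vertices of
  the fibre over \<open>\<gamma>\<close>. As a relation it can be studied before existence and
  uniqueness justify the \<open>THE\<close> in \<open>edge_transport\<close>.\<close>

definition related :: "'y \<Rightarrow> ('z \<Rightarrow> 'b) \<Rightarrow> ('z \<Rightarrow> 'b) \<Rightarrow> bool"
  where "related \<gamma> s t \<longleftrightarrow> (\<forall>e\<in>Ed. p (Suc 0) e = \<gamma> \<longrightarrow>
    t (tgt Z e) = edge_forth Z A e (s (src Z e)))"

section \<open>Transport of compatible families along an edge of the base\<close>

context
  fixes \<gamma> assumes \<gamma>: "\<gamma> \<in> simplices Y (Suc 0)"
begin

lemma \<gamma>_ends: "src Y \<gamma> \<in> simplices Y 0" "tgt Y \<gamma> \<in> simplices Y 0"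
  using \<gamma> by (auto simp: Y.face_in)

lemma over_ends: "e \<in> Ed \<Longrightarrow> p (Suc 0) e = \<gamma> \<Longrightarrow> p 0 (src Z e) = src Y \<gamma> \<and> p 0 (tgt Z e) = tgt Y \<gamma> \<and>
    src Z e \<in> simplices Z 0 \<and> tgt Z e \<in> simplices Z 0"
  using p_face[of e 0] by (auto simp: Z.face_in)

lemma degen_faces:
  "degen Y (Suc 0) 0 \<gamma> \<in> simplices Y (Suc (Suc 0))" "degen Y (Suc 0) (Suc 0) \<gamma> \<in> simplices Y (Suc (Suc 0))"
  "face Y (Suc (Suc 0)) 0 (degen Y (Suc 0) 0 \<gamma>) = \<gamma>" "face Y (Suc (Suc 0)) (Suc 0) (degen Y (Suc 0) 0 \<gamma>) = \<gamma>"
  "face Y (Suc (Suc 0)) (Suc (Suc 0)) (degen Y (Suc 0) 0 \<gamma>) = degen Y 0 0 (src Y \<gamma>)"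
  "face Y (Suc (Suc 0)) (Suc 0) (degen Y (Suc 0) (Suc 0) \<gamma>) = \<gamma>"
  "face Y (Suc (Suc 0)) (Suc (Suc 0)) (degen Y (Suc 0) (Suc 0) \<gamma>) = \<gamma>"
  "face Y (Suc (Suc 0)) 0 (degen Y (Suc 0) (Suc 0) \<gamma>) = degen Y 0 0 (tgt Y \<gamma>)"
  using \<gamma> Y.face_degen_greater[OF \<gamma>, of 0 "Suc (Suc 0)"] Y.face_degen_less[OF \<gamma>, of 0 "Suc 0"]
  by (auto simp: Y.degen_closed Y.face_degen_eq)

text \<open>Two lifts of \<open>\<gamma>\<close> with the same target span a triangle over
  \<open>s_0 \<gamma>\<close>. Its third edge lies in the fibre over the source, where
  \<open>s\<close> is compatible.\<close>

lemma forth_independent: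
  assumes s: "s \<in> carrier (H0 (src Y \<gamma>))" and e: "e \<in> Ed" "p (Suc 0) e = \<gamma>" "e' \<in> Ed" "p (Suc 0) e' = \<gamma>"
    and t: "tgt Z e = tgt Z e'"
  shows "edge_forth Z A e (s (src Z e)) = edge_forth Z A e' (s (src Z e'))"
proof -
  obtain \<sigma> where \<sigma>: "\<sigma> \<in> simplices Z (Suc (Suc 0))" "p (Suc (Suc 0)) \<sigma> = degen Y (Suc 0) 0 \<gamma>"
    "face Z (Suc (Suc 0)) 0 \<sigma> = e'" "face Z (Suc (Suc 0)) (Suc 0) \<sigma> = e"
    using lift_triangle[OF degen_faces(1), of 0 "Suc 0" e' e] degen_faces e t by auto
  let ?v = "face Z (Suc (Suc 0)) (Suc (Suc 0)) \<sigma>"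
  have v: "?v \<in> Ed" "p (Suc 0) ?v = degen Y 0 0 (src Y \<gamma>)"
    using \<sigma> p_face[OF \<sigma>(1), of "Suc (Suc 0)"] degen_faces by (auto simp: Z.face_in)
  note tr = Z.triangle_edges[OF \<sigma>(1)]
  have "s (src Z ?v) \<in> carrier (stalk A (src Z ?v))"
    using H0_in[OF \<gamma>_ends(1) s] over_ends[OF e(1,2)] tr \<sigma> by simp
  then show ?thesis
    using Z.edge_forth_triangle[OF \<sigma>(1), of "s (src Z ?v)"] H0_forth[OF \<gamma>_ends(1) s v] tr \<sigma> by simp
qed

text \<open>Dual argument: lifts with the same source span a triangle over
  \<open>s_1 \<gamma>\<close>, whose third edge lies in the fibre over the target.\<close>

lemma back_independent:
  assumes t: "t \<in> carrier (H0 (tgt Y \<gamma>))" and e: "e \<in> Ed" "p (Suc 0) e = \<gamma>" "e' \<in> Ed" "p (Suc 0) e' = \<gamma>"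
    and s: "src Z e = src Z e'"
  shows "edge_back Z A e (t (tgt Z e)) = edge_back Z A e' (t (tgt Z e'))"
proof -
  obtain \<sigma> where \<sigma>: "\<sigma> \<in> simplices Z (Suc (Suc 0))" "p (Suc (Suc 0)) \<sigma> = degen Y (Suc 0) (Suc 0) \<gamma>"
    "face Z (Suc (Suc 0)) (Suc 0) \<sigma> = e'" "face Z (Suc (Suc 0)) (Suc (Suc 0)) \<sigma> = e"
    using lift_triangle[OF degen_faces(2), of "Suc 0" "Suc (Suc 0)" e' e] degen_faces e s by auto
  let ?v = "face Z (Suc (Suc 0)) 0 \<sigma>"
  have v: "?v \<in> Ed" "p (Suc 0) ?v = degen Y 0 0 (tgt Y \<gamma>)"
    using \<sigma> p_face[OF \<sigma>(1), of 0] degen_faces by (auto simp: Z.face_in)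
  note tr = Z.triangle_edges[OF \<sigma>(1)]
  have "t (tgt Z ?v) \<in> carrier (stalk A (tgt Z ?v))"
    using H0_in[OF \<gamma>_ends(2) t] over_ends[OF e(3,4)] tr \<sigma> by simp
  then show ?thesis
    using Z.edge_back_triangle[OF \<sigma>(1), of "t (tgt Z ?v)"] H0_back[OF \<gamma>_ends(2) t v] tr \<sigma> by simp
qed

lemma sn_map_bound:
  "h \<in> sn_maps R M M' \<Longrightarrow> a \<in> carrier M \<Longrightarrow> snorm M a \<le> K \<Longrightarrow> h a \<in> carrier M' \<and> snorm M' (h a) \<le> K"
  using linear_mapsD(1) by (force simp: sn_maps_def)

text \<open>The value of \<open>t\<close> at a vertex is obtained by transporting \<open>s\<close>
  along any lift of \<open>\<gamma>\<close> ending there; by \<open>forth_independent\<close> the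
  choice is immaterial. Isometry of the transports keeps the bound.\<close>

lemma related_exists:
  assumes s: "s \<in> carrier (H0 (src Y \<gamma>))"
  obtains t where "t \<in> carrier (H0 (tgt Y \<gamma>))" "related \<gamma> s t"
proof -
  have "\<exists>e. e \<in> Ed \<and> p (Suc 0) e = \<gamma> \<and> tgt Z e = x" if "x \<in> simplices Z 0" "p 0 x = tgt Y \<gamma>" for x
    using lift_edge[OF \<gamma>, of 0 x] that by blast
  then obtain l where l: "\<And>x. x \<in> simplices Z 0 \<Longrightarrow> p 0 x = tgt Y \<gamma> \<Longrightarrow>
      l x \<in> Ed \<and> p (Suc 0) (l x) = \<gamma> \<and> tgt Z (l x) = x" by metis
  define t where "t = (\<lambda>x\<in>{x \<in> simplices Z 0. p 0 x = tgt Y \<gamma>}. edge_forth Z A (l x) (s (src Z (l x))))"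
  have rel: "related \<gamma> s t"
    unfolding related_def
  proof (intro ballI impI)
    fix e assume e: "e \<in> Ed" "p (Suc 0) e = \<gamma>"
    then show "t (tgt Z e) = edge_forth Z A e (s (src Z e))"
      using over_ends[OF e] l[of "tgt Z e"] forth_independent[OF s, of "l (tgt Z e)" e] by (simp add: t_def)
  qed
  obtain K where K: "\<forall>x\<in>simplices Z 0. p 0 x = src Y \<gamma> \<longrightarrow> snorm (stalk A x) (s x) \<le> K"
    using s H0_iff[OF \<gamma>_ends(1)] by blast
  have b: "t x \<in> carrier (stalk A x) \<and> snorm (stalk A x) (t x) \<le> K"
    if x: "x \<in> simplices Z 0" "p 0 x = tgt Y \<gamma>" for x
    using sn_map_bound[OF Z.edge_forth_back(1)[of "l x"], of "s (src Z (l x))" K] l[OF x] x over_ends[of "l x"] K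
      H0_in[OF \<gamma>_ends(1) s, of "src Z (l x)"] by (simp add: t_def)
  \<comment> \<open>Compatibility of \<open>t\<close>: a lift of \<open>\<gamma>\<close> ending at
    the source of \<open>v\<close>, followed by \<open>v\<close>, is completed to a triangle over
    \<open>s_1 \<gamma>\<close>. The long edge is again a lift of \<open>\<gamma>\<close>, now
    ending at the target of \<open>v\<close>.\<close>
  have "edge_back Z A v (t (tgt Z v)) = t (src Z v)"
    if v: "v \<in> Ed" "p (Suc 0) v = degen Y 0 0 (tgt Y \<gamma>)" for v
  proof -
    have ve: "src Z v \<in> simplices Z 0" "p 0 (src Z v) = tgt Y \<gamma>"
      using degen_edge_ends[OF \<gamma>_ends(2) v] v by (auto simp: Z.face_in)
    let ?e = "l (src Z v)"
    have e: "?e \<in> Ed" "p (Suc 0) ?e = \<gamma>" "tgt Z ?e = src Z v" using l[OF ve] by auto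
    obtain \<sigma> where \<sigma>: "\<sigma> \<in> simplices Z (Suc (Suc 0))" "p (Suc (Suc 0)) \<sigma> = degen Y (Suc 0) (Suc 0) \<gamma>"
      "face Z (Suc (Suc 0)) 0 \<sigma> = v" "face Z (Suc (Suc 0)) (Suc (Suc 0)) \<sigma> = ?e"
      using lift_triangle[OF degen_faces(2), of 0 "Suc (Suc 0)" v ?e] degen_faces e v by auto
    let ?d = "face Z (Suc (Suc 0)) (Suc 0) \<sigma>"
    have d: "?d \<in> Ed" "p (Suc 0) ?d = \<gamma>"
      using \<sigma> p_face[OF \<sigma>(1), of "Suc 0"] degen_faces by (auto simp: Z.face_in)
    note tr = Z.triangle_edges[OF \<sigma>(1)]
    have c: "s (src Z ?e) \<in> carrier (stalk A (src Z ?e))"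
      using H0_in[OF \<gamma>_ends(1) s] over_ends[OF e(1,2)] by simp
    have "edge_forth Z A v (t (src Z v)) = t (tgt Z v)"
      using Z.edge_forth_triangle[OF \<sigma>(1), of "s (src Z ?e)"] rel[unfolded related_def, rule_format, OF d]
        rel[unfolded related_def, rule_format, OF e(1,2)] tr \<sigma> c e(3) by simp
    then show ?thesis using Z.edge_forth_back(3)[OF v(1)] b[OF ve] by metis
  qed
  then have "t \<in> carrier (H0 (tgt Y \<gamma>))"
    using b by (auto simp: H0_iff[OF \<gamma>_ends(2)] t_def)
  then show thesis using that rel by blast
qed

text \<open>The mirror image of the preceding construction, with lifts starting at a given vertex
  and triangles over \<open>s_0 \<gamma>\<close>. It makes the transport surjective.\<close>

lemma related_exists_back:
  assumes t: "t \<in> carrier (H0 (tgt Y \<gamma>))"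
  obtains s where "s \<in> carrier (H0 (src Y \<gamma>))" "related \<gamma> s t"
proof -
  have "\<exists>e. e \<in> Ed \<and> p (Suc 0) e = \<gamma> \<and> src Z e = x" if "x \<in> simplices Z 0" "p 0 x = src Y \<gamma>" for x
    using lift_edge[OF \<gamma>, of "Suc 0" x] that by blast
  then obtain l where l: "\<And>x. x \<in> simplices Z 0 \<Longrightarrow> p 0 x = src Y \<gamma> \<Longrightarrow>
      l x \<in> Ed \<and> p (Suc 0) (l x) = \<gamma> \<and> src Z (l x) = x" by metis
  define s where "s = (\<lambda>x\<in>{x \<in> simplices Z 0. p 0 x = src Y \<gamma>}. edge_back Z A (l x) (t (tgt Z (l x))))"
  have bk: "s (src Z e) = edge_back Z A e (t (tgt Z e))" if e: "e \<in> Ed" "p (Suc 0) e = \<gamma>" for e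
    using over_ends[OF e] l[of "src Z e"] back_independent[OF t, of "l (src Z e)" e] e by (simp add: s_def)
  have rel: "related \<gamma> s t"
    unfolding related_def
    using bk over_ends Z.edge_forth_back(4) H0_in[OF \<gamma>_ends(2) t] by auto
  obtain K where K: "\<forall>x\<in>simplices Z 0. p 0 x = tgt Y \<gamma> \<longrightarrow> snorm (stalk A x) (t x) \<le> K"
    using t H0_iff[OF \<gamma>_ends(2)] by blast
  have b: "s x \<in> carrier (stalk A x) \<and> snorm (stalk A x) (s x) \<le> K"
    if x: "x \<in> simplices Z 0" "p 0 x = src Y \<gamma>" for x
    using sn_map_bound[OF Z.edge_forth_back(2)[of "l x"], of "t (tgt Z (l x))" K] l[OF x] x over_ends[of "l x"] K
      H0_in[OF \<gamma>_ends(2) t, of "tgt Z (l x)"] by (simp add: s_def)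
  have "edge_back Z A v (s (tgt Z v)) = s (src Z v)"
    if v: "v \<in> Ed" "p (Suc 0) v = degen Y 0 0 (src Y \<gamma>)" for v
  proof -
    have ve: "tgt Z v \<in> simplices Z 0" "p 0 (tgt Z v) = src Y \<gamma>"
      using degen_edge_ends[OF \<gamma>_ends(1) v] v by (auto simp: Z.face_in)
    let ?e = "l (tgt Z v)"
    have e: "?e \<in> Ed" "p (Suc 0) ?e = \<gamma>" "src Z ?e = tgt Z v" using l[OF ve] by auto
    obtain \<sigma> where \<sigma>: "\<sigma> \<in> simplices Z (Suc (Suc 0))" "p (Suc (Suc 0)) \<sigma> = degen Y (Suc 0) 0 \<gamma>"
      "face Z (Suc (Suc 0)) 0 \<sigma> = ?e" "face Z (Suc (Suc 0)) (Suc (Suc 0)) \<sigma> = v"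
      using lift_triangle[OF degen_faces(1), of 0 "Suc (Suc 0)" ?e v] degen_faces e v by auto
    let ?d = "face Z (Suc (Suc 0)) (Suc 0) \<sigma>"
    have d: "?d \<in> Ed" "p (Suc 0) ?d = \<gamma>"
      using \<sigma> p_face[OF \<sigma>(1), of "Suc 0"] degen_faces by (auto simp: Z.face_in)
    note tr = Z.triangle_edges[OF \<sigma>(1)]
    have c: "t (tgt Z ?e) \<in> carrier (stalk A (tgt Z ?e))"
      using H0_in[OF \<gamma>_ends(2) t] over_ends[OF e(1,2)] by simp
    show ?thesis
      using Z.edge_back_triangle[OF \<sigma>(1), of "t (tgt Z ?e)"] bk[OF d] bk[OF e(1,2)] tr \<sigma> c e(3) by simp
  qed
  then have "s \<in> carrier (H0 (src Y \<gamma>))"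
    using b by (auto simp: H0_iff[OF \<gamma>_ends(1)] s_def)
  then show thesis using that rel by blast
qed

lemma related_unique:
  assumes "t \<in> carrier (H0 (tgt Y \<gamma>))" "t' \<in> carrier (H0 (tgt Y \<gamma>))" "related \<gamma> s t" "related \<gamma> s t'"
  shows "t = t'"
proof (rule H0_eqI[OF \<gamma>_ends(2) assms(1,2)])
  fix x assume "x \<in> simplices Z 0" "p 0 x = tgt Y \<gamma>"
  then obtain e where "e \<in> Ed" "p (Suc 0) e = \<gamma>" "tgt Z e = x" using lift_edge[OF \<gamma>, of 0 x] by auto
  then show "t x = t' x" using assms(3,4) unfolding related_def by metis
qed

lemma related_back:
  assumes "s \<in> carrier (H0 (src Y \<gamma>))" "related \<gamma> s t" "e \<in> Ed" "p (Suc 0) e = \<gamma>"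
  shows "s (src Z e) = edge_back Z A e (t (tgt Z e))"
  using assms Z.edge_forth_back(3)[OF assms(3)] H0_in[OF \<gamma>_ends(1) assms(1)] over_ends[OF assms(3,4)]
  by (simp add: related_def)

lemma related_unique_back:
  assumes "s \<in> carrier (H0 (src Y \<gamma>))" "s' \<in> carrier (H0 (src Y \<gamma>))" "related \<gamma> s t" "related \<gamma> s' t"
  shows "s = s'"
proof (rule H0_eqI[OF \<gamma>_ends(1) assms(1,2)])
  fix x assume "x \<in> simplices Z 0" "p 0 x = src Y \<gamma>"
  then obtain e where "e \<in> Ed" "p (Suc 0) e = \<gamma>" "src Z e = x" using lift_edge[OF \<gamma>, of "Suc 0" x] by auto
  then show "s x = s' x" using related_back assms by metis
qed

abbreviation "ET \<equiv> edge_transport Z Y p A"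

lemma edge_transport:
  assumes s: "s \<in> carrier (H0 (src Y \<gamma>))"
  shows "ET \<gamma> s \<in> carrier (H0 (tgt Y \<gamma>))" "related \<gamma> s (ET \<gamma> s)"
proof -
  obtain t where t: "t \<in> carrier (H0 (tgt Y \<gamma>))" "related \<gamma> s t" using related_exists[OF s] by blast
  have "ET \<gamma> s = t"
    unfolding edge_transport_def
  proof (rule the_equality)
    show "t \<in> carrier (H0 (tgt Y \<gamma>)) \<and> (\<forall>e\<in>simplices Z 1. p 1 e = \<gamma> \<longrightarrow>
        t (tgt Z e) = transport A (src Z e) (tgt Z e) (pi_edge Z e) (s (src Z e)))"
      using t by (simp add: related_def edge_forth_def)
    show "t' = t" if "t' \<in> carrier (H0 (tgt Y \<gamma>)) \<and> (\<forall>e\<in>simplices Z 1. p 1 e = \<gamma> \<longrightarrow>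
        t' (tgt Z e) = transport A (src Z e) (tgt Z e) (pi_edge Z e) (s (src Z e)))" for t'
      using related_unique[OF _ t(1) _ t(2), of t'] that by (simp add: related_def edge_forth_def)
  qed
  then show "ET \<gamma> s \<in> carrier (H0 (tgt Y \<gamma>))" "related \<gamma> s (ET \<gamma> s)" using t by auto
qed

lemma edge_transport_eqI:
  "s \<in> carrier (H0 (src Y \<gamma>)) \<Longrightarrow> t \<in> carrier (H0 (tgt Y \<gamma>)) \<Longrightarrow> related \<gamma> s t \<Longrightarrow> ET \<gamma> s = t"
  using related_unique[OF edge_transport(1) _ edge_transport(2)] by simp

lemma edge_transport_bij: "bij_betw (ET \<gamma>) (carrier (H0 (src Y \<gamma>))) (carrier (H0 (tgt Y \<gamma>)))"
  unfolding bij_betw_def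
proof
  show "inj_on (ET \<gamma>) (carrier (H0 (src Y \<gamma>)))"
  proof (rule inj_onI)
    fix s s' assume s: "s \<in> carrier (H0 (src Y \<gamma>))" "s' \<in> carrier (H0 (src Y \<gamma>))" and eq: "ET \<gamma> s = ET \<gamma> s'"
    show "s = s'"
      using related_unique_back[OF s edge_transport(2)[OF s(1)]] edge_transport(2)[OF s(2)] eq by simp
  qed
  have "t \<in> ET \<gamma> ` carrier (H0 (src Y \<gamma>))" if t: "t \<in> carrier (H0 (tgt Y \<gamma>))" for t
  proof -
    obtain s where s: "s \<in> carrier (H0 (src Y \<gamma>))" "related \<gamma> s t" using related_exists_back[OF t] by blast
    then show ?thesis using edge_transport_eqI[OF s(1) t s(2)] by blast
  qed
  then show "ET \<gamma> ` carrier (H0 (src Y \<gamma>)) = carrier (H0 (tgt Y \<gamma>))"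
    using edge_transport(1) by blast
qed

lemma edge_transport_sn_iso: "ET \<gamma> \<in> sn_isos R (H0 (src Y \<gamma>)) (H0 (tgt Y \<gamma>))"
proof -
  interpret S: seminormed_module R N "H0 (src Y \<gamma>)" using H0_seminormed[OF \<gamma>_ends(1)] .
  interpret T: seminormed_module R N "H0 (tgt Y \<gamma>)" using H0_seminormed[OF \<gamma>_ends(2)] .
  have lin: "edge_forth Z A e \<in> linear_maps R (stalk A (src Z e)) (stalk A (tgt Z e))" if "e \<in> Ed" for e
    using Z.edge_forth_back(1)[OF that] by (simp add: sn_maps_def)
  have st: "s (src Z e) \<in> carrier (stalk A (src Z e))" if "s \<in> carrier (H0 (src Y \<gamma>))" "e \<in> Ed" "p (Suc 0) e = \<gamma>" for s e
    using H0_in[OF \<gamma>_ends(1) that(1)] over_ends[OF that(2,3)] by simp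
  show ?thesis
  proof (rule sn_isosI[OF S.abelian_group_axioms _ edge_transport_bij])
    have "ET \<gamma> (s \<oplus>\<^bsub>H0 (src Y \<gamma>)\<^esub> s') = ET \<gamma> s \<oplus>\<^bsub>H0 (tgt Y \<gamma>)\<^esub> ET \<gamma> s'"
      if s: "s \<in> carrier (H0 (src Y \<gamma>))" "s' \<in> carrier (H0 (src Y \<gamma>))" for s s'
    proof (rule edge_transport_eqI)
      show "related \<gamma> (s \<oplus>\<^bsub>H0 (src Y \<gamma>)\<^esub> s') (ET \<gamma> s \<oplus>\<^bsub>H0 (tgt Y \<gamma>)\<^esub> ET \<gamma> s')"
        using edge_transport(2)[OF s(1)] edge_transport(2)[OF s(2)] over_ends linear_mapsD(2)[OF lin]
          st[OF s(1)] st[OF s(2)] unfolding related_def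
        by (auto simp: H0_simps[OF \<gamma>_ends(1)] H0_simps[OF \<gamma>_ends(2)])
    qed (use s edge_transport(1) in auto)
    moreover have "ET \<gamma> (r \<odot>\<^bsub>H0 (src Y \<gamma>)\<^esub> s) = r \<odot>\<^bsub>H0 (tgt Y \<gamma>)\<^esub> ET \<gamma> s"
      if r: "r \<in> carrier R" and s: "s \<in> carrier (H0 (src Y \<gamma>))" for r s
    proof (rule edge_transport_eqI)
      show "related \<gamma> (r \<odot>\<^bsub>H0 (src Y \<gamma>)\<^esub> s) (r \<odot>\<^bsub>H0 (tgt Y \<gamma>)\<^esub> ET \<gamma> s)"
        using edge_transport(2)[OF s] over_ends linear_mapsD(3)[OF lin r]
          st[OF s] unfolding related_def
        by (auto simp: H0_simps[OF \<gamma>_ends(1)] H0_simps[OF \<gamma>_ends(2)])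
    qed (use r s edge_transport(1) S.smult_closed T.smult_closed in auto)
    ultimately show "ET \<gamma> \<in> linear_maps R (H0 (src Y \<gamma>)) (H0 (tgt Y \<gamma>))"
      using edge_transport(1) by (auto simp: linear_maps_def)
    show "snorm (H0 (tgt Y \<gamma>)) (ET \<gamma> s) = snorm (H0 (src Y \<gamma>)) s" if s: "s \<in> carrier (H0 (src Y \<gamma>))" for s
    proof -
      have iso: "snorm (stalk A (tgt Z e)) (ET \<gamma> s (tgt Z e)) = snorm (stalk A (src Z e)) (s (src Z e))"
        if e: "e \<in> Ed" "p (Suc 0) e = \<gamma>" for e
        using sn_isosD(4)[OF Z.edge_back_iso[OF e(1)], of "ET \<gamma> s (tgt Z e)"] related_back[OF s edge_transport(2)[OF s] e]
          H0_in[OF \<gamma>_ends(2) edge_transport(1)[OF s]] over_ends[OF e] by simp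
      \<comment> \<open>Every vertex of either fibre is an end of some edge over
        \<open>\<gamma>\<close>, and transport along that edge is isometric. So both suprema run
        over the same set of numbers.\<close>
      have "(\<lambda>x. snorm (stalk A x) (ET \<gamma> s x)) ` {x \<in> simplices Z 0. p 0 x = tgt Y \<gamma>} =
          (\<lambda>x. snorm (stalk A x) (s x)) ` {x \<in> simplices Z 0. p 0 x = src Y \<gamma>}" (is "?L = ?R")
      proof (intro equalityI subsetI)
        fix c assume "c \<in> ?L"
        then obtain x where x: "x \<in> simplices Z 0" "p 0 x = tgt Y \<gamma>" "c = snorm (stalk A x) (ET \<gamma> s x)" by blast
        obtain e where e: "e \<in> Ed" "p (Suc 0) e = \<gamma>" "tgt Z e = x" using lift_edge[OF \<gamma>, of 0 x] x by auto
        then show "c \<in> ?R" using iso[OF e(1,2)] over_ends[OF e(1,2)] x by auto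
      next
        fix c assume "c \<in> ?R"
        then obtain x where x: "x \<in> simplices Z 0" "p 0 x = src Y \<gamma>" "c = snorm (stalk A x) (s x)" by blast
        obtain e where e: "e \<in> Ed" "p (Suc 0) e = \<gamma>" "src Z e = x" using lift_edge[OF \<gamma>, of "Suc 0" x] x by auto
        then show "c \<in> ?L" using iso[OF e(1,2)] over_ends[OF e(1,2)] x by (auto intro!: image_eqI[of _ _ "tgt Z e"])
      qed
      then show ?thesis by (simp add: H0_simps(4)[OF \<gamma>_ends(1)] H0_simps(4)[OF \<gamma>_ends(2)])
    qed
  qed (use S.smult_closed in auto)
qed

end

text \<open>At a given vertex over the last corner, the edges of \<open>\<rho>\<close> with index 0
  and 2 are lifted backwards one after the other and completed to a triangle over
  \<open>\<rho>\<close>. The triangle relation for \<open>A\<close> there is the claim at that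
  vertex.\<close>

lemma edge_transport_triangle:
  assumes \<rho>: "\<rho> \<in> simplices Y (Suc (Suc 0))"
    and s: "s \<in> carrier (H0 (src Y (face Y (Suc (Suc 0)) (Suc (Suc 0)) \<rho>)))"
  shows "ET (face Y (Suc (Suc 0)) 0 \<rho>) (ET (face Y (Suc (Suc 0)) (Suc (Suc 0)) \<rho>) s) =
    ET (face Y (Suc (Suc 0)) (Suc 0) \<rho>) s"
proof -
  let ?g2 = "face Y (Suc (Suc 0)) (Suc (Suc 0)) \<rho>" and ?g1 = "face Y (Suc (Suc 0)) (Suc 0) \<rho>"
    and ?g0 = "face Y (Suc (Suc 0)) 0 \<rho>"
  have g: "?g0 \<in> simplices Y (Suc 0)" "?g1 \<in> simplices Y (Suc 0)" "?g2 \<in> simplices Y (Suc 0)"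
    using \<rho> by (auto simp: Y.face_in)
  note tY = Y.triangle_edges[OF \<rho>]
  have s1: "s \<in> carrier (H0 (src Y ?g1))" using s tY by simp
  have t: "ET ?g2 s \<in> carrier (H0 (src Y ?g0))" using edge_transport(1)[OF g(3) s] tY by simp
  have u: "ET ?g0 (ET ?g2 s) \<in> carrier (H0 (tgt Y ?g1))" using edge_transport(1)[OF g(1) t] tY by simp
  have u1: "ET ?g1 s \<in> carrier (H0 (tgt Y ?g1))" using edge_transport(1)[OF g(2) s1] .
  have y: "tgt Y ?g1 \<in> simplices Y 0" using g by (simp add: Y.face_in)
  show ?thesis
  proof (rule H0_eqI[OF y u u1])
    fix x assume x: "x \<in> simplices Z 0" "p 0 x = tgt Y ?g1"
    obtain e0 where e0: "e0 \<in> Ed" "p (Suc 0) e0 = ?g0" "tgt Z e0 = x" using lift_edge[OF g(1), of 0 x] x tY by auto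
    have "p 0 (src Z e0) = tgt Y ?g2" "src Z e0 \<in> simplices Z 0" using over_ends[OF g(1) e0(1,2)] tY by auto
    then obtain e2 where e2: "e2 \<in> Ed" "p (Suc 0) e2 = ?g2" "tgt Z e2 = src Z e0"
      using lift_edge[OF g(3), of 0 "src Z e0"] by auto
    obtain \<sigma> where \<sigma>: "\<sigma> \<in> simplices Z (Suc (Suc 0))" "p (Suc (Suc 0)) \<sigma> = \<rho>"
      "face Z (Suc (Suc 0)) 0 \<sigma> = e0" "face Z (Suc (Suc 0)) (Suc (Suc 0)) \<sigma> = e2"
      using lift_triangle[OF \<rho>, of 0 "Suc (Suc 0)" e0 e2] e0 e2 by auto
    let ?e1 = "face Z (Suc (Suc 0)) (Suc 0) \<sigma>"
    have e1: "?e1 \<in> Ed" "p (Suc 0) ?e1 = ?g1"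
      using \<sigma> p_face[OF \<sigma>(1), of "Suc 0"] by (auto simp: Z.face_in)
    note tr = Z.triangle_edges[OF \<sigma>(1)]
    have src_y: "src Y ?g2 \<in> simplices Y 0" using g by (simp add: Y.face_in)
    have c: "s (src Z e2) \<in> carrier (stalk A (src Z e2))"
      using H0_in[OF src_y s] over_ends[OF g(3) e2(1,2)] by simp
    have "ET ?g0 (ET ?g2 s) x = edge_forth Z A e0 (edge_forth Z A e2 (s (src Z e2)))"
      using edge_transport(2)[OF g(1) t] edge_transport(2)[OF g(3) s] e0 e2 unfolding related_def by metis
    also have "\<dots> = edge_forth Z A ?e1 (s (src Z e2))" using Z.edge_forth_triangle[OF \<sigma>(1)] \<sigma> c by simp
    also have "\<dots> = ET ?g1 s (tgt Z ?e1)"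
      using edge_transport(2)[OF g(2) s1] e1 tr \<sigma> unfolding related_def by metis
    finally show "ET ?g0 (ET ?g2 s) x = ET ?g1 s x" using tr \<sigma> e0 by simp
  qed
qed

section \<open>The coefficient system of compatible families on the base, and evaluation\<close>

abbreviation "word_transport \<equiv> fold (letter_transport Z Y p A)"

lemma letter_bij:
  assumes "\<gamma> \<in> simplices Y (Suc 0)"
  shows "bij_betw (letter_transport Z Y p A (\<gamma>, True)) (carrier (H0 (src Y \<gamma>))) (carrier (H0 (tgt Y \<gamma>)))"
    and "bij_betw (letter_transport Z Y p A (\<gamma>, False)) (carrier (H0 (tgt Y \<gamma>))) (carrier (H0 (src Y \<gamma>)))"
  using edge_transport_bij[OF assms] bij_betw_inv_into[OF edge_transport_bij[OF assms]]
  by (simp_all add: letter_transport_def)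

lemma word_transport_in:
  "is_path Y y w z \<Longrightarrow> s \<in> carrier (H0 y) \<Longrightarrow> word_transport w s \<in> carrier (H0 z)"
proof (induction arbitrary: s rule: is_path.induct)
  case (edge e w y)
  then show ?case using letter_bij(1)[of e] by (simp add: bij_betw_apply)
next
  case (inverse e w y)
  then show ?case using letter_bij(2)[of e] by (simp add: bij_betw_apply)
qed simp

text \<open>Cancellation holds because edge transports are bijective, the triangle relation by
  \<open>edge_transport_triangle\<close>. So the word picked by \<open>SOME\<close> in
  \<open>Hb0_system\<close> does not affect the result.\<close>

lemma word_transport_eq:
  "path_eq Y y z w w' \<Longrightarrow> s \<in> carrier (H0 y) \<Longrightarrow> word_transport w s = word_transport w' s"
proof (induction rule: path_eq.induct)
  case (cancel u \<gamma> b v)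
  obtain y' where u: "is_path Y y u y'" and r: "is_path Y y' ([(\<gamma>, b), (\<gamma>, \<not> b)] @ v) z"
    using cancel Y.is_path_append by blast
  have t: "word_transport u s \<in> carrier (H0 y')" using word_transport_in[OF u cancel.prems] .
  have \<gamma>: "\<gamma> \<in> simplices Y (Suc 0)" using r by (auto simp: is_path_Cons split: if_splits)
  have "letter_transport Z Y p A (\<gamma>, \<not> b) (letter_transport Z Y p A (\<gamma>, b) t') = t'" if "t' \<in> carrier (H0 y')" for t'
  proof (cases b)
    case True
    then have "y' = src Y \<gamma>" using r by (simp add: is_path_Cons)
    then show ?thesis using True that edge_transport_bij[OF \<gamma>] by (simp add: letter_transport_def bij_betw_def)
  next
    case False
    then have "y' = tgt Y \<gamma>" using r by (simp add: is_path_Cons)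
    then show ?thesis using False that edge_transport_bij[OF \<gamma>]
      by (simp add: letter_transport_def bij_betw_def f_inv_into_f)
  qed
  from this[OF t] show ?case by simp
next
  case (triangle \<rho> u v)
  have \<rho>: "\<rho> \<in> simplices Y (Suc (Suc 0))" using triangle by (simp add: numeral_2_eq_2)
  obtain y' where u: "is_path Y y u y'" and r: "is_path Y y' ([(face Y 2 2 \<rho>, True), (face Y 2 0 \<rho>, True)] @ v) z"
    using triangle Y.is_path_append by blast
  have "word_transport u s \<in> carrier (H0 (src Y (face Y (Suc (Suc 0)) (Suc (Suc 0)) \<rho>)))"
    using word_transport_in[OF u triangle.prems] r by (simp add: is_path_Cons numeral_2_eq_2)
  from edge_transport_triangle[OF \<rho> this] show ?case by (simp add: letter_transport_def numeral_2_eq_2)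
qed auto

lemma edge_back_AH:
  assumes \<gamma>: "\<gamma> \<in> simplices Y (Suc 0)" and t: "t \<in> carrier (H0 (tgt Y \<gamma>))"
  shows "edge_back Y AH \<gamma> t = inv_into (carrier (H0 (src Y \<gamma>))) (ET \<gamma>) t"
    and "edge_back Y AH \<gamma> t \<in> carrier (H0 (src Y \<gamma>))" "ET \<gamma> (edge_back Y AH \<gamma> t) = t"
    and "e \<in> Ed \<Longrightarrow> p (Suc 0) e = \<gamma> \<Longrightarrow> edge_back Y AH \<gamma> t (src Z e) = edge_back Z A e (t (tgt Z e))"
proof -
  \<comment> \<open>The chosen word need not be the single letter, but it represents the same
    morphism.\<close>
  let ?w = "SOME w. w \<in> pi_edge_inv Y \<gamma>"
  have "[(\<gamma>, False)] \<in> pi_edge_inv Y \<gamma>"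
    using Y.edge_paths(2)[OF \<gamma>] by (auto simp: pi_edge_inv_def path_class_def intro: path_eq.refl)
  then have "?w \<in> pi_edge_inv Y \<gamma>" by (rule someI)
  then have "path_eq Y (tgt Y \<gamma>) (src Y \<gamma>) [(\<gamma>, False)] ?w" by (simp add: pi_edge_inv_def path_class_def)
  from word_transport_eq[OF this t]
  show eq: "edge_back Y AH \<gamma> t = inv_into (carrier (H0 (src Y \<gamma>))) (ET \<gamma>) t"
    by (simp add: edge_back_def Hb0_system_def letter_transport_def)
  show s: "edge_back Y AH \<gamma> t \<in> carrier (H0 (src Y \<gamma>))" and ts: "ET \<gamma> (edge_back Y AH \<gamma> t) = t"
    using eq t edge_transport_bij[OF \<gamma>] by (auto simp: bij_betw_def inv_into_into f_inv_into_f)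
  show "edge_back Y AH \<gamma> t (src Z e) = edge_back Z A e (t (tgt Z e))" if "e \<in> Ed" "p (Suc 0) e = \<gamma>"
    using related_back[OF \<gamma> s edge_transport(2)[OF \<gamma> s] that] ts by simp
qed

lemma stalk_AH: "stalk AH y = H0 y"
  by (simp add: Hb0_system_def)

text \<open>The cochain complex sees only edges and triangles, so the verification is confined to
  these. The relation for backward transports is the inverse of
  \<open>edge_transport_triangle\<close>.\<close>

lemma AH_system: "edge_system R N Y AH"
proof (intro edge_system.intro edge_system_axioms.intro Y.semi_simplicial_set_axioms Z.normed_ring_axioms)
  show "seminormed_module R N (stalk AH y)" if "y \<in> simplices Y 0" for y
    using H0_seminormed[OF that] by (simp add: stalk_AH)
next
  fix \<gamma> assume \<gamma>: "\<gamma> \<in> simplices Y (Suc 0)"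
  let ?k = "inv_into (carrier (H0 (src Y \<gamma>))) (ET \<gamma>)"
  note iso = edge_transport_sn_iso[OF \<gamma>]
  interpret T: seminormed_module R N "H0 (tgt Y \<gamma>)" using H0_seminormed[OF \<gamma>_ends(2)[OF \<gamma>]] .
  have k: "?k \<in> sn_maps R (H0 (tgt Y \<gamma>)) (H0 (src Y \<gamma>))" using iso by (simp add: sn_isos_def)
  have "edge_back Y AH \<gamma> \<in> sn_isos R (H0 (tgt Y \<gamma>)) (H0 (src Y \<gamma>))"
  proof (rule sn_isosI[OF T.abelian_group_axioms])
    show "edge_back Y AH \<gamma> \<in> linear_maps R (H0 (tgt Y \<gamma>)) (H0 (src Y \<gamma>))"
      using k edge_back_AH(1)[OF \<gamma>] T.smult_closed by (auto simp: sn_maps_def linear_maps_def)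
    show "bij_betw (edge_back Y AH \<gamma>) (carrier (H0 (tgt Y \<gamma>))) (carrier (H0 (src Y \<gamma>)))"
      using bij_betw_inv_into[OF edge_transport_bij[OF \<gamma>]] edge_back_AH(1)[OF \<gamma>] by (simp cong: bij_betw_cong)
    show "snorm (H0 (src Y \<gamma>)) (edge_back Y AH \<gamma> t) = snorm (H0 (tgt Y \<gamma>)) t" if "t \<in> carrier (H0 (tgt Y \<gamma>))" for t
      using sn_isosD(4)[OF iso, of "edge_back Y AH \<gamma> t"] edge_back_AH(2,3)[OF \<gamma> that] by simp
  qed (use T.smult_closed in auto)
  then show "edge_back Y AH \<gamma> \<in> sn_isos R (stalk AH (tgt Y \<gamma>)) (stalk AH (src Y \<gamma>))" by (simp add: stalk_AH)
next
  fix \<rho> u assume \<rho>: "\<rho> \<in> simplices Y (Suc (Suc 0))" and "u \<in> carrier (stalk AH (tgt Y (face Y (Suc (Suc 0)) 0 \<rho>)))"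
  let ?g2 = "face Y (Suc (Suc 0)) (Suc (Suc 0)) \<rho>" and ?g1 = "face Y (Suc (Suc 0)) (Suc 0) \<rho>"
    and ?g0 = "face Y (Suc (Suc 0)) 0 \<rho>"
  have g: "?g0 \<in> simplices Y (Suc 0)" "?g1 \<in> simplices Y (Suc 0)" "?g2 \<in> simplices Y (Suc 0)"
    using \<rho> by (auto simp: Y.face_in)
  note tY = Y.triangle_edges[OF \<rho>]
  have u: "u \<in> carrier (H0 (tgt Y ?g0))" using \<open>u \<in> _\<close> by (simp add: stalk_AH)
  have t: "edge_back Y AH ?g0 u \<in> carrier (H0 (tgt Y ?g2))" using edge_back_AH(2)[OF g(1) u] tY by simp
  have s: "edge_back Y AH ?g2 (edge_back Y AH ?g0 u) \<in> carrier (H0 (src Y ?g2))" using edge_back_AH(2)[OF g(3) t] .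
  have u1: "u \<in> carrier (H0 (tgt Y ?g1))" using u tY by simp
  have "ET ?g1 (edge_back Y AH ?g2 (edge_back Y AH ?g0 u)) = u"
    using edge_transport_triangle[OF \<rho> s] edge_back_AH(3)[OF g(3) t] edge_back_AH(3)[OF g(1) u] by simp
  then show "edge_back Y AH ?g2 (edge_back Y AH ?g0 u) = edge_back Y AH ?g1 u"
    using edge_back_AH(1)[OF g(2) u1] edge_transport_bij[OF g(2)] s tY
    by (metis bij_betw_inv_into_left)
qed

abbreviation "ev \<equiv> (\<lambda>(x :: 'z) (s :: 'z \<Rightarrow> 'b). s x)"

lemma ev_system_map: "system_map K R Z A Y AH p ev"
proof -
  have "ev x \<in> sn_maps R (H0 (p 0 x)) (stalk A x)" if x: "x \<in> simplices Z 0" for x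
  proof -
    have y: "p 0 x \<in> simplices Y 0" using p_in[OF x] .
    show ?thesis
      using H0_in[OF y _ x] H0_snorm_upper[OF y _ x] x
      by (auto simp: sn_maps_def linear_maps_def H0_simps[OF y])
  qed
  moreover have "edge_back Y AH (p (Suc 0) e) s (src Z e) = edge_back Z A e (s (tgt Z e))"
    if e: "e \<in> Ed" and s: "s \<in> carrier (H0 (p 0 (tgt Z e)))" for e s
    using edge_back_AH(4)[OF p_in[OF e] _ e] s p_face[OF e, of 0] by simp
  ultimately show ?thesis using face_map_face_map_upto[OF p(2)] by (simp add: system_map_def stalk_AH)
qed

lemma ev_cochain_map: "cochain_map K R N Z A Y AH p ev"
  by (intro cochain_map.intro cochain_map_axioms.intro Z.edge_system_axioms AH_system ev_system_map)

text \<open>The edge homomorphism is a pullback along \<open>p\<close> in which evaluation at a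
  vertex is the map of coefficients. Thus the general results on cochain maps cover it.\<close>

lemma edge_cochain_eq: "edge_cochain Z p n = pullback_cochain Z p ev n"
  by (simp add: edge_cochain_def pullback_cochain_def fun_eq_iff)

end

section \<open>The edge homomorphism\<close>

context fibration_system begin

lemma AH_in: "\<psi> \<in> carrier (Cb Y AH n) \<Longrightarrow> \<sigma> \<in> simplices Y n \<Longrightarrow> \<psi> \<sigma> \<in> carrier (H0 (vertex0 Y n \<sigma>))"
  using Cb_in[of \<psi> Y AH n \<sigma>] by (simp add: stalk_AH)

lemma ev_cochain_0_inj:
  assumes \<psi>: "\<psi> \<in> carrier (Cb Y AH 0)" "\<psi>' \<in> carrier (Cb Y AH 0)"
    and eq: "pullback_cochain Z p ev 0 \<psi> = pullback_cochain Z p ev 0 \<psi>'"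
  shows "\<psi> = \<psi>'"
proof (rule Cb_eqI[OF \<psi>])
  fix y assume y: "y \<in> simplices Y 0"
  show "\<psi> y = \<psi>' y"
  proof (rule H0_eqI[OF y])
    show "\<psi> y x = \<psi>' y x" if "x \<in> simplices Z 0" "p 0 x = y" for x
      using fun_cong[OF eq, of x] that by (simp add: pullback_cochain_def)
  qed (use AH_in[OF \<psi>(1) y] AH_in[OF \<psi>(2) y] in auto)
qed

text \<open>Every vertex over the source of \<open>\<gamma>\<close> is the source of a lift of
  \<open>\<gamma>\<close>, so each member of the family at \<open>\<gamma>\<close> is a value of the
  pulled back cochain.\<close>

lemma ev_cochain_1_inj:
  assumes \<psi>: "\<psi> \<in> carrier (Cb Y AH (Suc 0))" "\<psi>' \<in> carrier (Cb Y AH (Suc 0))"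
    and eq: "pullback_cochain Z p ev (Suc 0) \<psi> = pullback_cochain Z p ev (Suc 0) \<psi>'"
  shows "\<psi> = \<psi>'"
proof (rule Cb_eqI[OF \<psi>])
  fix \<gamma> assume \<gamma>: "\<gamma> \<in> simplices Y (Suc 0)"
  show "\<psi> \<gamma> = \<psi>' \<gamma>"
  proof (rule H0_eqI[OF \<gamma>_ends(1)[OF \<gamma>]])
    fix x assume x: "x \<in> simplices Z 0" "p 0 x = src Y \<gamma>"
    obtain e where "e \<in> Ed" "p (Suc 0) e = \<gamma>" "src Z e = x" using lift_edge[OF \<gamma>, of "Suc 0" x] x by auto
    then show "\<psi> \<gamma> x = \<psi>' \<gamma> x"
      using fun_cong[OF eq, of e] by (simp add: pullback_cochain_def vertex0.simps(2))
  qed (use AH_in[OF \<psi>(1) \<gamma>] AH_in[OF \<psi>(2) \<gamma>] in \<open>auto simp: vertex0.simps(2)\<close>)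
qed

lemma ev_cochain_0_surj:
  assumes \<phi>: "\<phi> \<in> carrier (Cb Z A 0)"
    and comp: "\<And>e y. e \<in> Ed \<Longrightarrow> y \<in> simplices Y 0 \<Longrightarrow> p (Suc 0) e = degen Y 0 0 y \<Longrightarrow>
      edge_back Z A e (\<phi> (tgt Z e)) = \<phi> (src Z e)"
  obtains \<psi> where "\<psi> \<in> carrier (Cb Y AH 0)" "pullback_cochain Z p ev 0 \<psi> = \<phi>"
proof -
  define \<psi> where "\<psi> = (\<lambda>y\<in>simplices Y 0. \<lambda>x\<in>{x \<in> simplices Z 0. p 0 x = y}. \<phi> x)"
  obtain K where K: "0 \<le> K" "\<And>x. x \<in> simplices Z 0 \<Longrightarrow> snorm (stalk A x) (\<phi> x) \<le> K"
    using Z.Cb_bounded_by[OF \<phi>] by (metis vertex0.simps(1))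
  have "\<psi> y \<in> carrier (H0 y) \<and> snorm (H0 y) (\<psi> y) \<le> K" if y: "y \<in> simplices Y 0" for y
  proof
    have "\<exists>K. \<forall>x\<in>simplices Z 0. p 0 x = y \<longrightarrow> snorm (stalk A x) (\<phi> x) \<le> K" using K(2) by blast
    then show "\<psi> y \<in> carrier (H0 y)"
      using Cb_in[OF \<phi>] comp[OF _ y] degen_edge_ends[OF y] y
      by (auto simp: H0_iff[OF y] \<psi>_def Z.face_in)
    show "snorm (H0 y) (\<psi> y) \<le> K"
      unfolding H0_simps(4)[OF y] using K y by (intro cSup_least) (auto simp: \<psi>_def)
  qed
  then have "\<psi> \<in> carrier (Cb Y AH 0)"
    by (auto simp: Cb_carrier_iff stalk_AH \<psi>_def)
  moreover have "pullback_cochain Z p ev 0 \<psi> = \<phi>"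
    using \<phi> p_in by (intro extensionalityI[of _ "simplices Z 0"])
      (auto simp: pullback_cochain_def \<psi>_def Cb_carrier_iff)
  ultimately show thesis using that by blast
qed

text \<open>Evaluation is injective on cochains of degree 0 and 1, and a 0-cochain on
  \<open>Z\<close> comes from \<open>Y\<close> as soon as it is invariant along edges inside the
  fibres. No lifting of spheres is used, only the fibration property.\<close>

lemma edge_hom_low_degrees:
  shows "cohomology_inj Z A Y AH p ev 0" and "cohomology_surj Z A Y AH p ev 0"
    and "cohomology_inj Z A Y AH p ev (Suc 0)"
proof -
  interpret H: edge_system R N Y AH by (rule AH_system)
  interpret ev: cochain_map "Suc (Suc 0)" R N Z A Y AH p ev by (rule ev_cochain_map)
  show "cohomology_inj Z A Y AH p ev 0"
    unfolding cohomology_inj_def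
    using ev_cochain_0_inj[OF _ H.Cb_zero] ev.pullback_zero[of 0] by (auto simp: Bb_def Zb_def)
  show "cohomology_surj Z A Y AH p ev 0"
    unfolding cohomology_surj_def
  proof
    fix \<phi> assume \<phi>: "\<phi> \<in> Zb Z A 0"
    then have \<phi>C: "\<phi> \<in> carrier (Cb Z A 0)" by (simp add: Zb_def)
    have "edge_back Z A e (\<phi> (tgt Z e)) = \<phi> (src Z e)" if "e \<in> Ed" for e
      using \<phi> Z.coboundary_0(2)[OF \<phi>C that] that by (simp add: Z.Zb_iff vertex0.simps(2))
    then obtain \<psi> where \<psi>: "\<psi> \<in> carrier (Cb Y AH 0)" "pullback_cochain Z p ev 0 \<psi> = \<phi>"
      using ev_cochain_0_surj[OF \<phi>C] by metis
    \<comment> \<open>That \<open>\<psi>\<close> is a cocycle is detected after pulling back, by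
      injectivity in degree 1.\<close>
    have "pullback_cochain Z p ev (Suc 0) (coboundary Y AH 0 \<psi>) = pullback_cochain Z p ev (Suc 0) \<zero>\<^bsub>Cb Y AH (Suc 0)\<^esub>"
      using ev.pullback_coboundary[OF _ \<psi>(1)] ev.pullback_zero[of "Suc 0"] \<psi>(2) \<phi> by (simp add: Zb_def)
    then have "coboundary Y AH 0 \<psi> = \<zero>\<^bsub>Cb Y AH (Suc 0)\<^esub>"
      by (rule ev_cochain_1_inj[OF H.coboundary_in[OF \<psi>(1)] H.Cb_zero])
    then have "\<psi> \<in> Zb Y AH 0" using \<psi>(1) by (simp add: Zb_def)
    moreover interpret C: left_module R "Cb Z A 0" by (rule Z.Cb_left_module)
    have "\<phi> = pullback_cochain Z p ev 0 \<psi> \<oplus>\<^bsub>Cb Z A 0\<^esub> \<zero>\<^bsub>Cb Z A 0\<^esub>" using \<psi>(2) \<phi>C by simp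
    ultimately show "\<exists>\<psi>\<in>Zb Y AH 0. \<exists>b\<in>Bb Z A 0. \<phi> = pullback_cochain Z p ev 0 \<psi> \<oplus>\<^bsub>Cb Z A 0\<^esub> b"
      using Z.Bb_zero by blast
  qed
  show "cohomology_inj Z A Y AH p ev (Suc 0)"
    unfolding cohomology_inj_def
  proof (intro ballI impI)
    fix \<psi> assume \<psi>: "\<psi> \<in> Zb Y AH (Suc 0)" and "pullback_cochain Z p ev (Suc 0) \<psi> \<in> Bb Z A (Suc 0)"
    then obtain \<phi> where \<phi>: "\<phi> \<in> carrier (Cb Z A 0)" "pullback_cochain Z p ev (Suc 0) \<psi> = coboundary Z A 0 \<phi>"
      by (auto simp: Bb_def)
    have \<psi>C: "\<psi> \<in> carrier (Cb Y AH (Suc 0))" using \<psi> by (simp add: Zb_def)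
    \<comment> \<open>Cochains are not normalised, but a 1-cocycle vanishes on degenerate edges: on
      \<open>s_0 s_0 y\<close> the three terms of its coboundary are equal up to sign and add up to
      one copy.\<close>
    have degen0: "\<psi> (degen Y 0 0 y) = \<zero>\<^bsub>H0 y\<^esub>" if y: "y \<in> simplices Y 0" for y
    proof -
      let ?e = "degen Y 0 0 y" and ?s = "degen Y (Suc 0) 0 (degen Y 0 0 y)"
      have e: "?e \<in> simplices Y (Suc 0)" "src Y ?e = y" "tgt Y ?e = y"
        using y by (auto simp: Y.degen_closed Y.face_degen_eq)
      have s: "?s \<in> simplices Y (Suc (Suc 0))" using e by (simp add: Y.degen_closed)
      have f: "face Y (Suc (Suc 0)) i ?s = ?e" if i: "i \<le> Suc (Suc 0)" for i
      proof -
        consider "i = 0 \<or> i = Suc 0" | "i = Suc (Suc 0)" using i by linarith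
        then show ?thesis
          by cases (use e Y.face_degen_greater[OF e(1), of 0 "Suc (Suc 0)"] in \<open>auto simp: Y.face_degen_eq\<close>)
      qed
      have v: "vertex0 Y (Suc (Suc 0)) ?s = y" "front_edge Y (Suc 0) ?s = ?e"
        using f[of "Suc (Suc 0)"] e by (simp_all add: vertex0.simps(2) front_edge.simps(2))
      have c: "\<psi> ?e \<in> carrier (H0 y)" using AH_in[OF \<psi>C e(1)] e by (simp add: vertex0.simps(2))
      interpret M: seminormed_module R N "H0 y" using H0_seminormed[OF y] .
      have "coboundary_term Y AH (Suc 0) \<psi> ?s i = \<psi> ?e" if "i \<le> Suc (Suc 0)" for i
        using f[OF that] f[of 0] v H.edge_back_degenerate[OF Y.simplicial_set_axioms y] c stalk_AH
        by (auto simp: coboundary_term_def)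
      then have "coboundary Y AH (Suc 0) \<psi> ?s = finsum (H0 y) (\<lambda>i. signed (H0 y) i (\<psi> ?e)) {..Suc (Suc 0)}"
        unfolding H.coboundary_eq[OF \<psi>C s] v stalk_AH using c by (intro M.finsum_cong') auto
      also have "\<dots> = \<psi> ?e"
        using c by (simp add: signed_def M.finsum_Suc M.r_neg M.l_neg)
      finally show ?thesis using \<psi> s v stalk_AH by (simp add: H.Zb_iff)
    qed
    \<comment> \<open>Edges in a fibre lie over degenerate edges. There the coboundary of
      \<open>\<phi>\<close> is a value of \<open>\<psi>\<close> on a degenerate edge, hence zero, so
      \<open>\<phi>\<close> restricts to compatible families.\<close>
    have "edge_back Z A e (\<phi> (tgt Z e)) = \<phi> (src Z e)"
      if e: "e \<in> Ed" and y: "y \<in> simplices Y 0" "p (Suc 0) e = degen Y 0 0 y" for e y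
    proof -
      have x: "src Z e \<in> simplices Z 0" "p 0 (src Z e) = y"
        using degen_edge_ends[OF y(1) e y(2)] e by (auto simp: Z.face_in)
      have "coboundary Z A 0 \<phi> e = \<psi> (degen Y 0 0 y) (src Z e)"
        using fun_cong[OF \<phi>(2), of e] e y by (simp add: pullback_cochain_def vertex0.simps(2))
      then have "coboundary Z A 0 \<phi> e = \<zero>\<^bsub>stalk A (src Z e)\<^esub>"
        using degen0[OF y(1)] x by (simp add: H0_simps(1)[OF y(1)])
      then show ?thesis using Z.coboundary_0(2)[OF \<phi>(1) e] by simp
    qed
    then obtain \<psi>' where \<psi>': "\<psi>' \<in> carrier (Cb Y AH 0)" "pullback_cochain Z p ev 0 \<psi>' = \<phi>"
      using ev_cochain_0_surj[OF \<phi>(1)] by metis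
    have "pullback_cochain Z p ev (Suc 0) \<psi> = pullback_cochain Z p ev (Suc 0) (coboundary Y AH 0 \<psi>')"
      using ev.pullback_coboundary[OF _ \<psi>'(1)] \<psi>'(2) \<phi>(2) by simp
    then have "\<psi> = coboundary Y AH 0 \<psi>'"
      by (rule ev_cochain_1_inj[OF \<psi>C H.coboundary_in[OF \<psi>'(1)]])
    then show "\<psi> \<in> Bb Y AH (Suc 0)" using \<psi>'(1) by (simp add: Bb_def)
  qed
qed

text \<open>If spheres of dimension at most 1 in the fibres can be filled, the fibres are connected and
  simply connected, so that a compatible family is determined by any of its members.\<close>

lemma ev_iso:
  assumes lift: "lifts_spheres Z Y p (Suc 0)" "lifts_spheres Z Y p (Suc (Suc 0))" and x: "x \<in> simplices Z 0"
  shows "ev x \<in> sn_isos R (H0 (p 0 x)) (stalk A x)"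
proof -
  let ?y = "p 0 x" and ?d = "degen Y 0 0 (p 0 x)"
  have y: "?y \<in> simplices Y 0" using p_in[OF x] .
  have d: "?d \<in> simplices Y (Suc 0)" "src Y ?d = ?y" "tgt Y ?d = ?y"
    using y by (auto simp: Y.degen_closed Y.face_degen_eq)
  interpret S: seminormed_module R N "H0 ?y" using H0_seminormed[OF y] .
  \<comment> \<open>Lifting in dimension 1: any two vertices of the fibre are joined by an edge of
    the fibre.\<close>
  have edge: "\<exists>v\<in>Ed. p (Suc 0) v = ?d \<and> src Z v = a \<and> tgt Z v = b"
    if "a \<in> simplices Z 0" "b \<in> simplices Z 0" "p 0 a = ?y" "p 0 b = ?y" for a b
  proof -
    let ?t = "\<lambda>i. if i = 0 then b else a"
    have "\<exists>v\<in>Ed. p (Suc 0) v = ?d \<and> (\<forall>i\<le>Suc 0. face Z (Suc 0) i v = ?t i)"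
      by (rule lifts_spheresD[OF lift(1) d(1)]) (use that d in \<open>auto simp: sphere_data_def le_Suc_eq\<close>)
    then obtain v where "v \<in> Ed" "p (Suc 0) v = ?d" "\<forall>i\<le>Suc 0. face Z (Suc 0) i v = ?t i" by blast
    then show ?thesis by (intro bexI[of _ v]) auto
  qed
  \<comment> \<open>Lifting in dimension 2: any three edges of the fibre forming the boundary of a
    triangle do bound one, so transport within the fibre depends only on the end points.\<close>
  have tri: "edge_forth Z A w (edge_forth Z A v a) = edge_forth Z A u a"
    if "v \<in> Ed" "w \<in> Ed" "u \<in> Ed" "p (Suc 0) v = ?d" "p (Suc 0) w = ?d" "p (Suc 0) u = ?d"
      "src Z w = tgt Z v" "src Z u = src Z v" "tgt Z u = tgt Z w" "a \<in> carrier (stalk A (src Z v))" for u v w a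
  proof -
    let ?s = "degen Y (Suc 0) 0 ?d"
    let ?t = "\<lambda>i. if i = 0 then w else if i = Suc 0 then u else v"
    have s: "?s \<in> simplices Y (Suc (Suc 0))" "face Y (Suc (Suc 0)) 0 ?s = ?d" "face Y (Suc (Suc 0)) (Suc 0) ?s = ?d"
      "face Y (Suc (Suc 0)) (Suc (Suc 0)) ?s = ?d"
      using degen_faces[OF d(1)] d by auto
    have "\<exists>\<sigma>\<in>simplices Z (Suc (Suc 0)). p (Suc (Suc 0)) \<sigma> = ?s \<and> (\<forall>i\<le>Suc (Suc 0). face Z (Suc (Suc 0)) i \<sigma> = ?t i)"
    proof (rule lifts_spheresD[OF lift(2) s(1)])
      have "face Z (Suc 0) i (?t j) = face Z (Suc 0) (j - 1) (?t i)" if ij: "i < j" "j \<le> Suc (Suc 0)" for i j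
      proof -
        consider "i = 0" "j = Suc 0" | "i = 0" "j = Suc (Suc 0)" | "i = Suc 0" "j = Suc (Suc 0)"
          using ij by linarith
        then show ?thesis using \<open>src Z w = _\<close> \<open>src Z u = _\<close> \<open>tgt Z u = _\<close> by cases auto
      qed
      then show "sphere_data Z (Suc 0) ?t" using that(1-3) by (simp add: sphere_data_def)
      show "\<forall>i\<le>Suc (Suc 0). p (Suc 0) (?t i) = face Y (Suc (Suc 0)) i ?s"
        using s that(4-6) by (auto simp: le_Suc_eq)
    qed
    then obtain \<sigma> where \<sigma>: "\<sigma> \<in> simplices Z (Suc (Suc 0))" "\<forall>i\<le>Suc (Suc 0). face Z (Suc (Suc 0)) i \<sigma> = ?t i" by blast
    then show ?thesis using Z.edge_forth_triangle[OF \<sigma>(1), of a] that by simp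
  qed
  have "\<exists>v. v \<in> Ed \<and> p (Suc 0) v = ?d \<and> src Z v = x \<and> tgt Z v = b" if "b \<in> simplices Z 0" "p 0 b = ?y" for b
    using edge[OF x that(1) HOL.refl that(2)] by blast
  then obtain l where l: "\<And>b. b \<in> simplices Z 0 \<Longrightarrow> p 0 b = ?y \<Longrightarrow>
      l b \<in> Ed \<and> p (Suc 0) (l b) = ?d \<and> src Z (l b) = x \<and> tgt Z (l b) = b" by metis
  have det: "s b = edge_forth Z A (l b) (s x)" if s: "s \<in> carrier (H0 ?y)" and b: "b \<in> simplices Z 0" "p 0 b = ?y" for s b
    using H0_forth[OF y s, of "l b"] l[OF b] by simp
  have isom: "snorm (stalk A b) (edge_forth Z A (l b) a) = snorm (stalk A x) a \<and>
      edge_forth Z A (l b) a \<in> carrier (stalk A b)"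
    if b: "b \<in> simplices Z 0" "p 0 b = ?y" and a: "a \<in> carrier (stalk A x)" for a b
  proof -
    have e: "l b \<in> Ed" "src Z (l b) = x" "tgt Z (l b) = b" using l[OF b] by auto
    have c: "edge_forth Z A (l b) a \<in> carrier (stalk A b)"
      using Z.edge_forth_back(1)[OF e(1)] a e by (auto simp: sn_maps_def linear_maps_def)
    then show ?thesis
      using sn_isosD(4)[OF Z.edge_back_iso[OF e(1)], of "edge_forth Z A (l b) a"] Z.edge_forth_back(3)[OF e(1), of a] a e
      by simp
  qed
  \<comment> \<open>The chosen edge at \<open>x\<close> itself may be a nondegenerate loop. By
    \<open>tri\<close> its transport is idempotent, and being invertible it is the identity.\<close>
  have lx: "edge_forth Z A (l x) a = a" if a: "a \<in> carrier (stalk A x)" for a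
  proof -
    have e: "l x \<in> Ed" "src Z (l x) = x" "tgt Z (l x) = x" "p (Suc 0) (l x) = ?d" using l[OF x HOL.refl] by auto
    have c: "edge_forth Z A (l x) a \<in> carrier (stalk A x)" using isom[OF x HOL.refl a] by simp
    have "edge_forth Z A (l x) (edge_forth Z A (l x) a) = edge_forth Z A (l x) a"
      using tri[of "l x" "l x" "l x" a] e a by simp
    then show ?thesis
      using Z.edge_forth_back(3)[OF e(1), of a] Z.edge_forth_back(3)[OF e(1), of "edge_forth Z A (l x) a"] a c e by simp
  qed
  show ?thesis
  proof (rule sn_isosI[OF S.abelian_group_axioms])
    show "ev x \<in> linear_maps R (H0 ?y) (stalk A x)"
      using ev_system_map[of 0] x by (simp add: system_map_def sn_maps_def stalk_AH)
    show "bij_betw (ev x) (carrier (H0 ?y)) (carrier (stalk A x))"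
      unfolding bij_betw_def
    proof
      show "inj_on (ev x) (carrier (H0 ?y))"
      proof (rule inj_onI)
        fix s t assume st: "s \<in> carrier (H0 ?y)" "t \<in> carrier (H0 ?y)" and eq: "ev x s = ev x t"
        show "s = t"
        proof (rule H0_eqI[OF y st])
          show "s b = t b" if "b \<in> simplices Z 0" "p 0 b = ?y" for b
            using det[OF st(1) that] det[OF st(2) that] eq by simp
        qed
      qed
      have "a \<in> ev x ` carrier (H0 ?y)" if a: "a \<in> carrier (stalk A x)" for a
      proof -
        \<comment> \<open>The family with prescribed member \<open>a\<close> at \<open>x\<close> is
          spread out along the chosen edges; \<open>tri\<close> makes it compatible.\<close>
        define s where "s = (\<lambda>b\<in>{b \<in> simplices Z 0. p 0 b = ?y}. edge_forth Z A (l b) a)"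
        have "edge_back Z A v (s (tgt Z v)) = s (src Z v)" if v: "v \<in> Ed" "p (Suc 0) v = ?d" for v
        proof -
          have b: "src Z v \<in> simplices Z 0" "p 0 (src Z v) = ?y" "tgt Z v \<in> simplices Z 0" "p 0 (tgt Z v) = ?y"
            using degen_edge_ends[OF y v] v by (auto simp: Z.face_in)
          have "edge_forth Z A v (s (src Z v)) = s (tgt Z v)"
            using tri[of "l (src Z v)" v "l (tgt Z v)" a] l[OF b(1,2)] l[OF b(3,4)] v a b by (simp add: s_def)
          then show ?thesis using Z.edge_forth_back(3)[OF v(1), of "s (src Z v)"] isom[OF b(1,2) a] b by (simp add: s_def)
        qed
        then have "s \<in> carrier (H0 ?y)"
          using isom[OF _ _ a] by (auto simp: H0_iff[OF y] s_def)
        moreover have "ev x s = a" using lx[OF a] x by (simp add: s_def)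
        ultimately show ?thesis by blast
      qed
      then show "ev x ` carrier (H0 ?y) = carrier (stalk A x)" using H0_in[OF y _ x] by blast
    qed
    show "snorm (stalk A x) (ev x s) = snorm (H0 ?y) s" if s: "s \<in> carrier (H0 ?y)" for s
    proof (rule antisym)
      show "snorm (stalk A x) (ev x s) \<le> snorm (H0 ?y) s" using H0_snorm_upper[OF y s x] by simp
      interpret M: seminormed_module R N "stalk A x" using Z.stalk_seminormed[OF x] .
      have c: "s x \<in> carrier (stalk A x)" using H0_in[OF y s x] by simp
      have "snorm (stalk A b) (s b) \<le> snorm (stalk A x) (s x)" if "b \<in> simplices Z 0" "p 0 b = ?y" for b
        using det[OF s that] isom[OF that c] by simp
      then show "snorm (H0 ?y) s \<le> snorm (stalk A x) (ev x s)"
        unfolding H0_simps(4)[OF y] using M.snorm_nonneg[OF c] by (intro cSup_least) auto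
    qed
  qed (use S.smult_closed in auto)
qed

lemma edge_hom_cohomology:
  assumes lift: "\<And>k. k \<le> Suc n \<Longrightarrow> lifts_spheres Z Y p k"
  shows "k \<le> n \<Longrightarrow> cohomology_surj Z A Y AH p ev k" and "k \<le> Suc n \<Longrightarrow> cohomology_inj Z A Y AH p ev k"
proof -
  have "(k \<le> n \<longrightarrow> cohomology_surj Z A Y AH p ev k) \<and> (k \<le> Suc n \<longrightarrow> cohomology_inj Z A Y AH p ev k)"
  proof (cases n)
    case 0
    then show ?thesis using edge_hom_low_degrees by (auto simp: le_Suc_eq)
  next
    case (Suc n')
    \<comment> \<open>From \<open>n \<ge> 1\<close> on, spheres lift in dimensions 1 and 2, so
      \<open>ev_iso\<close> applies and evaluation is an isomorphism of coefficients.\<close>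
    have "sphere_lifting Z Y p (Suc n)"
      using lift p by (intro sphere_lifting.intro sphere_lifting_axioms.intro Z.semi_simplicial_set_axioms Y.simplicial_set_axioms)
    then have "sphere_lifting_systems Z Y p (Suc n) R N A AH ev"
      using ev_system_map ev_iso lift[of "Suc 0"] lift[of "Suc (Suc 0)"] Suc
      by (intro sphere_lifting_systems.intro sphere_lifting_systems_axioms.intro Z.edge_system_axioms AH_system)
        (auto simp: stalk_AH)
    from sphere_lifting_systems.sphere_lifting_cohomology[OF this, of k] show ?thesis by simp
  qed
  then show "k \<le> n \<Longrightarrow> cohomology_surj Z A Y AH p ev k" "k \<le> Suc n \<Longrightarrow> cohomology_inj Z A Y AH p ev k" by auto
qed

end

section \<open>Maps on bounded cohomology\<close>

lemma a_r_coset_eq: "B +>\<^bsub>M\<^esub> z = (\<lambda>b. b \<oplus>\<^bsub>M\<^esub> z) ` B"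
  by (auto simp: a_r_coset_def')

context edge_system begin

abbreviation cocycle_class :: "nat \<Rightarrow> ('x \<Rightarrow> 'a) \<Rightarrow> ('x \<Rightarrow> 'a) set"
  where "cocycle_class n z \<equiv> Bb X A n +>\<^bsub>Cb X A n\<^esub> z"

lemma Hb_carrier: "carrier (Hb X A n) = cocycle_class n ` Zb X A n"
  by (auto simp: Hb_def quot_module_def A_RCOSETS_def' a_r_coset_def')

text \<open>Equality of cosets becomes an explicit coboundary. In this form all statements about
  classes reduce to calculations with cochains.\<close>

lemma cocycle_class_eq_iff:
  assumes z: "z \<in> carrier (Cb X A n)" "z' \<in> carrier (Cb X A n)"
  shows "cocycle_class n z = cocycle_class n z' \<longleftrightarrow> (\<exists>b\<in>Bb X A n. z = b \<oplus>\<^bsub>Cb X A n\<^esub> z')"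
proof -
  interpret C: left_module R "Cb X A n" by (rule Cb_left_module)
  note sub = subsetD[OF Bb_subset]
  have le: "cocycle_class n z \<subseteq> cocycle_class n z'"
    if "z \<in> carrier (Cb X A n)" "z' \<in> carrier (Cb X A n)" "b \<in> Bb X A n" "z = b \<oplus>\<^bsub>Cb X A n\<^esub> z'" for z z' b
  proof
    fix u assume "u \<in> cocycle_class n z"
    then obtain c where c: "c \<in> Bb X A n" "u = c \<oplus>\<^bsub>Cb X A n\<^esub> z" by (auto simp: a_r_coset_eq)
    then have "u = (c \<oplus>\<^bsub>Cb X A n\<^esub> b) \<oplus>\<^bsub>Cb X A n\<^esub> z'" using that sub[of c] sub[of b] by (simp add: C.a_assoc)
    then show "u \<in> cocycle_class n z'" using Bb_add[OF c(1) that(3)] by (simp add: a_r_coset_eq)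
  qed
  show ?thesis
  proof
    assume "cocycle_class n z = cocycle_class n z'"
    moreover have "z \<in> cocycle_class n z"
      using Bb_zero z by (auto simp: a_r_coset_eq intro!: image_eqI[of _ _ "\<zero>\<^bsub>Cb X A n\<^esub>"])
    ultimately show "\<exists>b\<in>Bb X A n. z = b \<oplus>\<^bsub>Cb X A n\<^esub> z'" by (auto simp: a_r_coset_eq)
  next
    assume "\<exists>b\<in>Bb X A n. z = b \<oplus>\<^bsub>Cb X A n\<^esub> z'"
    then obtain b where b: "b \<in> Bb X A n" "z = b \<oplus>\<^bsub>Cb X A n\<^esub> z'" by blast
    have "z' = \<ominus>\<^bsub>Cb X A n\<^esub> b \<oplus>\<^bsub>Cb X A n\<^esub> z"
      using b z sub[of b] by (simp add: C.a_assoc[symmetric] C.l_neg)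
    then show "cocycle_class n z = cocycle_class n z'"
      using le[OF z b] le[OF z(2,1) Bb_minus[OF b(1)]] by blast
  qed
qed

lemma Hb_add:
  assumes z: "z \<in> carrier (Cb X A n)" "z' \<in> carrier (Cb X A n)"
  shows "cocycle_class n z \<oplus>\<^bsub>Hb X A n\<^esub> cocycle_class n z' = cocycle_class n (z \<oplus>\<^bsub>Cb X A n\<^esub> z')"
proof -
  interpret C: left_module R "Cb X A n" by (rule Cb_left_module)
  note sub = subsetD[OF Bb_subset]
  have eq: "(b \<oplus>\<^bsub>Cb X A n\<^esub> z) \<oplus>\<^bsub>Cb X A n\<^esub> (b' \<oplus>\<^bsub>Cb X A n\<^esub> z') =
      (b \<oplus>\<^bsub>Cb X A n\<^esub> b') \<oplus>\<^bsub>Cb X A n\<^esub> (z \<oplus>\<^bsub>Cb X A n\<^esub> z')"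
    if "b \<in> Bb X A n" "b' \<in> Bb X A n" for b b'
    using sub[OF that(1)] sub[OF that(2)] z by (simp add: C.a_ac)
  have "cocycle_class n z \<oplus>\<^bsub>Hb X A n\<^esub> cocycle_class n z' =
      {u \<oplus>\<^bsub>Cb X A n\<^esub> v |u v. u \<in> cocycle_class n z \<and> v \<in> cocycle_class n z'}"
    by (auto simp: Hb_def quot_module_def set_add_def')
  also have "\<dots> = cocycle_class n (z \<oplus>\<^bsub>Cb X A n\<^esub> z')"
  proof (intro equalityI subsetI)
    fix u assume "u \<in> {u \<oplus>\<^bsub>Cb X A n\<^esub> v |u v. u \<in> cocycle_class n z \<and> v \<in> cocycle_class n z'}"
    then show "u \<in> cocycle_class n (z \<oplus>\<^bsub>Cb X A n\<^esub> z')" using eq Bb_add by (force simp: a_r_coset_eq)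
  next
    fix u assume "u \<in> cocycle_class n (z \<oplus>\<^bsub>Cb X A n\<^esub> z')"
    then obtain b where b: "b \<in> Bb X A n" "u = b \<oplus>\<^bsub>Cb X A n\<^esub> (z \<oplus>\<^bsub>Cb X A n\<^esub> z')" by (auto simp: a_r_coset_eq)
    then have "u = (b \<oplus>\<^bsub>Cb X A n\<^esub> z) \<oplus>\<^bsub>Cb X A n\<^esub> (\<zero>\<^bsub>Cb X A n\<^esub> \<oplus>\<^bsub>Cb X A n\<^esub> z')"
      using eq[OF b(1) Bb_zero] sub[OF b(1)] by simp
    then show "u \<in> {u \<oplus>\<^bsub>Cb X A n\<^esub> v |u v. u \<in> cocycle_class n z \<and> v \<in> cocycle_class n z'}"
      using b(1) Bb_zero unfolding a_r_coset_eq by blast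
  qed
  finally show ?thesis .
qed

lemma Hb_smult:
  assumes z: "z \<in> carrier (Cb X A n)" and r: "r \<in> carrier R"
  shows "r \<odot>\<^bsub>Hb X A n\<^esub> cocycle_class n z = cocycle_class n (r \<odot>\<^bsub>Cb X A n\<^esub> z)"
proof -
  interpret C: left_module R "Cb X A n" by (rule Cb_left_module)
  note sub = subsetD[OF Bb_subset]
  have "cocycle_class n (r \<odot>\<^bsub>Cb X A n\<^esub> a) = cocycle_class n (r \<odot>\<^bsub>Cb X A n\<^esub> z)" if "a \<in> cocycle_class n z" for a
  proof -
    obtain b where b: "b \<in> Bb X A n" "a = b \<oplus>\<^bsub>Cb X A n\<^esub> z" using \<open>a \<in> _\<close> by (auto simp: a_r_coset_eq)
    then have "r \<odot>\<^bsub>Cb X A n\<^esub> a = r \<odot>\<^bsub>Cb X A n\<^esub> b \<oplus>\<^bsub>Cb X A n\<^esub> r \<odot>\<^bsub>Cb X A n\<^esub> z"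
      using r z sub[OF b(1)] by (simp add: C.smult_r_distr)
    moreover have "a \<in> carrier (Cb X A n)" using b z sub by simp
    ultimately show ?thesis
      using cocycle_class_eq_iff[of "r \<odot>\<^bsub>Cb X A n\<^esub> a" n "r \<odot>\<^bsub>Cb X A n\<^esub> z"] Bb_smult[OF b(1) r] z r C.smult_closed
      by blast
  qed
  moreover have "cocycle_class n z \<noteq> {}" using Bb_zero by (auto simp: a_r_coset_eq)
  moreover have "r \<odot>\<^bsub>Hb X A n\<^esub> cocycle_class n z = (\<Union>a\<in>cocycle_class n z. cocycle_class n (r \<odot>\<^bsub>Cb X A n\<^esub> a))"
    by (auto simp: Hb_def quot_module_def a_r_coset_def')
  ultimately show ?thesis by auto
qed

end

lemma (in cochain_map) Hb_map_class:
  assumes n: "n \<le> K" and z: "z \<in> carrier (Cb Y B n)"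
  shows "Hb_map X A n (pullback_cochain X g \<eta> n) (Y.cocycle_class n z) = X.cocycle_class n (pullback_cochain X g \<eta> n z)"
proof -
  have "X.cocycle_class n (pullback_cochain X g \<eta> n a) = X.cocycle_class n (pullback_cochain X g \<eta> n z)"
    if "a \<in> Y.cocycle_class n z" for a
  proof -
    obtain b where b: "b \<in> Bb Y B n" "a = b \<oplus>\<^bsub>Cb Y B n\<^esub> z" using \<open>a \<in> _\<close> by (auto simp: a_r_coset_eq)
    have bC: "b \<in> carrier (Cb Y B n)" using b Y.Bb_subset by blast
    interpret C: left_module R "Cb Y B n" by (rule Y.Cb_left_module)
    have "pullback_cochain X g \<eta> n a = pullback_cochain X g \<eta> n b \<oplus>\<^bsub>Cb X A n\<^esub> pullback_cochain X g \<eta> n z"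
      unfolding b(2) by (rule linear_mapsD(2)[OF pullback_linear[OF n] bC z])
    then show ?thesis
      using X.cocycle_class_eq_iff[OF pullback_in[OF n] pullback_in[OF n z], of a] pullback_Bb[OF n b(1)] b(2) bC z by auto
  qed
  moreover have "Y.cocycle_class n z \<noteq> {}" using Y.Bb_zero by (auto simp: a_r_coset_eq)
  ultimately show ?thesis unfolding Hb_map_def by auto
qed

lemma (in cochain_map) Hb_map_linear:
  assumes n: "Suc n \<le> K"
  shows "Hb_map X A n (pullback_cochain X g \<eta> n) \<in> linear_maps R (Hb Y B n) (Hb X A n)"
proof -
  let ?f = "pullback_cochain X g \<eta> n" and ?F = "Hb_map X A n (pullback_cochain X g \<eta> n)"
  have n': "n \<le> K" using n by simp
  interpret C: left_module R "Cb Y B n" by (rule Y.Cb_left_module)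
  have sub: "z \<in> carrier (Cb Y B n)" if "z \<in> Zb Y B n" for z using that by (simp add: Zb_def)
  note cl = Hb_map_class[OF n'] and lin = linear_mapsD[OF pullback_linear[OF n']] and pin = pullback_in[OF n']
  have "?F (Y.cocycle_class n z) \<in> carrier (Hb X A n)" if "z \<in> Zb Y B n" for z
    using cl[OF sub[OF that]] pullback_Zb[OF n that] by (simp add: X.Hb_carrier)
  moreover have "?F (Y.cocycle_class n z \<oplus>\<^bsub>Hb Y B n\<^esub> Y.cocycle_class n z') =
      ?F (Y.cocycle_class n z) \<oplus>\<^bsub>Hb X A n\<^esub> ?F (Y.cocycle_class n z')"
    if "z \<in> Zb Y B n" "z' \<in> Zb Y B n" for z z'
    using sub[OF that(1)] sub[OF that(2)] by (simp add: Y.Hb_add X.Hb_add cl lin(2) pin)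
  moreover have "?F (r \<odot>\<^bsub>Hb Y B n\<^esub> Y.cocycle_class n z) = r \<odot>\<^bsub>Hb X A n\<^esub> ?F (Y.cocycle_class n z)"
    if "z \<in> Zb Y B n" "r \<in> carrier R" for z r
    using sub[OF that(1)] that(2) C.smult_closed by (simp add: Y.Hb_smult X.Hb_smult cl lin(3) pin)
  ultimately show ?thesis by (auto simp: linear_maps_def Y.Hb_carrier)
qed

text \<open>Two cocycles with the same image class differ by a cocycle whose pullback is a
  coboundary, so the trivial kernel suffices.\<close>

lemma (in cochain_map) Hb_map_inj:
  assumes n: "Suc n \<le> K" and inj: "cohomology_inj X A Y B g \<eta> n"
  shows "inj_on (Hb_map X A n (pullback_cochain X g \<eta> n)) (carrier (Hb Y B n))"
proof (rule inj_onI)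
  let ?f = "pullback_cochain X g \<eta> n" and ?F = "Hb_map X A n (pullback_cochain X g \<eta> n)"
  have n': "n \<le> K" using n by simp
  interpret C: left_module R "Cb Y B n" by (rule Y.Cb_left_module)
  interpret C': left_module R "Cb X A n" by (rule X.Cb_left_module)
  fix c c' assume "c \<in> carrier (Hb Y B n)" "c' \<in> carrier (Hb Y B n)" and eq: "?F c = ?F c'"
  then obtain z z' where z: "z \<in> Zb Y B n" "z' \<in> Zb Y B n" "c = Y.cocycle_class n z" "c' = Y.cocycle_class n z'"
    by (auto simp: Y.Hb_carrier)
  have zC: "z \<in> carrier (Cb Y B n)" "z' \<in> carrier (Cb Y B n)" using z by (auto simp: Zb_def)
  note fin = pullback_in[OF n' zC(1)] pullback_in[OF n' zC(2)]
  obtain b where b: "b \<in> Bb X A n" "?f z = b \<oplus>\<^bsub>Cb X A n\<^esub> ?f z'"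
    using eq z Hb_map_class[OF n'] zC X.cocycle_class_eq_iff[OF fin] by auto
  have bC: "b \<in> carrier (Cb X A n)" using b X.Bb_subset by blast
  let ?d = "z \<oplus>\<^bsub>Cb Y B n\<^esub> \<ominus>\<^bsub>Cb Y B n\<^esub> z'"
  have mz: "\<ominus>\<^bsub>Cb Y B n\<^esub> z' \<in> Zb Y B n"
    using Y.Zb_submodule(3)[of "\<ominus>\<^bsub>R\<^esub> \<one>\<^bsub>R\<^esub>" z' n] C.smult_minus_one[OF zC(2)] z by simp
  have "?f ?d = ?f z \<oplus>\<^bsub>Cb X A n\<^esub> \<ominus>\<^bsub>Cb X A n\<^esub> ?f z'"
    using linear_mapsD(2)[OF pullback_linear[OF n'] zC(1), of "\<ominus>\<^bsub>Cb Y B n\<^esub> z'"] zC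
      C.linear_minus[OF pullback_linear[OF n'] C'.left_module_axioms zC(2)] by simp
  also have "\<dots> = b" using b bC fin by (simp add: C'.a_assoc C'.r_neg)
  finally have "?d \<in> Bb Y B n"
    using inj b(1) Y.Zb_submodule(2)[OF z(1) mz] by (simp add: cohomology_inj_def)
  moreover have "z = ?d \<oplus>\<^bsub>Cb Y B n\<^esub> z'" using zC by (simp add: C.a_assoc C.l_neg)
  ultimately show "c = c'" using Y.cocycle_class_eq_iff[OF zC] z by blast
qed

lemma (in cochain_map) Hb_map_surj:
  assumes n: "Suc n \<le> K" and surj: "cohomology_surj X A Y B g \<eta> n"
  shows "carrier (Hb X A n) \<subseteq> Hb_map X A n (pullback_cochain X g \<eta> n) ` carrier (Hb Y B n)"
proof
  let ?f = "pullback_cochain X g \<eta> n"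
  have n': "n \<le> K" using n by simp
  interpret C': left_module R "Cb X A n" by (rule X.Cb_left_module)
  fix c assume "c \<in> carrier (Hb X A n)"
  then obtain \<phi> where \<phi>: "\<phi> \<in> Zb X A n" "c = X.cocycle_class n \<phi>" by (auto simp: X.Hb_carrier)
  then obtain \<psi> b where \<psi>: "\<psi> \<in> Zb Y B n" "b \<in> Bb X A n" "\<phi> = ?f \<psi> \<oplus>\<^bsub>Cb X A n\<^esub> b"
    using surj unfolding cohomology_surj_def by blast
  have cs: "\<psi> \<in> carrier (Cb Y B n)" "\<phi> \<in> carrier (Cb X A n)" "b \<in> carrier (Cb X A n)"
    using \<psi> \<phi> X.Bb_subset by (auto simp: Zb_def)
  have "\<phi> = b \<oplus>\<^bsub>Cb X A n\<^esub> ?f \<psi>" using \<psi>(3) cs pullback_in[OF n' cs(1)] by (simp add: C'.a_comm)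
  then have "c = X.cocycle_class n (?f \<psi>)"
    using X.cocycle_class_eq_iff[OF cs(2) pullback_in[OF n' cs(1)]] \<psi>(2) \<phi>(2) by blast
  then show "c \<in> Hb_map X A n ?f ` carrier (Hb Y B n)"
    using Hb_map_class[OF n' cs(1)] \<psi>(1) by (auto simp: Y.Hb_carrier intro!: image_eqI[of _ _ "Y.cocycle_class n \<psi>"])
qed

lemma linear_isosI:
  assumes "h \<in> linear_maps R M M'" "inj_on h (carrier M)" "carrier M' \<subseteq> h ` carrier M"
  shows "h \<in> linear_isos R M M'"
  using assms by (auto simp: linear_isos_def bij_betw_def linear_maps_def)

lemma linear_isos_compose:
  "h \<in> linear_isos R M M' \<Longrightarrow> k \<in> linear_isos R M' M'' \<Longrightarrow> k \<circ> h \<in> linear_isos R M M''"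
  using linear_maps_compose[of h R M M' k M''] bij_betw_trans by (auto simp: linear_isos_def)

section \<open>The corollary\<close>

text \<open>At simplices in the image of \<open>j\<close>, injectivity and surjectivity of \<open>p\<close> on relative homotopy
  classes follow from those of \<open>p j\<close> and \<open>j\<close>; the prisms of a section of the path space of \<open>j\<close>
  connect every simplex to one in the image.\<close>

lemma second_map_inj_surj_at:
  assumes X: "kan_complex X" and Z: "kan_complex Z" and Y: "kan_complex Y" and ne: "simplices X 0 \<noteq> {}"
    and j: "simplicial_map X Z j" and p: "simplicial_map Z Y p" and f: "simplicial_map X Y f"
    and fpj: "\<And>n \<sigma>. \<sigma> \<in> simplices X n \<Longrightarrow> f n \<sigma> = p n (j n \<sigma>)"
    and ji: "\<And>k a. a \<in> simplices X k \<Longrightarrow> inj_at X Z j k a"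
    and js: "\<And>k a. a \<in> simplices X k \<Longrightarrow> surj_at X Z j k a"
    and a: "a \<in> simplices Z k"
  shows "(\<And>x. x \<in> simplices X k \<Longrightarrow> inj_at X Y f k x) \<Longrightarrow> inj_at Z Y p k a"
    and "(\<And>x. x \<in> simplices X k \<Longrightarrow> surj_at X Y f k x) \<Longrightarrow> surj_at Z Y p k a"
proof -
  interpret j: kan_map X Z j using X Z j by (intro kan_map.intro kan_map_axioms.intro kan_set.intro)
  interpret p: kan_map Z Y p using Z Y p by (intro kan_map.intro kan_map_axioms.intro kan_set.intro)
  have L: "sphere_lifting (path_space X Z j) Z (path_top Z) k"
  proof (intro sphere_lifting.intro sphere_lifting_axioms.intro j.path_space_semi_simplicial j.Y.simplicial_set_axioms)
    show "face_map (path_space X Z j) Z (path_top Z)"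
      using j.Y.face_wall[of _ _ _ 0] by (auto simp: face_map_def path_space_simplices path_space_face intro!: j.Y.wall_in)
    show "lifts_spheres (path_space X Z j) Z (path_top Z) l" if "l \<le> k" for l
      using j.path_space_lifts_spheres[OF ne, of k l] ji js that by blast
  qed
  obtain s where "sphere_lifting.section_on (path_space X Z j) Z (path_top Z) k s"
    using sphere_lifting.section_exists[OF L] by blast
  then obtain \<tau> where "\<tau> \<in> simplices (path_space X Z j) k" "path_top Z k \<tau> = a"
    using a unfolding sphere_lifting.section_on_def[OF L] by blast
  then obtain x h where x: "x \<in> simplices X k" and h: "prism Z k h" "wall Z k h (Suc k) = j k x" "wall Z k h 0 = a"
    by (cases \<tau>) (auto simp: path_space_simplices)
  \<comment> \<open>The walls of the prism lead from the bottom \<open>j k x\<close> to the top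
    \<open>a\<close>, and consecutive walls are faces of one simplex. A property invariant under
    changing the face therefore travels along them.\<close>
  have move: "P a" if start: "P (j k x)"
    and step: "\<And>h v l. h \<in> simplices Z (Suc k) \<Longrightarrow> v \<noteq> l \<Longrightarrow> v \<le> Suc k \<Longrightarrow> l \<le> Suc k \<Longrightarrow>
      P (face Z (Suc k) l h) \<Longrightarrow> P (face Z (Suc k) v h)" for P
  proof -
    have "P (wall Z k h (Suc k - d))" if "d \<le> Suc k" for d
      using that
    proof (induction d)
      case 0
      then show ?case using start h by simp
    next
      case (Suc d)
      let ?l = "k - d"
      have l: "Suc k - d = Suc ?l" "?l \<le> k" using Suc.prems by auto
      have "P (face Z (Suc k) (Suc ?l) (h ?l))" using Suc l wall_Suc[OF h(1) l(2)] by simp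
      then have "P (face Z (Suc k) ?l (h ?l))" using step[OF prism_in[OF h(1) l(2)], of ?l "Suc ?l"] l(2) by simp
      then show ?case using wall_le[OF l(2), of Z h] by simp
    qed
    from this[of "Suc k"] h(3) show ?thesis by simp
  qed
  have jx: "j k x \<in> simplices Z k" using simplicial_mapD(1)[OF j x] .
  have lift: "\<exists>x'\<in>simplices X k. same_boundary X k x x' \<and> homotopic Z k (j k x') b"
    if "b \<in> simplices Z k" "same_boundary Z k (j k x) b" for b
    using js[OF x] that by (simp add: surj_at_def)
  show "inj_at Z Y p k a" if fi: "\<And>x. x \<in> simplices X k \<Longrightarrow> inj_at X Y f k x"
  proof (rule move)
    show "inj_at Z Y p k (j k x)"
      unfolding inj_at_def
    proof (intro ballI impI)
      fix b assume b: "b \<in> simplices Z k" "same_boundary Z k (j k x) b" and hom: "homotopic Y k (p k (j k x)) (p k b)"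
      \<comment> \<open>The competitor \<open>b\<close> need not lie in the image of
        \<open>j\<close>. It is replaced by a homotopic simplex that does, to which the hypothesis
        on \<open>f\<close> applies.\<close>
      obtain x' where x': "x' \<in> simplices X k" "same_boundary X k x x'" "homotopic Z k (j k x') b"
        using lift[OF b] by blast
      have "homotopic Y k (p k (j k x')) (p k b)"
        using homotopic_at_map[OF j.Y.simplicial_set_axioms p x'(3)] by simp
      then have "homotopic Y k (f k x) (f k x')"
        using p.Y.homotopic_trans[OF hom p.Y.homotopic_sym] fpj x x'(1) by simp
      then have "homotopic X k x x'" using fi[OF x] x' by (simp add: inj_at_def)
      then have "homotopic Z k (j k x) (j k x')"
        using homotopic_at_map[OF j.X.simplicial_set_axioms j] by simp
      then show "homotopic Z k (j k x) b" using j.Y.homotopic_trans x'(3) by blast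
    qed
  qed (use p.inj_at_face in blast)
  show "surj_at Z Y p k a" if fs: "\<And>x. x \<in> simplices X k \<Longrightarrow> surj_at X Y f k x"
  proof (rule move)
    show "surj_at Z Y p k (j k x)"
      unfolding surj_at_def
    proof (intro ballI impI)
      fix b assume b: "b \<in> simplices Y k" "same_boundary Y k (p k (j k x)) b"
      then obtain x' where x': "x' \<in> simplices X k" "same_boundary X k x x'" "homotopic Y k (f k x') b"
        using fs[OF x] fpj[OF x] by (auto simp: surj_at_def)
      then show "\<exists>a'\<in>simplices Z k. same_boundary Z k (j k x) a' \<and> homotopic Y k (p k a') b"
        using map_same_boundary[OF j x'(2) x x'(1)] simplicial_mapD(1)[OF j x'(1)] fpj[OF x'(1)] by auto
    qed
  qed (use p.surj_at_face in blast)
qed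

theorem corollary6p1:
  fixes R :: "('r, 'm) ring_scheme" and N :: "'r \<Rightarrow> real"
    and X :: "'x sset" and Y :: "'y sset" and f :: "nat \<Rightarrow> 'x \<Rightarrow> 'y"
    and A :: "('r, 'x, 'a) coeff_system"
    and Z :: "'z sset" and j :: "nat \<Rightarrow> 'x \<Rightarrow> 'z" and p :: "nat \<Rightarrow> 'z \<Rightarrow> 'y"
    and A' :: "('r, 'z, 'b) coeff_system" and \<eta> :: "'x \<Rightarrow> 'b \<Rightarrow> 'a"
    and n :: nat
  assumes "normed_ring R N"
    and "kan_complex X" and "connected_sset X"
    and "kan_complex Y" and "connected_sset Y"
    and "n_equivalence (n + 1) X Y f"
    and "local_system R N X A"
    and "fibrant_replacement R N X Y f A Z j p A' \<eta>"
  shows "(\<forall>i\<le>n. canonical_map X Y A Z j p A' \<eta> i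
            \<in> linear_isos R (Hb Y (Hb0_system Z Y p A') i) (Hb X A i)) \<and>
    canonical_map X Y A Z j p A' \<eta> (n + 1)
            \<in> linear_maps R (Hb Y (Hb0_system Z Y p A') (n + 1)) (Hb X A (n + 1)) \<and>
    inj_on (canonical_map X Y A Z j p A' \<eta> (n + 1))
            (carrier (Hb Y (Hb0_system Z Y p A') (n + 1)))"
proof -
  have Z: "kan_complex Z" and we: "weak_equivalence X Z j" and fib: "kan_fibration Z Y p"
    and fpj: "\<And>n \<sigma>. \<sigma> \<in> simplices X n \<Longrightarrow> f n \<sigma> = p n (j n \<sigma>)"
    and A': "local_system R N Z A'" and \<eta>: "system_iso R X (pullback_system X Z j A') A \<eta>"
    using assms(8) by (auto simp: fibrant_replacement_def)
  have j: "simplicial_map X Z j" and p: "simplicial_map Z Y p" and f: "simplicial_map X Y f"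
    using we fib assms(6) by (auto simp: weak_equivalence_def kan_fibration_def n_equivalence_def)
  have ne: "simplices X 0 \<noteq> {}" using assms(3) by (simp add: connected_sset_def)
  then have neZ: "simplices Z 0 \<noteq> {}" using simplicial_mapD(1)[OF j] by blast
  interpret X: kan_set X using assms(2) by (rule kan_set.intro)
  interpret Y: kan_set Y using assms(4) by (rule kan_set.intro)
  interpret Z: kan_set Z using Z by (rule kan_set.intro)
  interpret j: kan_map X Z j using j by unfold_locales
  interpret f: kan_map X Y f using f by unfold_locales
  interpret p: kan_map Z Y p using p by unfold_locales
  have XA: "local_system_on R N X A"
    using assms(1,7) X.semi_simplicial_set_axioms by (intro local_system_on.intro)
  have ZA: "local_system_on R N Z A'"
    using assms(1) A' Z.semi_simplicial_set_axioms by (intro local_system_on.intro)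
  interpret P: fibration_system R N Z Y A' p
    using ZA fib by (intro fibration_system.intro fibration_system_axioms.intro Z.simplicial_set_axioms Y.simplicial_set_axioms)
  have j_inj: "inj_at X Z j k a" and j_surj: "surj_at X Z j k a" if "a \<in> simplices X k" for k a
    using we j.inj_at_all[OF _ that] j.surj_at_all[OF _ that] by (auto simp: weak_equivalence_def bij_betw_def)
  have f_inj: "inj_at X Y f k a" if "k < n + 1" "a \<in> simplices X k" for k a
    using assms(6) that f.inj_at_all[OF _ that(2)] by (auto simp: n_equivalence_def bij_betw_def)
  \<comment> \<open>Below dimension \<open>n + 1\<close> surjectivity is part of bijectivity; in
    dimension \<open>n + 1\<close> it is the separate clause of the definition of an
    equivalence.\<close>
  have f_surj: "surj_at X Y f k a" if "k \<le> n + 1" "a \<in> simplices X k" for k a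
  proof (rule f.surj_at_all[OF _ that(2)])
    show "homotopy_map X Y f k x ` homotopy_group X k x = homotopy_group Y k (f 0 x)" if "x \<in> simplices X 0" for x
      using assms(6) that \<open>k \<le> n + 1\<close> by (cases "k = n + 1") (auto simp: n_equivalence_def bij_betw_def)
  qed
  note second = second_map_inj_surj_at[OF assms(2) Z assms(4) ne j p f fpj j_inj j_surj]
  \<comment> \<open>The connectivity of \<open>f\<close> is inherited by \<open>p\<close> because
    \<open>j\<close> is a weak equivalence, and for a fibration connectivity means strict
    lifting.\<close>
  have lift: "lifts_spheres Z Y p k" if "k \<le> Suc n" for k
  proof (rule p.fibration_lifts_spheres[OF fib neZ _ _ that])
    show "inj_at Z Y p k a" if "k < Suc n" "a \<in> simplices Z k" for k a
      using second(1)[OF _ _ _ that(2)] f_inj that(1) by simp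
    show "surj_at Z Y p k a" if "k \<le> Suc n" "a \<in> simplices Z k" for k a
      using second(2)[OF _ _ _ that(2)] f_surj that(1) by simp
  qed
  note \<eta>_map = system_iso_system_map[OF X.semi_simplicial_set_axioms Z.semi_simplicial_set_axioms
      simplicial_map_face_map[OF j] \<eta>]
  interpret XA: local_system_on R N X A by (rule XA)
  \<comment> \<open>A weak equivalence satisfies the conditions for every bound. This one covers all
    degrees up to \<open>n + 1\<close>, for surjectivity as well as injectivity.\<close>
  have sysj: "kan_map_systems X Z j R N A A' \<eta> (Suc (Suc n))"
    using \<eta>_map ne j_inj j_surj
    by (intro kan_map_systems.intro kan_map_systems_axioms.intro j.kan_map_axioms
        XA.edge_system_axioms P.Z.edge_system_axioms)
  note j_coh = kan_map_systems.cohomology_of_connected_map[OF sysj]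
  note p_coh = P.edge_hom_cohomology[OF lift]
  have cm_j: "cochain_map (Suc i) R N X A Z A' j \<eta>" for i
    by (rule kan_map_systems.cochain_map_g[OF sysj])
  have cm_p: "cochain_map (Suc i) R N Z A' Y (Hb0_system Z Y p A') p P.ev" for i
    by (rule P.ev_cochain_map)
  have can: "canonical_map X Y A Z j p A' \<eta> i =
      Hb_map X A i (pullback_cochain X j \<eta> i) \<circ> Hb_map Z A' i (pullback_cochain Z p P.ev i)" for i
    by (simp add: canonical_map_def pullback_hom_def edge_hom_def P.edge_cochain_eq)
  have lin_j: "Hb_map X A i (pullback_cochain X j \<eta> i) \<in> linear_maps R (Hb Z A' i) (Hb X A i)" for i
    by (rule cochain_map.Hb_map_linear[OF cm_j le_refl])
  have lin_p: "Hb_map Z A' i (pullback_cochain Z p P.ev i) \<in> linear_maps R (Hb Y (Hb0_system Z Y p A') i) (Hb Z A' i)" for i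
    by (rule cochain_map.Hb_map_linear[OF cm_p le_refl])
  have inj_j: "inj_on (Hb_map X A i (pullback_cochain X j \<eta> i)) (carrier (Hb Z A' i))" if "i \<le> Suc n" for i
    using cochain_map.Hb_map_inj[OF cm_j le_refl j_coh(1)] that by simp
  have inj_p: "inj_on (Hb_map Z A' i (pullback_cochain Z p P.ev i)) (carrier (Hb Y (Hb0_system Z Y p A') i))"
    if "i \<le> Suc n" for i
    using cochain_map.Hb_map_inj[OF cm_p le_refl p_coh(2)[OF _ that]] by simp
  have "canonical_map X Y A Z j p A' \<eta> i \<in> linear_isos R (Hb Y (Hb0_system Z Y p A') i) (Hb X A i)" if i: "i \<le> n" for i
    unfolding can
  proof (rule linear_isos_compose)
    show "Hb_map Z A' i (pullback_cochain Z p P.ev i) \<in> linear_isos R (Hb Y (Hb0_system Z Y p A') i) (Hb Z A' i)"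
      using lin_p inj_p cochain_map.Hb_map_surj[OF cm_p le_refl p_coh(1)[OF _ i]] i by (intro linear_isosI) auto
    show "Hb_map X A i (pullback_cochain X j \<eta> i) \<in> linear_isos R (Hb Z A' i) (Hb X A i)"
      using lin_j inj_j cochain_map.Hb_map_surj[OF cm_j le_refl j_coh(2)] i by (intro linear_isosI) auto
  qed
  moreover have "canonical_map X Y A Z j p A' \<eta> (n + 1) \<in> linear_maps R (Hb Y (Hb0_system Z Y p A') (n + 1)) (Hb X A (n + 1))"
    unfolding can by (rule linear_maps_compose[OF lin_p lin_j])
  moreover have "inj_on (canonical_map X Y A Z j p A' \<eta> (n + 1)) (carrier (Hb Y (Hb0_system Z Y p A') (n + 1)))"
    unfolding can
  proof (rule comp_inj_on)
    show "inj_on (Hb_map Z A' (n + 1) (pullback_cochain Z p P.ev (n + 1))) (carrier (Hb Y (Hb0_system Z Y p A') (n + 1)))"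
      using inj_p[of "n + 1"] by simp
    have "Hb_map Z A' (n + 1) (pullback_cochain Z p P.ev (n + 1)) ` carrier (Hb Y (Hb0_system Z Y p A') (n + 1)) \<subseteq>
        carrier (Hb Z A' (n + 1))" using lin_p[of "n + 1"] by (auto simp: linear_maps_def)
    then show "inj_on (Hb_map X A (n + 1) (pullback_cochain X j \<eta> (n + 1)))
        (Hb_map Z A' (n + 1) (pullback_cochain Z p P.ev (n + 1)) ` carrier (Hb Y (Hb0_system Z Y p A') (n + 1)))"
      using inj_j[of "n + 1"] by (auto intro: inj_on_subset)
  qed
  ultimately show ?thesis by blast
qed

end
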